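(* Let $\alpha\in(0,1)$ be irrational, let $p_i=1/i^{\alpha}$ for $i>1$ and let $p_1=p_2=1/2^{\alpha}$. For each $n\ge 1$ let $G_n$ be the random graph with vertex set $[n]=\{1,\dots,n\}$ in which, independently for each unordered pair $\{i,j\}$ of distinct elements of $[n]$, $\{i,j\}$ is an edge with probability $p_{|i-j|}$. Then the zero-one law for first order logic holds: for every first order sentence $\varphi$ in the vocabulary of graphs (one binary relation symbol, interpreted as adjacency, together with equality), the sequence $\langle \mathrm{Prob}(G_n\models\varphi): n\ge 1\rangle$ converges either to $0$ or to $1$.
   Context: Graphs are viewed as structures with a single symmetric irreflexive binary relation (adjacency). The structure $G_n$ carries only the adjacency relation: neither the successor relation nor the order on $[n]$ is part of the structure. *)

theory Defs
  imports "HOL-Probability.Probability"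
begin

text \<open>First-order formulas in the vocabulary of graphs, with variables named by natural numbers.
  The remaining connectives and the universal quantifier are definable from these.\<close>

datatype fo_formula =
    Eq nat nat
  | Adj nat nat
  | Neg fo_formula
  | Conj fo_formula fo_formula
  | Exi nat fo_formula

primrec free_vars :: "fo_formula \<Rightarrow> nat set" where
  "free_vars (Eq x y) = {x, y}"
| "free_vars (Adj x y) = {x, y}"
| "free_vars (Neg \<phi>) = free_vars \<phi>"
| "free_vars (Conj \<phi> \<psi>) = free_vars \<phi> \<union> free_vars \<psi>"
| "free_vars (Exi x \<phi>) = free_vars \<phi> - {x}"

definition sentence :: "fo_formula \<Rightarrow> bool" where
  "sentence \<phi> \<longleftrightarrow> free_vars \<phi> = {}"

primrec sat :: "'a set \<Rightarrow> ('a \<Rightarrow> 'a \<Rightarrow> bool) \<Rightarrow> (nat \<Rightarrow> 'a) \<Rightarrow> fo_formula \<Rightarrow> bool" where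
  "sat V E v (Eq x y) \<longleftrightarrow> v x = v y"
| "sat V E v (Adj x y) \<longleftrightarrow> E (v x) (v y)"
| "sat V E v (Neg \<phi>) \<longleftrightarrow> \<not> sat V E v \<phi>"
| "sat V E v (Conj \<phi> \<psi>) \<longleftrightarrow> sat V E v \<phi> \<and> sat V E v \<psi>"
| "sat V E v (Exi x \<phi>) \<longleftrightarrow> (\<exists>a\<in>V. sat V E (v(x := a)) \<phi>)"

text \<open>Truth of a sentence in the structure with universe \<open>V\<close>. For a nonempty universe the truth
  value of a sentence does not depend on the assignment.\<close>

definition models :: "'a set \<Rightarrow> ('a \<Rightarrow> 'a \<Rightarrow> bool) \<Rightarrow> fo_formula \<Rightarrow> bool" where
  "models V E \<phi> \<longleftrightarrow> (\<forall>v. range v \<subseteq> V \<longrightarrow> sat V E v \<phi>)"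

definition edge_prob :: "real \<Rightarrow> nat \<Rightarrow> real" where
  "edge_prob \<alpha> i = (if i = 1 then 1 / 2 powr \<alpha> else 1 / real i powr \<alpha>)"

text \<open>An unordered pair of distinct vertices is represented by its increasing enumeration.\<close>

definition vertex_pairs :: "nat \<Rightarrow> (nat \<times> nat) set" where
  "vertex_pairs n = {(i, j). 1 \<le> i \<and> i < j \<and> j \<le> n}"

definition adjacency :: "(nat \<times> nat \<Rightarrow> bool) \<Rightarrow> nat \<Rightarrow> nat \<Rightarrow> bool" where
  "adjacency f i j \<longleftrightarrow> i < j \<and> f (i, j) \<or> j < i \<and> f (j, i)"

text \<open>The distribution of the adjacency relation of the random graph on \<open>{1..n}\<close>; a finite product
  of Bernoulli distributions makes the edges independent.\<close>

definition random_graph :: "real \<Rightarrow> nat \<Rightarrow> (nat \<Rightarrow> nat \<Rightarrow> bool) pmf" where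
  "random_graph \<alpha> n =
     map_pmf adjacency
       (Pi_pmf (vertex_pairs n) False (\<lambda>(i, j). bernoulli_pmf (edge_prob \<alpha> (j - i))))"

definition sentence_prob :: "real \<Rightarrow> fo_formula \<Rightarrow> nat \<Rightarrow> real" where
  "sentence_prob \<alpha> \<phi> n = measure_pmf.prob (random_graph \<alpha> n) {E. models {1..n} E \<phi>}"

end

theory Submission
  imports Defs
begin

text \<open>An extension of a finite vertex set \<open>A\<close> to \<open>S\<close> is called dense if, for every partition of \<open>S\<close> with \<open>A\<close> inside one
  class, the number of other classes is less than \<open>\<alpha>\<close> times the number of edges between classes. As edges between
  clusters at distance about \<open>n\<close> have probability about \<open>n\<close> to the power \<open>-\<alpha>\<close>, dense extensions stay close to their
  root. An extension without dense part is called free; as \<open>\<alpha>\<close> is irrational, it has a partition all of whose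
  partial exponents are positive, so its copies are abundant.

  On the logical side, every new vertex lies in a free extension \<open>R\<close> of a bounded dense extension \<open>B\<close> of the
  vertices chosen before, and small dense extensions do not connect \<open>R - B\<close> with the outside of \<open>R\<close>. If the
  finitely many types of such \<open>R\<close> are realised over all copies of \<open>B\<close>, then a back-and-forth argument, whose
  invariant is a game played with bounded dense extensions only, shows that the truth of a sentence depends
  only on the dense extensions of the empty set. There are none except the empty set, so the sentence is decided.

  On the probabilistic side, Kruskal's algorithm bounds the sum over all dense extensions of the product of their
  edge probabilities: it is finite, and it decays polynomially if long edges are required. For a fixed copy
  of \<open>B\<close>, each of a constant number of independent trials searches copies of \<open>R\<close> in separate intervals. The second
  moment method yields many copies in a trial except with polynomially small probability, and unwanted dense
  extensions spoil all of them in many trials at once only with polynomially small probability. Sufficiently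
  many trials beat the union bound over the copies of \<open>B\<close>.\<close>

section \<open>Colourings and dense extensions\<close>

text \<open>Pairs at bounded distance are adjacent with probability bounded away from 0 and from 1.
  Comparing the number of vertices with \<alpha> times the number of edges, as for edge probability
  n^(-\<alpha>), is therefore not enough: every grouping into clusters has to be tested. Moreover,
  adding bounded dense extensions again and again need not stop after boundedly many rounds, so a
  finite set has no bounded closure. What does become stationary after boundedly many rounds is the
  largest exponent over all partitions. This bounds the root \<open>B\<close>, whereas
  \<open>R\<close> stays unbounded and is only known through its type. Irrationality enters through
  a single fact: h - \<alpha> x vanishes only for h = x = 0, so that maximality of an exponent
  yields strict inequalities. In the probabilistic part the failures of different trials are not
  independent, as one dense extension may touch several copies; the substitute is one density
  estimate for the union of all the extensions involved.\<close>

definition crossing :: "(nat \<Rightarrow> nat \<Rightarrow> bool) \<Rightarrow> (nat \<Rightarrow> nat) \<Rightarrow> nat set \<Rightarrow> (nat \<times> nat) set" where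
  "crossing E c S = {(u, v). u \<in> S \<and> v \<in> S \<and> u < v \<and> E u v \<and> c u \<noteq> c v}"

definition blocks :: "(nat \<Rightarrow> nat) \<Rightarrow> nat set \<Rightarrow> nat" where
  "blocks c S = card (c ` S - {0})"

lemma finite_crossing [simp]: "finite S \<Longrightarrow> finite (crossing E c S)"
  by (rule finite_subset[of _ "S \<times> S"]) (auto simp: crossing_def)

lemma crossing_mono: "S \<subseteq> T \<Longrightarrow> crossing E c S \<subseteq> crossing E c T"
  by (auto simp: crossing_def)

lemma card_crossing_mono:
  "finite T \<Longrightarrow> S \<subseteq> T \<Longrightarrow> card (crossing E c S) \<le> card (crossing E c T)"
  by (intro card_mono finite_crossing crossing_mono)

lemma blocks_le_card: "finite S \<Longrightarrow> blocks c S \<le> card S"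
  unfolding blocks_def by (meson card_Diff1_le card_image_le le_trans)

lemma blocks_eq_0_iff: "finite S \<Longrightarrow> blocks c S = 0 \<longleftrightarrow> (\<forall>v\<in>S. c v = 0)"
  by (auto simp: blocks_def)

text \<open>\<open>crossing\<close> lists each edge once, in increasing order, and a renaming of
  vertices can reverse that order. The symmetric count is invariant under renaming and serves to
  transport \<open>iext\<close> along injections.\<close>

lemma crossing_double:
  assumes "finite S" "symp E"
  shows "2 * card (crossing E c S) = card {(u, v). u \<in> S \<and> v \<in> S \<and> E u v \<and> c u \<noteq> c v}"
proof -
  let ?A = "crossing E c S" and ?B = "prod.swap ` crossing E c S"
  have "{(u, v). u \<in> S \<and> v \<in> S \<and> E u v \<and> c u \<noteq> c v} = ?A \<union> ?B"
  proof (intro set_eqI iffI)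
    fix x assume x: "x \<in> {(u, v). u \<in> S \<and> v \<in> S \<and> E u v \<and> c u \<noteq> c v}"
    obtain u v where uv: "x = (u, v)" by force
    have "u < v \<or> v < u" using x uv by (metis (mono_tags, lifting) case_prodD mem_Collect_eq linorder_neqE_nat)
    then show "x \<in> ?A \<union> ?B"
    proof
      assume "u < v" then show ?thesis using x uv by (auto simp: crossing_def)
    next
      assume "v < u"
      moreover have "E v u" using x uv assms(2) by (auto dest: sympD)
      ultimately have "(v, u) \<in> ?A" using x uv by (auto simp: crossing_def)
      then have "x \<in> ?B" using uv by force
      then show ?thesis by blast
    qed
  qed (use assms(2) in \<open>auto simp: crossing_def dest: sympD\<close>)
  moreover have "card (?A \<union> ?B) = card ?A + card ?B"
    using assms(1) by (intro card_Un_disjoint finite_imageI finite_crossing) (auto simp: crossing_def)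
  moreover have "card ?B = card ?A" by (intro card_image) (auto simp: inj_on_def)
  ultimately show ?thesis by simp
qed

text \<open>The partition induced by \<open>c\<close> when \<open>T\<close> becomes the root: all
  classes meeting \<open>T\<close> are absorbed into class 0. Together with \<open>c\<close>
  restricted to \<open>T\<close> it splits the blocks exactly and the crossing edges disjointly,
  which gives transitivity of density.\<close>

definition collapse :: "(nat \<Rightarrow> nat) \<Rightarrow> nat set \<Rightarrow> nat \<Rightarrow> nat" where
  "collapse c T v = (if c v \<in> c ` T then 0 else c v)"

lemma collapse_eq_0 [simp]: "v \<in> T \<Longrightarrow> collapse c T v = 0"
  by (simp add: collapse_def)

lemma blocks_collapse:
  assumes "finite S" "T \<subseteq> S"
  shows "blocks c S = blocks c T + blocks (collapse c T) S"
proof -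
  have eq: "collapse c T ` S - {0} = (c ` S - {0}) - (c ` T - {0})"
  proof (intro set_eqI iffI)
    fix w assume "w \<in> (c ` S - {0}) - (c ` T - {0})"
    then obtain x where "x \<in> S" "w = c x" "w \<noteq> 0" "w \<notin> c ` T" by blast
    then have "collapse c T x = w" by (simp add: collapse_def)
    then show "w \<in> collapse c T ` S - {0}" using \<open>x \<in> S\<close> \<open>w \<noteq> 0\<close> by blast
  qed (auto simp: collapse_def split: if_splits)
  have "card (c ` T - {0}) \<le> card (c ` S - {0})"
    using assms by (intro card_mono) auto
  moreover have "card (collapse c T ` S - {0}) = card (c ` S - {0}) - card (c ` T - {0})"
    unfolding eq using assms by (intro card_Diff_subset) (auto dest: finite_subset)
  ultimately show ?thesis by (simp add: blocks_def)
qed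

lemma crossing_collapse:
  "crossing E (collapse c T) S \<subseteq> crossing E c S - crossing E c T"
  by (auto simp: crossing_def collapse_def split: if_splits)

lemma card_crossing_collapse:
  assumes "finite S" "T \<subseteq> S"
  shows "card (crossing E c T) + card (crossing E (collapse c T) S) \<le> card (crossing E c S)"
proof -
  have "finite T" using assms finite_subset by blast
  have "card (crossing E c T) + card (crossing E (collapse c T) S)
      = card (crossing E c T \<union> crossing E (collapse c T) S)"
    using assms \<open>finite T\<close> crossing_collapse[of E c T S]
    by (intro card_Un_disjoint [symmetric]) auto
  also have "\<dots> \<le> card (crossing E c S)"
    using assms crossing_collapse[of E c T S] crossing_mono[OF assms(2), of E c]
    by (intro card_mono) auto
  finally show ?thesis .
qed

section \<open>Density of extensions and its closure properties\<close>

locale exponent =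
  fixes \<alpha> :: real
  assumes \<alpha>_pos: "0 < \<alpha>" and \<alpha>_less_1: "\<alpha> < 1"
begin

text \<open>A colouring \<open>c\<close> encodes a partition of \<open>S\<close> in which colour \<open>0\<close> is reserved for the class of the root \<open>A\<close>.
  Placing every class as a cluster of bounded diameter at an arbitrary position, one expects about \<open>n\<close> to the
  power \<open>wt E c S\<close> copies of \<open>S\<close> over a given copy of \<open>A\<close>. For \<open>iext\<close> this exponent is negative for every nontrivial
  partition, for \<open>dense_ext\<close> with a margin proportional to the number of clusters.\<close>

definition iext :: "(nat \<Rightarrow> nat \<Rightarrow> bool) \<Rightarrow> nat set \<Rightarrow> nat set \<Rightarrow> bool" where
  "iext E A S \<longleftrightarrow> A \<subseteq> S \<and> finite S \<and>
     (\<forall>c. (\<forall>v\<in>A. c v = 0) \<longrightarrow> blocks c S > 0 \<longrightarrow> real (blocks c S) < \<alpha> * real (card (crossing E c S)))"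

definition dense_ext :: "real \<Rightarrow> (nat \<Rightarrow> nat \<Rightarrow> bool) \<Rightarrow> nat set \<Rightarrow> nat set \<Rightarrow> bool" where
  "dense_ext \<theta> E A S \<longleftrightarrow> A \<subseteq> S \<and> finite S \<and>
     (\<forall>c. (\<forall>v\<in>A. c v = 0) \<longrightarrow> (1 + \<theta>) * real (blocks c S) \<le> \<alpha> * real (card (crossing E c S)))"

definition ifree :: "(nat \<Rightarrow> nat \<Rightarrow> bool) \<Rightarrow> nat set \<Rightarrow> nat set \<Rightarrow> bool" where
  "ifree E B S \<longleftrightarrow> B \<subseteq> S \<and> finite S \<and> (\<forall>Y. Y \<subseteq> S \<longrightarrow> iext E B Y \<longrightarrow> Y = B)"

definition wt :: "(nat \<Rightarrow> nat \<Rightarrow> bool) \<Rightarrow> (nat \<Rightarrow> nat) \<Rightarrow> nat set \<Rightarrow> real" where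
  "wt E c S = real (blocks c S) - \<alpha> * real (card (crossing E c S))"

lemma iextD: "iext E A S \<Longrightarrow> (\<And>v. v \<in> A \<Longrightarrow> c v = 0) \<Longrightarrow> blocks c S > 0 \<Longrightarrow>
    real (blocks c S) < \<alpha> * real (card (crossing E c S))"
  by (auto simp: iext_def)

lemma iext_imp_subset: "iext E A S \<Longrightarrow> A \<subseteq> S" by (simp add: iext_def)
lemma iext_imp_finite: "iext E A S \<Longrightarrow> finite S" by (simp add: iext_def)

lemma iext_refl: "finite A \<Longrightarrow> iext E A A"
  by (auto simp: iext_def blocks_def card_gt_0_iff)

lemma iext_trans:
  assumes "iext E A T" "iext E T S" shows "iext E A S"
  unfolding iext_def
proof (intro conjI allI impI)
  show "A \<subseteq> S" "finite S" using assms by (auto simp: iext_def)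
  fix c :: "nat \<Rightarrow> nat" assume c: "\<forall>v\<in>A. c v = 0" and pos: "blocks c S > 0"
  have fin: "finite S" "T \<subseteq> S" using assms by (auto simp: iext_def)
  note bl = blocks_collapse[OF fin, of c] and cr = card_crossing_collapse[OF fin, of E c]
  have 1: "blocks c T > 0 \<Longrightarrow> real (blocks c T) < \<alpha> * real (card (crossing E c T))"
    using assms(1) c by (auto intro: iextD)
  have 2: "blocks (collapse c T) S > 0 \<Longrightarrow>
      real (blocks (collapse c T) S) < \<alpha> * real (card (crossing E (collapse c T) S))"
    using assms(2) by (auto intro: iextD)
  have "\<alpha> * real (card (crossing E c T)) + \<alpha> * real (card (crossing E (collapse c T) S))
      \<le> \<alpha> * real (card (crossing E c S))"
    using cr \<alpha>_pos by (metis distrib_left mult_left_mono of_nat_add of_nat_mono less_imp_le)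
  moreover have "0 \<le> \<alpha> * real (card (crossing E c T))"
      "0 \<le> \<alpha> * real (card (crossing E (collapse c T) S))" using \<alpha>_pos by auto
  ultimately show "real (blocks c S) < \<alpha> * real (card (crossing E c S))"
    using 1 2 bl pos by (cases "blocks c T > 0"; cases "blocks (collapse c T) S > 0") auto
qed

lemma dense_ext_trans:
  assumes "dense_ext \<theta> E A T" "dense_ext \<theta> E T S" shows "dense_ext \<theta> E A S"
  unfolding dense_ext_def
proof (intro conjI allI impI)
  show "A \<subseteq> S" "finite S" using assms by (auto simp: dense_ext_def)
  fix c :: "nat \<Rightarrow> nat" assume c: "\<forall>v\<in>A. c v = 0"
  have fin: "finite S" "T \<subseteq> S" using assms by (auto simp: dense_ext_def)
  note bl = blocks_collapse[OF fin, of c] and cr = card_crossing_collapse[OF fin, of E c]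
  have 1: "(1 + \<theta>) * real (blocks c T) \<le> \<alpha> * real (card (crossing E c T))"
    using assms(1) c by (auto simp: dense_ext_def)
  have 2: "(1 + \<theta>) * real (blocks (collapse c T) S) \<le> \<alpha> * real (card (crossing E (collapse c T) S))"
    using assms(2) by (auto simp: dense_ext_def)
  have "\<alpha> * real (card (crossing E c T)) + \<alpha> * real (card (crossing E (collapse c T) S))
      \<le> \<alpha> * real (card (crossing E c S))"
    using cr \<alpha>_pos by (metis distrib_left mult_left_mono of_nat_add of_nat_mono less_imp_le)
  with 1 2 bl show "(1 + \<theta>) * real (blocks c S) \<le> \<alpha> * real (card (crossing E c S))"
    by (simp add: distrib_left)
qed

lemma blocks_Un_zero:
  assumes "\<And>v. v \<in> A \<Longrightarrow> c v = 0" shows "blocks c (A \<union> S) = blocks c S"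
proof -
  have "c ` (A \<union> S) - {0} = c ` S - {0}" using assms by auto
  then show ?thesis by (simp add: blocks_def)
qed

lemma iext_mono:
  assumes "iext E A S" "A \<subseteq> A'" "finite A'" shows "iext E A' (A' \<union> S)"
  unfolding iext_def
proof (intro conjI allI impI)
  show "A' \<subseteq> A' \<union> S" "finite (A' \<union> S)" using assms by (auto simp: iext_def)
  fix c :: "nat \<Rightarrow> nat" assume c: "\<forall>v\<in>A'. c v = 0" and pos: "blocks c (A' \<union> S) > 0"
  have bl: "blocks c (A' \<union> S) = blocks c S" using c by (intro blocks_Un_zero) auto
  have "real (blocks c S) < \<alpha> * real (card (crossing E c S))"
    using assms c pos bl by (intro iextD[OF assms(1)]) auto
  also have "\<dots> \<le> \<alpha> * real (card (crossing E c (A' \<union> S)))"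
    using assms \<alpha>_pos by (intro mult_left_mono of_nat_mono card_crossing_mono) (auto simp: iext_def)
  finally show "real (blocks c (A' \<union> S)) < \<alpha> * real (card (crossing E c (A' \<union> S)))" using bl by simp
qed

lemma dense_ext_mono:
  assumes "dense_ext \<theta> E A S" "A \<subseteq> A'" "finite A'" shows "dense_ext \<theta> E A' (A' \<union> S)"
  unfolding dense_ext_def
proof (intro conjI allI impI)
  show "A' \<subseteq> A' \<union> S" "finite (A' \<union> S)" using assms by (auto simp: dense_ext_def)
  fix c :: "nat \<Rightarrow> nat" assume c: "\<forall>v\<in>A'. c v = 0"
  have bl: "blocks c (A' \<union> S) = blocks c S" using c by (intro blocks_Un_zero) auto
  have "\<forall>v\<in>A. c v = 0" using assms c by auto
  then have "(1 + \<theta>) * real (blocks c S) \<le> \<alpha> * real (card (crossing E c S))"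
    using assms unfolding dense_ext_def by blast
  also have "\<dots> \<le> \<alpha> * real (card (crossing E c (A' \<union> S)))"
    using assms \<alpha>_pos by (intro mult_left_mono of_nat_mono card_crossing_mono) (auto simp: dense_ext_def)
  finally show "(1 + \<theta>) * real (blocks c (A' \<union> S)) \<le> \<alpha> * real (card (crossing E c (A' \<union> S)))"
    using bl by simp
qed

lemma iext_Un:
  assumes "iext E A S" "iext E A T" shows "iext E A (S \<union> T)"
  using iext_trans[OF assms(1) iext_mono[OF assms(2) iext_imp_subset[OF assms(1)]]]
    iext_imp_finite[OF assms(1)] by simp

text \<open>A colouring of \<open>T\<close> is extended by 0 to \<open>S\<close>. A crossing edge
  not inside \<open>T\<close> would join a vertex of \<open>T\<close> with nonzero colour, which
  lies outside \<open>A\<close>, to \<open>S - T\<close>; such edges are excluded. This lemma cuts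
  dense extensions along places without edges.\<close>

lemma iext_restrict:
  assumes "iext E A S" "T \<subseteq> S" "symp E" "\<And>x y. x \<in> T - A \<Longrightarrow> y \<in> S - T \<Longrightarrow> \<not> E x y"
  shows "iext E (A \<inter> T) T"
  unfolding iext_def
proof (intro conjI allI impI)
  show fin: "finite T" using assms by (auto simp: iext_def intro: finite_subset)
  fix c :: "nat \<Rightarrow> nat" assume c: "\<forall>v\<in>A \<inter> T. c v = 0" and pos: "blocks c T > 0"
  let ?c = "\<lambda>v. if v \<in> T then c v else 0"
  have bl: "blocks ?c S = blocks c T"
  proof -
    have "?c ` S - {0} = c ` T - {0}" using assms(2) by auto
    then show ?thesis by (simp add: blocks_def)
  qed
  have "crossing E ?c S \<subseteq> crossing E c T"
  proof
    fix e assume "e \<in> crossing E ?c S"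
    then obtain x y where e: "e = (x, y)" "x \<in> S" "y \<in> S" "x < y" "E x y" "?c x \<noteq> ?c y"
      by (auto simp: crossing_def)
    have "x \<in> T \<and> y \<in> T"
    proof (rule ccontr)
      assume not: "\<not> (x \<in> T \<and> y \<in> T)"
      show False
      proof (cases "x \<in> T")
        case True
        then have "y \<notin> T" "c x \<noteq> 0" using not e(6) by auto
        then have "x \<in> T - A" "y \<in> S - T" using True c e(3) by auto
        then show False using assms(4)[of x y] e(5) by blast
      next
        case False
        then have "y \<in> T" "c y \<noteq> 0" using e(6) by (auto split: if_splits)
        then have "y \<in> T - A" "x \<in> S - T" using False c e(2) by auto
        then show False using assms(4)[of y x] sympD[OF assms(3) e(5)] by blast
      qed
    qed
    then show "e \<in> crossing E c T" using e by (auto simp: crossing_def)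
  qed
  then have "card (crossing E ?c S) \<le> card (crossing E c T)" using fin by (intro card_mono) auto
  moreover have "real (blocks ?c S) < \<alpha> * real (card (crossing E ?c S))"
    using bl pos c by (intro iextD[OF assms(1)]) auto
  ultimately show "real (blocks c T) < \<alpha> * real (card (crossing E c T))"
    using bl \<alpha>_pos by (smt (verit) mult_left_mono of_nat_mono)
qed auto

text \<open>With no root to force colour 0, the constant colouring 1 has one block and no crossing
  edge.\<close>

lemma iext_empty: "iext E {} S \<Longrightarrow> S = {}"
proof (rule ccontr)
  assume *: "iext E {} S" "S \<noteq> {}"
  have b: "blocks (\<lambda>_. 1) S = 1" using *(2) by (simp add: blocks_def image_constant_conv)
  have "crossing E (\<lambda>_. 1) S = {}" by (auto simp: crossing_def)
  then show False using iextD[OF *(1), of "\<lambda>_. 1"] b by simp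
qed

text \<open>The root is monochromatic, so edges inside it never cross and density does not see
  them.\<close>

lemma iext_cong:
  assumes "\<And>x y. x \<in> S \<Longrightarrow> y \<in> S \<Longrightarrow> x \<notin> A \<or> y \<notin> A \<Longrightarrow> E x y \<longleftrightarrow> E' x y"
  shows "iext E A S \<longleftrightarrow> iext E' A S"
proof -
  have "crossing E c S = crossing E' c S" if "\<forall>v\<in>A. c v = 0" for c
    unfolding crossing_def using assms that by (intro Collect_cong) (clarsimp, metis)
  then show ?thesis by (auto simp: iext_def)
qed

lemma dense_ext_cong:
  assumes "\<And>x y. x \<in> S \<Longrightarrow> y \<in> S \<Longrightarrow> x \<notin> A \<or> y \<notin> A \<Longrightarrow> E x y \<longleftrightarrow> E' x y"
  shows "dense_ext \<theta> E A S \<longleftrightarrow> dense_ext \<theta> E' A S"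
proof -
  have "crossing E c S = crossing E' c S" if "\<forall>v\<in>A. c v = 0" for c
    unfolding crossing_def using assms that by (intro Collect_cong) (clarsimp, metis)
  then show ?thesis by (auto simp: dense_ext_def)
qed

lemma iext_image:
  assumes "iext E A S" "inj_on g S" "symp E" "symp E'"
    and "\<And>x y. x \<in> S \<Longrightarrow> y \<in> S \<Longrightarrow> E' (g x) (g y) \<longleftrightarrow> E x y"
  shows "iext E' (g ` A) (g ` S)"
  unfolding iext_def
proof (intro conjI allI impI)
  show "g ` A \<subseteq> g ` S" "finite (g ` S)" using assms by (auto simp: iext_def)
  have fin: "finite S" using assms(1) by (simp add: iext_def)
  fix c :: "nat \<Rightarrow> nat" assume c: "\<forall>v\<in>g ` A. c v = 0" and pos: "blocks c (g ` S) > 0"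
  have bl: "blocks c (g ` S) = blocks (c \<circ> g) S" by (simp add: blocks_def image_comp)
  let ?P = "{(u, v). u \<in> S \<and> v \<in> S \<and> E u v \<and> (c \<circ> g) u \<noteq> (c \<circ> g) v}"
  have "{(u, v). u \<in> g ` S \<and> v \<in> g ` S \<and> E' u v \<and> c u \<noteq> c v} = map_prod g g ` ?P"
  proof (intro set_eqI iffI)
    fix e assume "e \<in> {(u, v). u \<in> g ` S \<and> v \<in> g ` S \<and> E' u v \<and> c u \<noteq> c v}"
    then obtain x y where e: "e = (g x, g y)" "x \<in> S" "y \<in> S" "E' (g x) (g y)" "c (g x) \<noteq> c (g y)" by blast
    then have "(x, y) \<in> ?P" using assms(5) by auto
    then show "e \<in> map_prod g g ` ?P" using e(1) by force
  qed (use assms(5) in auto)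
  moreover have "card (map_prod g g ` ?P) = card ?P"
    using assms(2) by (intro card_image) (auto simp: inj_on_def)
  ultimately have "card (crossing E' c (g ` S)) = card (crossing E (c \<circ> g) S)"
    using crossing_double[OF fin assms(3), of "c \<circ> g"] crossing_double[of "g ` S" E' c] assms(4) fin
    by simp
  moreover have "real (blocks (c \<circ> g) S) < \<alpha> * real (card (crossing E (c \<circ> g) S))"
    using c pos bl by (intro iextD[OF assms(1)]) auto
  ultimately show "real (blocks c (g ` S)) < \<alpha> * real (card (crossing E' c (g ` S)))"
    using bl by simp
qed

text \<open>For each h the least x with h < \<alpha> x gives the smallest excess, and only finitely
  many h are allowed. The condition \<delta> \<le> \<alpha> makes a single additional crossing edge
  cost at least \<delta> as well.\<close>

lemma iext_bound:
  obtains \<delta> where "0 < \<delta>" "\<delta> \<le> \<alpha>"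
    "\<And>h x :: nat. 0 < h \<Longrightarrow> h \<le> m \<Longrightarrow> real h < \<alpha> * real x \<Longrightarrow> real h + \<delta> \<le> \<alpha> * real x"
proof -
  have "\<exists>\<delta>>0. \<delta> \<le> \<alpha> \<and> (\<forall>h x :: nat. h \<le> m \<longrightarrow> real h < \<alpha> * real x \<longrightarrow> real h + \<delta> \<le> \<alpha> * real x)"
  proof (induction m)
    case 0
    show ?case
    proof (intro exI[of _ \<alpha>] conjI allI impI)
      fix h x :: nat assume "h \<le> 0" "real h < \<alpha> * real x"
      then have "x \<ge> 1" using \<alpha>_pos by (cases x) auto
      then have "\<alpha> * 1 \<le> \<alpha> * real x" using \<alpha>_pos by (intro mult_left_mono) auto
      then show "real h + \<alpha> \<le> \<alpha> * real x" using \<open>h \<le> 0\<close> by simp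
    qed (use \<alpha>_pos in auto)
  next
    case (Suc m)
    then obtain \<delta> where \<delta>: "\<delta> > 0" "\<delta> \<le> \<alpha>"
      "\<And>h x :: nat. h \<le> m \<Longrightarrow> real h < \<alpha> * real x \<Longrightarrow> real h + \<delta> \<le> \<alpha> * real x" by blast
    define y where "y = (LEAST y :: nat. real (Suc m) < \<alpha> * real y)"
    have ex: "\<exists>y::nat. real (Suc m) < \<alpha> * real y"
      using reals_Archimedean3[OF \<alpha>_pos] by (metis mult.commute)
    have y: "real (Suc m) < \<alpha> * real y" unfolding y_def using ex by (rule LeastI_ex)
    define \<delta>' where "\<delta>' = min \<delta> (\<alpha> * real y - real (Suc m))"
    have "real h + \<delta>' \<le> \<alpha> * real x" if hx: "h \<le> Suc m" "real h < \<alpha> * real x" for h x :: nat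
    proof (cases "h = Suc m")
      case True
      then have "y \<le> x" unfolding y_def using hx by (intro Least_le) auto
      then have "\<alpha> * real y \<le> \<alpha> * real x" using \<alpha>_pos by (intro mult_left_mono) auto
      then show ?thesis using True by (auto simp: \<delta>'_def)
    next
      case False
      then have "h \<le> m" using hx by auto
      from \<delta>(3)[OF this hx(2)] show ?thesis by (auto simp: \<delta>'_def)
    qed
    moreover have "\<delta>' > 0" "\<delta>' \<le> \<alpha>" using \<delta> y by (auto simp: \<delta>'_def)
    ultimately show ?case by blast
  qed
  then show ?thesis using that by blast
qed

text \<open>A bounded extension has boundedly many blocks, so the uniform excess \<delta> can be
  spread over them. The multiplicative form keeps the same \<theta> when many such extensions are
  united, and it is the margin that makes the sums over spanning trees converge.\<close>

lemma iext_imp_dense_ext: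
  obtains \<theta> where "0 < \<theta>" "\<And>E A S. iext E A S \<Longrightarrow> card (S - A) \<le> m \<Longrightarrow> dense_ext \<theta> E A S"
proof -
  obtain \<delta> where \<delta>: "0 < \<delta>"
    "\<And>h x :: nat. 0 < h \<Longrightarrow> h \<le> m \<Longrightarrow> real h < \<alpha> * real x \<Longrightarrow> real h + \<delta> \<le> \<alpha> * real x"
    using iext_bound[of m] by metis
  define \<theta> where "\<theta> = \<delta> / (real m + 1)"
  have "dense_ext \<theta> E A S" if ie: "iext E A S" and m: "card (S - A) \<le> m" for E A S
    unfolding dense_ext_def
  proof (intro conjI allI impI)
    show fin: "A \<subseteq> S" "finite S" using ie by (auto simp: iext_def)
    fix c :: "nat \<Rightarrow> nat" assume c: "\<forall>v\<in>A. c v = 0"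
    show "(1 + \<theta>) * real (blocks c S) \<le> \<alpha> * real (card (crossing E c S))"
    proof (cases "blocks c S = 0")
      case True then show ?thesis using \<alpha>_pos by simp
    next
      case False
      have "A \<union> (S - A) = S" using fin by auto
      then have "blocks c S = blocks c (S - A)" using blocks_Un_zero[of A c "S - A"] c by metis
      then have le: "blocks c S \<le> m" using blocks_le_card[of "S - A" c] m fin by simp
      have "real (blocks c S) + \<delta> \<le> \<alpha> * real (card (crossing E c S))"
        using False c by (intro \<delta>(2) le iextD[OF ie]) auto
      moreover have "\<theta> * real (blocks c S) \<le> \<delta>"
      proof -
        have "\<theta> * real (blocks c S) \<le> \<theta> * (real m + 1)"
          using le \<delta>(1) by (intro mult_left_mono) (auto simp: \<theta>_def)
        then show ?thesis by (simp add: \<theta>_def)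
      qed
      ultimately show ?thesis by (simp add: distrib_right)
    qed
  qed
  moreover have "\<theta> > 0" using \<delta> by (simp add: \<theta>_def)
  ultimately show ?thesis using that by blast
qed

section \<open>Colourings of maximal weight\<close>

definition is_max :: "(nat \<Rightarrow> nat \<Rightarrow> bool) \<Rightarrow> nat set \<Rightarrow> nat set \<Rightarrow> (nat \<Rightarrow> nat) \<Rightarrow> bool" where
  "is_max E B S c \<longleftrightarrow> (\<forall>v\<in>B. c v = 0) \<and> (\<forall>c'. (\<forall>v\<in>B. c' v = 0) \<longrightarrow> wt E c' S \<le> wt E c S)"

lemma is_max_exists:
  assumes "finite S" obtains c where "is_max E B S c"
proof -
  let ?W = "(\<lambda>c. wt E c S) ` {c. \<forall>v\<in>B. c v = 0}"
  have "?W \<subseteq> (\<lambda>(h, x). real h - \<alpha> * real x) ` ({..card S} \<times> {..card (S \<times> S)})"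
  proof
    fix w assume "w \<in> ?W"
    then obtain c where c: "w = wt E c S" by auto
    have "card (crossing E c S) \<le> card (S \<times> S)"
      using assms by (intro card_mono) (auto simp: crossing_def)
    then show "w \<in> (\<lambda>(h, x). real h - \<alpha> * real x) ` ({..card S} \<times> {..card (S \<times> S)})"
      using c blocks_le_card[OF assms, of c] by (auto simp: wt_def)
  qed
  then have fin: "finite ?W" by (rule finite_subset) auto
  have ne: "?W \<noteq> {}" by (auto intro: exI[of _ "\<lambda>_. 0"])
  have "Max ?W \<in> ?W" using fin ne by (rule Max_in)
  then obtain c where c: "\<forall>v\<in>B. c v = 0" "wt E c S = Max ?W" by auto
  have "is_max E B S c" unfolding is_max_def
    using c fin by auto
  then show ?thesis by (rule that)
qed

lemma is_max_zero: "is_max E B S c \<Longrightarrow> v \<in> B \<Longrightarrow> c v = 0"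
  by (simp add: is_max_def)

lemma is_maxD: "is_max E B S c \<Longrightarrow> (\<And>v. v \<in> B \<Longrightarrow> c' v = 0) \<Longrightarrow> wt E c' S \<le> wt E c S"
  by (simp add: is_max_def)

lemma is_max_wt_eq: "is_max E B S c \<Longrightarrow> is_max E B S c' \<Longrightarrow> wt E c S = wt E c' S"
  by (intro order_antisym) (simp_all add: is_max_def)

lemma is_maxI_wt: "is_max E B S c \<Longrightarrow> (\<And>v. v \<in> B \<Longrightarrow> c' v = 0) \<Longrightarrow> wt E c S \<le> wt E c' S \<Longrightarrow> is_max E B S c'"
  unfolding is_max_def by (metis order_trans)

text \<open>Recolouring the classes in \<open>J\<close> by 0 gives up \<open>card J\<close> blocks
  and saves the crossing edges among \<open>J\<close> and the root; maximality forbids a gain. So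
  every part spanned by the root and some of the clusters has a nonnegative exponent, which is the
  kind of condition a second moment argument needs.\<close>

lemma is_max_colours:
  assumes max: "is_max E B S c" and fin: "finite S" and J: "J \<subseteq> c ` S - {0}"
  shows "\<alpha> * real (card {(u, v) \<in> crossing E c S. c u \<in> insert 0 J \<and> c v \<in> insert 0 J}) \<le> real (card J)"
proof -
  let ?d = "\<lambda>v. if c v \<in> J then 0 else c v"
  let ?K = "{(u, v) \<in> crossing E c S. c u \<in> insert 0 J \<and> c v \<in> insert 0 J}"
  have "?d ` S - {0} = (c ` S - {0}) - J" by auto
  then have "card (?d ` S - {0}) = card (c ` S - {0}) - card J"
    using J fin by (simp add: card_Diff_subset finite_subset)
  moreover have "card J \<le> card (c ` S - {0})" using J fin by (intro card_mono) auto
  ultimately have bl: "real (blocks ?d S) = real (blocks c S) - real (card J)"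
    by (simp add: blocks_def of_nat_diff)
  have "crossing E ?d S \<subseteq> crossing E c S - ?K"
    by (auto simp: crossing_def split: if_splits)
  then have "card (crossing E ?d S) \<le> card (crossing E c S - ?K)" using fin by (intro card_mono) auto
  also have "\<dots> = card (crossing E c S) - card ?K"
  proof (rule card_Diff_subset)
    show "finite ?K" by (rule finite_subset[OF _ finite_crossing[OF fin, of E c]]) auto
  qed auto
  finally have "card (crossing E ?d S) \<le> card (crossing E c S) - card ?K" .
  moreover have "card ?K \<le> card (crossing E c S)" using fin by (intro card_mono) auto
  ultimately have cr: "real (card (crossing E ?d S)) \<le> real (card (crossing E c S)) - real (card ?K)" by linarith
  have "wt E ?d S \<le> wt E c S" using max by (auto simp: is_max_def)
  then have "real (blocks c S) - real (card J) - \<alpha> * real (card (crossing E ?d S))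
      \<le> real (blocks c S) - \<alpha> * real (card (crossing E c S))" using bl by (simp add: wt_def)
  moreover have "\<alpha> * real (card (crossing E ?d S)) \<le> \<alpha> * (real (card (crossing E c S)) - real (card ?K))"
    using cr \<alpha>_pos by (intro mult_left_mono) auto
  ultimately show ?thesis by (simp add: right_diff_distrib)
qed

text \<open>Merging the colour classes of \<open>c\<close> that meet one class \<open>D\<close> of \<open>d\<close> changes the weight by at least
  the amount lost by splitting \<open>D\<close> along \<open>c\<close>, which is nonnegative by maximality of \<open>d\<close>.\<close>

lemma is_max_coarsest:
  assumes max: "is_max E B S c" and fin: "finite S" "B \<subseteq> S"
    and min: "\<And>c'. is_max E B S c' \<Longrightarrow> blocks c S \<le> blocks c' S"
    and nz: "\<And>v. v \<in> S - B \<Longrightarrow> c v \<noteq> 0"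
    and d: "is_max E B S d" "\<And>v. v \<in> S - B \<Longrightarrow> d v \<noteq> 0"
    and uv: "u \<in> S" "v \<in> S" "d u = d v"
  shows "c u = c v"
proof (cases "d u = 0")
  case True
  then have "u \<in> B" "v \<in> B" using d(2)[of u] d(2)[of v] uv by auto
  then show ?thesis using max by (simp add: is_max_def)
next
  case False
  define D where "D = {x \<in> S. d x = d u}"
  have DB: "D \<inter> B = {}" using d(1) False by (auto simp: D_def is_max_def)
  have D: "finite D" "D \<subseteq> S" "u \<in> D" "v \<in> D" using fin uv by (auto simp: D_def)
  define K where "K = c ` D"
  have "0 \<notin> K"
  proof
    assume "0 \<in> K"
    then obtain x where "x \<in> D" "c x = 0" by (auto simp: K_def)
    then show False using nz[of x] D DB by blast
  qed
  then have K: "finite K" "c u \<in> K" "0 \<notin> K" "K \<subseteq> c ` S - {0}"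
    using D by (auto simp: K_def)
  \<comment> \<open>Colours from \<open>m\<close> on are fresh for \<open>d\<close>. In
    \<open>d'\<close> they go to the parts into which \<open>c\<close> splits \<open>D\<close>; the
    part containing \<open>u\<close> keeps the colour of \<open>D\<close>.\<close>
  define m where "m = Max (insert 0 (d ` S)) + 1"
  have m: "d x < m" if "x \<in> S" for x
    unfolding m_def using that fin by (simp add: less_Suc_eq_le)
  define d' where "d' = (\<lambda>x. if x \<in> D \<and> c x \<noteq> c u then m + c x else d x)"
  define c' where "c' = (\<lambda>x. if c x \<in> K then c u else c x)"
  define F where "F = {(x, y) \<in> crossing E c S. c x \<in> K \<and> c y \<in> K}"
  have F: "F \<subseteq> crossing E c S" "finite F"
  proof -
    show "F \<subseteq> crossing E c S" by (auto simp: F_def)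
    then show "finite F" by (rule finite_subset[OF _ finite_crossing[OF fin(1)]])
  qed
  have bl_c': "blocks c' S + card K = blocks c S + 1"
  proof -
    have "c' ` S - {0} = insert (c u) ((c ` S - {0}) - K)"
      using K uv nz DB by (auto simp: c'_def) 
    moreover have "c u \<notin> (c ` S - {0}) - K" using K by auto
    ultimately have "blocks c' S = card ((c ` S - {0}) - K) + 1"
      using fin by (simp add: blocks_def)
    moreover have "card ((c ` S - {0}) - K) = blocks c S - card K"
      using K by (simp add: blocks_def card_Diff_subset)
    moreover have "card K \<le> blocks c S" unfolding blocks_def using K fin by (intro card_mono) auto
    ultimately show ?thesis by linarith
  qed
  have cr_c': "card (crossing E c' S) + card F \<le> card (crossing E c S)"
  proof -
    have "crossing E c' S \<subseteq> crossing E c S - F"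
      by (auto simp: crossing_def c'_def F_def split: if_splits)
    then have "card (crossing E c' S) \<le> card (crossing E c S - F)" using fin by (intro card_mono) auto
    also have "\<dots> = card (crossing E c S) - card F"
      using F by (intro card_Diff_subset)
    finally have "card (crossing E c' S) \<le> card (crossing E c S) - card F" .
    moreover have "card F \<le> card (crossing E c S)" using fin F by (intro card_mono) auto
    ultimately show ?thesis by linarith
  qed
  have bl_d': "blocks d S + card K \<le> blocks d' S + 1"
  proof -
    let ?N = "(\<lambda>k. m + k) ` (K - {c u})"
    have sub: "(d ` S - {0}) \<union> ?N \<subseteq> d' ` S - {0}"
    proof (intro subsetI, elim UnE)
      fix w assume w: "w \<in> d ` S - {0}"
      then obtain x where x: "x \<in> S" "w = d x" "w \<noteq> 0" by auto
      show "w \<in> d' ` S - {0}"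
      proof (cases "x \<in> D")
        case True
        then have "w = d' u" using x by (auto simp: d'_def D_def)
        then show ?thesis using uv x by auto
      next
        case False
        then have "w = d' x" using x by (auto simp: d'_def)
        then show ?thesis using x by auto
      qed
    next
      fix w assume "w \<in> ?N"
      then obtain x where x: "x \<in> D" "c x \<noteq> c u" "w = m + c x" by (auto simp: K_def)
      then have "w = d' x" by (simp add: d'_def)
      moreover have "w \<noteq> 0" using x by (simp add: m_def)
      ultimately show "w \<in> d' ` S - {0}" using x D by auto
    qed
    have "card ((d ` S - {0}) \<union> ?N) = card (d ` S - {0}) + card ?N"
      using fin K m by (intro card_Un_disjoint) (auto dest!: m)
    moreover have "card ?N = card K - 1" using K by (simp add: card_image)
    moreover have "card K \<ge> 1" using K by (metis One_nat_def Suc_leI card_gt_0_iff empty_iff)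
    moreover have "card ((d ` S - {0}) \<union> ?N) \<le> card (d' ` S - {0})"
      using sub fin by (intro card_mono) auto
    ultimately show ?thesis unfolding blocks_def by linarith
  qed
  have cr_d': "card (crossing E d' S) \<le> card (crossing E d S) + card F"
  proof -
    have "crossing E d' S \<subseteq> crossing E d S \<union> F"
    proof
      fix e assume "e \<in> crossing E d' S"
      then obtain x y where e: "e = (x, y)" "x \<in> S" "y \<in> S" "x < y" "E x y" "d' x \<noteq> d' y"
        by (auto simp: crossing_def)
      show "e \<in> crossing E d S \<union> F"
      proof (cases "d x = d y")
        case True
        then have "(x \<in> D) = (y \<in> D)" using e by (auto simp: D_def)
        then have "x \<in> D" "y \<in> D" "c x \<noteq> c y" using e True by (auto simp: d'_def split: if_splits)
        then show ?thesis using e by (auto simp: F_def K_def crossing_def)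
      qed (use e in \<open>auto simp: crossing_def\<close>)
    qed
    then have "card (crossing E d' S) \<le> card (crossing E d S \<union> F)"
      using fin F by (intro card_mono) auto
    also have "\<dots> \<le> card (crossing E d S) + card F" by (rule card_Un_le)
    finally show ?thesis .
  qed
  have "wt E d' S \<le> wt E d S"
  proof -
    have "d' x = 0" if "x \<in> B" for x using that DB d(1) by (auto simp: d'_def is_max_def)
    then show ?thesis using d(1) by (auto simp: is_max_def)
  qed
  then have "real (blocks d' S) - real (blocks d S) \<le> \<alpha> * (real (card (crossing E d' S)) - real (card (crossing E d S)))"
    by (simp add: wt_def right_diff_distrib)
  also have "\<dots> \<le> \<alpha> * real (card F)" using cr_d' \<alpha>_pos by (intro mult_left_mono) auto
  finally have key: "real (card K) - 1 \<le> \<alpha> * real (card F)" using bl_d' by linarith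
  have wt': "wt E c S \<le> wt E c' S"
  proof -
    have "\<alpha> * real (card F) \<le> \<alpha> * (real (card (crossing E c S)) - real (card (crossing E c' S)))"
      using cr_c' \<alpha>_pos by (intro mult_left_mono) auto
    then show ?thesis using key bl_c' by (simp add: wt_def right_diff_distrib)
  qed
  have "c' x = 0" if "x \<in> B" for x
    using that max K by (auto simp: c'_def is_max_def)
  then have "is_max E B S c'" using is_maxI_wt[OF max _ wt'] by simp
  \<comment> \<open>\<open>c'\<close> is again maximal and has \<open>card K - 1\<close> fewer
    blocks than \<open>c\<close>, so only one class of \<open>c\<close> meets
    \<open>D\<close>.\<close>
  from min[OF this] bl_c' have "card K \<le> 1" by linarith
  moreover have "c u \<in> K" "c v \<in> K" using D by (auto simp: K_def)
  ultimately show ?thesis using K(1) by (metis card_le_Suc0_iff_eq One_nat_def)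
qed

end

locale irrational_exponent = exponent +
  assumes \<alpha>_irrational: "\<alpha> \<notin> \<rat>"
begin

lemma irrational_eq_iff: "\<alpha> * real x = real h \<longleftrightarrow> x = 0 \<and> h = 0"
proof
  assume eq: "\<alpha> * real x = real h"
  show "x = 0 \<and> h = 0"
  proof (cases "x = 0")
    case False
    then have "\<alpha> = real h / real x" using eq by (simp add: field_simps)
    then have "\<alpha> \<in> \<rat>" by simp
    then show ?thesis using \<alpha>_irrational by simp
  qed (use eq in simp)
qed simp

text \<open>If the root class \<open>Z\<close> of a maximal colouring were larger than
  \<open>B\<close>, it would not be dense over \<open>B\<close>, so some colouring of
  \<open>Z\<close> with at least one block has nonnegative weight, hence positive weight by
  irrationality. Splitting \<open>Z\<close> accordingly, with fresh colours, would increase the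
  weight.\<close>

lemma ifree_is_max_nonzero:
  assumes max: "is_max E B S c" and free: "ifree E B S" and v: "v \<in> S - B"
  shows "c v \<noteq> 0"
proof
  assume v0: "c v = 0"
  have fin: "finite S" "B \<subseteq> S" using free by (auto simp: ifree_def)
  define Z where "Z = {x \<in> S. c x = 0}"
  have BZ: "B \<subseteq> Z" "Z \<subseteq> S" "finite Z" "v \<in> Z" using max fin v v0 by (auto simp: Z_def is_max_def)
  have "\<not> iext E B Z" using free BZ v by (auto simp: ifree_def)
  then obtain c' where c': "\<And>x. x \<in> B \<Longrightarrow> c' x = 0" "blocks c' Z > 0"
    "\<not> real (blocks c' Z) < \<alpha> * real (card (crossing E c' Z))"
    using BZ by (auto simp: iext_def)
  have pos: "wt E c' Z > 0"
  proof -
    have "\<alpha> * real (card (crossing E c' Z)) \<noteq> real (blocks c' Z)"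
      using irrational_eq_iff c'(2) by auto
    then show ?thesis using c'(3) by (auto simp: wt_def)
  qed
  define m where "m = Max (c ` S) + 1"
  have m: "c x < m" if "x \<in> S" for x
    unfolding m_def using that fin by (simp add: less_Suc_eq_le)
  define d where "d = (\<lambda>x. if x \<in> Z then (if c' x = 0 then 0 else m + c' x) else c x)"
  have col: "d ` S - {0} = (c ` S - {0}) \<union> (\<lambda>k. m + k) ` (c' ` Z - {0})"
  proof (intro set_eqI iffI)
    fix w assume "w \<in> d ` S - {0}"
    then obtain x where "x \<in> S" "w = d x" "w \<noteq> 0" by auto
    then show "w \<in> (c ` S - {0}) \<union> (\<lambda>k. m + k) ` (c' ` Z - {0})"
      by (auto simp: d_def split: if_splits)
  next
    fix w assume "w \<in> (c ` S - {0}) \<union> (\<lambda>k. m + k) ` (c' ` Z - {0})"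
    then show "w \<in> d ` S - {0}"
    proof
      assume "w \<in> c ` S - {0}"
      then obtain x where x: "x \<in> S" "w = c x" "w \<noteq> 0" by auto
      then have "d x = w" by (auto simp: d_def Z_def)
      then show ?thesis using x(1,3) by (metis DiffI image_eqI singletonD)
    next
      assume "w \<in> (\<lambda>k. m + k) ` (c' ` Z - {0})"
      then obtain x where x: "x \<in> Z" "w = m + c' x" "c' x \<noteq> 0" by auto
      then have "d x = w" "w \<noteq> 0" by (auto simp: d_def)
      then show ?thesis using x(1) BZ by (metis DiffI image_eqI singletonD subsetD)
    qed
  qed
  have "card (d ` S - {0}) = card (c ` S - {0}) + card ((\<lambda>k. m + k) ` (c' ` Z - {0}))"
    unfolding col using fin BZ by (intro card_Un_disjoint) (auto dest!: m)
  then have bl: "blocks d S = blocks c S + blocks c' Z"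
    by (simp add: blocks_def card_image)
  have "crossing E d S \<subseteq> crossing E c S \<union> crossing E c' Z"
    by (auto simp: crossing_def d_def Z_def split: if_splits)
  then have "card (crossing E d S) \<le> card (crossing E c S \<union> crossing E c' Z)"
    using fin BZ by (intro card_mono) auto
  also have "\<dots> \<le> card (crossing E c S) + card (crossing E c' Z)" by (rule card_Un_le)
  finally have "\<alpha> * real (card (crossing E d S)) \<le> \<alpha> * (real (card (crossing E c S)) + real (card (crossing E c' Z)))"
    using \<alpha>_pos by (intro mult_left_mono) auto
  then have "wt E c S < wt E d S" using bl pos by (simp add: wt_def distrib_left)
  moreover have "d x = 0" if "x \<in> B" for x using that BZ c' by (auto simp: d_def)
  ultimately show False using is_maxD[OF max, of d] by (simp add: not_less [symmetric])
qed

lemma is_max_colours_strict: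
  assumes max: "is_max E B S c" and fin: "finite S" and J: "J \<subseteq> c ` S - {0}" "J \<noteq> {}"
  shows "\<alpha> * real (card {(u, v) \<in> crossing E c S. c u \<in> insert 0 J \<and> c v \<in> insert 0 J}) < real (card J)"
proof -
  have "finite J" using J fin by (meson finite_Diff finite_imageI finite_subset)
  then have "card J \<noteq> 0" using J by simp
  then show ?thesis
    using is_max_colours[OF max fin J(1)] irrational_eq_iff
    by (metis (no_types, lifting) less_eq_real_def)
qed

end

section \<open>Envelopes\<close>

context exponent
begin

text \<open>The largest dense extension of \<open>A\<close> inside \<open>S\<close>, since a union
  of dense extensions is dense; \<open>S\<close> is free over it.\<close>

definition dhull :: "(nat \<Rightarrow> nat \<Rightarrow> bool) \<Rightarrow> nat set \<Rightarrow> nat set \<Rightarrow> nat set" where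
  "dhull E A S = \<Union>{Y. Y \<subseteq> S \<and> iext E A Y}"

definition max_wt :: "(nat \<Rightarrow> nat \<Rightarrow> bool) \<Rightarrow> nat set \<Rightarrow> nat set \<Rightarrow> real" where
  "max_wt E A S = wt E (SOME c. is_max E (dhull E A S) S c) S"

lemma hull_subset: "dhull E A S \<subseteq> S"
  by (auto simp: dhull_def)

lemma subset_hull: "iext E A Y \<Longrightarrow> Y \<subseteq> S \<Longrightarrow> Y \<subseteq> dhull E A S"
  by (auto simp: dhull_def)

lemma hull_mono: "S \<subseteq> T \<Longrightarrow> dhull E A S \<subseteq> dhull E A T"
  by (auto simp: dhull_def)

lemma iext_Union:
  assumes "finite F" "F \<noteq> {}" "\<And>Y. Y \<in> F \<Longrightarrow> iext E A Y" shows "iext E A (\<Union>F)"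
  using assms by (induction F rule: finite_ne_induct) (auto intro: iext_Un)

lemma iext_hull:
  assumes "finite S" "A \<subseteq> S" shows "iext E A (dhull E A S)"
  unfolding dhull_def
proof (rule iext_Union)
  have "iext E A A" using assms by (intro iext_refl) (rule finite_subset)
  then show "{Y. Y \<subseteq> S \<and> iext E A Y} \<noteq> {}" using assms by blast
  show "finite {Y. Y \<subseteq> S \<and> iext E A Y}"
    by (rule finite_subset[of _ "Pow S"]) (use assms in auto)
qed auto

lemma base_subset_hull: "finite S \<Longrightarrow> A \<subseteq> S \<Longrightarrow> A \<subseteq> dhull E A S"
  by (rule iext_imp_subset[OF iext_hull])

lemma ifree_hull:
  assumes "finite S" "A \<subseteq> S" shows "ifree E (dhull E A S) S"
  unfolding ifree_def
proof (intro conjI allI impI)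
  fix Y assume Y: "Y \<subseteq> S" "iext E (dhull E A S) Y"
  then have "iext E A Y" using iext_trans[OF iext_hull[OF assms]] by blast
  then have "Y \<subseteq> dhull E A S" using Y by (intro subset_hull)
  then show "Y = dhull E A S" using iext_imp_subset[OF Y(2)] by blast
qed (use assms hull_subset in auto)

lemma is_max_max_wt:
  assumes "finite S" shows "is_max E (dhull E A S) S c \<Longrightarrow> wt E c S = max_wt E A S"
proof -
  assume c: "is_max E (dhull E A S) S c"
  have "is_max E (dhull E A S) S (SOME c. is_max E (dhull E A S) S c)"
    using someI[of "is_max E (dhull E A S) S", OF c] .
  then show ?thesis unfolding max_wt_def using is_max_wt_eq c by blast
qed

lemma wt_le_max_wt:
  assumes "finite S" "\<And>v. v \<in> dhull E A S \<Longrightarrow> c v = 0" shows "wt E c S \<le> max_wt E A S"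
proof -
  obtain d where d: "is_max E (dhull E A S) S d" using is_max_exists assms(1) by blast
  show ?thesis using is_maxD[OF d, of c] assms is_max_max_wt[OF assms(1) d] by simp
qed

lemma is_maxI_max_wt:
  assumes "finite S" "\<And>v. v \<in> dhull E A S \<Longrightarrow> c v = 0" "max_wt E A S \<le> wt E c S"
  shows "is_max E (dhull E A S) S c"
  unfolding is_max_def using assms(2) wt_le_max_wt[OF assms(1), of E A] assms(3)
  by (meson order_trans)

lemma max_wt_nonneg: "finite S \<Longrightarrow> 0 \<le> max_wt E A S"
  using wt_le_max_wt[of S E A "\<lambda>_. 0"] by (simp add: wt_def blocks_def crossing_def image_constant_conv)

text \<open>Over the root \<open>S\<close>, density makes new blocks cost at least \<delta> more
  than they bring. Without new blocks, one new crossing edge costs \<alpha>, which is at least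
  \<delta>. The only way to keep the weight is to reuse the colours of \<open>S\<close> and 0 on
  \<open>X\<close> without any new crossing edge.\<close>

lemma wt_extension:
  assumes bound: "\<And>h x :: nat. 0 < h \<Longrightarrow> h \<le> T \<Longrightarrow> real h < \<alpha> * real x \<Longrightarrow> real h + \<delta> \<le> \<alpha> * real x"
    and \<delta>: "\<delta> \<le> \<alpha>" and ie: "iext E S (S \<union> X)" and card: "card (X - S) \<le> T"
  obtains h where "blocks c (S \<union> X) = blocks c S + h" "h \<le> T"
    "(\<forall>v\<in>X. c v \<in> insert 0 (c ` S)) \<and> h = 0 \<and> crossing E c (S \<union> X) = crossing E c S \<or> 
      wt E c (S \<union> X) \<le> wt E c S - \<delta>"
proof -
  have fin: "finite (S \<union> X)" using ie by (simp add: iext_def)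
  let ?d = "collapse c S"
  define h where "h = blocks ?d (S \<union> X)"
  have bl: "blocks c (S \<union> X) = blocks c S + h"
    using blocks_collapse[OF fin, of S c] by (simp add: h_def)
  have cr: "card (crossing E c S) + card (crossing E ?d (S \<union> X)) \<le> card (crossing E c (S \<union> X))"
    using card_crossing_collapse[OF fin, of S E c] by simp
  have "h = blocks ?d (X - S)"
    using blocks_Un_zero[of S ?d "X - S"] by (simp add: h_def)
  then have hT: "h \<le> T" using blocks_le_card[of "X - S" ?d] card fin by simp
  show ?thesis
  proof (cases "h = 0")
    case True
    have col: "\<forall>v\<in>X. c v \<in> insert 0 (c ` S)"
    proof
      fix v assume "v \<in> X"
      then have "?d v = 0" using True fin blocks_eq_0_iff[of "S \<union> X" ?d] unfolding h_def by blast
      then show "c v \<in> insert 0 (c ` S)" by (auto simp: collapse_def split: if_splits)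
    qed
    show ?thesis
    proof (cases "crossing E c (S \<union> X) = crossing E c S")
      case eq: True
      show ?thesis by (rule that[OF bl hT]) (use col True eq in blast)
    next
      case False
      then have "crossing E c S \<subset> crossing E c (S \<union> X)" using crossing_mono[of S "S \<union> X" E c] by blast
      then have "card (crossing E c S) < card (crossing E c (S \<union> X))"
        using fin by (intro psubset_card_mono) auto
      then have "\<alpha> * (real (card (crossing E c S)) + 1) \<le> \<alpha> * real (card (crossing E c (S \<union> X)))"
        using \<alpha>_pos by (intro mult_left_mono) auto
      then have "wt E c (S \<union> X) \<le> wt E c S - \<delta>"
        using bl True \<delta> by (simp add: wt_def distrib_left)
      then show ?thesis using that[OF bl hT] by blast
    qed
  next
    case False
    then have "real h < \<alpha> * real (card (crossing E ?d (S \<union> X)))"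
      unfolding h_def by (intro iextD[OF ie]) auto
    then have "real h + \<delta> \<le> \<alpha> * real (card (crossing E ?d (S \<union> X)))" using False hT by (intro bound) auto
    moreover have "\<alpha> * (real (card (crossing E c S)) + real (card (crossing E ?d (S \<union> X))))
        \<le> \<alpha> * real (card (crossing E c (S \<union> X)))"
      using cr \<alpha>_pos by (intro mult_left_mono) auto
    ultimately have "wt E c (S \<union> X) \<le> wt E c S - \<delta>"
      using bl by (simp add: wt_def distrib_left)
    then show ?thesis using that[OF bl hT] by blast
  qed
qed

text \<open>Stationarity of the maximal weight only: small dense extensions of \<open>S\<close> may
  still exist, and the hull may still grow with them.\<close>

definition terminal :: "nat set \<Rightarrow> (nat \<Rightarrow> nat \<Rightarrow> bool) \<Rightarrow> nat set \<Rightarrow> nat \<Rightarrow> nat set \<Rightarrow> bool" where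
  "terminal V E A T S \<longleftrightarrow>
     (\<forall>X. X \<subseteq> V \<longrightarrow> card (X - S) \<le> T \<longrightarrow> iext E S (S \<union> X) \<longrightarrow> max_wt E A (S \<union> X) = max_wt E A S)"

text \<open>Passing from \<open>S\<close> to an extension never increases the maximal weight. The linear invariant bounds
  the number of colours of a colouring of nonnegative weight, so that only boundedly many weights occur.\<close>

lemma terminal_exists:
  obtains N where "\<And>V E A v. finite V \<Longrightarrow> A \<subseteq> V \<Longrightarrow> v \<in> V \<Longrightarrow> card A \<le> s \<Longrightarrow>
    \<exists>S. A \<subseteq> S \<and> v \<in> S \<and> S \<subseteq> V \<and> card S \<le> N \<and> terminal V E A T S"
proof -
  obtain \<delta> where \<delta>: "0 < \<delta>" "\<delta> \<le> \<alpha>"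
    "\<And>h x :: nat. 0 < h \<Longrightarrow> h \<le> T \<Longrightarrow> real h < \<alpha> * real x \<Longrightarrow> real h + \<delta> \<le> \<alpha> * real x"
    using iext_bound[of T] by blast
  \<comment> \<open>For a colouring of nonnegative weight the invariant below bounds the blocks by
    \<open>H\<close>, hence the crossing edges by \<open>H / \<alpha>\<close>. All weights of this
    kind form the finite set \<open>\<Omega>\<close>.\<close>
  define H where "H = (real T + \<delta>) / \<delta>"
  define \<Omega> where "\<Omega> = (\<lambda>(h, x). real h - \<alpha> * real x) ` ({h::nat. real h \<le> H} \<times> {x::nat. real x \<le> H / \<alpha>})"
  have "finite {h::nat. real h \<le> r}" for r
    by (rule finite_subset[of _ "{..nat \<lceil>r\<rceil>}"]) (auto simp: le_nat_iff, linarith)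
  then have fin\<Omega>: "finite \<Omega>" by (auto simp: \<Omega>_def)
  have "\<exists>S. A \<subseteq> S \<and> v \<in> S \<and> S \<subseteq> V \<and> card S \<le> s + 1 + (card \<Omega> + 1) * T \<and> terminal V E A T S"
    if fin: "finite V" and A: "A \<subseteq> V" "v \<in> V" "card A \<le> s" for V E A v
  proof -
    \<comment> \<open>At the start at most the class of \<open>v\<close> is nonzero, so weight and
      number of blocks are at most 1; this gives the right-hand side. A step either changes neither
      quantity, or it adds at most \<open>T\<close> blocks while the weight drops by at least
      \<delta>; the sum does not grow.\<close>
    define Inv where "Inv = (\<lambda>S. \<forall>c. (\<forall>v\<in>A. c v = 0) \<longrightarrow> real T * wt E c S + \<delta> * real (blocks c S) \<le> real T + \<delta>)"
    have in\<Omega>: "max_wt E A S \<in> \<Omega>" if "Inv S" "finite S" "A \<subseteq> S" for S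
    proof -
      obtain c where c: "is_max E (dhull E A S) S c" using is_max_exists \<open>finite S\<close> by blast
      have w: "wt E c S = max_wt E A S" using is_max_max_wt c \<open>finite S\<close> by blast
      then have w0: "0 \<le> wt E c S" using max_wt_nonneg \<open>finite S\<close> by simp
      have "\<forall>v\<in>A. c v = 0" using base_subset_hull[of S A E] that is_max_zero[OF c] by auto
      then have "real T * wt E c S + \<delta> * real (blocks c S) \<le> real T + \<delta>" using that by (simp add: Inv_def)
      moreover have "0 \<le> real T * wt E c S" using w0 by simp
      ultimately have "\<delta> * real (blocks c S) \<le> real T + \<delta>" by linarith
      then have h: "real (blocks c S) \<le> H" using \<delta> by (simp add: H_def field_simps)
      have "\<alpha> * real (card (crossing E c S)) \<le> H" using w0 h by (simp add: wt_def)
      then have "real (card (crossing E c S)) \<le> H / \<alpha>" using \<alpha>_pos by (simp add: field_simps)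
      then show ?thesis unfolding w [symmetric] \<Omega>_def wt_def using h by force
    qed
    have finA: "finite A" using A fin finite_subset by blast
    \<comment> \<open>A round that is not terminal strictly lowers the maximal weight inside
      \<open>\<Omega>\<close>, so after \<open>card \<Omega> + 1\<close> rounds the second
      alternative is impossible.\<close>
    have "\<exists>S. A \<subseteq> S \<and> v \<in> S \<and> S \<subseteq> V \<and> Inv S \<and> card S \<le> s + 1 + i * T \<and>
        (terminal V E A T S \<or> card {w\<in>\<Omega>. w < max_wt E A S} + i \<le> card \<Omega>)" for i
    proof (induction i)
      case 0
      have "Inv (insert v A)"
        unfolding Inv_def
      proof (intro allI impI)
        fix c :: "nat \<Rightarrow> nat" assume c: "\<forall>v\<in>A. c v = 0"
        have "blocks c (A \<union> {v}) = blocks c {v}" using c by (intro blocks_Un_zero) auto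
        then have b: "blocks c (insert v A) \<le> 1" using blocks_le_card[of "{v}" c] by simp
        have "wt E c (insert v A) \<le> real (blocks c (insert v A))" using \<alpha>_pos by (simp add: wt_def)
        then have "real T * wt E c (insert v A) \<le> real T * 1" using b by (intro mult_left_mono) auto
        moreover have "\<delta> * real (blocks c (insert v A)) \<le> \<delta> * 1" using b \<delta> by (intro mult_left_mono) auto
        ultimately show "real T * wt E c (insert v A) + \<delta> * real (blocks c (insert v A)) \<le> real T + \<delta>" by linarith
      qed
      moreover have "card {w\<in>\<Omega>. w < max_wt E A (insert v A)} \<le> card \<Omega>" using fin\<Omega> by (intro card_mono) auto
      moreover have "card (insert v A) \<le> s + 1" using A finA by (simp add: card_insert_if)
      ultimately show ?case using A by (intro exI[of _ "insert v A"]) auto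
    next
      case (Suc i)
      then obtain S where S: "A \<subseteq> S" "v \<in> S" "S \<subseteq> V" "Inv S" "card S \<le> s + 1 + i * T"
        "terminal V E A T S \<or> card {w\<in>\<Omega>. w < max_wt E A S} + i \<le> card \<Omega>" by blast
      show ?case
      proof (cases "terminal V E A T S")
        case True
        then show ?thesis using S by (intro exI[of _ S]) auto
      next
        case False
        then obtain X where X: "X \<subseteq> V" "card (X - S) \<le> T" "iext E S (S \<union> X)"
          "max_wt E A (S \<union> X) \<noteq> max_wt E A S" by (auto simp: terminal_def)
        have finSX: "finite (S \<union> X)" "finite S" using X by (auto simp: iext_def)
        have inv: "Inv (S \<union> X)"
          unfolding Inv_def
        proof (intro allI impI)
          fix c :: "nat \<Rightarrow> nat" assume c: "\<forall>v\<in>A. c v = 0"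
          have I: "real T * wt E c S + \<delta> * real (blocks c S) \<le> real T + \<delta>" using S(4) c by (simp add: Inv_def)
          obtain h where h: "blocks c (S \<union> X) = blocks c S + h" "h \<le> T"
            "(\<forall>v\<in>X. c v \<in> insert 0 (c ` S)) \<and> h = 0 \<and> crossing E c (S \<union> X) = crossing E c S \<or> 
              wt E c (S \<union> X) \<le> wt E c S - \<delta>"
            using wt_extension[OF \<delta>(3) \<delta>(2) X(3) X(2)] by blast
          from h(3) show "real T * wt E c (S \<union> X) + \<delta> * real (blocks c (S \<union> X)) \<le> real T + \<delta>"
          proof
            assume "wt E c (S \<union> X) \<le> wt E c S - \<delta>"
            then have "real T * wt E c (S \<union> X) \<le> real T * (wt E c S - \<delta>)" by (intro mult_left_mono) auto
            moreover have "\<delta> * real h \<le> \<delta> * real T" using h \<delta> by (intro mult_left_mono) auto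
            ultimately show ?thesis using I h(1) by (simp add: algebra_simps)
          qed (use h I in \<open>simp add: wt_def\<close>)
        qed
        have le: "max_wt E A (S \<union> X) \<le> max_wt E A S"
        proof -
          obtain c where c: "is_max E (dhull E A (S \<union> X)) (S \<union> X) c" using is_max_exists finSX by blast
          obtain h where h: "blocks c (S \<union> X) = blocks c S + h" "h \<le> T"
            "(\<forall>v\<in>X. c v \<in> insert 0 (c ` S)) \<and> h = 0 \<and> crossing E c (S \<union> X) = crossing E c S \<or> 
              wt E c (S \<union> X) \<le> wt E c S - \<delta>"
            using wt_extension[OF \<delta>(3) \<delta>(2) X(3) X(2)] by blast
          then have "wt E c (S \<union> X) \<le> wt E c S" using \<delta> by (auto simp: wt_def)
          also have "\<dots> \<le> max_wt E A S"
            using hull_mono[of S "S \<union> X" E A] is_max_zero[OF c] by (intro wt_le_max_wt finSX) auto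
          finally show ?thesis using is_max_max_wt[OF finSX(1) c] by simp
        qed
        with X have less: "max_wt E A (S \<union> X) < max_wt E A S" by simp
        have "max_wt E A (S \<union> X) \<in> \<Omega>" using inv finSX S by (intro in\<Omega>) auto
        then have "{w\<in>\<Omega>. w < max_wt E A (S \<union> X)} \<subset> {w\<in>\<Omega>. w < max_wt E A S}" using less by auto
        then have "card {w\<in>\<Omega>. w < max_wt E A (S \<union> X)} < card {w\<in>\<Omega>. w < max_wt E A S}"
          using fin\<Omega> by (intro psubset_card_mono) auto
        then have 1: "card {w\<in>\<Omega>. w < max_wt E A (S \<union> X)} + Suc i \<le> card \<Omega>" using S(6) False by linarith
        have "card (S \<union> X) \<le> card S + card (X - S)" using card_Un_le[of S "X - S"] by simp
        then have "card (S \<union> X) \<le> s + 1 + Suc i * T" using X S by simp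
        then show ?thesis using S X inv 1 by (intro exI[of _ "S \<union> X"]) auto
      qed
    qed
    from this[of "card \<Omega> + 1"] obtain S where S: "A \<subseteq> S" "v \<in> S" "S \<subseteq> V"
      "card S \<le> s + 1 + (card \<Omega> + 1) * T"
      "terminal V E A T S \<or> card {w\<in>\<Omega>. w < max_wt E A S} + (card \<Omega> + 1) \<le> card \<Omega>" by blast
    from S(5) have "terminal V E A T S" by linarith
    with S show ?thesis by blast
  qed
  note main = this
  show ?thesis by (rule that[of "s + 1 + (card \<Omega> + 1) * T"]) (rule main)
qed

end

context irrational_exponent
begin

text \<open>By stationarity a maximal colouring of \<open>S \<union> X\<close>, for a small dense
  extension \<open>X\<close>, uses no new colour and has no crossing edge outside \<open>S\<close>.
  Hence the coarsest maximal colouring of \<open>S\<close> spreads over all small dense extensions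
  in exactly one way. Vertices in hulls get colour 0; those of \<open>X\<close> outside the hull get
  a nonzero colour and go into \<open>R\<close>. Since different colours are joined only inside
  \<open>S\<close>, freeness of \<open>R\<close> reduces to maximality of the colouring of
  \<open>S\<close>, and an edge from a hull vertex outside \<open>S\<close> to \<open>R - B\<close>
  would be a forbidden crossing edge.\<close>

lemma envelope_of_terminal:
  assumes fin: "finite V" and sym: "symp E" and AS: "A \<subseteq> S" "v \<in> S" "S \<subseteq> V"
    and tmnl: "terminal V E A (2 * m) S"
  defines "B \<equiv> dhull E A S"
  shows "\<exists>R. B \<subseteq> R \<and> R \<subseteq> V \<and> v \<in> R \<and> ifree E B R \<and>
    (\<forall>W. W \<subseteq> V \<longrightarrow> card (W - insert v B) \<le> m \<longrightarrow> iext E (insert v B) (insert v B \<union> W) \<longrightarrow>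
       (\<forall>x\<in>W - R. \<forall>y\<in>R - B. \<not> E x y))"
proof -
  obtain \<delta> where \<delta>: "0 < \<delta>" "\<delta> \<le> \<alpha>"
    "\<And>h x :: nat. 0 < h \<Longrightarrow> h \<le> 2 * m \<Longrightarrow> real h < \<alpha> * real x \<Longrightarrow> real h + \<delta> \<le> \<alpha> * real x"
    using iext_bound[of "2 * m"] by blast
  have finS: "finite S" using fin AS finite_subset by blast
  have BS: "B \<subseteq> S" unfolding B_def by (rule hull_subset)
  have freeS: "ifree E B S" unfolding B_def using finS AS by (intro ifree_hull)
  define good where "good = (\<lambda>k X. X \<subseteq> V \<and> card (X - S) \<le> k \<and> iext E S (S \<union> X))"
  have good_mono: "good k X" if "good l X" "l \<le> k" for k l X using that by (auto simp: good_def)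
  have finX: "finite X" if "good k X" for k X using that by (auto simp: good_def iext_def)
  have good_Un: "good (k + l) (X \<union> Y)" if "good k X" "good l Y" for k l X Y
  proof -
    have "(S \<union> X) \<union> (S \<union> Y) = S \<union> (X \<union> Y)" by auto
    then have "iext E S (S \<union> (X \<union> Y))"
      using that iext_Un[of E S "S \<union> X" "S \<union> Y"] by (simp add: good_def)
    moreover have "X \<union> Y - S = (X - S) \<union> (Y - S)" by auto
    then have "card (X \<union> Y - S) \<le> card (X - S) + card (Y - S)" by (simp add: card_Un_le)
    ultimately show ?thesis using that by (auto simp: good_def)
  qed
  have good0: "good k {}" for k using iext_refl[OF finS] by (simp add: good_def)
  have mw: "max_wt E A (S \<union> X) = max_wt E A S" if "good (2 * m) X" for X
    using that tmnl by (auto simp: good_def terminal_def)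
  have local: "(\<forall>v\<in>X. \<pi> v \<in> insert 0 (\<pi> ` S)) \<and> crossing E \<pi> (S \<union> X) = crossing E \<pi> S \<and> is_max E B S \<pi>"
    if X: "good (2 * m) X" and \<pi>: "is_max E (dhull E A (S \<union> X)) (S \<union> X) \<pi>" for X \<pi>
  proof -
    have finSX: "finite (S \<union> X)" using X by (auto simp: good_def iext_def)
    have X': "card (X - S) \<le> 2 * m" "iext E S (S \<union> X)" using X by (auto simp: good_def)
    obtain h where h: "blocks \<pi> (S \<union> X) = blocks \<pi> S + h"
      "(\<forall>v\<in>X. \<pi> v \<in> insert 0 (\<pi> ` S)) \<and> h = 0 \<and> crossing E \<pi> (S \<union> X) = crossing E \<pi> S \<or> 
              wt E \<pi> (S \<union> X) \<le> wt E \<pi> S - \<delta>"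
      using wt_extension[OF \<delta>(3) \<delta>(2) X'(2) X'(1)] by blast
    have z: "\<pi> v = 0" if "v \<in> dhull E A S" for v
      using that hull_mono[of S "S \<union> X" E A] is_max_zero[OF \<pi>] by blast
    have le: "wt E \<pi> S \<le> max_wt E A S" using z by (intro wt_le_max_wt finS)
    have eq: "wt E \<pi> (S \<union> X) = max_wt E A S" using is_max_max_wt[OF finSX \<pi>] mw[OF X] by simp
    from h(2) have h': "(\<forall>v\<in>X. \<pi> v \<in> insert 0 (\<pi> ` S)) \<and> h = 0 \<and> crossing E \<pi> (S \<union> X) = crossing E \<pi> S"
      using le eq \<delta>(1) by linarith
    then have "wt E \<pi> S = wt E \<pi> (S \<union> X)" using h(1) by (simp add: wt_def)
    then have "is_max E (dhull E A S) S \<pi>" using z eq by (intro is_maxI_max_wt finS) auto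
    then show ?thesis using h' by (simp add: B_def)
  qed
  \<comment> \<open>Having the fewest blocks makes \<open>\<pi>0\<close> coarser than every maximal
    colouring of \<open>S\<close>, so it factors through each of them.\<close>
  obtain \<pi>0 where \<pi>0: "is_max E B S \<pi>0" "\<And>c. is_max E B S c \<Longrightarrow> blocks \<pi>0 S \<le> blocks c S"
    using ex_has_least_nat[of "is_max E B S" _ "\<lambda>c. blocks c S"] is_max_exists[OF finS] by metis
  have nz: "c u \<noteq> 0" if "is_max E B S c" "u \<in> S - B" for c u
    using ifree_is_max_nonzero[OF that(1) freeS that(2)] .
  have coarse: "\<pi>0 x = \<pi>0 y" if "is_max E B S d" "x \<in> S" "y \<in> S" "d x = d y" for d x y
    using is_max_coarsest[OF \<pi>0(1) finS BS \<pi>0(2) nz[OF \<pi>0(1)] that(1) nz[OF that(1)] that(2-4)] by blast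
  have ext_ex: "\<exists>\<pi>. is_max E (dhull E A (S \<union> X)) (S \<union> X) \<pi> \<and> (\<forall>v\<in>S. \<pi> v = \<pi>0 v)"
    if X: "good (2 * m) X" for X
  proof -
    have finSX: "finite (S \<union> X)" using X by (auto simp: good_def iext_def)
    obtain \<tau> where \<tau>: "is_max E (dhull E A (S \<union> X)) (S \<union> X) \<tau>" using is_max_exists[OF finSX] by blast
    note loc = local[OF X \<tau>]
    \<comment> \<open>The classes of \<open>\<tau>\<close> are renamed by the
      \<open>\<pi>0\<close>-colour of a representative in \<open>S\<close>; by coarseness the choice
      of the representative does not matter.\<close>
    define \<pi> where "\<pi> = (\<lambda>w. if w \<in> S then \<pi>0 w else if \<tau> w = 0 then 0 else \<pi>0 (SOME e. e \<in> S \<and> \<tau> e = \<tau> w))"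
    have zero: "\<pi> w = 0" if "\<tau> w = 0" for w
    proof (cases "w \<in> S")
      case True
      then have "w \<in> B" using nz[of \<tau> w] loc that by blast
      then show ?thesis using True is_max_zero[OF \<pi>0(1)] by (simp add: \<pi>_def)
    qed (use that in \<open>simp add: \<pi>_def\<close>)
    have rep: "\<pi> w = \<pi>0 e" if "e \<in> S" "\<tau> e = \<tau> w" "\<tau> w \<noteq> 0" for w e
    proof (cases "w \<in> S")
      case True
      then show ?thesis using coarse[of \<tau> w e] that loc by (simp add: \<pi>_def)
    next
      case False
      have "(SOME e. e \<in> S \<and> \<tau> e = \<tau> w) \<in> S \<and> \<tau> (SOME e. e \<in> S \<and> \<tau> e = \<tau> w) = \<tau> w"
        by (rule someI[of "\<lambda>e. e \<in> S \<and> \<tau> e = \<tau> w" e]) (use that in auto)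
      then show ?thesis using coarse[of \<tau> "SOME e. e \<in> S \<and> \<tau> e = \<tau> w" e] that loc False by (simp add: \<pi>_def)
    qed
    have same: "\<pi> x = \<pi> y" if xy: "x \<in> S \<union> X" "y \<in> S \<union> X" "\<tau> x = \<tau> y" for x y
    proof (cases "\<tau> x = 0")
      case True
      then show ?thesis using zero xy by metis
    next
      case False
      have "\<tau> x \<in> \<tau> ` S" using xy(1) loc False by auto
      then obtain e where "e \<in> S" "\<tau> e = \<tau> x" by auto
      then show ?thesis using rep[of e x] rep[of e y] xy False by simp
    qed
    have cr: "crossing E \<pi> (S \<union> X) \<subseteq> crossing E \<pi>0 S"
    proof
      fix p assume "p \<in> crossing E \<pi> (S \<union> X)"
      then obtain x y where p: "p = (x, y)" "x \<in> S \<union> X" "y \<in> S \<union> X" "x < y" "E x y" "\<pi> x \<noteq> \<pi> y"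
        by (auto simp: crossing_def)
      then have "\<tau> x \<noteq> \<tau> y" using same by blast
      then have "(x, y) \<in> crossing E \<tau> (S \<union> X)" using p by (auto simp: crossing_def)
      then have "x \<in> S" "y \<in> S" using loc by (auto simp: crossing_def)
      then show "p \<in> crossing E \<pi>0 S" using p by (auto simp: crossing_def \<pi>_def)
    qed
    have "\<pi> ` S = \<pi>0 ` S" by (auto simp: \<pi>_def)
    then have "\<pi>0 ` S - {0} \<subseteq> \<pi> ` (S \<union> X) - {0}" by auto
    then have bl: "blocks \<pi>0 S \<le> blocks \<pi> (S \<union> X)" unfolding blocks_def using finSX by (intro card_mono) auto
    have "\<alpha> * real (card (crossing E \<pi> (S \<union> X))) \<le> \<alpha> * real (card (crossing E \<pi>0 S))"
      using cr finS \<alpha>_pos by (intro mult_left_mono of_nat_mono card_mono) auto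
    then have "wt E \<pi>0 S \<le> wt E \<pi> (S \<union> X)" using bl by (simp add: wt_def)
    then have "max_wt E A (S \<union> X) \<le> wt E \<pi> (S \<union> X)"
      using is_max_max_wt[OF finS] \<pi>0(1) mw[OF X] by (simp add: B_def)
    then have "is_max E (dhull E A (S \<union> X)) (S \<union> X) \<pi>"
      using zero is_max_zero[OF \<tau>] by (intro is_maxI_max_wt finSX) auto
    moreover have "\<forall>v\<in>S. \<pi> v = \<pi>0 v" by (simp add: \<pi>_def)
    ultimately show ?thesis by blast
  qed
  define kap where "kap = (\<lambda>X. SOME \<pi>. is_max E (dhull E A (S \<union> X)) (S \<union> X) \<pi> \<and> (\<forall>v\<in>S. \<pi> v = \<pi>0 v))"
  have kap: "is_max E (dhull E A (S \<union> X)) (S \<union> X) (kap X)" "\<And>v. v \<in> S \<Longrightarrow> kap X v = \<pi>0 v"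
    if "good (2 * m) X" for X
    using someI_ex[OF ext_ex[OF that]] by (auto simp: kap_def)
  have uniq: "\<pi> z = \<pi>' z"
    if X: "good (2 * m) X" and \<pi>: "is_max E (dhull E A (S \<union> X)) (S \<union> X) \<pi>" "\<And>v. v \<in> S \<Longrightarrow> \<pi> v = \<pi>0 v"
      and \<pi>': "is_max E (dhull E A (S \<union> X)) (S \<union> X) \<pi>'" "\<And>v. v \<in> S \<Longrightarrow> \<pi>' v = \<pi>0 v"
      and z: "z \<in> S \<union> X" for X \<pi> \<pi>' z
  proof (rule ccontr)
    assume neq: "\<pi> z \<noteq> \<pi>' z"
    \<comment> \<open>The set where two extensions of \<open>\<pi>0\<close> differ, taken as one
      block. It avoids \<open>S\<close>, and no edge leaves it: an edge outside \<open>S\<close>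
      crosses neither \<open>\<pi>\<close> nor \<open>\<pi>'\<close>, so its ends lie both in the
      set or both outside. This contradicts density over \<open>S\<close>.\<close>
    define c where "c = (\<lambda>w. if w \<in> S \<union> X \<and> \<pi> w \<noteq> \<pi>' w then 1 else 0 :: nat)"
    have e1: "\<pi> x = \<pi> y \<and> \<pi>' x = \<pi>' y" if "(x, y) \<in> crossing E c (S \<union> X)" for x y
    proof -
      have "x \<notin> S \<or> y \<notin> S" using that \<pi>(2) \<pi>'(2) by (auto simp: crossing_def c_def split: if_splits)
      then have "(x, y) \<notin> crossing E \<pi> S" "(x, y) \<notin> crossing E \<pi>' S" by (auto simp: crossing_def)
      then have "(x, y) \<notin> crossing E \<pi> (S \<union> X)" "(x, y) \<notin> crossing E \<pi>' (S \<union> X)"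
        using local[OF X \<pi>(1)] local[OF X \<pi>'(1)] by auto
      then show ?thesis using that by (auto simp: crossing_def)
    qed
    have "crossing E c (S \<union> X) = {}"
    proof (rule ccontr)
      assume "crossing E c (S \<union> X) \<noteq> {}"
      then obtain x y where xy: "(x, y) \<in> crossing E c (S \<union> X)" by auto
      from e1[OF this] xy show False by (auto simp: crossing_def c_def split: if_splits)
    qed
    moreover have "\<forall>v\<in>S. c v = 0" using \<pi>(2) \<pi>'(2) by (auto simp: c_def)
    moreover have finSX: "finite (S \<union> X)" using X by (auto simp: good_def iext_def)
    have "c z = 1" using neq z by (simp add: c_def)
    then have "blocks c (S \<union> X) > 0" using blocks_eq_0_iff[OF finSX, of c] z by auto
    ultimately show False using iextD[of E S "S \<union> X" c] X by (auto simp: good_def)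
  qed
  have restrict: "kap Z z = kap X z" if X: "good (2 * m) X" and Z: "good (2 * m) Z" and "X \<subseteq> Z" "z \<in> S \<union> X" for X Z z
  proof -
    have finSX: "finite (S \<union> X)" using X by (auto simp: good_def iext_def)
    have "crossing E (kap Z) (S \<union> X) \<subseteq> crossing E (kap Z) (S \<union> Z)"
      using that by (intro crossing_mono) auto
    then have "crossing E (kap Z) (S \<union> X) \<subseteq> crossing E (kap Z) S" using local[OF Z kap(1)[OF Z]] by simp
    then have "\<alpha> * real (card (crossing E (kap Z) (S \<union> X))) \<le> \<alpha> * real (card (crossing E (kap Z) S))"
      using finS \<alpha>_pos by (intro mult_left_mono of_nat_mono card_mono) auto
    moreover have "blocks (kap Z) S \<le> blocks (kap Z) (S \<union> X)"
      unfolding blocks_def using finSX by (intro card_mono) auto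
    ultimately have "wt E (kap Z) S \<le> wt E (kap Z) (S \<union> X)" by (simp add: wt_def)
    moreover have "wt E (kap Z) S = max_wt E A S"
      using local[OF Z kap(1)[OF Z]] is_max_max_wt[OF finS] by (simp add: B_def)
    ultimately have "is_max E (dhull E A (S \<union> X)) (S \<union> X) (kap Z)"
      using mw[OF X] is_max_zero[OF kap(1)[OF Z]] hull_mono[of "S \<union> X" "S \<union> Z" E A] that
      by (intro is_maxI_max_wt finSX) auto
    then show ?thesis using uniq[OF X _ kap(2)[OF Z] kap(1)[OF X] kap(2)[OF X]] that by blast
  qed
  \<comment> \<open>All of \<open>S\<close>, and the vertices of small dense extensions that escape
    the hull. Nothing bounds the size of this union.\<close>
  define R where "R = S \<union> \<Union>{X - dhull E A (S \<union> X) | X. good m X}"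
  have "\<exists>X. good m X \<and> r \<in> S \<union> X \<and> (r \<in> S \<or> r \<notin> dhull E A (S \<union> X))" if "r \<in> R" for r
    using that good0 unfolding R_def by blast
  then obtain xr where xr: "\<And>r. r \<in> R \<Longrightarrow> good m (xr r) \<and> r \<in> S \<union> xr r \<and> (r \<in> S \<or> r \<notin> dhull E A (S \<union> xr r))"
    by metis
  \<comment> \<open>By \<open>restrict\<close> the colour does not depend on the extension in which
    the vertex is seen.\<close>
  define \<kappa> where "\<kappa> = (\<lambda>r. kap (xr r) r)"
  have \<kappa>: "kap Z r = \<kappa> r" if "r \<in> R" "good (2 * m) Z" "xr r \<subseteq> Z" for r Z
    using restrict[of "xr r" Z r] xr[OF that(1)] that good_mono[of m "xr r" "2 * m"] by (simp add: \<kappa>_def)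
  have \<kappa>nz: "\<kappa> r \<noteq> 0" if "r \<in> R - B" for r
  proof (cases "r \<in> S")
    case True
    have "\<kappa> r = \<pi>0 r" using True kap(2)[of "xr r" r] xr[of r] that good_mono[of m "xr r" "2 * m"] by (simp add: \<kappa>_def)
    then show ?thesis using nz[OF \<pi>0(1)] True that by simp
  next
    case False
    have g: "good (2 * m) (xr r)" using xr[of r] that good_mono[of m "xr r" "2 * m"] by simp
    then have "finite (S \<union> xr r)" by (auto simp: good_def iext_def)
    then have "ifree E (dhull E A (S \<union> xr r)) (S \<union> xr r)" using AS by (intro ifree_hull) auto
    then show ?thesis using ifree_is_max_nonzero[OF kap(1)[OF g]] xr[of r] that False by (auto simp: \<kappa>_def)
  qed
  have \<kappa>B: "\<kappa> r = 0" if "r \<in> B" for r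
  proof -
    have "r \<in> R" "r \<in> S" using that BS by (auto simp: R_def)
    then have "\<kappa> r = \<pi>0 r" using kap(2)[of "xr r" r] xr[of r] good_mono[of m "xr r" "2 * m"] by (simp add: \<kappa>_def)
    then show ?thesis using is_max_zero[OF \<pi>0(1)] that by simp
  qed
  have RV: "R \<subseteq> V" using AS by (auto simp: R_def good_def)
  have free: "ifree E B R"
    unfolding ifree_def
  proof (intro conjI allI impI)
    show "B \<subseteq> R" using BS by (auto simp: R_def)
    show "finite R" using RV fin finite_subset by blast
    fix Y assume Y: "Y \<subseteq> R" "iext E B Y"
    show "Y = B"
    proof (rule ccontr)
      assume "Y \<noteq> B"
      then obtain y where y: "y \<in> Y" "y \<notin> B" using iext_imp_subset[OF Y(2)] by blast
      have finY: "finite Y" using Y by (simp add: iext_def)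
      have "blocks \<kappa> Y > 0" using blocks_eq_0_iff[OF finY, of \<kappa>] y \<kappa>nz[of y] Y(1) by auto
      then have less: "real (blocks \<kappa> Y) < \<alpha> * real (card (crossing E \<kappa> Y))"
        using \<kappa>B by (intro iextD[OF Y(2)]) auto
      define J where "J = \<kappa> ` Y - {0}"
      have J: "J \<subseteq> \<pi>0 ` S - {0}"
      proof
        fix j assume "j \<in> J"
        then obtain r where r: "r \<in> Y" "j = \<kappa> r" "j \<noteq> 0" by (auto simp: J_def)
        then have rR: "r \<in> R" using Y by auto
        have g: "good (2 * m) (xr r)" using xr[OF rR] good_mono[of m "xr r" "2 * m"] by simp
        have "kap (xr r) r \<in> insert 0 (kap (xr r) ` S)" using local[OF g kap(1)[OF g]] xr[OF rR] by blast
        moreover have "kap (xr r) ` S = \<pi>0 ` S" using kap(2)[OF g] by (intro image_cong) auto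
        ultimately show "j \<in> \<pi>0 ` S - {0}" using r by (simp add: \<kappa>_def)
      qed
      have cr: "crossing E \<kappa> Y \<subseteq> {(u, v) \<in> crossing E \<pi>0 S. \<pi>0 u \<in> insert 0 J \<and> \<pi>0 v \<in> insert 0 J}"
      proof
        fix p assume "p \<in> crossing E \<kappa> Y"
        then obtain x y where p: "p = (x, y)" "x \<in> Y" "y \<in> Y" "x < y" "E x y" "\<kappa> x \<noteq> \<kappa> y"
          by (auto simp: crossing_def)
        have xy: "x \<in> R" "y \<in> R" using p Y by auto
        \<comment> \<open>The ends of an edge may come from different extensions. Their union has up
          to 2 m vertices outside \<open>S\<close>, which is why \<open>S\<close> is required to be
          terminal for \<open>2 * m\<close>.\<close>
        have g: "good (2 * m) (xr x \<union> xr y)"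
          using good_Un[of m "xr x" m "xr y"] xr[OF xy(1)] xr[OF xy(2)] by (simp add: mult_2)
        let ?Z = "xr x \<union> xr y"
        have k: "kap ?Z x = \<kappa> x" "kap ?Z y = \<kappa> y" using \<kappa>[OF xy(1) g] \<kappa>[OF xy(2) g] by auto
        have "x \<in> S \<union> ?Z" "y \<in> S \<union> ?Z" using xr[OF xy(1)] xr[OF xy(2)] by auto
        then have "(x, y) \<in> crossing E (kap ?Z) (S \<union> ?Z)" using p k by (auto simp: crossing_def)
        then have "(x, y) \<in> crossing E (kap ?Z) S" using local[OF g kap(1)[OF g]] by simp
        then have S: "x \<in> S" "y \<in> S" by (auto simp: crossing_def)
        then have "\<pi>0 x = \<kappa> x" "\<pi>0 y = \<kappa> y" using kap(2)[OF g] k by auto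
        then show "p \<in> {(u, v) \<in> crossing E \<pi>0 S. \<pi>0 u \<in> insert 0 J \<and> \<pi>0 v \<in> insert 0 J}"
          using p S by (auto simp: crossing_def J_def)
      qed
      have "finite {(u, v) \<in> crossing E \<pi>0 S. \<pi>0 u \<in> insert 0 J \<and> \<pi>0 v \<in> insert 0 J}"
        by (rule finite_subset[OF _ finite_crossing[OF finS, of E \<pi>0]]) auto
      then have "card (crossing E \<kappa> Y) \<le> card {(u, v) \<in> crossing E \<pi>0 S. \<pi>0 u \<in> insert 0 J \<and> \<pi>0 v \<in> insert 0 J}"
        using cr by (rule card_mono)
      then have "\<alpha> * real (card (crossing E \<kappa> Y))
          \<le> \<alpha> * real (card {(u, v) \<in> crossing E \<pi>0 S. \<pi>0 u \<in> insert 0 J \<and> \<pi>0 v \<in> insert 0 J})"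
        using \<alpha>_pos by (intro mult_left_mono of_nat_mono) auto
      also have "\<dots> \<le> real (card J)" using is_max_colours[OF \<pi>0(1) finS J] .
      finally show False using less by (simp add: J_def blocks_def)
    qed
  qed
  have sep: "\<not> E x y" if W: "W \<subseteq> V" "card (W - insert v B) \<le> m" "iext E (insert v B) (insert v B \<union> W)"
    and x: "x \<in> W - R" and y: "y \<in> R - B" for W x y
  proof
    assume Exy: "E x y"
    have "iext E S (S \<union> (insert v B \<union> W))" using AS BS by (intro iext_mono[OF W(3)] finS) auto
    moreover have "S \<union> (insert v B \<union> W) = S \<union> W" using AS BS by auto
    ultimately have ie: "iext E S (S \<union> W)" by simp
    have "card (W - S) \<le> card (W - insert v B)"
      using AS BS W fin by (intro card_mono) (auto dest: finite_subset)
    then have gW: "good m W" using W ie by (auto simp: good_def)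
    have xS: "x \<notin> S" "x \<in> dhull E A (S \<union> W)" using x gW unfolding R_def by blast+
    have yR: "y \<in> R" using y by simp
    let ?Z = "W \<union> xr y"
    have g: "good (2 * m) ?Z" using good_Un[OF gW, of m "xr y"] xr[OF yR] by (simp add: mult_2)
    have "x \<in> dhull E A (S \<union> ?Z)" using xS hull_mono[of "S \<union> W" "S \<union> ?Z" E A] by auto
    then have kx: "kap ?Z x = 0" using is_max_zero[OF kap(1)[OF g]] by blast
    have "kap ?Z y = \<kappa> y" using \<kappa>[OF yR g] by auto
    then have ky: "kap ?Z y \<noteq> 0" using \<kappa>nz[OF y] by simp
    have in': "x \<in> S \<union> ?Z" "y \<in> S \<union> ?Z" using x xr[OF yR] by auto
    have "x \<noteq> y" using x y by blast
    then have "(x, y) \<in> crossing E (kap ?Z) (S \<union> ?Z) \<or> (y, x) \<in> crossing E (kap ?Z) (S \<union> ?Z)"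
      using in' kx ky Exy sympD[OF sym Exy] by (auto simp: crossing_def)
    then have "x \<in> S" using local[OF g kap(1)[OF g]] by (auto simp: crossing_def)
    then show False using xS by simp
  qed
  have "B \<subseteq> R" "v \<in> R" using BS AS by (auto simp: R_def)
  then show ?thesis using RV free by (intro exI[of _ R] conjI allI impI ballI sep)
qed

text \<open>\<open>B\<close> is bounded in terms of \<open>s\<close> and \<open>m\<close> because it
  is a hull inside a bounded terminal set; there is no bound for \<open>R\<close>.\<close>

lemma envelope:
  obtains N where "\<And>V E A v. finite V \<Longrightarrow> symp E \<Longrightarrow> A \<subseteq> V \<Longrightarrow> v \<in> V \<Longrightarrow> card A \<le> s \<Longrightarrow>
    \<exists>B R. iext E A B \<and> B \<subseteq> R \<and> R \<subseteq> V \<and> card B \<le> N \<and> v \<in> R \<and> ifree E B R \<and>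
    (\<forall>W. W \<subseteq> V \<longrightarrow> card (W - insert v B) \<le> m \<longrightarrow> iext E (insert v B) (insert v B \<union> W) \<longrightarrow>
       (\<forall>x\<in>W - R. \<forall>y\<in>R - B. \<not> E x y))"
proof -
  obtain N where N: "\<And>V E A v. finite V \<Longrightarrow> A \<subseteq> V \<Longrightarrow> v \<in> V \<Longrightarrow> card A \<le> s \<Longrightarrow>
    \<exists>S. A \<subseteq> S \<and> v \<in> S \<and> S \<subseteq> V \<and> card S \<le> N \<and> terminal V E A (2 * m) S"
    using terminal_exists[of s "2 * m"] by blast
  show ?thesis
  proof (rule that[of N])
    fix V A :: "nat set" and E :: "nat \<Rightarrow> nat \<Rightarrow> bool" and v assume a: "finite V" "symp E" "A \<subseteq> V" "v \<in> V" "card A \<le> s"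
    obtain S where S: "A \<subseteq> S" "v \<in> S" "S \<subseteq> V" "card S \<le> N" "terminal V E A (2 * m) S"
      using N[OF a(1,3-5)] by blast
    have finS: "finite S" using S a finite_subset by blast
    have "card (dhull E A S) \<le> N" using card_mono[OF finS hull_subset[of E A S]] S(4) by linarith
    moreover have "iext E A (dhull E A S)" using iext_hull[OF finS S(1)] .
    ultimately show "\<exists>B R. iext E A B \<and> B \<subseteq> R \<and> R \<subseteq> V \<and> card B \<le> N \<and> v \<in> R \<and> ifree E B R \<and>
    (\<forall>W. W \<subseteq> V \<longrightarrow> card (W - insert v B) \<le> m \<longrightarrow> iext E (insert v B) (insert v B \<union> W) \<longrightarrow>
       (\<forall>x\<in>W - R. \<forall>y\<in>R - B. \<not> E x y))"
      using envelope_of_terminal[OF a(1,2) S(1-3,5)] by - (rule exI[of _ "dhull E A S"], simp)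
  qed
qed

end

section \<open>Types of rooted graphs\<close>

text \<open>A partial isomorphism as a set of pairs: exchanging the two structures is
  \<open>converse\<close>, restricting is inclusion, and no choice of a direction is built
  in.\<close>

definition piso :: "nat set \<Rightarrow> (nat \<Rightarrow> nat \<Rightarrow> bool) \<Rightarrow> nat set \<Rightarrow> (nat \<Rightarrow> nat \<Rightarrow> bool) \<Rightarrow> (nat \<times> nat) set \<Rightarrow> bool" where
  "piso V E V' E' P \<longleftrightarrow> P \<subseteq> V \<times> V' \<and>
     (\<forall>p\<in>P. \<forall>q\<in>P. (fst p = fst q \<longleftrightarrow> snd p = snd q) \<and> (E (fst p) (fst q) \<longleftrightarrow> E' (snd p) (snd q)))"

lemma fst_converse: "fst ` (P\<inverse>) = snd ` P" and snd_converse: "snd ` (P\<inverse>) = fst ` P"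
  by (force simp: image_iff)+

lemma piso_converse:
  assumes "piso V E V' E' P" shows "piso V' E' V E (P\<inverse>)"
  unfolding piso_def
proof (intro conjI ballI)
  show "P\<inverse> \<subseteq> V' \<times> V" using assms by (auto simp: piso_def)
  fix p q assume "p \<in> P\<inverse>" "q \<in> P\<inverse>"
  then have "(snd p, fst p) \<in> P" "(snd q, fst q) \<in> P" by auto
  then have "(fst (snd p, fst p) = fst (snd q, fst q) \<longleftrightarrow> snd (snd p, fst p) = snd (snd q, fst q)) \<and>
      (E (fst (snd p, fst p)) (fst (snd q, fst q)) \<longleftrightarrow> E' (snd (snd p, fst p)) (snd (snd q, fst q)))"
    using assms unfolding piso_def by blast
  then show "fst p = fst q \<longleftrightarrow> snd p = snd q" "E' (fst p) (fst q) \<longleftrightarrow> E (snd p) (snd q)" by auto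
qed

lemma piso_subset: "piso V E V' E' P \<Longrightarrow> Q \<subseteq> P \<Longrightarrow> piso V E V' E' Q"
  unfolding piso_def by blast

lemma piso_fst_subset: "piso V E V' E' P \<Longrightarrow> fst ` P \<subseteq> V"
  and piso_snd_subset: "piso V E V' E' P \<Longrightarrow> snd ` P \<subseteq> V'"
  by (auto simp: piso_def)

lemma piso_eq: "piso V E V' E' P \<Longrightarrow> p \<in> P \<Longrightarrow> q \<in> P \<Longrightarrow> fst p = fst q \<longleftrightarrow> snd p = snd q"
  and piso_adj: "piso V E V' E' P \<Longrightarrow> p \<in> P \<Longrightarrow> q \<in> P \<Longrightarrow> E (fst p) (fst q) \<longleftrightarrow> E' (snd p) (snd q)"
  by (simp_all add: piso_def)

lemma piso_function:
  assumes "piso V E V' E' P"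
  obtains g where "inj_on g (fst ` P)" "\<And>p. p \<in> P \<Longrightarrow> g (fst p) = snd p"
    "\<And>x y. x \<in> fst ` P \<Longrightarrow> y \<in> fst ` P \<Longrightarrow> E' (g x) (g y) \<longleftrightarrow> E x y"
    "\<And>Q. Q \<subseteq> P \<Longrightarrow> g ` fst ` Q = snd ` Q"
proof -
  define g where "g = (\<lambda>x. SOME y. (x, y) \<in> P)"
  have g: "g (fst p) = snd p" if p: "p \<in> P" for p
  proof -
    have "(fst p, g (fst p)) \<in> P" unfolding g_def by (rule someI[of _ "snd p"]) (use p in simp)
    then show ?thesis using piso_eq[OF assms p, of "(fst p, g (fst p))"] by simp
  qed
  have "inj_on g (fst ` P)"
    by (rule inj_onI) (use g piso_eq[OF assms] in auto)
  moreover have "E' (g x) (g y) \<longleftrightarrow> E x y" if xy: "x \<in> fst ` P" "y \<in> fst ` P" for x y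
  proof -
    obtain p q where "p \<in> P" "x = fst p" "q \<in> P" "y = fst q" using xy by blast
    then show ?thesis using g piso_adj[OF assms] by simp
  qed
  moreover have "g ` fst ` Q = snd ` Q" if "Q \<subseteq> P" for Q
    using that g by (auto simp: image_image intro!: image_cong)
  ultimately show ?thesis using g that by blast
qed

lemma piso_card_diff:
  assumes "piso V E V' E' P" "Q \<subseteq> P"
  shows "card (snd ` P - snd ` Q) = card (fst ` P - fst ` Q)"
proof -
  obtain g where g: "inj_on g (fst ` P)" "\<And>Q. Q \<subseteq> P \<Longrightarrow> g ` fst ` Q = snd ` Q"
    using piso_function[OF assms(1)] by metis
  have "snd ` P - snd ` Q = g ` (fst ` P - fst ` Q)"
    using inj_on_image_set_diff[OF g(1), of "fst ` P" "fst ` Q"] g(2)[OF assms(2)] g(2)[OF order_refl]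
      image_mono[OF assms(2), of fst] by (simp del: image_subset_iff)
  moreover have "inj_on g (fst ` P - fst ` Q)" using g(1) by (rule inj_on_subset) auto
  ultimately show ?thesis by (simp add: card_image)
qed

lemma fst_set_zip: "length xs = length ys \<Longrightarrow> fst ` set (zip xs ys) = set xs"
  by (metis list.set_map map_fst_zip)

lemma snd_set_zip: "length xs = length ys \<Longrightarrow> snd ` set (zip xs ys) = set ys"
  by (metis list.set_map map_snd_zip)

lemma set_zip_converse: "length xs = length ys \<Longrightarrow> (set (zip xs ys))\<inverse> = set (zip ys xs)"
  by (auto simp: set_zip)

lemma finite_code:
  assumes "finite (g ` S)"
  obtains f :: "'a \<Rightarrow> nat" where "finite (f ` S)" "\<And>x y. x \<in> S \<Longrightarrow> y \<in> S \<Longrightarrow> f x = f y \<Longrightarrow> g x = g y"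
proof -
  obtain h :: "'b \<Rightarrow> nat" where h: "inj_on h (g ` S)"
    using assms by (meson finite_imp_inj_to_nat_seg)
  show ?thesis
  proof (rule that[of "h \<circ> g"])
    show "finite ((h \<circ> g) ` S)" using finite_imageI[OF assms, of h] by (simp add: image_image comp_def)
    show "g x = g y" if "x \<in> S" "y \<in> S" "(h \<circ> g) x = (h \<circ> g) y" for x y
      using that h by (auto dest: inj_onD)
  qed
qed

section \<open>Back-and-forth equivalence by dense moves\<close>

context exponent
begin

text \<open>Back-and-forth equivalence in which only moves to dense extensions with at most \<open>t\<close> new elements are allowed.\<close>

primrec eqv :: "nat \<Rightarrow> nat \<Rightarrow> nat set \<Rightarrow> (nat \<Rightarrow> nat \<Rightarrow> bool) \<Rightarrow> nat set \<Rightarrow> (nat \<Rightarrow> nat \<Rightarrow> bool) \<Rightarrow> (nat \<times> nat) set \<Rightarrow> bool" where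
  "eqv 0 t V E V' E' P \<longleftrightarrow> piso V E V' E' P"
| "eqv (Suc k) t V E V' E' P \<longleftrightarrow> piso V E V' E' P \<and>
     (\<forall>X. X \<subseteq> V \<longrightarrow> card X \<le> t \<longrightarrow> iext E (fst ` P) (fst ` P \<union> X) \<longrightarrow>
        (\<exists>P'. P \<subseteq> P' \<and> fst ` P' = fst ` P \<union> X \<and> eqv k t V E V' E' P')) \<and>
     (\<forall>X. X \<subseteq> V' \<longrightarrow> card X \<le> t \<longrightarrow> iext E' (snd ` P) (snd ` P \<union> X) \<longrightarrow>
        (\<exists>P'. P \<subseteq> P' \<and> snd ` P' = snd ` P \<union> X \<and> eqv k t V E V' E' P'))"

lemma eqv_imp_piso: "eqv k t V E V' E' P \<Longrightarrow> piso V E V' E' P"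
  by (cases k) auto

lemma eqv_forth:
  assumes "eqv (Suc k) t V E V' E' P" "X \<subseteq> V" "card X \<le> t" "iext E (fst ` P) (fst ` P \<union> X)"
  obtains P' where "P \<subseteq> P'" "fst ` P' = fst ` P \<union> X" "eqv k t V E V' E' P'"
proof -
  have *: "\<forall>X. X \<subseteq> V \<longrightarrow> card X \<le> t \<longrightarrow> iext E (fst ` P) (fst ` P \<union> X) \<longrightarrow>
        (\<exists>P'. P \<subseteq> P' \<and> fst ` P' = fst ` P \<union> X \<and> eqv k t V E V' E' P')"
    using assms(1) unfolding eqv.simps by (elim conjE)
  from *[rule_format, OF assms(2-4)] show ?thesis by (elim exE conjE) (rule that)
qed

lemma eqv_back:
  assumes "eqv (Suc k) t V E V' E' P" "X \<subseteq> V'" "card X \<le> t" "iext E' (snd ` P) (snd ` P \<union> X)"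
  obtains P' where "P \<subseteq> P'" "snd ` P' = snd ` P \<union> X" "eqv k t V E V' E' P'"
proof -
  have *: "\<forall>X. X \<subseteq> V' \<longrightarrow> card X \<le> t \<longrightarrow> iext E' (snd ` P) (snd ` P \<union> X) \<longrightarrow>
        (\<exists>P'. P \<subseteq> P' \<and> snd ` P' = snd ` P \<union> X \<and> eqv k t V E V' E' P')"
    using assms(1) unfolding eqv.simps by (elim conjE)
  from *[rule_format, OF assms(2-4)] show ?thesis by (elim exE conjE) (rule that)
qed

lemma eqv_converse: "eqv k t V E V' E' P \<Longrightarrow> eqv k t V' E' V E (P\<inverse>)"
proof (induction k arbitrary: P)
  case 0
  then show ?case by (simp add: piso_converse)
next
  case (Suc k)
  show ?case unfolding eqv.simps fst_converse snd_converse
  proof (intro conjI allI impI)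
    show "piso V' E' V E (P\<inverse>)" using Suc.prems by (auto intro: piso_converse)
  next
    fix X assume "X \<subseteq> V'" "card X \<le> t" "iext E' (snd ` P) (snd ` P \<union> X)"
    then obtain P' where "P \<subseteq> P'" "snd ` P' = snd ` P \<union> X" "eqv k t V E V' E' P'"
      by (rule eqv_back[OF Suc.prems])
    then show "\<exists>P'. P\<inverse> \<subseteq> P' \<and> fst ` P' = snd ` P \<union> X \<and> eqv k t V' E' V E P'"
      by (intro exI[of _ "P'\<inverse>"] conjI Suc.IH) (simp_all add: fst_converse converse_mono)
  next
    fix X assume "X \<subseteq> V" "card X \<le> t" "iext E (fst ` P) (fst ` P \<union> X)"
    then obtain P' where "P \<subseteq> P'" "fst ` P' = fst ` P \<union> X" "eqv k t V E V' E' P'"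
      by (rule eqv_forth[OF Suc.prems])
    then show "\<exists>P'. P\<inverse> \<subseteq> P' \<and> snd ` P' = fst ` P \<union> X \<and> eqv k t V' E' V E P'"
      by (intro exI[of _ "P'\<inverse>"] conjI Suc.IH) (simp_all add: snd_converse converse_mono)
  qed
qed

text \<open>The backward condition is phrased for the converse, so that one proof of the forward
  condition, general in both structures, covers both.\<close>

lemma eqv_SucI:
  assumes "piso V E V' E' P"
    and "\<And>X. X \<subseteq> V \<Longrightarrow> card X \<le> t \<Longrightarrow> iext E (fst ` P) (fst ` P \<union> X) \<Longrightarrow>
      \<exists>P'. P \<subseteq> P' \<and> fst ` P' = fst ` P \<union> X \<and> eqv k t V E V' E' P'"
    and bk: "\<And>X. X \<subseteq> V' \<Longrightarrow> card X \<le> t \<Longrightarrow> iext E' (fst ` (P\<inverse>)) (fst ` (P\<inverse>) \<union> X) \<Longrightarrow>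
      \<exists>P'. P\<inverse> \<subseteq> P' \<and> fst ` P' = fst ` (P\<inverse>) \<union> X \<and> eqv k t V' E' V E P'"
  shows "eqv (Suc k) t V E V' E' P"
  unfolding eqv.simps
proof (intro conjI allI impI)
  fix X assume "X \<subseteq> V'" "card X \<le> t" "iext E' (snd ` P) (snd ` P \<union> X)"
  then obtain P' where P': "P\<inverse> \<subseteq> P'" "fst ` P' = snd ` P \<union> X" "eqv k t V' E' V E P'"
    using bk[of X] by (auto simp: fst_converse)
  have "P \<subseteq> P'\<inverse>" using P'(1) by auto
  then show "\<exists>P'. P \<subseteq> P' \<and> snd ` P' = snd ` P \<union> X \<and> eqv k t V E V' E' P'"
    using eqv_converse[OF P'(3)] P'(2) by (intro exI[of _ "P'\<inverse>"]) (simp add: snd_converse)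
qed (fact assms)+

lemma eqv_Suc_imp: "eqv (Suc k) t V E V' E' P \<Longrightarrow> eqv k t V E V' E' P"
proof (induction k arbitrary: P)
  case (Suc k)
  show ?case unfolding eqv.simps(2)[of k]
  proof (intro conjI allI impI)
    show "piso V E V' E' P" using Suc.prems by (rule eqv_imp_piso)
  next
    fix X assume "X \<subseteq> V" "card X \<le> t" "iext E (fst ` P) (fst ` P \<union> X)"
    then obtain P' where "P \<subseteq> P'" "fst ` P' = fst ` P \<union> X" "eqv (Suc k) t V E V' E' P'"
      by (rule eqv_forth[OF Suc.prems])
    then show "\<exists>P'. P \<subseteq> P' \<and> fst ` P' = fst ` P \<union> X \<and> eqv k t V E V' E' P'"
      by (intro exI[of _ P'] conjI Suc.IH)
  next
    fix X assume "X \<subseteq> V'" "card X \<le> t" "iext E' (snd ` P) (snd ` P \<union> X)"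
    then obtain P' where "P \<subseteq> P'" "snd ` P' = snd ` P \<union> X" "eqv (Suc k) t V E V' E' P'"
      by (rule eqv_back[OF Suc.prems])
    then show "\<exists>P'. P \<subseteq> P' \<and> snd ` P' = snd ` P \<union> X \<and> eqv k t V E V' E' P'"
      by (intro exI[of _ P'] conjI Suc.IH)
  qed
qed (simp only: eqv.simps)

lemma eqv_mono_depth: "k \<le> k' \<Longrightarrow> eqv k' t V E V' E' P \<Longrightarrow> eqv k t V E V' E' P"
  by (induction k' rule: dec_induct) (blast intro: eqv_Suc_imp)+

lemma eqv_mono_size: "t \<le> t' \<Longrightarrow> eqv k t' V E V' E' P \<Longrightarrow> eqv k t V E V' E' P"
proof (induction k arbitrary: P)
  case (Suc k)
  show ?case unfolding eqv.simps
  proof (intro conjI allI impI)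
    show "piso V E V' E' P" using Suc.prems(2) by (rule eqv_imp_piso)
  next
    fix X assume "X \<subseteq> V" "card X \<le> t" "iext E (fst ` P) (fst ` P \<union> X)"
    then obtain P' where "P \<subseteq> P'" "fst ` P' = fst ` P \<union> X" "eqv k t' V E V' E' P'"
      by (rule eqv_forth[OF Suc.prems(2) _ order_trans[OF _ Suc.prems(1)]])
    then show "\<exists>P'. P \<subseteq> P' \<and> fst ` P' = fst ` P \<union> X \<and> eqv k t V E V' E' P'"
      by (intro exI[of _ P'] conjI Suc.IH[OF Suc.prems(1)])
  next
    fix X assume "X \<subseteq> V'" "card X \<le> t" "iext E' (snd ` P) (snd ` P \<union> X)"
    then obtain P' where "P \<subseteq> P'" "snd ` P' = snd ` P \<union> X" "eqv k t' V E V' E' P'"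
      by (rule eqv_back[OF Suc.prems(2) _ order_trans[OF _ Suc.prems(1)]])
    then show "\<exists>P'. P \<subseteq> P' \<and> snd ` P' = snd ` P \<union> X \<and> eqv k t V E V' E' P'"
      by (intro exI[of _ P'] conjI Suc.IH[OF Suc.prems(1)])
  qed
qed (simp only: eqv.simps)

text \<open>A move that is dense over a smaller position is dense over the larger one; the answer
  found there is cut down to the pairs that are needed.\<close>

lemma eqv_subset:
  assumes "eqv k t V E V' E' P" "Q \<subseteq> P" "finite V" "finite V'"
  shows "eqv k t V E V' E' Q"
  using assms
proof (induction k arbitrary: P Q V E V' E')
  case 0
  then show ?case by (simp add: piso_subset)
next
  case (Suc k)
  have forth: "\<exists>Q'. Q \<subseteq> Q' \<and> fst ` Q' = fst ` Q \<union> X \<and> eqv k t V E V' E' Q'"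
    if eq: "eqv (Suc k) t V E V' E' P" and QP: "Q \<subseteq> P" and fin: "finite V" "finite V'"
      and X: "X \<subseteq> V" "card X \<le> t" "iext E (fst ` Q) (fst ` Q \<union> X)" for V E V' E' P Q X
  proof -
    have "fst ` P \<subseteq> V" using eqv_imp_piso[OF eq] by (rule piso_fst_subset)
    then have "finite (fst ` P)" using fin finite_subset by blast
    then have "iext E (fst ` P) (fst ` P \<union> (fst ` Q \<union> X))" using QP by (intro iext_mono[OF X(3)]) auto
    moreover have "fst ` P \<union> (fst ` Q \<union> X) = fst ` P \<union> X" using QP by auto
    ultimately obtain P' where P': "P \<subseteq> P'" "fst ` P' = fst ` P \<union> X" "eqv k t V E V' E' P'"
      using eqv_forth[OF eq X(1,2)] by metis
    let ?Q = "{p \<in> P'. fst p \<in> fst ` Q \<union> X}"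
    have "Q \<subseteq> ?Q" using QP P'(1) by auto
    moreover have "fst ` ?Q = fst ` Q \<union> X"
    proof
      show "fst ` Q \<union> X \<subseteq> fst ` ?Q"
      proof
        fix x assume x: "x \<in> fst ` Q \<union> X"
        then have "x \<in> fst ` P'" using P'(2) QP by auto
        then show "x \<in> fst ` ?Q" using x by auto
      qed
    qed auto
    moreover have "eqv k t V E V' E' ?Q" by (rule Suc.IH[OF P'(3) _ fin]) auto
    ultimately show ?thesis by (intro exI[of _ ?Q] conjI)
  qed
  show ?case
  proof (rule eqv_SucI)
    show "piso V E V' E' Q" using eqv_imp_piso[OF Suc.prems(1)] Suc.prems(2) by (rule piso_subset)
  next
    fix X assume "X \<subseteq> V" "card X \<le> t" "iext E (fst ` Q) (fst ` Q \<union> X)"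
    then show "\<exists>P'. Q \<subseteq> P' \<and> fst ` P' = fst ` Q \<union> X \<and> eqv k t V E V' E' P'"
      by (rule forth[OF Suc.prems])
  next
    fix X assume X: "X \<subseteq> V'" "card X \<le> t" "iext E' (fst ` (Q\<inverse>)) (fst ` (Q\<inverse>) \<union> X)"
    have "Q\<inverse> \<subseteq> P\<inverse>" using Suc.prems(2) by auto
    from forth[OF eqv_converse[OF Suc.prems(1)] this Suc.prems(4,3) X]
    show "\<exists>P'. Q\<inverse> \<subseteq> P' \<and> fst ` P' = fst ` (Q\<inverse>) \<union> X \<and> eqv k t V' E' V E P'" .
  qed
qed

lemma iext_pullback:
  assumes "iext E' (g ` A) (g ` S)" "A \<subseteq> S" "inj_on g S" "symp E" "symp E'"
    and "\<And>x y. x \<in> S \<Longrightarrow> y \<in> S \<Longrightarrow> E' (g x) (g y) \<longleftrightarrow> E x y"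
  shows "iext E A S"
proof -
  let ?h = "inv_into S g"
  have h: "?h (g x) = x" if "x \<in> S" for x using that assms(3) by simp
  have "iext E (?h ` g ` A) (?h ` g ` S)"
  proof (rule iext_image[OF assms(1) _ assms(5,4)])
    show "inj_on ?h (g ` S)" by (rule inj_on_inv_into) auto
  qed (use assms(6) h in auto)
  moreover have "?h ` g ` A = A" using assms(2) h by (force simp: image_image)
  moreover have "?h ` g ` S = S" using h by (force simp: image_image)
  ultimately show ?thesis by simp
qed

lemma ifree_image:
  assumes "ifree E B K" "inj_on g K" "symp E" "symp E'"
    and "\<And>x y. x \<in> K \<Longrightarrow> y \<in> K \<Longrightarrow> E' (g x) (g y) \<longleftrightarrow> E x y"
  shows "ifree E' (g ` B) (g ` K)"
  unfolding ifree_def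
proof (intro conjI allI impI)
  show "g ` B \<subseteq> g ` K" "finite (g ` K)" using assms(1) by (auto simp: ifree_def)
  fix Y assume Y: "Y \<subseteq> g ` K" "iext E' (g ` B) Y"
  then obtain Z where Z: "Z \<subseteq> K" "Y = g ` Z" by (auto simp: subset_image_iff)
  have BK: "B \<subseteq> K" using assms(1) by (simp add: ifree_def)
  have "B \<subseteq> Z"
  proof
    fix b assume b: "b \<in> B"
    then have "g b \<in> g ` Z" using iext_imp_subset[OF Y(2)] Z by auto
    then show "b \<in> Z" using inj_on_image_mem_iff[OF assms(2)] b BK Z by auto
  qed
  have "iext E B Z"
    by (rule iext_pullback[OF Y(2)[unfolded Z(2)] \<open>B \<subseteq> Z\<close> inj_on_subset[OF assms(2) Z(1)] assms(3,4)])
      (use assms(5) Z(1) in auto)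
  then have "Z = B" using assms(1) Z(1) unfolding ifree_def by blast
  then show "Y = g ` B" using Z(2) by simp
qed

text \<open>Needed to exchange an abstract pattern for its realisation in another graph.\<close>

lemma eqv_image:
  assumes "eqv k t V E K F P" "inj_on g K" "symp F" "symp E'"
    and adj: "\<And>x y. x \<in> K \<Longrightarrow> y \<in> K \<Longrightarrow> E' (g x) (g y) \<longleftrightarrow> F x y"
  shows "eqv k t V E (g ` K) E' ((\<lambda>(x, y). (x, g y)) ` P)"
  using assms(1)
proof (induction k arbitrary: P)
  case (0 P)
  have P: "piso V E K F P" using 0 by simp
  have sub: "P \<subseteq> V \<times> K" using P by (simp add: piso_def)
  have "(fst p = fst q \<longleftrightarrow> snd p = snd q) \<and> (E (fst p) (fst q) \<longleftrightarrow> E' (snd p) (snd q))"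
    if pq: "p \<in> (\<lambda>(x, y). (x, g y)) ` P" "q \<in> (\<lambda>(x, y). (x, g y)) ` P" for p q
  proof -
    obtain x y where p: "(x, y) \<in> P" "p = (x, g y)" using pq by auto
    obtain x' y' where q: "(x', y') \<in> P" "q = (x', g y')" using pq by auto
    have K: "y \<in> K" "y' \<in> K" using p q sub by auto
    then show ?thesis using piso_eq[OF P p(1) q(1)] piso_adj[OF P p(1) q(1)] adj[OF K] p q
        inj_on_eq_iff[OF assms(2) K] by simp
  qed
  then show ?case using sub by (auto simp: piso_def)
next
  case (Suc k P)
  let ?m = "\<lambda>(x, y). (x, g y)"
  have P: "piso V E K F P" using Suc.prems by simp
  have fst_m: "fst ` ?m ` Q = fst ` Q" for Q :: "(nat \<times> nat) set" by (force simp: image_iff)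
  have snd_m: "snd ` ?m ` Q = g ` snd ` Q" for Q :: "(nat \<times> nat) set" by (force simp: image_iff)
  have sub: "snd ` P \<subseteq> K" using P by (rule piso_snd_subset)
  have "piso V E (g ` K) E' (?m ` P)"
  proof (rule eqv_imp_piso)
    show "eqv k t V E (g ` K) E' (?m ` P)" by (rule Suc.IH) (rule eqv_Suc_imp[OF Suc.prems])
  qed
  then show ?case unfolding eqv.simps
  proof (intro conjI allI impI)
    fix X assume X: "X \<subseteq> V" "card X \<le> t" "iext E (fst ` ?m ` P) (fst ` ?m ` P \<union> X)"
    obtain P' where P': "P \<subseteq> P'" "fst ` P' = fst ` P \<union> X" "eqv k t V E K F P'"
      using eqv_forth[OF Suc.prems X(1,2)] X(3) unfolding fst_m by blast
    show "\<exists>P'. ?m ` P \<subseteq> P' \<and> fst ` P' = fst ` ?m ` P \<union> X \<and> eqv k t V E (g ` K) E' P'"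
      by (rule exI[of _ "?m ` P'"]) (use P' Suc.IH[OF P'(3)] fst_m in \<open>simp add: image_mono\<close>)
  next
    fix X assume X: "X \<subseteq> g ` K" "card X \<le> t" "iext E' (snd ` ?m ` P) (snd ` ?m ` P \<union> X)"
    then obtain Y where Y: "Y \<subseteq> K" "X = g ` Y" by (auto simp: subset_image_iff)
    have cY: "card Y \<le> t" using X(2) Y card_image[OF inj_on_subset[OF assms(2) Y(1)]] by simp
    have "iext F (snd ` P) (snd ` P \<union> Y)"
    proof (rule iext_pullback)
      show "iext E' (g ` snd ` P) (g ` (snd ` P \<union> Y))" using X(3) by (simp add: snd_m Y image_Un)
      show "inj_on g (snd ` P \<union> Y)" using assms(2) sub Y(1) by (auto intro: inj_on_subset)
      fix x y assume "x \<in> snd ` P \<union> Y" "y \<in> snd ` P \<union> Y"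
      then have "x \<in> K" "y \<in> K" using sub Y(1) by blast+
      then show "E' (g x) (g y) \<longleftrightarrow> F x y" by (rule adj)
    qed (use assms(3,4) in simp_all)
    then obtain P' where P': "P \<subseteq> P'" "snd ` P' = snd ` P \<union> Y" "eqv k t V E K F P'"
      by (rule eqv_back[OF Suc.prems Y(1) cY])
    show "\<exists>P'. ?m ` P \<subseteq> P' \<and> snd ` P' = snd ` ?m ` P \<union> X \<and> eqv k t V E (g ` K) E' P'"
    proof (intro exI conjI)
      show "?m ` P \<subseteq> ?m ` P'" using P'(1) by (rule image_mono)
      show "snd ` ?m ` P' = snd ` ?m ` P \<union> X" by (simp add: snd_m P'(2) Y(2) image_Un)
      show "eqv k t V E (g ` K) E' (?m ` P')" by (rule Suc.IH[OF P'(3)])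
    qed
  qed
qed

text \<open>The values of \<open>f\<close> are codes of types. The type of depth k + 1 is determined
  by the type of depth k and the set of types of depth k that dense moves lead to; there are only
  finitely many such sets. The induction hypothesis is applied to tuples that are longer by
  \<open>t\<close>.\<close>

lemma eqv_finite_index:
  "\<exists>f :: nat set \<times> (nat \<Rightarrow> nat \<Rightarrow> bool) \<times> nat list \<Rightarrow> nat.
     finite (f ` {(V, E, xs). length xs \<le> M \<and> set xs \<subseteq> V}) \<and>
     (\<forall>V E xs V' E' ys. length xs \<le> M \<longrightarrow> length ys \<le> M \<longrightarrow> set xs \<subseteq> V \<longrightarrow> set ys \<subseteq> V' \<longrightarrow>
        f (V, E, xs) = f (V', E', ys) \<longrightarrow> length xs = length ys \<and> eqv k t V E V' E' (set (zip xs ys)))"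
proof (induction k arbitrary: M)
  case (0 M)
  let ?S = "{(V :: nat set, E :: nat \<Rightarrow> nat \<Rightarrow> bool, xs). length xs \<le> M \<and> set xs \<subseteq> V}"
  define g where "g = (\<lambda>(V :: nat set, E :: nat \<Rightarrow> nat \<Rightarrow> bool, xs :: nat list).
     (length xs, {(i, j). i < length xs \<and> j < length xs \<and> xs ! i = xs ! j},
      {(i, j). i < length xs \<and> j < length xs \<and> E (xs ! i) (xs ! j)}))"
  have "g ` ?S \<subseteq> {..M} \<times> Pow ({..M} \<times> {..M}) \<times> Pow ({..M} \<times> {..M})"
    by (auto simp: g_def)
  then have "finite (g ` ?S)" by (rule finite_subset) auto
  then obtain f :: "nat set \<times> (nat \<Rightarrow> nat \<Rightarrow> bool) \<times> nat list \<Rightarrow> nat" where f: "finite (f ` ?S)" "\<And>x y. x \<in> ?S \<Longrightarrow> y \<in> ?S \<Longrightarrow> f x = f y \<Longrightarrow> g x = g y"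
    using finite_code by blast
  show ?case
  proof (intro exI[of _ f] conjI f(1) allI impI)
    fix V E xs V' E' ys
    assume a: "length xs \<le> M" "length ys \<le> M" "set xs \<subseteq> V" "set ys \<subseteq> V'" "f (V, E, xs) = f (V', E', ys)"
    then have g: "g (V, E, xs) = g (V', E', ys)" by (intro f(2)) auto
    then show len: "length xs = length ys" by (simp add: g_def)
    have e: "xs ! i = xs ! j \<longleftrightarrow> ys ! i = ys ! j" "E (xs ! i) (xs ! j) \<longleftrightarrow> E' (ys ! i) (ys ! j)"
      if "i < length xs" "j < length xs" for i j
    proof -
      have "{(i, j). i < length xs \<and> j < length xs \<and> xs ! i = xs ! j} = {(i, j). i < length xs \<and> j < length xs \<and> ys ! i = ys ! j}"
        "{(i, j). i < length xs \<and> j < length xs \<and> E (xs ! i) (xs ! j)} = {(i, j). i < length xs \<and> j < length xs \<and> E' (ys ! i) (ys ! j)}"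
        using g len by (simp_all add: g_def)
      then show "xs ! i = xs ! j \<longleftrightarrow> ys ! i = ys ! j" "E (xs ! i) (xs ! j) \<longleftrightarrow> E' (ys ! i) (ys ! j)"
        using that by (auto simp: set_eq_iff)
    qed
    show "eqv 0 t V E V' E' (set (zip xs ys))"
      using e len a(3,4) by (auto simp: piso_def set_zip subset_iff)
  qed
next
  case (Suc k M)
  let ?S = "\<lambda>M. {(V :: nat set, E :: nat \<Rightarrow> nat \<Rightarrow> bool, xs). length xs \<le> M \<and> set xs \<subseteq> V}"
  obtain f :: "nat set \<times> (nat \<Rightarrow> nat \<Rightarrow> bool) \<times> nat list \<Rightarrow> nat" where f: "finite (f ` ?S (M + t))"
    and f': "\<forall>V E xs V' E' ys. length xs \<le> M + t \<longrightarrow> length ys \<le> M + t \<longrightarrow> set xs \<subseteq> V \<longrightarrow> set ys \<subseteq> V' \<longrightarrow>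
        f (V, E, xs) = f (V', E', ys) \<longrightarrow> length xs = length ys \<and> eqv k t V E V' E' (set (zip xs ys))"
    using Suc.IH[of "M + t"] by (elim exE conjE) (rule that)
  note f2 = f'[rule_format]
  define ex where "ex = (\<lambda>(V :: nat set, E :: nat \<Rightarrow> nat \<Rightarrow> bool, xs :: nat list).
     {(V, E, xs @ es) | es. set es \<subseteq> V \<and> length es \<le> t \<and> iext E (set xs) (set xs \<union> set es)})"
  define g where "g = (\<lambda>x. (f x, f ` ex x))"
  have "g ` ?S M \<subseteq> f ` ?S (M + t) \<times> Pow (f ` ?S (M + t))"
  proof
    fix y assume "y \<in> g ` ?S M"
    then obtain V E xs where x: "y = g (V, E, xs)" "length xs \<le> M" "set xs \<subseteq> V" by auto
    have e: "ex (V, E, xs) \<subseteq> ?S (M + t)" "(V, E, xs) \<in> ?S (M + t)" using x by (auto simp: ex_def)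
    have "f ` ex (V, E, xs) \<subseteq> f ` ?S (M + t)" "f (V, E, xs) \<in> f ` ?S (M + t)"
      by (rule image_mono[OF e(1)], rule imageI[OF e(2)])
    then show "y \<in> f ` ?S (M + t) \<times> Pow (f ` ?S (M + t))" unfolding x(1) g_def by simp
  qed
  then have "finite (g ` ?S M)" by (rule finite_subset) (use f(1) in auto)
  then obtain h :: "nat set \<times> (nat \<Rightarrow> nat \<Rightarrow> bool) \<times> nat list \<Rightarrow> nat" where h: "finite (h ` ?S M)" "\<And>x y. x \<in> ?S M \<Longrightarrow> y \<in> ?S M \<Longrightarrow> h x = h y \<Longrightarrow> g x = g y"
    using finite_code by blast
  show ?case
  proof (intro exI[of _ h] conjI h(1) allI impI)
    fix V E xs V' E' ys
    assume a: "length xs \<le> M" "length ys \<le> M" "set xs \<subseteq> V" "set ys \<subseteq> V'" "h (V, E, xs) = h (V', E', ys)"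
    then have g: "g (V, E, xs) = g (V', E', ys)" by (intro h(2)) auto
    then have fe: "f (V, E, xs) = f (V', E', ys)" by (simp add: g_def)
    then have base: "length xs = length ys" "eqv k t V E V' E' (set (zip xs ys))"
      using f2[of xs ys V V' E E'] a by simp_all
    then show len: "length xs = length ys" by simp
    have forth: "\<exists>P'. set (zip xs ys) \<subseteq> P' \<and> fst ` P' = fst ` set (zip xs ys) \<union> X \<and> eqv k t V E V' E' P'"
      if a: "length xs \<le> M" "length ys \<le> M" "set xs \<subseteq> V" "set ys \<subseteq> V'"
        and g: "g (V, E, xs) = g (V', E', ys)" and len: "length xs = length ys"
        and X: "X \<subseteq> V" "card X \<le> t" "iext E (fst ` set (zip xs ys)) (fst ` set (zip xs ys) \<union> X)"
      for xs ys V V' E E' X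
    proof -
      have "finite X" using X(3) by (auto simp: iext_def)
      then obtain es where es: "set es = X" "distinct es" using finite_distinct_list by blast
      then have les: "length es \<le> t" using X(2) distinct_card by fastforce
      have "(V, E, xs @ es) \<in> ex (V, E, xs)"
        using X es les by (auto simp: ex_def fst_set_zip[OF len])
      then have "f (V, E, xs @ es) \<in> f ` ex (V', E', ys)" using g by (auto simp: g_def)
      then obtain fs where fs: "f (V, E, xs @ es) = f (V', E', ys @ fs)" "set fs \<subseteq> V'" "length fs \<le> t"
        by (auto simp: ex_def)
      have r: "length (xs @ es) = length (ys @ fs) \<and> eqv k t V E V' E' (set (zip (xs @ es) (ys @ fs)))"
        by (rule f2) (use a fs es les X(1) in auto)
      then have l2: "length es = length fs" using len by simp
      have z: "set (zip (xs @ es) (ys @ fs)) = set (zip xs ys) \<union> set (zip es fs)" using len l2 by simp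
      show ?thesis
      proof (intro exI conjI)
        show "set (zip xs ys) \<subseteq> set (zip (xs @ es) (ys @ fs))" unfolding z by blast
        show "fst ` set (zip (xs @ es) (ys @ fs)) = fst ` set (zip xs ys) \<union> X"
          unfolding z by (simp add: image_Un fst_set_zip[OF l2] es)
        show "eqv k t V E V' E' (set (zip (xs @ es) (ys @ fs)))" using r by blast
      qed
    qed
    show "eqv (Suc k) t V E V' E' (set (zip xs ys))"
    proof (rule eqv_SucI)
      show "piso V E V' E' (set (zip xs ys))" using base(2) by (rule eqv_imp_piso)
    next
      fix X assume "X \<subseteq> V" "card X \<le> t" "iext E (fst ` set (zip xs ys)) (fst ` set (zip xs ys) \<union> X)"
      then show "\<exists>P'. set (zip xs ys) \<subseteq> P' \<and> fst ` P' = fst ` set (zip xs ys) \<union> X \<and> eqv k t V E V' E' P'"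
        by (rule forth[OF a(1-4) g len])
    next
      fix X assume X: "X \<subseteq> V'" "card X \<le> t"
        "iext E' (fst ` ((set (zip xs ys))\<inverse>)) (fst ` ((set (zip xs ys))\<inverse>) \<union> X)"
      show "\<exists>P'. (set (zip xs ys))\<inverse> \<subseteq> P' \<and> fst ` P' = fst ` ((set (zip xs ys))\<inverse>) \<union> X \<and> eqv k t V' E' V E P'"
        using forth[OF a(2,1,4,3) g[symmetric] len[symmetric] X(1,2)] X(3)
        unfolding set_zip_converse[OF len] by blast
    qed
  qed
qed

lemma piso_iext:
  assumes "piso V E V' E' P" "Q \<subseteq> P" "iext E (fst ` Q) (fst ` P)" "symp E" "symp E'"
  shows "iext E' (snd ` Q) (snd ` P)"
proof -
  obtain g where g: "inj_on g (fst ` P)" "\<And>x y. x \<in> fst ` P \<Longrightarrow> y \<in> fst ` P \<Longrightarrow> E' (g x) (g y) \<longleftrightarrow> E x y"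
    "\<And>Q. Q \<subseteq> P \<Longrightarrow> g ` fst ` Q = snd ` Q"
    using piso_function[OF assms(1)] by metis
  have "iext E' (g ` fst ` Q) (g ` fst ` P)" by (rule iext_image[OF assms(3) g(1) assms(4,5) g(2)])
  then show ?thesis using g(3)[OF assms(2)] g(3)[OF order_refl] by simp
qed

end

section \<open>Amalgamation\<close>

context irrational_exponent
begin

text \<open>As far as small dense extensions of \<open>Q\<close> are concerned, \<open>V\<close> is the free amalgam of \<open>R\<close> and \<open>V - (R - B)\<close>
  over \<open>B\<close>; this is what makes a composition argument in the style of Feferman and Vaught possible.\<close>

definition separated :: "nat \<Rightarrow> nat set \<Rightarrow> (nat \<Rightarrow> nat \<Rightarrow> bool) \<Rightarrow> nat set \<Rightarrow> nat set \<Rightarrow> nat set \<Rightarrow> bool" where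
  "separated m V E B Q R \<longleftrightarrow> finite V \<and> symp E \<and> B \<subseteq> Q \<and> Q \<subseteq> R \<and> R \<subseteq> V \<and> ifree E B R \<and>
     (\<forall>W. W \<subseteq> V \<longrightarrow> card (W - Q) \<le> m \<longrightarrow> iext E Q (Q \<union> W) \<longrightarrow> (\<forall>x\<in>W - R. \<forall>y\<in>R - B. \<not> E x y))"

text \<open>\<open>L\<close> and \<open>K\<close> are the parts of a game position outside and
  inside \<open>R\<close>. The number \<open>l\<close> is reserved for vertices that later moves may
  add; the budget \<open>m\<close> keeps every position small enough for \<open>separated\<close> to
  apply.\<close>

definition amalgam :: "nat \<Rightarrow> nat \<Rightarrow> nat set \<Rightarrow> (nat \<Rightarrow> nat \<Rightarrow> bool) \<Rightarrow> nat set \<Rightarrow> nat set \<Rightarrow> nat set \<Rightarrow> nat set \<Rightarrow> nat set \<Rightarrow> bool" where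
  "amalgam m l V E B Q R L K \<longleftrightarrow> separated m V E B Q R \<and> B \<subseteq> L \<and> L \<subseteq> V \<and> Q \<subseteq> K \<and> K \<subseteq> R \<and>
     iext E B L \<and> iext E Q K \<and> card ((L \<union> K) - Q) + l \<le> m"

lemma separatedD:
  assumes "separated m V E B Q R" "W \<subseteq> V" "card (W - Q) \<le> m" "iext E Q (Q \<union> W)" "x \<in> W - R" "y \<in> R - B"
  shows "\<not> E x y" "\<not> E y x"
proof -
  show "\<not> E x y" using assms unfolding separated_def by (elim conjE) blast
  then show "\<not> E y x" using assms(1) unfolding separated_def by (auto dest: sympD)
qed

lemma amalgam_facts:
  assumes "amalgam m l V E B Q R L K"
  shows "separated m V E B Q R" "finite V" "symp E" "B \<subseteq> Q" "Q \<subseteq> R" "R \<subseteq> V" "ifree E B R"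
    "B \<subseteq> L" "L \<subseteq> V" "Q \<subseteq> K" "K \<subseteq> R" "iext E B L" "iext E Q K" "card ((L \<union> K) - Q) + l \<le> m"
    "finite L" "finite K" "finite Q"
proof -
  note d = assms[unfolded amalgam_def separated_def]
  show "separated m V E B Q R" "finite V" "symp E" "B \<subseteq> Q" "Q \<subseteq> R" "R \<subseteq> V" "ifree E B R"
    "B \<subseteq> L" "L \<subseteq> V" "Q \<subseteq> K" "K \<subseteq> R" "iext E B L" "iext E Q K" "card ((L \<union> K) - Q) + l \<le> m"
    using d assms[unfolded amalgam_def] by simp_all
  show "finite L" "finite K" "finite Q" using d iext_imp_finite[of E B L] iext_imp_finite[of E Q K] finite_subset[of Q K] by auto
qed

lemma amalgam_left_iext:
  assumes "amalgam m l V E B Q R L K" shows "iext E Q (Q \<union> L)" "card (L - Q) \<le> m"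
proof -
  note a = amalgam_facts[OF assms]
  show "iext E Q (Q \<union> L)" by (rule iext_mono[OF a(12) a(4) a(17)])
  have "card (L - Q) \<le> card ((L \<union> K) - Q)" using a by (intro card_mono) auto
  then show "card (L - Q) \<le> m" using a(14) by linarith
qed

text \<open>Separation leaves no edge between \<open>L \<inter> R - B\<close> and the rest of
  \<open>L\<close>, so \<open>L \<inter> R\<close> is itself dense over \<open>B\<close>; inside the
  free extension \<open>R\<close> nothing but \<open>B\<close> is.\<close>

lemma amalgam_Int:
  assumes "amalgam m l V E B Q R L K" shows "L \<inter> R = B"
proof -
  note a = amalgam_facts[OF assms]
  have "iext E (B \<inter> (L \<inter> R)) (L \<inter> R)"
  proof (rule iext_restrict[OF a(12) _ a(3)])
    fix x y assume "x \<in> L \<inter> R - B" "y \<in> L - L \<inter> R"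
    then show "\<not> E x y"
      using separatedD(2)[OF a(1) a(9) amalgam_left_iext(2)[OF assms] amalgam_left_iext(1)[OF assms], of y x] by auto
  qed auto
  moreover have "B \<inter> (L \<inter> R) = B" using a by auto
  ultimately show ?thesis using a(7) unfolding ifree_def by auto
qed

lemma amalgam_not_adj:
  assumes "amalgam m l V E B Q R L K" "x \<in> L - B" "y \<in> K - B"
  shows "x \<noteq> y" "\<not> E x y" "\<not> E y x"
proof -
  note a = amalgam_facts[OF assms(1)]
  have x: "x \<in> L - R" using amalgam_Int[OF assms(1)] assms(2) by auto
  have y: "y \<in> R - B" using assms(3) a by auto
  show "x \<noteq> y" using x y by auto
  show "\<not> E x y" "\<not> E y x"
    using separatedD[OF a(1) a(9) amalgam_left_iext(2)[OF assms(1)] amalgam_left_iext(1)[OF assms(1)] x y] .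
qed

lemma amalgam_union_iext:
  assumes "amalgam m l V E B Q R L K" shows "iext E Q (L \<union> K)"
proof -
  note a = amalgam_facts[OF assms]
  have "iext E Q ((Q \<union> L) \<union> K)" by (rule iext_Un[OF amalgam_left_iext(1)[OF assms] a(13)])
  moreover have "(Q \<union> L) \<union> K = L \<union> K" using a by auto
  ultimately show ?thesis by simp
qed

text \<open>A dense move splits along \<open>R\<close>. Separation, applied to the whole new
  position, leaves no edges between the vertices outside \<open>R\<close> and those of
  \<open>R - B\<close>, so each half is dense over its own side by
  \<open>iext_restrict\<close>.\<close>

lemma amalgam_extend:
  assumes am: "amalgam m (l + t) V E B Q R L K" and X: "X \<subseteq> V" "card X \<le> t" "iext E (L \<union> K) (L \<union> K \<union> X)"
  shows "iext E L (L \<union> (X - R))" "iext E K (K \<union> (X \<inter> R))"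
    "amalgam m l V E B Q R (L \<union> (X - R)) (K \<union> (X \<inter> R))"
proof -
  note a = amalgam_facts[OF am]
  have finX: "finite X" using X a finite_subset by blast
  let ?W = "L \<union> K \<union> X"
  have eqW: "(L \<union> (X - R)) \<union> (K \<union> (X \<inter> R)) = ?W" by auto
  have WV: "?W \<subseteq> V" using a X by auto
  have "?W - Q \<subseteq> ((L \<union> K) - Q) \<union> X" by auto
  then have "card (?W - Q) \<le> card (((L \<union> K) - Q) \<union> X)" using a finX by (intro card_mono) auto
  also have "\<dots> \<le> card ((L \<union> K) - Q) + card X" by (rule card_Un_le)
  finally have cW: "card (?W - Q) + l \<le> m" using a(14) X(2) by linarith
  then have cW': "card (?W - Q) \<le> m" by simp
  have "iext E Q ?W" by (rule iext_trans[OF amalgam_union_iext[OF am] X(3)])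
  moreover have "Q \<union> ?W = ?W" using a by auto
  ultimately have iW: "iext E Q (Q \<union> ?W)" by simp
  note sep = separatedD[OF a(1) WV cW' iW]
  note Int = amalgam_Int[OF am]
  have "iext E ((L \<union> K) \<inter> (L \<union> (X - R))) (L \<union> (X - R))"
  proof (rule iext_restrict[OF X(3) _ a(3)])
    fix x y assume "x \<in> L \<union> (X - R) - (L \<union> K)" "y \<in> ?W - (L \<union> (X - R))"
    then show "\<not> E x y" using a by (intro sep(1)) auto
  qed auto
  moreover have "(L \<union> K) \<inter> (L \<union> (X - R)) = L" using a by auto
  ultimately show 1: "iext E L (L \<union> (X - R))" by simp
  have "iext E ((L \<union> K) \<inter> (K \<union> (X \<inter> R))) (K \<union> (X \<inter> R))"
  proof (rule iext_restrict[OF X(3) _ a(3)])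
    fix x y assume xy: "x \<in> K \<union> (X \<inter> R) - (L \<union> K)" "y \<in> ?W - (K \<union> (X \<inter> R))"
    then have "y \<in> ?W - R" using a Int by auto
    then show "\<not> E x y" using xy a by (intro sep(2)) auto
  qed auto
  moreover have "(L \<union> K) \<inter> (K \<union> (X \<inter> R)) = K" using a Int by auto
  ultimately show 2: "iext E K (K \<union> (X \<inter> R))" by simp
  show "amalgam m l V E B Q R (L \<union> (X - R)) (K \<union> (X \<inter> R))"
    unfolding amalgam_def eqW
    using a X cW iext_trans[OF a(12) 1] iext_trans[OF a(13) 2] by (intro conjI) auto
qed

text \<open>The left parts are compared in the whole graphs, the right parts only inside
  \<open>R\<close> and \<open>R'\<close>, because an envelope is represented by its internal type.
  The amount \<open>k * t\<close> is what \<open>k\<close> moves of at most \<open>t\<close>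
  vertices can add.\<close>

definition amalgam_iso :: "nat \<Rightarrow> nat \<Rightarrow> nat \<Rightarrow> nat set \<Rightarrow> (nat \<Rightarrow> nat \<Rightarrow> bool) \<Rightarrow> nat set \<Rightarrow> nat set \<Rightarrow> nat set \<Rightarrow>
    nat set \<Rightarrow> (nat \<Rightarrow> nat \<Rightarrow> bool) \<Rightarrow> nat set \<Rightarrow> nat set \<Rightarrow> nat set \<Rightarrow> (nat \<times> nat) set \<Rightarrow> (nat \<times> nat) set \<Rightarrow> (nat \<times> nat) set \<Rightarrow> bool" where
  "amalgam_iso m k t V E B Q R V' E' B' Q' R' PB PL PR \<longleftrightarrow>
     amalgam m (k * t) V E B Q R (fst ` PL) (fst ` PR) \<and>
     amalgam m (k * t) V' E' B' Q' R' (snd ` PL) (snd ` PR) \<and>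
     PB \<subseteq> PL \<and> PB \<subseteq> PR \<and> fst ` PB = B \<and> snd ` PB = B' \<and>
     eqv k t V E V' E' PL \<and> eqv k t R E R' E' PR"

lemma amalgam_iso_converse:
  "amalgam_iso m k t V E B Q R V' E' B' Q' R' PB PL PR \<Longrightarrow>
   amalgam_iso m k t V' E' B' Q' R' V E B Q R (PB\<inverse>) (PL\<inverse>) (PR\<inverse>)"
  unfolding amalgam_iso_def fst_converse snd_converse converse_mono
  by (elim conjE, intro conjI eqv_converse)

text \<open>Beyond the root, vertices of different sides are distinct and nonadjacent in both
  structures, so pairs from different sides are automatically compatible.\<close>

lemma amalgam_iso_piso:
  assumes "amalgam_iso m k t V E B Q R V' E' B' Q' R' PB PL PR"
  shows "piso V E V' E' (PL \<union> PR)"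
proof -
  have am: "amalgam m (k * t) V E B Q R (fst ` PL) (fst ` PR)" "amalgam m (k * t) V' E' B' Q' R' (snd ` PL) (snd ` PR)"
    and PB: "PB \<subseteq> PL" "PB \<subseteq> PR" "fst ` PB = B" "snd ` PB = B'"
    and eq: "eqv k t V E V' E' PL" "eqv k t R E R' E' PR"
    using assms unfolding amalgam_iso_def by simp_all
  note a = amalgam_facts[OF am(1)] and a' = amalgam_facts[OF am(2)]
  have pL: "piso V E V' E' PL" using eq(1) by (rule eqv_imp_piso)
  have "piso R E R' E' PR" using eq(2) by (rule eqv_imp_piso)
  then have pR: "piso V E V' E' PR" unfolding piso_def using a(6) a'(6) by blast
  have inB: "p \<in> PB" if pp: "p \<in> PL \<or> p \<in> PR" "fst p \<in> B \<or> snd p \<in> B'" for p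
  proof -
    obtain b where b: "b \<in> PB" "fst b = fst p \<or> snd b = snd p"
      using pp(2) PB(3,4) by (metis imageE)
    have "p = b"
      using pp(1)
    proof
      assume "p \<in> PL"
      then show ?thesis using piso_eq[OF pL, of b p] b PB by (auto simp: prod_eq_iff)
    next
      assume "p \<in> PR"
      then show ?thesis using piso_eq[OF pR, of b p] b PB by (auto simp: prod_eq_iff)
    qed
    then show ?thesis using b by simp
  qed
  have LR: "(fst p = fst q \<longleftrightarrow> snd p = snd q) \<and> (E (fst p) (fst q) \<longleftrightarrow> E' (snd p) (snd q)) \<and>
      (E (fst q) (fst p) \<longleftrightarrow> E' (snd q) (snd p))" if pq: "p \<in> PL" "q \<in> PR" for p q
  proof (cases "p \<in> PB \<or> q \<in> PB")
    case True
    then show ?thesis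
    proof
      assume "p \<in> PB"
      then have "p \<in> PR" using PB by blast
      then show ?thesis using piso_eq[OF pR _ pq(2)] piso_adj[OF pR _ pq(2)] piso_adj[OF pR pq(2)] by blast
    next
      assume "q \<in> PB"
      then have "q \<in> PL" using PB by blast
      then show ?thesis using piso_eq[OF pL pq(1)] piso_adj[OF pL _ pq(1)] piso_adj[OF pL pq(1)] by blast
    qed
  next
    case False
    then have "fst p \<in> fst ` PL - B" "snd p \<in> snd ` PL - B'" "fst q \<in> fst ` PR - B" "snd q \<in> snd ` PR - B'"
      using inB pq by blast+
    then show ?thesis using amalgam_not_adj[OF am(1)] amalgam_not_adj[OF am(2)] by metis
  qed
  show ?thesis unfolding piso_def
  proof (intro conjI ballI)
    show "PL \<union> PR \<subseteq> V \<times> V'" using pL pR by (simp add: piso_def)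
    fix p q assume "p \<in> PL \<union> PR" "q \<in> PL \<union> PR"
    then consider "p \<in> PL" "q \<in> PL" | "p \<in> PR" "q \<in> PR" | "p \<in> PL" "q \<in> PR" | "p \<in> PR" "q \<in> PL" by blast
    then have "(fst p = fst q \<longleftrightarrow> snd p = snd q) \<and> (E (fst p) (fst q) \<longleftrightarrow> E' (snd p) (snd q))"
    proof cases
      case 1 then show ?thesis using piso_eq[OF pL] piso_adj[OF pL] by simp
    next
      case 2 then show ?thesis using piso_eq[OF pR] piso_adj[OF pR] by simp
    next
      case 3 then show ?thesis using LR by simp
    next
      case 4 then show ?thesis using LR[of q p] by metis
    qed
    then show "fst p = fst q \<longleftrightarrow> snd p = snd q" "E (fst p) (fst q) \<longleftrightarrow> E' (snd p) (snd q)" by auto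
  qed
qed

text \<open>On the side of the move, \<open>amalgam_extend\<close> applies directly. For the answers
  there is no such argument; their density and the number of their new vertices are carried over by
  the partial isomorphisms.\<close>

lemma amalgam_transfer:
  assumes am: "amalgam m l V E B Q R (fst ` PL') (fst ` PR')"
    and am': "amalgam m (l + t) V' E' B' Q' R' (snd ` PL) (snd ` PR)"
    and P: "piso V E V' E' PL'" "piso R E R' E' PR'" "PL \<subseteq> PL'" "PR \<subseteq> PR'"
    and ie: "iext E (fst ` PL) (fst ` PL')" "iext E (fst ` PR) (fst ` PR')"
    and card: "card (fst ` PL' - fst ` PL) + card (fst ` PR' - fst ` PR) \<le> t"
  shows "amalgam m l V' E' B' Q' R' (snd ` PL') (snd ` PR')"
proof -
  note a = amalgam_facts[OF am] and a' = amalgam_facts[OF am']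
  have i: "iext E' (snd ` PL) (snd ` PL')" by (rule piso_iext[OF P(1,3) ie(1) a(3) a'(3)])
  have i': "iext E' (snd ` PR) (snd ` PR')" by (rule piso_iext[OF P(2,4) ie(2) a(3) a'(3)])
  have sub: "snd ` PL' \<subseteq> V'" "snd ` PR' \<subseteq> R'" using P(1,2) by (simp_all add: piso_snd_subset)
  have mono: "snd ` PL \<subseteq> snd ` PL'" "snd ` PR \<subseteq> snd ` PR'" using P by auto
  have fin: "finite (snd ` PL')" "finite (snd ` PR')" using i i' by (simp_all add: iext_def)
  have "(snd ` PL' \<union> snd ` PR') - Q' \<subseteq>
      ((snd ` PL \<union> snd ` PR) - Q') \<union> ((snd ` PL' - snd ` PL) \<union> (snd ` PR' - snd ` PR))" by blast
  then have "card ((snd ` PL' \<union> snd ` PR') - Q') \<le>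
      card (((snd ` PL \<union> snd ` PR) - Q') \<union> ((snd ` PL' - snd ` PL) \<union> (snd ` PR' - snd ` PR)))"
    using fin a' by (intro card_mono) auto
  also have "\<dots> \<le> card ((snd ` PL \<union> snd ` PR) - Q') + (card (snd ` PL' - snd ` PL) + card (snd ` PR' - snd ` PR))"
    by (intro order_trans[OF card_Un_le] add_mono card_Un_le order_refl)
  also have "\<dots> \<le> card ((snd ` PL \<union> snd ` PR) - Q') + t"
    using piso_card_diff[OF P(1,3)] piso_card_diff[OF P(2,4)] card by linarith
  finally have "card ((snd ` PL' \<union> snd ` PR') - Q') + l \<le> m" using a'(14) by linarith
  then show ?thesis
    unfolding amalgam_def
    using a'(1) sub mono a'(8,10) iext_trans[OF a'(12) i] iext_trans[OF a'(13) i'] by (intro conjI) auto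
qed

text \<open>Each half of a split move is answered in its own game and the answers are united. Both
  structures remain amalgams over the same root, so the play can go on.\<close>

theorem eqv_amalgam:
  "amalgam_iso m k t V E B Q R V' E' B' Q' R' PB PL PR \<Longrightarrow> eqv k t V E V' E' (PL \<union> PR)"
proof (induction k arbitrary: V E B Q R V' E' B' Q' R' PB PL PR)
  case 0
  then show ?case by (simp add: amalgam_iso_piso)
next
  case (Suc k)
  have forth: "\<exists>P'. PL \<union> PR \<subseteq> P' \<and> fst ` P' = fst ` (PL \<union> PR) \<union> X \<and> eqv k t V E V' E' P'"
    if iso: "amalgam_iso m (Suc k) t V E B Q R V' E' B' Q' R' PB PL PR"
      and X: "X \<subseteq> V" "card X \<le> t" "iext E (fst ` (PL \<union> PR)) (fst ` (PL \<union> PR) \<union> X)"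
    for V E B Q R V' E' B' Q' R' PB PL PR X
  proof -
    have am: "amalgam m (k * t + t) V E B Q R (fst ` PL) (fst ` PR)" "amalgam m (k * t + t) V' E' B' Q' R' (snd ` PL) (snd ` PR)"
      and PB: "PB \<subseteq> PL" "PB \<subseteq> PR" "fst ` PB = B" "snd ` PB = B'"
      and eq: "eqv (Suc k) t V E V' E' PL" "eqv (Suc k) t R E R' E' PR"
      using iso unfolding amalgam_iso_def by (simp_all add: add.commute)
    note a = amalgam_facts[OF am(1)]
    have finX: "finite X" using X a finite_subset by blast
    note ext = amalgam_extend[OF am(1) X(1,2) X(3)[unfolded image_Un]]
    have cX: "card X = card (X - R) + card (X \<inter> R)"
      using card_Int_Diff[OF finX, of R] by simp
    obtain PL' where PL': "PL \<subseteq> PL'" "fst ` PL' = fst ` PL \<union> (X - R)" "eqv k t V E V' E' PL'"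
      by (rule eqv_forth[OF eq(1) _ _ ext(1)]) (use X cX in auto)
    obtain PR' where PR': "PR \<subseteq> PR'" "fst ` PR' = fst ` PR \<union> (X \<inter> R)" "eqv k t R E R' E' PR'"
      by (rule eqv_forth[OF eq(2) _ _ ext(2)]) (use X cX in auto)
    have am2: "amalgam m (k * t) V E B Q R (fst ` PL') (fst ` PR')" using ext(3) unfolding PL'(2) PR'(2) .
    have "fst ` PL' - fst ` PL \<subseteq> X - R" "fst ` PR' - fst ` PR \<subseteq> X \<inter> R" using PL'(2) PR'(2) by auto
    then have "card (fst ` PL' - fst ` PL) \<le> card (X - R)" "card (fst ` PR' - fst ` PR) \<le> card (X \<inter> R)"
      using finX by (simp_all add: card_mono)
    then have c: "card (fst ` PL' - fst ` PL) + card (fst ` PR' - fst ` PR) \<le> t" using cX X(2) by linarith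
    have am3: "amalgam m (k * t) V' E' B' Q' R' (snd ` PL') (snd ` PR')"
      by (rule amalgam_transfer[OF am2 am(2) eqv_imp_piso[OF PL'(3)] eqv_imp_piso[OF PR'(3)] PL'(1) PR'(1) _ _ c])
        (use ext PL'(2) PR'(2) in simp_all)
    have "amalgam_iso m k t V E B Q R V' E' B' Q' R' PB PL' PR'"
      unfolding amalgam_iso_def
      by (intro conjI am2 am3 order_trans[OF PB(1) PL'(1)] order_trans[OF PB(2) PR'(1)] PB(3,4) PL'(3) PR'(3))
    then have "eqv k t V E V' E' (PL' \<union> PR')" by (rule Suc.IH)
    moreover have "fst ` (PL' \<union> PR') = fst ` (PL \<union> PR) \<union> X"
      by (simp add: image_Un PL'(2) PR'(2)) auto
    moreover have "PL \<union> PR \<subseteq> PL' \<union> PR'" using PL'(1) PR'(1) by (rule Un_mono)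
    ultimately show ?thesis by (intro exI[of _ "PL' \<union> PR'"] conjI)
  qed
  show ?case
  proof (rule eqv_SucI)
    show "piso V E V' E' (PL \<union> PR)" using Suc.prems by (rule amalgam_iso_piso)
  next
    fix X assume "X \<subseteq> V" "card X \<le> t" "iext E (fst ` (PL \<union> PR)) (fst ` (PL \<union> PR) \<union> X)"
    then show "\<exists>P'. PL \<union> PR \<subseteq> P' \<and> fst ` P' = fst ` (PL \<union> PR) \<union> X \<and> eqv k t V E V' E' P'"
      by (rule forth[OF Suc.prems])
  next
    fix X assume "X \<subseteq> V'" "card X \<le> t" "iext E' (fst ` ((PL \<union> PR)\<inverse>)) (fst ` ((PL \<union> PR)\<inverse>) \<union> X)"
    then show "\<exists>P'. (PL \<union> PR)\<inverse> \<subseteq> P' \<and> fst ` P' = fst ` ((PL \<union> PR)\<inverse>) \<union> X \<and> eqv k t V' E' V E P'"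
      unfolding converse_Un by (rule forth[OF amalgam_iso_converse[OF Suc.prems]])
  qed
qed

section \<open>Extension axioms decide sentences\<close>

text \<open>Every copy of \<open>B\<close> extends to a copy of \<open>K\<close> whose new vertices have no neighbours in a small dense extension
  of that copy.\<close>

definition extension_axiom :: "nat \<Rightarrow> nat set \<Rightarrow> (nat \<Rightarrow> nat \<Rightarrow> bool) \<Rightarrow> nat set \<Rightarrow> nat set \<Rightarrow> (nat \<Rightarrow> nat \<Rightarrow> bool) \<Rightarrow> bool" where
  "extension_axiom m K F B V E \<longleftrightarrow>
     (\<forall>\<beta>. inj_on \<beta> B \<longrightarrow> \<beta> ` B \<subseteq> V \<longrightarrow> (\<forall>x\<in>B. \<forall>y\<in>B. E (\<beta> x) (\<beta> y) \<longleftrightarrow> F x y) \<longrightarrow>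
       (\<exists>g. inj_on g K \<and> g ` K \<subseteq> V \<and> (\<forall>x\<in>B. g x = \<beta> x) \<and> (\<forall>x\<in>K. \<forall>y\<in>K. E (g x) (g y) \<longleftrightarrow> F x y) \<and>
          (\<forall>W. W \<subseteq> V \<longrightarrow> card (W - g ` K) \<le> m \<longrightarrow> iext E (g ` K) (g ` K \<union> W) \<longrightarrow>
             (\<forall>x\<in>W - g ` K. \<forall>y\<in>g ` (K - B). \<not> E x y))))"

definition pattern :: "nat set \<Rightarrow> (nat \<Rightarrow> nat \<Rightarrow> bool) \<Rightarrow> nat set \<Rightarrow> bool" where
  "pattern K F B \<longleftrightarrow> symp F \<and> irreflp F \<and> ifree F B K"

definition good_graph :: "(nat \<times> nat set \<times> (nat \<Rightarrow> nat \<Rightarrow> bool) \<times> nat set) set \<Rightarrow> nat set \<Rightarrow> (nat \<Rightarrow> nat \<Rightarrow> bool) \<Rightarrow> bool" where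
  "good_graph \<I> V E \<longleftrightarrow> finite V \<and> symp E \<and> irreflp E \<and> (\<forall>m K F B. (m, K, F, B) \<in> \<I> \<longrightarrow> extension_axiom m K F B V E)"

definition patterns :: "(nat \<times> nat set \<times> (nat \<Rightarrow> nat \<Rightarrow> bool) \<times> nat set) set \<Rightarrow> bool" where
  "patterns \<I> \<longleftrightarrow> finite \<I> \<and> (\<forall>m K F B. (m, K, F, B) \<in> \<I> \<longrightarrow> pattern K F B)"

text \<open>The patterns represent the finitely many depth \<open>k\<close> types of rooted graphs \<open>R\<close> provided by the envelope
  of \<open>c\<close>; the closed copy of such a pattern over the image of \<open>B\<close> then answers the move \<open>c\<close>.\<close>

theorem extension_step:
  "\<exists>\<I> k' t'. patterns \<I> \<and> (\<forall>V E V' E' P c. good_graph \<I> V E \<longrightarrow> good_graph \<I> V' E' \<longrightarrow>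
     card (fst ` P) \<le> s \<longrightarrow> eqv k' t' V E V' E' P \<longrightarrow> c \<in> V \<longrightarrow> (\<exists>d. eqv k t V E V' E' (insert (c, d) P)))"
proof -
  \<comment> \<open>The number of vertices that \<open>k\<close> moves of at most \<open>t\<close>
    vertices can add to the position.\<close>
  define m where "m = k * t"
  obtain N where N: "\<And>V E A v. finite V \<Longrightarrow> symp E \<Longrightarrow> A \<subseteq> V \<Longrightarrow> v \<in> V \<Longrightarrow> card A \<le> s \<Longrightarrow>
    \<exists>B R. iext E A B \<and> B \<subseteq> R \<and> R \<subseteq> V \<and> card B \<le> N \<and> v \<in> R \<and> ifree E B R \<and>
    (\<forall>W. W \<subseteq> V \<longrightarrow> card (W - insert v B) \<le> m \<longrightarrow> iext E (insert v B) (insert v B \<union> W) \<longrightarrow>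
       (\<forall>x\<in>W - R. \<forall>y\<in>R - B. \<not> E x y))"
    by (rule envelope[of s m]) (rule that)
  let ?S = "{(V :: nat set, E :: nat \<Rightarrow> nat \<Rightarrow> bool, xs). length xs \<le> N + 1 \<and> set xs \<subseteq> V}"
  obtain f :: "nat set \<times> (nat \<Rightarrow> nat \<Rightarrow> bool) \<times> nat list \<Rightarrow> nat" where f: "finite (f ` ?S)"
    and f': "\<forall>V E xs V' E' ys. length xs \<le> N + 1 \<longrightarrow> length ys \<le> N + 1 \<longrightarrow> set xs \<subseteq> V \<longrightarrow> set ys \<subseteq> V' \<longrightarrow>
        f (V, E, xs) = f (V', E', ys) \<longrightarrow> length xs = length ys \<and> eqv k t V E V' E' (set (zip xs ys))"
    using eqv_finite_index[of "N + 1" k t] by (elim exE conjE) (rule that)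
  \<comment> \<open>Tuples list the root and then the chosen vertex, so \<open>butlast\<close>
    recovers the root and the length is at most \<open>N + 1\<close>. Only the tuple is bounded; the
    graph around it may have any finite size, and finitely many representatives realise all
    codes.\<close>
  define Z where "Z = {(V, E, xs) \<in> ?S. xs \<noteq> [] \<and> pattern V E (set (butlast xs))}"
  have "Z \<subseteq> ?S" by (auto simp: Z_def)
  then have "finite (f ` Z)" using f by (meson finite_subset image_mono)
  then obtain T where T: "T \<subseteq> Z" "finite T" "f ` Z = f ` T"
    using finite_subset_image[of "f ` Z" f Z] by auto
  define \<I> where "\<I> = (\<lambda>(V, E, xs). (m, V, E, set (butlast xs))) ` T"
  show ?thesis
  \<comment> \<open>One round is spent on moving from \<open>P\<close> to the root \<open>B\<close>,
    a move that may add up to \<open>N\<close> vertices.\<close>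
  proof (rule exI[of _ \<I>], rule exI[of _ "Suc k"], rule exI[of _ "max N t"], intro conjI allI impI)
    show "patterns \<I>" using T(1,2) by (auto simp: patterns_def \<I>_def Z_def)
  next
    fix V E V' E' P c
    assume good: "good_graph \<I> V E" "good_graph \<I> V' E'"
      and cP: "card (fst ` P) \<le> s" and eq: "eqv (Suc k) (max N t) V E V' E' P" and c: "c \<in> V"
    have fin: "finite V" "finite V'" and sym: "symp E" "symp E'" and irr: "irreflp E"
      using good by (simp_all add: good_graph_def)
    have ax: "extension_axiom m K F B V' E'" if "(m, K, F, B) \<in> \<I>" for m K F B
      using good(2) that by (simp add: good_graph_def)
    have PV: "fst ` P \<subseteq> V" using eqv_imp_piso[OF eq] by (rule piso_fst_subset)
    obtain B R where BR: "iext E (fst ` P) B" "B \<subseteq> R" "R \<subseteq> V" "card B \<le> N" "c \<in> R" "ifree E B R"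
      and sep: "\<forall>W. W \<subseteq> V \<longrightarrow> card (W - insert c B) \<le> m \<longrightarrow> iext E (insert c B) (insert c B \<union> W) \<longrightarrow>
       (\<forall>x\<in>W - R. \<forall>y\<in>R - B. \<not> E x y)"
      using N[OF fin(1) sym(1) PV c cP] by (elim exE conjE) (rule that)
    have PB_eq: "fst ` P \<union> B = B" using iext_imp_subset[OF BR(1)] by (rule Un_absorb1)
    have finR: "finite R" by (rule finite_subset[OF BR(3) fin(1)])
    have finB: "finite B" by (rule finite_subset[OF BR(2) finR])
    have BV: "B \<subseteq> V" using BR(2,3) by (rule order_trans)
    have cB: "card B \<le> max N t" using BR(4) by (rule max.coboundedI1)
    have iB: "iext E (fst ` P) (fst ` P \<union> B)" unfolding PB_eq by (rule BR(1))
    obtain PB where PB: "P \<subseteq> PB" "fst ` PB = fst ` P \<union> B" "eqv k (max N t) V E V' E' PB"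
      by (rule eqv_forth[OF eq BV cB iB])
    have fPB: "fst ` PB = B" unfolding PB(2) by (rule PB_eq)
    have eqB: "eqv k t V E V' E' PB" by (rule eqv_mono_size[OF _ PB(3)]) simp
    have pB: "piso V E V' E' PB" using eqB by (rule eqv_imp_piso)
    obtain h where h: "inj_on h B" "\<And>p. p \<in> PB \<Longrightarrow> h (fst p) = snd p"
      "\<And>x y. x \<in> B \<Longrightarrow> y \<in> B \<Longrightarrow> E' (h x) (h y) \<longleftrightarrow> E x y" "\<And>Q. Q \<subseteq> PB \<Longrightarrow> h ` fst ` Q = snd ` Q"
      by (rule piso_function[OF pB], unfold fPB) (rule that)
    have hB: "h ` B = snd ` PB" using h(4)[OF order_refl] fPB by simp
    obtain bs where bs: "set bs = B" "distinct bs" using finB finite_distinct_list by blast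
    have lb: "length bs \<le> N" using bs BR(4) distinct_card by fastforce
    have "(R, E, bs @ [c]) \<in> Z"
      using lb BR bs sym irr by (auto simp: Z_def pattern_def)
    then have "f (R, E, bs @ [c]) \<in> f ` T" using T(3) by blast
    then obtain K F zs where zs: "(K, F, zs) \<in> T" "f (R, E, bs @ [c]) = f (K, F, zs)" by auto
    then have zsZ: "length zs \<le> N + 1" "set zs \<subseteq> K" "zs \<noteq> []" "pattern K F (set (butlast zs))"
      using T(1) by (auto simp: Z_def)
    define ws where "ws = butlast zs"
    define c0 where "c0 = last zs"
    have zs_eq: "zs = ws @ [c0]" using zsZ by (simp add: ws_def c0_def)
    have "length (bs @ [c]) = length zs \<and> eqv k t R E K F (set (zip (bs @ [c]) zs))"
      using f'[rule_format, of "bs @ [c]" zs R K E F] lb zsZ BR bs zs(2) by simp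
    then have len: "length bs = length ws" and eqK: "eqv k t R E K F (set (zip bs ws) \<union> {(c, c0)})"
      by (auto simp: zs_eq)
    define PK where "PK = set (zip bs ws) \<union> {(c, c0)}"
    have pK: "piso R E K F PK" using eqK unfolding PK_def by (rule eqv_imp_piso)
    define B0 where "B0 = set ws"
    have patt: "symp F" "irreflp F" "ifree F B0 K" using zsZ(4) by (simp_all add: pattern_def B0_def ws_def)
    have B0K: "B0 \<subseteq> K" "c0 \<in> K" using zsZ(2) by (auto simp: zs_eq B0_def)
    \<comment> \<open>Places the root \<open>B0\<close> of the representative onto the image of
      \<open>B\<close> in the second graph; \<open>zip\<close> matches \<open>bs\<close> with
      \<open>ws\<close> as equality of the codes does.\<close>
    define \<beta> where "\<beta> = (\<lambda>y. h (SOME x. (x, y) \<in> set (zip bs ws)))"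
    have \<beta>: "\<beta> y = h x" if xy: "(x, y) \<in> set (zip bs ws)" for x y
    proof -
      have "(SOME x. (x, y) \<in> set (zip bs ws), y) \<in> set (zip bs ws)" by (rule someI[of _ x]) (rule xy)
      then have "(SOME x. (x, y) \<in> set (zip bs ws)) = x"
        using piso_eq[OF pK, of "(SOME x. (x, y) \<in> set (zip bs ws), y)" "(x, y)"] xy by (simp add: PK_def)
      then show ?thesis by (simp add: \<beta>_def)
    qed
    have zipB: "\<exists>x. x \<in> B \<and> (x, y) \<in> set (zip bs ws)" if "y \<in> B0" for y
    proof -
      have "y \<in> snd ` set (zip bs ws)" using that by (simp add: snd_set_zip[OF len] B0_def)
      then obtain x where x: "(x, y) \<in> set (zip bs ws)" by auto
      then have "x \<in> set bs" by (rule set_zip_leftD)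
      then show ?thesis using x bs by blast
    qed
    have adj\<beta>: "(E' (\<beta> y) (\<beta> y') \<longleftrightarrow> F y y') \<and> (\<beta> y = \<beta> y' \<longrightarrow> y = y')" if y: "y \<in> B0" "y' \<in> B0" for y y'
    proof -
      obtain x where x: "x \<in> B" "(x, y) \<in> set (zip bs ws)" using zipB[OF y(1)] by blast
      obtain x' where x': "x' \<in> B" "(x', y') \<in> set (zip bs ws)" using zipB[OF y(2)] by blast
      have "E x x' \<longleftrightarrow> F y y'" "x = x' \<longleftrightarrow> y = y'"
        using piso_adj[OF pK, of "(x, y)" "(x', y')"] piso_eq[OF pK, of "(x, y)" "(x', y')"] x x' by (simp_all add: PK_def)
      then show ?thesis using \<beta>[OF x(2)] \<beta>[OF x'(2)] h(3)[OF x(1) x'(1)] inj_on_eq_iff[OF h(1) x(1) x'(1)] by simp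
    qed
    have \<beta>B: "\<beta> ` B0 = snd ` PB"
    proof -
      have "\<beta> ` B0 = h ` B"
      proof (intro set_eqI iffI)
        fix z assume "z \<in> \<beta> ` B0"
        then obtain y where "y \<in> B0" "z = \<beta> y" by blast
        moreover obtain x where "x \<in> B" "(x, y) \<in> set (zip bs ws)" using zipB[OF \<open>y \<in> B0\<close>] by blast
        ultimately show "z \<in> h ` B" using \<beta> by blast
      next
        fix z assume "z \<in> h ` B"
        then obtain x where x: "x \<in> B" "z = h x" by blast
        then have "x \<in> fst ` set (zip bs ws)" using bs by (simp add: fst_set_zip[OF len])
        then obtain y where y: "(x, y) \<in> set (zip bs ws)" by auto
        then have y0: "y \<in> B0" unfolding B0_def by (rule set_zip_rightD)
        have "z = \<beta> y" using \<beta>[OF y] x by simp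
        then show "z \<in> \<beta> ` B0" using y0 by (rule image_eqI)
      qed
      then show ?thesis using hB by simp
    qed
    have "inj_on \<beta> B0" by (rule inj_onI) (use adj\<beta> in blast)
    moreover have "\<beta> ` B0 \<subseteq> V'" using \<beta>B piso_snd_subset[OF pB] by simp
    moreover have "extension_axiom m K F B0 V' E'"
      by (rule ax) (use zs(1) in \<open>force simp: \<I>_def B0_def ws_def\<close>)
    moreover have "\<forall>x\<in>B0. \<forall>y\<in>B0. E' (\<beta> x) (\<beta> y) \<longleftrightarrow> F x y" using adj\<beta> by blast
    ultimately obtain g where g: "inj_on g K" "g ` K \<subseteq> V'" "\<forall>x\<in>B0. g x = \<beta> x"
      "\<forall>x\<in>K. \<forall>y\<in>K. E' (g x) (g y) \<longleftrightarrow> F x y"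
      and gsep: "\<forall>W. W \<subseteq> V' \<longrightarrow> card (W - g ` K) \<le> m \<longrightarrow> iext E' (g ` K) (g ` K \<union> W) \<longrightarrow>
             (\<forall>x\<in>W - g ` K. \<forall>y\<in>g ` (K - B0). \<not> E' x y)"
      unfolding extension_axiom_def by (elim allE[of _ \<beta>] impE exE conjE) (assumption | rule that)+
    define PR where "PR = (\<lambda>(x, y). (x, g y)) ` PK"
    define R' where "R' = g ` K"
    define B' where "B' = snd ` PB"
    have gB: "g ` B0 = B'" using g(3) \<beta>B by (simp add: B'_def)
    have eqR: "eqv k t R E R' E' PR"
      unfolding R'_def PR_def by (rule eqv_image[OF eqK[folded PK_def] g(1) patt(1) sym(2)]) (use g(4) in blast)
    have PBR: "PB \<subseteq> PR"
    proof
      fix p assume p: "p \<in> PB"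
      then have "fst p \<in> B" using fPB by blast
      then have "fst p \<in> fst ` set (zip bs ws)" using bs by (simp add: fst_set_zip[OF len])
      then obtain y where y: "(fst p, y) \<in> set (zip bs ws)" by auto
      then have "y \<in> B0" unfolding B0_def by (rule set_zip_rightD)
      then have "g y = snd p" using g(3) \<beta>[OF y] h(2)[OF p] by simp
      then have "p = (\<lambda>(x, y). (x, g y)) (fst p, y)" by simp
      then show "p \<in> PR" unfolding PR_def PK_def using y by blast
    qed
    have fPR: "fst ` PR = insert c B"
      by (simp add: PR_def PK_def image_image case_prod_beta fst_set_zip[OF len, unfolded image_image] bs)
    have sPR: "snd ` PR = insert (g c0) B'"
    proof -
      have "snd ` PR = g ` snd ` PK" by (simp add: PR_def image_image case_prod_beta)
      also have "snd ` PK = insert c0 B0" by (simp add: PK_def snd_set_zip[OF len] B0_def)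
      finally show ?thesis using gB by simp
    qed
    have am: "amalgam m (k * t) V E B (insert c B) R (fst ` PB) (fst ` PR)"
      unfolding amalgam_def separated_def fPB fPR
      using fin sym BR sep finB iext_refl[of B] iext_refl[of "insert c B"] by (intro conjI) (auto simp: m_def)
    have fin': "finite R'" using g(2) fin finite_subset by (auto simp: R'_def)
    have B'R': "B' \<subseteq> R'" "g c0 \<in> R'" using gB B0K by (auto simp: R'_def)
    have "ifree E' B' R'"
      unfolding gB[symmetric] R'_def by (rule ifree_image[OF patt(3) g(1) patt(1) sym(2)]) (use g(4) in blast)
    moreover have "\<not> E' x y"
      if W: "W \<subseteq> V'" "card (W - insert (g c0) B') \<le> m" "iext E' (insert (g c0) B') (insert (g c0) B' \<union> W)"
        and x: "x \<in> W - R'" and y: "y \<in> R' - B'" for W x y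
    proof -
      have "iext E' R' (R' \<union> (insert (g c0) B' \<union> W))" using B'R' by (intro iext_mono[OF W(3)] fin') auto
      moreover have "R' \<union> (insert (g c0) B' \<union> W) = R' \<union> W" using B'R' by auto
      ultimately have ie: "iext E' R' (R' \<union> W)" by simp
      have "finite W" by (rule finite_subset[OF W(1) fin(2)])
      then have "card (W - R') \<le> card (W - insert (g c0) B')"
        using B'R' by (intro card_mono) auto
      then have cW: "card (W - R') \<le> m" using W(2) by (rule order_trans)
      have "R' - B' = g ` (K - B0)"
        unfolding R'_def gB[symmetric] using inj_on_image_set_diff[OF g(1), of K B0] B0K by auto
      then have y': "y \<in> g ` (K - B0)" using y by simp
      show ?thesis by (rule gsep[rule_format, OF W(1) cW[unfolded R'_def] ie[unfolded R'_def] x[unfolded R'_def] y'])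
    qed
    ultimately have am': "amalgam m (k * t) V' E' B' (insert (g c0) B') R' (snd ` PB) (snd ` PR)"
      unfolding amalgam_def separated_def sPR B'_def[symmetric]
      using fin sym B'R' g(2) iext_refl[of B'] iext_refl[of "insert (g c0) B'"] finite_subset[OF B'R'(1) fin']
      by (intro conjI allI impI ballI) (auto simp: m_def R'_def)
    have "amalgam_iso m k t V E B (insert c B) R V' E' B' (insert (g c0) B') R' PB PB PR"
      unfolding amalgam_iso_def using am am' PBR fPB eqB eqR by (simp add: B'_def)
    then have "eqv k t V E V' E' (PB \<union> PR)" by (rule eqv_amalgam)
    then have "eqv k t V E V' E' (insert (c, g c0) P)"
      by (rule eqv_subset[OF _ _ fin]) (use PB(1) in \<open>auto simp: PR_def PK_def\<close>)
    then show "\<exists>d. eqv k t V E V' E' (insert (c, d) P)" by (rule exI)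
  qed
qed

section \<open>Invariance of formulas and decision of sentences\<close>

lemma patterns_Un: "patterns \<I> \<Longrightarrow> patterns \<J> \<Longrightarrow> patterns (\<I> \<union> \<J>)"
  unfolding patterns_def by blast

lemma good_graph_mono: "\<I> \<subseteq> \<J> \<Longrightarrow> good_graph \<J> V E \<Longrightarrow> good_graph \<I> V E"
  unfolding good_graph_def by blast

text \<open>The number \<open>s\<close> bounds the position because the size of the root given by an
  envelope depends on it.\<close>

definition invariant_at :: "nat \<Rightarrow> fo_formula \<Rightarrow> nat \<Rightarrow> nat \<Rightarrow> (nat \<times> nat set \<times> (nat \<Rightarrow> nat \<Rightarrow> bool) \<times> nat set) set \<Rightarrow> bool" where
  "invariant_at s \<phi> k t \<I> \<longleftrightarrow> (\<forall>V E V' E' P v v'. good_graph \<I> V E \<longrightarrow> good_graph \<I> V' E' \<longrightarrow> card (fst ` P) \<le> s \<longrightarrow>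
     eqv k t V E V' E' P \<longrightarrow> (\<forall>x\<in>free_vars \<phi>. (v x, v' x) \<in> P) \<longrightarrow> sat V E v \<phi> = sat V' E' v' \<phi>)"

lemma invariant_atD:
  assumes "invariant_at s \<phi> k t \<I>" "good_graph \<I> V E" "good_graph \<I> V' E'" "card (fst ` P) \<le> s"
    "eqv k t V E V' E' P" "\<And>x. x \<in> free_vars \<phi> \<Longrightarrow> (v x, v' x) \<in> P"
  shows "sat V E v \<phi> = sat V' E' v' \<phi>"
proof -
  have "\<forall>x\<in>free_vars \<phi>. (v x, v' x) \<in> P" using assms(6) by blast
  with assms(1)[unfolded invariant_at_def, rule_format, of V E V' E' P v v'] assms(2-5) show ?thesis by blast
qed

text \<open>A quantifier adds one element to the position and, through
  \<open>extension_step\<close>, raises depth and size of the game and adds patterns. Hence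
  \<open>s\<close> has to vary in the induction.\<close>

theorem formula_invariant: "\<exists>k t \<I>. patterns \<I> \<and> invariant_at s \<phi> k t \<I>"
proof (induction \<phi> arbitrary: s)
  case (Eq x y)
  have "invariant_at s (Eq x y) 0 0 {}"
    unfolding invariant_at_def
  proof (intro allI impI)
    fix V E V' E' P and v v' :: "nat \<Rightarrow> nat"
    assume "eqv 0 0 V E V' E' P" "\<forall>z\<in>free_vars (Eq x y). (v z, v' z) \<in> P"
    then show "sat V E v (Eq x y) = sat V' E' v' (Eq x y)"
      using piso_eq[of V E V' E' P "(v x, v' x)" "(v y, v' y)"] by simp
  qed
  moreover have "patterns {}" by (simp add: patterns_def)
  ultimately show ?case by blast
next
  case (Adj x y)
  have "invariant_at s (Adj x y) 0 0 {}"
    unfolding invariant_at_def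
  proof (intro allI impI)
    fix V E V' E' P and v v' :: "nat \<Rightarrow> nat"
    assume "eqv 0 0 V E V' E' P" "\<forall>z\<in>free_vars (Adj x y). (v z, v' z) \<in> P"
    then show "sat V E v (Adj x y) = sat V' E' v' (Adj x y)"
      using piso_adj[of V E V' E' P "(v x, v' x)" "(v y, v' y)"] by simp
  qed
  moreover have "patterns {}" by (simp add: patterns_def)
  ultimately show ?case by blast
next
  case (Neg \<phi>)
  then obtain k t \<I> where *: "patterns \<I>" "invariant_at s \<phi> k t \<I>" by blast
  have "invariant_at s (Neg \<phi>) k t \<I>"
    unfolding invariant_at_def
  proof (intro allI impI)
    fix V E V' E' P and v v' :: "nat \<Rightarrow> nat"
    assume a: "good_graph \<I> V E" "good_graph \<I> V' E'" "card (fst ` P) \<le> s" "eqv k t V E V' E' P"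
      and v: "\<forall>z\<in>free_vars (Neg \<phi>). (v z, v' z) \<in> P"
    have "sat V E v \<phi> = sat V' E' v' \<phi>" by (rule invariant_atD[OF *(2) a]) (use v in simp)
    then show "sat V E v (Neg \<phi>) = sat V' E' v' (Neg \<phi>)" by simp
  qed
  then show ?case using *(1) by blast
next
  case (Conj \<phi> \<psi>)
  obtain k t \<I> where 1: "patterns \<I>" "invariant_at s \<phi> k t \<I>" using Conj.IH(1) by blast
  obtain k' t' \<I>' where 2: "patterns \<I>'" "invariant_at s \<psi> k' t' \<I>'" using Conj.IH(2) by blast
  have "invariant_at s (Conj \<phi> \<psi>) (max k k') (max t t') (\<I> \<union> \<I>')"
    unfolding invariant_at_def
  proof (intro allI impI)
    fix V E V' E' P and v v' :: "nat \<Rightarrow> nat"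
    assume a: "good_graph (\<I> \<union> \<I>') V E" "good_graph (\<I> \<union> \<I>') V' E'" and c: "card (fst ` P) \<le> s"
      and e: "eqv (max k k') (max t t') V E V' E' P"
      and v: "\<forall>z\<in>free_vars (Conj \<phi> \<psi>). (v z, v' z) \<in> P"
    have e1: "eqv k t V E V' E' P" by (rule eqv_mono_depth[OF _ eqv_mono_size[OF _ e]]) auto
    have e2: "eqv k' t' V E V' E' P" by (rule eqv_mono_depth[OF _ eqv_mono_size[OF _ e]]) auto
    have "sat V E v \<phi> = sat V' E' v' \<phi>"
      by (rule invariant_atD[OF 1(2) good_graph_mono[OF _ a(1)] good_graph_mono[OF _ a(2)] c e1]) (use v in auto)
    moreover have "sat V E v \<psi> = sat V' E' v' \<psi>"
      by (rule invariant_atD[OF 2(2) good_graph_mono[OF _ a(1)] good_graph_mono[OF _ a(2)] c e2]) (use v in auto)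
    ultimately show "sat V E v (Conj \<phi> \<psi>) = sat V' E' v' (Conj \<phi> \<psi>)" by simp
  qed
  then show ?case using patterns_Un[OF 1(1) 2(1)] by blast
next
  case (Exi x \<phi>)
  obtain k t \<I> where 1: "patterns \<I>" "invariant_at (s + 1) \<phi> k t \<I>" using Exi.IH by blast
  obtain \<J> k' t' where pJ: "patterns \<J>"
    and step: "\<forall>V E V' E' P c. good_graph \<J> V E \<longrightarrow> good_graph \<J> V' E' \<longrightarrow>
     card (fst ` P) \<le> s \<longrightarrow> eqv k' t' V E V' E' P \<longrightarrow> c \<in> V \<longrightarrow> (\<exists>d. eqv k t V E V' E' (insert (c, d) P))"
    using extension_step[of s k t] by (elim exE conjE) (rule that)
  have forth: "sat V' E' v' (Exi x \<phi>)"
    if g: "good_graph (\<I> \<union> \<J>) V E" "good_graph (\<I> \<union> \<J>) V' E'" and c: "card (fst ` P) \<le> s"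
      and e: "eqv k' t' V E V' E' P" and v: "\<forall>z\<in>free_vars (Exi x \<phi>). (v z, v' z) \<in> P"
      and s: "sat V E v (Exi x \<phi>)" for V E V' E' P and v v' :: "nat \<Rightarrow> nat"
  proof -
    obtain a where a: "a \<in> V" "sat V E (v(x := a)) \<phi>" using s by auto
    have "\<exists>d. eqv k t V E V' E' (insert (a, d) P)"
      by (rule step[rule_format, OF good_graph_mono[OF _ g(1)] good_graph_mono[OF _ g(2)] c e a(1)]) auto
    then obtain d where d: "eqv k t V E V' E' (insert (a, d) P)" by blast
    have "d \<in> V'" using piso_snd_subset[OF eqv_imp_piso[OF d]] by simp
    moreover have "sat V E (v(x := a)) \<phi> = sat V' E' (v'(x := d)) \<phi>"
    proof (rule invariant_atD[OF 1(2) good_graph_mono[OF _ g(1)] good_graph_mono[OF _ g(2)] _ d])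
      show "card (fst ` insert (a, d) P) \<le> s + 1"
        using c card_insert_le_m1[of "s + 1" "fst ` P" a] by simp
      show "((v(x := a)) z, (v'(x := d)) z) \<in> insert (a, d) P" if "z \<in> free_vars \<phi>" for z
        using v that by auto
    qed auto
    ultimately show ?thesis using a(2) by auto
  qed
  have "invariant_at s (Exi x \<phi>) k' t' (\<I> \<union> \<J>)"
    unfolding invariant_at_def
  proof (intro allI impI)
    fix V E V' E' P and v v' :: "nat \<Rightarrow> nat"
    assume g: "good_graph (\<I> \<union> \<J>) V E" "good_graph (\<I> \<union> \<J>) V' E'" and c: "card (fst ` P) \<le> s"
      and e: "eqv k' t' V E V' E' P" and v: "\<forall>z\<in>free_vars (Exi x \<phi>). (v z, v' z) \<in> P"
    have "card (fst ` (P\<inverse>)) = card (fst ` P)"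
      using piso_card_diff[OF eqv_imp_piso[OF e], of "{}"] by (simp add: fst_converse)
    then have c': "card (fst ` (P\<inverse>)) \<le> s" using c by simp
    have v': "\<forall>z\<in>free_vars (Exi x \<phi>). (v' z, v z) \<in> P\<inverse>" using v by simp
    show "sat V E v (Exi x \<phi>) = sat V' E' v' (Exi x \<phi>)"
      using forth[OF g c e v] forth[OF g(2,1) c' eqv_converse[OF e] v'] by blast
  qed
  then show ?case using patterns_Un[OF 1(1) pJ] by blast
qed

text \<open>The empty position admits only the empty dense move, so no information about the two
  graphs is ever compared.\<close>

lemma eqv_empty: "eqv k t V E V' E' {}"
proof (induction k)
  case (Suc k)
  have "eqv (Suc k) t V E V' E' {}"
  proof (rule eqv_SucI)
    fix X assume "iext E (fst ` {}) (fst ` {} \<union> X)"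
    then have "X = {}" using iext_empty[of E X] by simp
    then show "\<exists>P'. {} \<subseteq> P' \<and> fst ` P' = fst ` {} \<union> X \<and> eqv k t V E V' E' P'"
      using Suc by (intro exI[of _ "{}"]) simp
  next
    fix X assume "iext E' (fst ` ({}\<inverse>)) (fst ` ({}\<inverse>) \<union> X)"
    then have "X = {}" using iext_empty[of E' X] by simp
    then show "\<exists>P'. {}\<inverse> \<subseteq> P' \<and> fst ` P' = fst ` ({}\<inverse>) \<union> X \<and> eqv k t V' E' V E P'"
      using eqv_converse[OF Suc] by (intro exI[of _ "{}"]) simp
  qed (simp add: piso_def)
  then show ?case .
qed (simp add: piso_def)

theorem sentence_decided:
  assumes "sentence \<phi>"
  obtains \<I> b where "patterns \<I>" "\<And>V E. good_graph \<I> V E \<Longrightarrow> V \<noteq> {} \<Longrightarrow> models V E \<phi> = b"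
proof -
  obtain k t \<I> where I: "patterns \<I>" "invariant_at 0 \<phi> k t \<I>" using formula_invariant by blast
  have same: "sat V E v \<phi> = sat V' E' v' \<phi>" if "good_graph \<I> V E" "good_graph \<I> V' E'" for V E V' E' v v'
    by (rule invariant_atD[OF I(2) that _ eqv_empty]) (use assms in \<open>auto simp: sentence_def\<close>)
  have m: "models V E \<phi> = sat V E v \<phi>" if g: "good_graph \<I> V E" "V \<noteq> {}" for V E v
  proof -
    obtain a where "a \<in> V" using g(2) by blast
    then have "range (\<lambda>_. a) \<subseteq> V" by auto
    then show ?thesis unfolding models_def using same[OF g(1) g(1)] by blast
  qed
  show ?thesis
  proof (rule that[OF I(1)])
    fix V E assume "good_graph \<I> V E" "V \<noteq> {}"
    \<comment> \<open>The common truth value must be fixed before any graph is given; it is read off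
      from an arbitrary good graph.\<close>
    then show "models V E \<phi> = (\<exists>V E v. good_graph \<I> V E \<and> sat V E v \<phi>)"
      using m same by blast
  qed
qed

end

section \<open>Summing over dense graphs\<close>

definition dst :: "nat \<Rightarrow> nat \<Rightarrow> real" where
  "dst u v = \<bar>real u - real v\<bar>"

lemma dst_commute: "dst u v = dst v u" by (simp add: dst_def)

lemma dst_ge_1: "u \<noteq> v \<Longrightarrow> 1 \<le> dst u v" by (auto simp: dst_def)

lemma dst_less: "a < b \<Longrightarrow> dst a b = real (b - a)" by (simp add: dst_def)

definition pairs :: "nat set \<Rightarrow> (nat \<times> nat) set" where
  "pairs S = {(a, b). a \<in> S \<and> b \<in> S \<and> a < b}"

definition adj_of :: "(nat \<times> nat) set \<Rightarrow> nat \<Rightarrow> nat \<Rightarrow> bool" where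
  "adj_of D a b \<longleftrightarrow> (a, b) \<in> D \<or> (b, a) \<in> D"

lemma finite_pairs [simp]: "finite S \<Longrightarrow> finite (pairs S)"
  by (rule finite_subset[of _ "S \<times> S"]) (auto simp: pairs_def)

text \<open>The multigraph that \<open>T\<close> induces on the colour classes is connected.\<close>

definition spans :: "(nat \<times> nat) set \<Rightarrow> (nat \<Rightarrow> nat) \<Rightarrow> nat set \<Rightarrow> bool" where
  "spans T c V \<longleftrightarrow> (\<forall>Y. Y \<subseteq> V \<longrightarrow> Y \<noteq> {} \<longrightarrow> (\<forall>v\<in>Y. c v \<noteq> 0) \<longrightarrow> (\<forall>u\<in>Y. \<forall>v\<in>V. c v = c u \<longrightarrow> v \<in> Y) \<longrightarrow>
     (\<exists>u v. (u, v) \<in> T \<and> ((u \<in> Y) \<noteq> (v \<in> Y))))"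

context exponent
begin

text \<open>Kruskal's algorithm: the crossing edges of the partition reached when all gaps below \<open>s\<close> have been
  closed are at least \<open>s\<close> long, and their number is controlled by the density of the extension.\<close>

lemma kruskal:
  fixes \<theta> s :: real
  assumes dense: "dense_ext \<theta> (adj_of D) F V" and D: "D \<subseteq> pairs V" and \<theta>: "0 \<le> \<theta>"
    and c: "\<forall>v\<in>F. c v = 0" and s: "\<And>u v. u \<in> V \<Longrightarrow> v \<in> V \<Longrightarrow> c u \<noteq> c v \<Longrightarrow> s \<le> ln (dst u v)"
  shows "\<exists>T. T \<subseteq> {(u, v). u \<in> V \<and> v \<in> V \<and> c u \<noteq> c v} \<and> card T = blocks c V \<and> spans T c V \<and>
     (1 + \<theta>) * (\<Sum>(u, v)\<in>T. ln (dst u v) - s) \<le> (\<Sum>(u, v)\<in>crossing (adj_of D) c V. \<alpha> * ln (dst u v) - \<alpha> * s)"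
  using c s
proof (induction "blocks c V" arbitrary: c s)
  case 0
  have fin: "finite V" using dense by (simp add: dense_ext_def)
  then have z: "\<forall>v\<in>V. c v = 0" using 0(1) blocks_eq_0_iff[of V c] by simp
  then have "crossing (adj_of D) c V = {}" by (auto simp: crossing_def)
  moreover have "spans {} c V" using z unfolding spans_def by (metis ex_in_conv subsetD)
  ultimately show ?case using 0(1) by (intro exI[of _ "{}"]) simp
next
  case (Suc n)
  have fin: "finite V" using dense by (simp add: dense_ext_def)
  let ?N = "crossing (adj_of D) c V"
  have den: "(1 + \<theta>) * real (blocks c V) \<le> \<alpha> * real (card ?N)"
    using dense Suc.prems(1) by (simp add: dense_ext_def)
  have "0 < (1 + \<theta>) * real (blocks c V)" using Suc(2) \<theta> by (intro mult_pos_pos) auto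
  then have "\<alpha> * real (card ?N) \<noteq> 0" using den by linarith
  then have "?N \<noteq> {}" by auto
  then obtain u0 v0 where uv0: "u0 \<in> V" "v0 \<in> V" "c u0 \<noteq> c v0" by (auto simp: crossing_def)
  let ?P = "{(u, v). u \<in> V \<and> v \<in> V \<and> c u \<noteq> c v}"
  have finP: "finite ?P" by (rule finite_subset[of _ "V \<times> V"]) (use fin in auto)
  have "?P \<noteq> {}" using uv0 by auto
  then obtain e where e: "e \<in> ?P" "\<And>e'. e' \<in> ?P \<Longrightarrow> ln (dst (fst e) (snd e)) \<le> ln (dst (fst e') (snd e'))"
    using ex_min_if_finite[of "(\<lambda>e. ln (dst (fst e) (snd e))) ` ?P"] finP
    by (metis (no_types, lifting) arg_min_if_finite(1) arg_min_least)
  \<comment> \<open>A closest pair with different colours, ordered such that \<open>v\<close> is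
    outside the root class. Its class is merged into that of \<open>u\<close>, so the root keeps
    colour 0.\<close>
  obtain u v where uv: "u \<in> V" "v \<in> V" "c u \<noteq> c v" "c v \<noteq> 0" 
    and min: "\<And>x y. x \<in> V \<Longrightarrow> y \<in> V \<Longrightarrow> c x \<noteq> c y \<Longrightarrow> ln (dst u v) \<le> ln (dst x y)"
  proof (cases "c (snd e) = 0")
    case True
    show ?thesis
      by (rule that[of "snd e" "fst e"]) (use e True dst_commute in \<open>auto simp: case_prod_beta\<close>)
  next
    case False
    show ?thesis
      by (rule that[of "fst e" "snd e"]) (use e False in \<open>auto simp: case_prod_beta\<close>)
  qed
  define s' where "s' = ln (dst u v)"
  have ss': "s \<le> s'" unfolding s'_def by (rule Suc.prems(2)) (use uv in auto)
  define c' where "c' = (\<lambda>w. if c w = c v then c u else c w)"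
  have img: "c' ` V = c ` V - {c v}"
  proof (intro set_eqI iffI)
    fix w assume "w \<in> c ` V - {c v}"
    then obtain x where "x \<in> V" "w = c x" "c x \<noteq> c v" by auto
    then have "w = c' x" by (simp add: c'_def)
    then show "w \<in> c' ` V" using \<open>x \<in> V\<close> by blast
  qed (use uv in \<open>auto simp: c'_def\<close>)
  have bl: "n = blocks c' V"
  proof -
    have "c' ` V - {0} = (c ` V - {0}) - {c v}" using img by auto
    then have "blocks c' V = blocks c V - 1" using uv fin by (simp add: blocks_def)
    then show ?thesis using Suc(2) by simp
  qed
  have c'F: "\<forall>w\<in>F. c' w = 0" using Suc.prems(1) uv by (auto simp: c'_def)
  have c'c: "c x \<noteq> c y" if "c' x \<noteq> c' y" for x y using that by (auto simp: c'_def split: if_splits)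
  have "s' \<le> ln (dst x y)" if "x \<in> V" "y \<in> V" "c' x \<noteq> c' y" for x y
    unfolding s'_def using min that c'c by blast
  from Suc.hyps(1)[OF bl c'F this] obtain T' where T': "T' \<subseteq> {(u, v). u \<in> V \<and> v \<in> V \<and> c' u \<noteq> c' v}"
    "card T' = blocks c' V" "spans T' c' V"
    "(1 + \<theta>) * (\<Sum>(u, v)\<in>T'. ln (dst u v) - s') \<le> (\<Sum>(u, v)\<in>crossing (adj_of D) c' V. \<alpha> * ln (dst u v) - \<alpha> * s')"
    by blast
  have finT': "finite T'" by (rule finite_subset[OF T'(1)], rule finite_subset[of _ "V \<times> V"]) (use fin in auto)
  have new: "(u, v) \<notin> T'" using T'(1) uv by (auto simp: c'_def)
  define T where "T = insert (u, v) T'"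
  show ?case
  proof (intro exI conjI)
    show "T \<subseteq> {(u, v). u \<in> V \<and> v \<in> V \<and> c u \<noteq> c v}"
      using T'(1) uv c'c by (auto simp: T_def)
    show cardT: "card T = blocks c V" using T'(2) bl Suc(2) finT' new by (simp add: T_def)
    show "spans T c V"
      unfolding spans_def
    proof (intro allI impI)
      fix Y assume Y: "Y \<subseteq> V" "Y \<noteq> {}" "\<forall>v\<in>Y. c v \<noteq> 0" "\<forall>u\<in>Y. \<forall>v\<in>V. c v = c u \<longrightarrow> v \<in> Y"
      show "\<exists>u v. (u, v) \<in> T \<and> ((u \<in> Y) \<noteq> (v \<in> Y))"
      proof (cases "(u \<in> Y) = (v \<in> Y)")
        case False
        then show ?thesis by (intro exI[of _ u] exI[of _ v]) (simp add: T_def)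
      next
        case True
        have closed: "w \<in> Y" if "x \<in> Y" "w \<in> V" "c w = c x" for x w using Y(4) that by blast
        have 1: "\<forall>x\<in>Y. c' x \<noteq> 0"
        proof
          fix x assume x: "x \<in> Y"
          show "c' x \<noteq> 0"
          proof (cases "c x = c v")
            case eq: True
            then have "v \<in> Y" using closed[OF x uv(2)] by simp
            then have "u \<in> Y" using True by simp
            then show ?thesis using Y(3) eq by (simp add: c'_def)
          qed (use Y(3) x in \<open>simp add: c'_def\<close>)
        qed
        have 2: "\<forall>x\<in>Y. \<forall>w\<in>V. c' w = c' x \<longrightarrow> w \<in> Y"
        proof (intro ballI impI)
          fix x w assume x: "x \<in> Y" and w: "w \<in> V" and eq: "c' w = c' x"
          show "w \<in> Y"
          proof (cases "c x = c w")
            case True then show ?thesis using closed[OF x w] by simp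
          next
            case False
            then have "c x = c v \<and> c w = c u \<or> c x = c u \<and> c w = c v"
              using eq by (auto simp: c'_def split: if_splits)
            then show ?thesis
            proof
              assume a: "c x = c v \<and> c w = c u"
              then have "v \<in> Y" using closed[OF x uv(2)] by simp
              then show ?thesis using True closed[of u w] w a by simp
            next
              assume a: "c x = c u \<and> c w = c v"
              then have "u \<in> Y" using closed[OF x uv(1)] by simp
              then show ?thesis using True closed[of v w] w a by simp
            qed
          qed
        qed
        obtain a b where "(a, b) \<in> T'" "(a \<in> Y) \<noteq> (b \<in> Y)"
          using T'(3)[unfolded spans_def, rule_format, OF Y(1,2)] 1 2 by blast
        then show ?thesis by (intro exI[of _ a] exI[of _ b]) (simp add: T_def)
      qed
    qed
    let ?N' = "crossing (adj_of D) c' V"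
    have NN: "?N' \<subseteq> ?N" using c'c by (auto simp: crossing_def)
    \<comment> \<open>Raising the threshold from \<open>s\<close> to \<open>s'\<close> takes (1 +
      \<theta>) (s' - s) per block from the left-hand side and \<alpha> (s' - s) per crossing edge
      from the right-hand side; density compares the two. Edges that stop crossing have nonnegative
      terms, as all crossing pairs are at least as long as the closest one.\<close>
    have "(\<Sum>(u, v)\<in>?N'. \<alpha> * ln (dst u v) - \<alpha> * s') \<le> (\<Sum>(u, v)\<in>?N. \<alpha> * ln (dst u v) - \<alpha> * s')"
    proof (rule sum_mono2[OF finite_crossing[OF fin] NN])
      fix e assume "e \<in> ?N - ?N'"
      then obtain x y where "e = (x, y)" "x \<in> V" "y \<in> V" "c x \<noteq> c y" by (auto simp: crossing_def)
      then show "0 \<le> (case e of (u, v) \<Rightarrow> \<alpha> * ln (dst u v) - \<alpha> * s')"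
        using min[of x y] \<alpha>_pos by (simp add: s'_def)
    qed
    moreover have "(\<Sum>(u, v)\<in>?N. \<alpha> * ln (dst u v) - \<alpha> * s) =
        (\<Sum>(u, v)\<in>?N. \<alpha> * ln (dst u v) - \<alpha> * s') + (\<alpha> * real (card ?N)) * (s' - s)"
      by (simp add: case_prod_beta sum_subtractf algebra_simps)
    moreover have "(1 + \<theta>) * real (blocks c V) * (s' - s) \<le> (\<alpha> * real (card ?N)) * (s' - s)"
      using den ss' by (intro mult_right_mono) auto
    moreover have "(\<Sum>(u, v)\<in>T. ln (dst u v) - s) = (\<Sum>(u, v)\<in>T'. ln (dst u v) - s') + real (blocks c V) * (s' - s)"
    proof -
      have "(\<Sum>(u, v)\<in>T. ln (dst u v) - s) = (s' - s) + (\<Sum>(u, v)\<in>T'. ln (dst u v) - s)"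
        using finT' new by (simp add: T_def s'_def)
      also have "(\<Sum>(u, v)\<in>T'. ln (dst u v) - s) = (\<Sum>(u, v)\<in>T'. ln (dst u v) - s') + real (card T') * (s' - s)"
        by (simp add: case_prod_beta sum_subtractf algebra_simps)
      also have "real (card T') = real (blocks c V) - 1" using T'(2) bl Suc(2) by simp
      finally show ?thesis by (simp add: algebra_simps)
    qed
    ultimately show "(1 + \<theta>) * (\<Sum>(u, v)\<in>T. ln (dst u v) - s) \<le> (\<Sum>(u, v)\<in>?N. \<alpha> * ln (dst u v) - \<alpha> * s)"
      using T'(4) by (simp add: distrib_left mult.assoc)
  qed
qed

end

text \<open>Attaching the vertices of \<open>X\<close> one by one to \<open>F\<close> majorises the sum over all spanning trees.\<close>

primrec tree_sum :: "real \<Rightarrow> nat \<Rightarrow> nat set \<Rightarrow> nat set \<Rightarrow> real" where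
  "tree_sum p 0 F X = 1"
| "tree_sum p (Suc k) F X = (\<Sum>x\<in>X. \<Sum>y\<in>F. dst x y powr (- p) * tree_sum p k (insert x F) (X - {x}))"

lemma tree_sum_nonneg: "0 \<le> tree_sum p k F X"
  by (induction k arbitrary: F X) (auto intro!: sum_nonneg)

text \<open>Some edge of \<open>T\<close> leaves \<open>X\<close>, so it attaches a vertex x of
  \<open>X\<close> to \<open>F\<close>. Move x to \<open>F\<close> and delete this edge: a set
  \<open>Y\<close> that avoids x has neither end of the deleted edge and keeps its own connecting
  edge.\<close>

lemma tree_le_tree_sum:
  assumes "finite F" "finite X" "F \<inter> X = {}" "card X = k" "finite T" "card T = k" "T \<subseteq> (F \<union> X) \<times> (F \<union> X)"
    and "\<And>Y. Y \<subseteq> X \<Longrightarrow> Y \<noteq> {} \<Longrightarrow> \<exists>u v. (u, v) \<in> T \<and> ((u \<in> Y) \<noteq> (v \<in> Y))"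
  shows "(\<Prod>(u, v)\<in>T. dst u v powr (- p)) \<le> tree_sum p k F X"
  using assms
proof (induction k arbitrary: F X T)
  case (Suc k)
  have "X \<noteq> {}" using Suc.prems(4) by auto
  then obtain u v where uv: "(u, v) \<in> T" "(u \<in> X) \<noteq> (v \<in> X)" using Suc.prems(8)[of X] by blast
  have uv': "u \<in> F \<union> X" "v \<in> F \<union> X" using uv Suc.prems(7) by auto
  obtain x y where xy: "x \<in> X" "y \<in> F" "dst u v = dst x y" "{u, v} = {x, y}"
  proof (cases "u \<in> X")
    case True then show ?thesis using that[of u v] uv uv' by auto
  next
    case False then show ?thesis using that[of v u] uv uv' by (auto simp: dst_commute)
  qed
  let ?T = "T - {(u, v)}"
  have IH: "(\<Prod>(u, v)\<in>?T. dst u v powr (- p)) \<le> tree_sum p k (insert x F) (X - {x})"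
  proof (rule Suc.IH)
    show "card (X - {x}) = k" "card ?T = k" using Suc.prems xy uv by auto
    show "?T \<subseteq> (insert x F \<union> (X - {x})) \<times> (insert x F \<union> (X - {x}))" using Suc.prems(7) by blast
    fix Y assume Y: "Y \<subseteq> X - {x}" "Y \<noteq> {}"
    then obtain a b where ab: "(a, b) \<in> T" "(a \<in> Y) \<noteq> (b \<in> Y)" using Suc.prems(8)[of Y] by blast
    have "x \<notin> Y" "y \<notin> Y" using Y xy Suc.prems(3) by auto
    then have "u \<notin> Y" "v \<notin> Y" using xy(4) by (metis insert_iff singletonD)+
    then have "(a, b) \<noteq> (u, v)" using ab by auto
    then show "\<exists>a b. (a, b) \<in> ?T \<and> ((a \<in> Y) \<noteq> (b \<in> Y))" using ab by blast
  qed (use Suc.prems xy in auto)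
  have "(\<Prod>(u, v)\<in>T. dst u v powr (- p)) = dst x y powr (- p) * (\<Prod>(u, v)\<in>?T. dst u v powr (- p))"
    using prod.remove[OF Suc.prems(5) uv(1), of "\<lambda>(u, v). dst u v powr (- p)"] xy(3) by simp
  also have "\<dots> \<le> dst x y powr (- p) * tree_sum p k (insert x F) (X - {x})"
    using IH by (intro mult_left_mono) auto
  also have "\<dots> \<le> (\<Sum>y\<in>F. dst x y powr (- p) * tree_sum p k (insert x F) (X - {x}))"
    using xy Suc.prems(1) by (intro member_le_sum[of y F "\<lambda>y. dst x y powr (- p) * tree_sum p k (insert x F) (X - {x})"])
      (auto intro!: mult_nonneg_nonneg tree_sum_nonneg)
  also have "\<dots> \<le> tree_sum p (Suc k) F X"
    unfolding tree_sum.simps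
    using xy Suc.prems(2) by (intro member_le_sum[of x X "\<lambda>x. \<Sum>y\<in>F. dst x y powr (- p) * tree_sum p k (insert x F) (X - {x})"])
      (auto intro!: sum_nonneg mult_nonneg_nonneg tree_sum_nonneg)
  finally show ?case .
qed simp

text \<open>On the integer line the exponent must exceed 1 for the sum over all positions to
  converge; the margin \<theta> of density provides this.\<close>

lemma dst_sum_bound:
  assumes "1 < p"
  obtains Z where "1 \<le> Z" "\<And>U y. finite U \<Longrightarrow> y \<notin> U \<Longrightarrow> (\<Sum>x\<in>U. dst x y powr (- p)) \<le> Z"
proof -
  have sm: "summable (\<lambda>d. real d powr (- p))" using assms by (simp add: summable_real_powr_iff)
  define Z where "Z = 2 * (\<Sum>d. real d powr (- p)) + 1"
  have Z0: "0 \<le> (\<Sum>d. real d powr (- p))" by (intro suminf_nonneg sm) auto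
  show ?thesis
  proof (rule that[of Z])
    show "1 \<le> Z" using Z0 by (simp add: Z_def)
    fix U y assume U: "finite (U :: nat set)" "(y :: nat) \<notin> U"
    have half: "(\<Sum>x\<in>W. dst x y powr (- p)) \<le> (\<Sum>d. real d powr (- p))"
      if W: "finite W" "inj_on h W" "\<And>x. x \<in> W \<Longrightarrow> dst x y = real (h x)" for W and h :: "nat \<Rightarrow> nat"
    proof -
      have "(\<Sum>x\<in>W. dst x y powr (- p)) = (\<Sum>d\<in>h ` W. real d powr (- p))"
        using W by (simp add: sum.reindex)
      also have "\<dots> \<le> (\<Sum>d. real d powr (- p))"
        using W by (intro sum_le_suminf sm) auto
      finally show ?thesis .
    qed
    have "U = {x\<in>U. x < y} \<union> {x\<in>U. y < x}" using U by (auto simp: not_less_iff_gr_or_eq)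
    then have "(\<Sum>x\<in>U. dst x y powr (- p)) = (\<Sum>x\<in>{x\<in>U. x < y} \<union> {x\<in>U. y < x}. dst x y powr (- p))" by simp
    also have "\<dots> = (\<Sum>x\<in>{x\<in>U. x < y}. dst x y powr (- p)) + (\<Sum>x\<in>{x\<in>U. y < x}. dst x y powr (- p))"
      using U by (intro sum.union_disjoint) auto
    also have "\<dots> \<le> (\<Sum>d. real d powr (- p)) + (\<Sum>d. real d powr (- p))"
    proof (intro add_mono)
      show "(\<Sum>x\<in>{x\<in>U. x < y}. dst x y powr (- p)) \<le> (\<Sum>d. real d powr (- p))"
        by (rule half[of _ "\<lambda>x. y - x"]) (use U in \<open>auto simp: inj_on_def dst_def\<close>)
      show "(\<Sum>x\<in>{x\<in>U. y < x}. dst x y powr (- p)) \<le> (\<Sum>d. real d powr (- p))"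
        by (rule half[of _ "\<lambda>x. x - y"]) (use U in \<open>auto simp: inj_on_def dst_def\<close>)
    qed
    finally show "(\<Sum>x\<in>U. dst x y powr (- p)) \<le> Z" by (simp add: Z_def)
  qed
qed

text \<open>Summing over \<open>X\<close> and its first attached vertex x amounts to summing over x
  and the remaining set. Each attachment then costs at most \<open>Z\<close> per possible neighbour,
  and there are at most \<open>card F + k\<close> neighbours throughout, as this number is unchanged
  when x passes to \<open>F\<close>.\<close>

lemma tree_sum_bound:
  assumes Z: "1 \<le> Z" "\<And>U y. finite U \<Longrightarrow> y \<notin> U \<Longrightarrow> (\<Sum>x\<in>U. dst x y powr (- p)) \<le> Z"
    and U: "finite U" and F: "finite F"
  shows "(\<Sum>X | X \<subseteq> U - F \<and> card X = k. tree_sum p k F X) \<le> (real (card F + k) * Z) ^ k"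
  using F
proof (induction k arbitrary: F)
  case 0
  have "{X. X \<subseteq> U - F \<and> card X = 0} = {{}}" using U by (auto simp: finite_subset)
  then show ?case by simp
next
  case (Suc k)
  let ?A = "\<lambda>F k. {X. X \<subseteq> U - F \<and> card X = k}"
  let ?g = "\<lambda>x X. \<Sum>y\<in>F. dst x y powr (- p) * tree_sum p k (insert x F) X"
  have finA: "finite (?A G j)" for G j by (rule finite_subset[of _ "Pow U"]) (use U in auto)
  have "(\<Sum>X\<in>?A F (Suc k). tree_sum p (Suc k) F X) = (\<Sum>X\<in>?A F (Suc k). \<Sum>x\<in>X. ?g x (X - {x}))"
    by simp
  also have "\<dots> = (\<Sum>(X, x)\<in>Sigma (?A F (Suc k)) (\<lambda>X. X). ?g x (X - {x}))"
    by (rule sum.Sigma) (use finA U in \<open>auto intro: finite_subset\<close>)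
  also have "\<dots> = (\<Sum>(x, X)\<in>Sigma (U - F) (\<lambda>x. ?A (insert x F) k). ?g x X)"
  proof (rule sum.reindex_bij_witness[of _ "\<lambda>(x, X). (insert x X, x)" "\<lambda>(X, x). (x, X - {x})"], goal_cases)
    case (3 a)
    then show ?case using U by (auto simp: card_insert_if finite_subset)
  next
    case (4 a)
    then obtain x X where a: "a = (x, X)" "x \<in> U - F" "X \<subseteq> U - insert x F" "card X = k" by auto
    then have "finite X" "x \<notin> X" using U by (auto intro: finite_subset[of X U])
    then show ?case using a by (auto simp: card_insert_if)
  qed (auto simp: insert_absorb)
  also have "\<dots> = (\<Sum>x\<in>U - F. \<Sum>X\<in>?A (insert x F) k. ?g x X)"
    by (rule sum.Sigma [symmetric]) (use finA U in auto)
  also have "\<dots> = (\<Sum>x\<in>U - F. \<Sum>y\<in>F. dst x y powr (- p) * (\<Sum>X\<in>?A (insert x F) k. tree_sum p k (insert x F) X))"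
    by (rule sum.cong[OF refl], subst sum.swap) (simp add: sum_distrib_left)
  also have "\<dots> \<le> (\<Sum>x\<in>U - F. \<Sum>y\<in>F. dst x y powr (- p) * (real (card F + Suc k) * Z) ^ k)"
  proof (intro sum_mono mult_left_mono)
    fix x assume "x \<in> U - F"
    then have "card (insert x F) = Suc (card F)" using Suc.prems by simp
    then show "(\<Sum>X\<in>?A (insert x F) k. tree_sum p k (insert x F) X) \<le> (real (card F + Suc k) * Z) ^ k"
      using Suc.IH[of "insert x F"] Suc.prems by simp
  qed auto
  also have "\<dots> = (\<Sum>y\<in>F. \<Sum>x\<in>U - F. dst x y powr (- p)) * (real (card F + Suc k) * Z) ^ k"
    by (subst sum.swap) (simp add: sum_distrib_right)
  also have "\<dots> \<le> (\<Sum>y\<in>F. Z) * (real (card F + Suc k) * Z) ^ k"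
    using Z U by (intro mult_right_mono sum_mono Z(2)) auto
  also have "\<dots> \<le> (real (card F + Suc k) * Z) * (real (card F + Suc k) * Z) ^ k"
    using Z by (intro mult_right_mono) auto
  finally show ?case by simp
qed

section \<open>Total weight of dense graphs\<close>

context exponent
begin

text \<open>Edge sets that witness density. The requirement of \<open>g\<close> edges longer than
  \<open>l\<close> buys a factor that decays in \<open>l\<close>.\<close>

definition dense_graphs :: "real \<Rightarrow> nat \<Rightarrow> nat \<Rightarrow> nat set \<Rightarrow> nat set \<Rightarrow> (nat \<times> nat) set set" where
  "dense_graphs \<theta> l g F X = {D. D \<subseteq> pairs (F \<union> X) \<and> dense_ext \<theta> (adj_of D) F (F \<union> X) \<and> g \<le> card {(a, b) \<in> D. l < b - a}}"

text \<open>For the partition into singletons, \<open>kruskal\<close> shows that \<alpha> times the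
  sum of the logarithmic lengths in \<open>D\<close> is at least 1 + \<theta> times the same sum
  over a spanning tree. A fraction \<eta> is reserved for the long edges. As (1 - \<eta>) (1 +
  \<theta>) = 1 + \<theta> / 2, every tree edge still has an exponent above 1.\<close>

lemma dense_graph_weight:
  assumes F: "finite F" "finite X" "F \<inter> X = {}" and \<theta>: "0 < \<theta>" and D: "D \<in> dense_graphs \<theta> l g F X" and l: "1 \<le> l"
  shows "(\<Prod>(a, b)\<in>D. real (b - a) powr (- \<alpha>)) \<le>
     real l powr (- (\<theta> / (2 * (1 + \<theta>)) * \<alpha> * real g)) * tree_sum (1 + \<theta> / 2) (card X) F X"
proof -
  define \<eta> where "\<eta> = \<theta> / (2 * (1 + \<theta>))"
  have \<eta>: "0 < \<eta>" "\<eta> < 1" "(1 - \<eta>) * (1 + \<theta>) = 1 + \<theta> / 2"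
    using \<theta> by (auto simp: \<eta>_def field_simps)
  let ?V = "F \<union> X"
  have D': "D \<subseteq> pairs ?V" "dense_ext \<theta> (adj_of D) F ?V" "g \<le> card {(a, b) \<in> D. l < b - a}"
    using D by (simp_all add: dense_graphs_def)
  have finD: "finite D" using D'(1) F by (rule_tac finite_subset) auto
  \<comment> \<open>The partition into singletons outside the root; \<open>Suc\<close> keeps the
    vertex 0 from receiving the root colour.\<close>
  define c where "c = (\<lambda>v. if v \<in> F then 0 else Suc v)"
  have c0: "\<forall>v\<in>F. c v = 0" by (simp add: c_def)
  have ln0: "0 \<le> ln (dst u v)" if "c u \<noteq> c v" for u v
  proof -
    have "u \<noteq> v" using that by auto
    then show ?thesis using dst_ge_1[of u v] by simp
  qed
  obtain T where T: "T \<subseteq> {(u, v). u \<in> ?V \<and> v \<in> ?V \<and> c u \<noteq> c v}" "card T = blocks c ?V" "spans T c ?V"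
     "(1 + \<theta>) * (\<Sum>(u, v)\<in>T. ln (dst u v) - 0) \<le> (\<Sum>(u, v)\<in>crossing (adj_of D) c ?V. \<alpha> * ln (dst u v) - \<alpha> * 0)"
    using kruskal[OF D'(2,1) less_imp_le[OF \<theta>] c0, of 0] ln0 by blast
  have finT: "finite T" by (rule finite_subset[OF T(1)], rule finite_subset[of _ "?V \<times> ?V"]) (use F in auto)
  have cX: "c ` ?V - {0} = Suc ` X"
    using F(3) by (auto simp: c_def image_iff)
  then have cardT: "card T = card X" using T(2) by (simp add: blocks_def card_image)
  have "(\<Prod>(u, v)\<in>T. dst u v powr (- (1 + \<theta> / 2))) \<le> tree_sum (1 + \<theta> / 2) (card X) F X"
  proof (rule tree_le_tree_sum[OF F refl finT cardT])
    show "T \<subseteq> ?V \<times> ?V" using T(1) by auto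
    fix Y assume Y: "Y \<subseteq> X" "Y \<noteq> {}"
    have "\<forall>v\<in>Y. c v \<noteq> 0" using Y F(3) by (auto simp: c_def)
    moreover have "\<forall>u\<in>Y. \<forall>v\<in>?V. c v = c u \<longrightarrow> v \<in> Y" using Y F(3) by (auto simp: c_def split: if_splits)
    ultimately show "\<exists>u v. (u, v) \<in> T \<and> ((u \<in> Y) \<noteq> (v \<in> Y))"
      using T(3)[unfolded spans_def, rule_format, of Y] Y by blast
  qed
  moreover have "(\<Prod>(a, b)\<in>D. real (b - a) powr (- \<alpha>)) \<le>
      real l powr (- (\<eta> * \<alpha> * real g)) * (\<Prod>(u, v)\<in>T. dst u v powr (- (1 + \<theta> / 2)))"
  proof -
    let ?L = "\<Sum>(a, b)\<in>D. ln (dst a b)"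
    have pos: "0 \<le> ln (dst a b)" if "(a, b) \<in> D" for a b
    proof -
      have "a \<noteq> b" using that D'(1) by (auto simp: pairs_def)
      then show ?thesis using dst_ge_1[of a b] by simp
    qed
    have "crossing (adj_of D) c ?V \<subseteq> D" using D'(1) by (auto simp: crossing_def adj_of_def pairs_def)
    then have "(\<Sum>(u, v)\<in>crossing (adj_of D) c ?V. ln (dst u v)) \<le> ?L"
      using pos by (intro sum_mono2[OF finD]) auto
    then have "\<alpha> * (\<Sum>(u, v)\<in>crossing (adj_of D) c ?V. ln (dst u v)) \<le> \<alpha> * ?L"
      using \<alpha>_pos by (intro mult_left_mono) auto
    then have 1: "(1 + \<theta>) * (\<Sum>(u, v)\<in>T. ln (dst u v)) \<le> \<alpha> * ?L"
      using T(4) by (simp add: sum_distrib_left case_prod_beta)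
    have 2: "real g * ln (real l) \<le> ?L"
    proof -
      let ?G = "{(a, b) \<in> D. l < b - a}"
      have "real g * ln (real l) \<le> real (card ?G) * ln (real l)"
        using D'(3) l by (intro mult_right_mono) auto
      also have "\<dots> = (\<Sum>e\<in>?G. ln (real l))" by simp
      also have "\<dots> \<le> (\<Sum>e\<in>?G. case e of (a, b) \<Rightarrow> ln (dst a b))"
      proof (rule sum_mono)
        fix e assume "e \<in> ?G"
        then obtain a b where e: "e = (a, b)" "(a, b) \<in> D" "l < b - a" by auto
        then have "dst a b = real (b - a)" by (intro dst_less) auto
        then show "ln (real l) \<le> (case e of (a, b) \<Rightarrow> ln (dst a b))" using e l by simp
      qed
      also have "\<dots> \<le> ?L" using pos by (intro sum_mono2[OF finD]) auto
      finally show ?thesis .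
    qed
    have "(1 - \<eta>) * ((1 + \<theta>) * (\<Sum>(u, v)\<in>T. ln (dst u v))) \<le> (1 - \<eta>) * (\<alpha> * ?L)"
      using 1 \<eta> by (intro mult_left_mono) auto
    moreover have "\<eta> * \<alpha> * (real g * ln (real l)) \<le> \<eta> * \<alpha> * ?L" using 2 \<eta> \<alpha>_pos by (intro mult_left_mono) auto
    moreover have "(1 - \<eta>) * ((1 + \<theta>) * (\<Sum>(u, v)\<in>T. ln (dst u v))) = (1 + \<theta> / 2) * (\<Sum>(u, v)\<in>T. ln (dst u v))"
      using \<eta>(3) by (metis mult.assoc)
    ultimately have main: "(1 + \<theta> / 2) * (\<Sum>(u, v)\<in>T. ln (dst u v)) + \<eta> * \<alpha> * real g * ln (real l) \<le> \<alpha> * ?L"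
      by (simp add: algebra_simps)
    have expo: "(\<Prod>(a, b)\<in>S. dst a b powr (- q)) = exp (- q * (\<Sum>(a, b)\<in>S. ln (dst a b)))"
      if S: "finite S" "\<And>a b. (a, b) \<in> S \<Longrightarrow> a \<noteq> b" for S and q :: real
    proof -
      have "(\<Prod>(a, b)\<in>S. dst a b powr (- q)) = (\<Prod>e\<in>S. exp (- q * (case e of (a, b) \<Rightarrow> ln (dst a b))))"
      proof (rule prod.cong[OF refl])
        fix e assume "e \<in> S"
        then obtain a b where e: "e = (a, b)" "a \<noteq> b" using S(2) by (cases e) auto
        then have "dst a b \<noteq> 0" using dst_ge_1[of a b] by auto
        then show "(case e of (a, b) \<Rightarrow> dst a b powr (- q)) = exp (- q * (case e of (a, b) \<Rightarrow> ln (dst a b)))"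
          using e by (simp add: powr_def)
      qed
      also have "\<dots> = exp (\<Sum>e\<in>S. - q * (case e of (a, b) \<Rightarrow> ln (dst a b)))" using S(1) by (simp add: exp_sum)
      finally show ?thesis by (simp add: sum_distrib_left)
    qed
    have "(\<Prod>(a, b)\<in>D. real (b - a) powr (- \<alpha>)) = (\<Prod>(a, b)\<in>D. dst a b powr (- \<alpha>))"
      using D'(1) by (intro prod.cong) (auto simp: pairs_def dst_less)
    also have "\<dots> = exp (- \<alpha> * ?L)"
      by (rule expo[OF finD]) (use D'(1) in \<open>auto simp: pairs_def\<close>)
    also have "\<dots> \<le> exp (- (\<eta> * \<alpha> * real g) * ln (real l) + - (1 + \<theta> / 2) * (\<Sum>(u, v)\<in>T. ln (dst u v)))"
      using main by (simp add: algebra_simps)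
    also have "\<dots> = real l powr (- (\<eta> * \<alpha> * real g)) * (\<Prod>(u, v)\<in>T. dst u v powr (- (1 + \<theta> / 2)))"
    proof -
      have "(\<Prod>(u, v)\<in>T. dst u v powr (- (1 + \<theta> / 2))) = exp (- (1 + \<theta> / 2) * (\<Sum>(u, v)\<in>T. ln (dst u v)))"
        by (rule expo[OF finT]) (use T(1) in auto)
      moreover have "real l powr (- (\<eta> * \<alpha> * real g)) = exp (- (\<eta> * \<alpha> * real g) * ln (real l))"
        using l by (simp add: powr_def)
      ultimately show ?thesis by (simp only: exp_add)
    qed
    finally show ?thesis .
  qed
  ultimately show ?thesis unfolding \<eta>_def
    by (meson mult_left_mono order_trans powr_ge_zero)
qed

text \<open>The bound is independent of n, as the sums over positions converge. The power of 2 in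
  the constant counts the edge sets on at most f + k vertices.\<close>

theorem dense_graphs_sum:
  assumes \<theta>: "0 < \<theta>"
  obtains C where "0 < C" "\<And>n F l g. F \<subseteq> {1..n} \<Longrightarrow> card F \<le> f \<Longrightarrow> 1 \<le> l \<Longrightarrow>
    (\<Sum>X | X \<subseteq> {1..n} - F \<and> card X \<le> k. \<Sum>D\<in>dense_graphs \<theta> l g F X. \<Prod>(a, b)\<in>D. real (b - a) powr (- \<alpha>))
      \<le> C * real l powr (- (\<theta> / (2 * (1 + \<theta>)) * \<alpha> * real g))"
proof -
  obtain Z where Z: "1 \<le> Z" "\<And>U y. finite U \<Longrightarrow> y \<notin> U \<Longrightarrow> (\<Sum>x\<in>U. dst x y powr (- (1 + \<theta> / 2))) \<le> Z"
    by (rule dst_sum_bound[of "1 + \<theta> / 2"]) (use \<theta> in auto)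
  define C where "C = 2 ^ ((f + k) * (f + k)) * ((\<Sum>j\<le>k. (real (f + j) * Z) ^ j) + 1)"
  have S0: "0 \<le> (\<Sum>j\<le>k. (real (f + j) * Z) ^ j)" using Z by (intro sum_nonneg zero_le_power) auto
  show ?thesis
  proof (rule that[of C])
    show "0 < C" unfolding C_def using S0 by (intro mult_pos_pos) auto
    fix n l g :: nat and F :: "nat set"
    assume F: "F \<subseteq> {1..n}" "card F \<le> f" and l: "1 \<le> l"
    let ?r = "real l powr (- (\<theta> / (2 * (1 + \<theta>)) * \<alpha> * real g))"
    let ?U = "{1..n}"
    let ?XS = "\<lambda>j. {X. X \<subseteq> ?U - F \<and> card X = j}"
    have finF: "finite F" using F(1) by (rule finite_subset) auto
    have finXS: "finite (?XS j)" for j by (rule finite_subset[of _ "Pow ?U"]) auto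
    have card_dg: "real (card (dense_graphs \<theta> l g F X)) \<le> 2 ^ ((f + k) * (f + k))"
      if X: "finite X" "card X \<le> k" for X
    proof -
      have "dense_graphs \<theta> l g F X \<subseteq> Pow (pairs (F \<union> X))" by (auto simp: dense_graphs_def)
      then have "card (dense_graphs \<theta> l g F X) \<le> card (Pow (pairs (F \<union> X)))"
        using finF X by (intro card_mono) auto
      also have "\<dots> = 2 ^ card (pairs (F \<union> X))" using finF X by (simp add: card_Pow)
      also have "\<dots> \<le> 2 ^ ((f + k) * (f + k))"
      proof (rule power_increasing)
        have "card (pairs (F \<union> X)) \<le> card ((F \<union> X) \<times> (F \<union> X))"
          using finF X by (intro card_mono) (auto simp: pairs_def)
        also have "\<dots> = card (F \<union> X) * card (F \<union> X)" by (simp add: card_cartesian_product)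
        also have "\<dots> \<le> (f + k) * (f + k)"
          using card_Un_le[of F X] F(2) X(2) by (intro mult_mono) auto
        finally show "card (pairs (F \<union> X)) \<le> (f + k) * (f + k)" .
      qed auto
      finally show ?thesis by (metis of_nat_le_iff of_nat_numeral of_nat_power)
    qed
    have "(\<Sum>X | X \<subseteq> ?U - F \<and> card X \<le> k. \<Sum>D\<in>dense_graphs \<theta> l g F X. \<Prod>(a, b)\<in>D. real (b - a) powr (- \<alpha>))
        \<le> (\<Sum>X | X \<subseteq> ?U - F \<and> card X \<le> k. 2 ^ ((f + k) * (f + k)) * (?r * tree_sum (1 + \<theta> / 2) (card X) F X))"
    proof (rule sum_mono)
      fix X assume "X \<in> {X. X \<subseteq> ?U - F \<and> card X \<le> k}"
      then have X: "X \<subseteq> ?U - F" "card X \<le> k" by auto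
      have finX: "finite X" using X(1) by (rule finite_subset) auto
      have "(\<Sum>D\<in>dense_graphs \<theta> l g F X. \<Prod>(a, b)\<in>D. real (b - a) powr (- \<alpha>))
          \<le> (\<Sum>D\<in>dense_graphs \<theta> l g F X. ?r * tree_sum (1 + \<theta> / 2) (card X) F X)"
        by (intro sum_mono dense_graph_weight finF finX \<theta> l) (use X in auto)
      also have "\<dots> = real (card (dense_graphs \<theta> l g F X)) * (?r * tree_sum (1 + \<theta> / 2) (card X) F X)" by simp
      also have "\<dots> \<le> 2 ^ ((f + k) * (f + k)) * (?r * tree_sum (1 + \<theta> / 2) (card X) F X)"
        by (intro mult_right_mono card_dg finX X(2) mult_nonneg_nonneg tree_sum_nonneg) auto
      finally show "(\<Sum>D\<in>dense_graphs \<theta> l g F X. \<Prod>(a, b)\<in>D. real (b - a) powr (- \<alpha>))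
          \<le> 2 ^ ((f + k) * (f + k)) * (?r * tree_sum (1 + \<theta> / 2) (card X) F X)" .
    qed
    also have "\<dots> = 2 ^ ((f + k) * (f + k)) * ?r * (\<Sum>X | X \<subseteq> ?U - F \<and> card X \<le> k. tree_sum (1 + \<theta> / 2) (card X) F X)"
      by (simp add: sum_distrib_left mult.assoc)
    also have "(\<Sum>X | X \<subseteq> ?U - F \<and> card X \<le> k. tree_sum (1 + \<theta> / 2) (card X) F X) =
        (\<Sum>X\<in>(\<Union>j\<in>{..k}. ?XS j). tree_sum (1 + \<theta> / 2) (card X) F X)"
      by (rule sum.cong) auto
    also have "\<dots> = (\<Sum>j\<le>k. \<Sum>X\<in>?XS j. tree_sum (1 + \<theta> / 2) (card X) F X)"
      by (rule sum.UNION_disjoint) (use finXS in auto)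
    also have "\<dots> = (\<Sum>j\<le>k. \<Sum>X\<in>?XS j. tree_sum (1 + \<theta> / 2) j F X)" by (intro sum.cong refl) auto
    also have "\<dots> \<le> (\<Sum>j\<le>k. (real (f + j) * Z) ^ j)"
    proof (rule sum_mono)
      fix j
      have "(\<Sum>X\<in>?XS j. tree_sum (1 + \<theta> / 2) j F X) \<le> (real (card F + j) * Z) ^ j"
        by (rule tree_sum_bound[OF Z _ finF]) auto
      also have "\<dots> \<le> (real (f + j) * Z) ^ j" using Z F(2) by (intro power_mono mult_right_mono) auto
      finally show "(\<Sum>X\<in>?XS j. tree_sum (1 + \<theta> / 2) j F X) \<le> (real (f + j) * Z) ^ j" .
    qed
    also have "2 ^ ((f + k) * (f + k)) * ?r * (\<Sum>j\<le>k. (real (f + j) * Z) ^ j) \<le> C * ?r"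
    proof -
      have "2 ^ ((f + k) * (f + k)) * (\<Sum>j\<le>k. (real (f + j) * Z) ^ j) \<le> C"
        unfolding C_def by (intro mult_left_mono) auto
      then have "2 ^ ((f + k) * (f + k)) * (\<Sum>j\<le>k. (real (f + j) * Z) ^ j) * ?r \<le> C * ?r"
        by (intro mult_right_mono) auto
      then show ?thesis by (simp add: mult_ac)
    qed
    finally show "(\<Sum>X | X \<subseteq> ?U - F \<and> card X \<le> k. \<Sum>D\<in>dense_graphs \<theta> l g F X. \<Prod>(a, b)\<in>D. real (b - a) powr (- \<alpha>)) \<le> C * ?r"
      by (simp add: mult_left_mono)
  qed
qed

end

section \<open>The random graph\<close>

definition depends_on :: "'a set \<Rightarrow> ('a \<Rightarrow> bool) set \<Rightarrow> bool" where
  "depends_on A S \<longleftrightarrow> (\<forall>\<omega> \<omega>'. (\<forall>e\<in>A. \<omega> e = \<omega>' e) \<longrightarrow> (\<omega> \<in> S \<longleftrightarrow> \<omega>' \<in> S))"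

lemma depends_onD: "depends_on A S \<Longrightarrow> (\<And>e. e \<in> A \<Longrightarrow> \<omega> e = \<omega>' e) \<Longrightarrow> \<omega> \<in> S \<longleftrightarrow> \<omega>' \<in> S"
  unfolding depends_on_def by blast

lemma depends_on_mono: "depends_on A S \<Longrightarrow> A \<subseteq> B \<Longrightarrow> depends_on B S"
  unfolding depends_on_def by blast

lemma depends_on_Int: "depends_on A S \<Longrightarrow> depends_on B T \<Longrightarrow> depends_on (A \<union> B) (S \<inter> T)"
  unfolding depends_on_def by blast

lemma depends_on_INT:
  fixes S :: "'i \<Rightarrow> ('a \<Rightarrow> bool) set"
  assumes "\<And>j. j \<in> J \<Longrightarrow> depends_on (A j) (S j)"
  shows "depends_on (\<Union>j\<in>J. A j) (\<Inter>j\<in>J. S j)"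
  unfolding depends_on_def
proof (intro allI impI)
  fix \<omega> \<omega>' :: "'a \<Rightarrow> bool" assume *: "\<forall>e\<in>(\<Union>j\<in>J. A j). \<omega> e = \<omega>' e"
  have "\<omega> \<in> S j \<longleftrightarrow> \<omega>' \<in> S j" if "j \<in> J" for j
    using depends_onD[OF assms[OF that], of \<omega> \<omega>'] * that by simp
  then show "\<omega> \<in> (\<Inter>j\<in>J. S j) \<longleftrightarrow> \<omega>' \<in> (\<Inter>j\<in>J. S j)" by simp
qed

lemma depends_on_exact: "depends_on D {\<omega>. \<forall>e\<in>D. \<omega> e = b e}"
  by (auto simp: depends_on_def)

lemma depends_on_present: "depends_on D {\<omega>. \<forall>e\<in>D. \<omega> e}"
  by (auto simp: depends_on_def)

text \<open>The index set is split along \<open>A\<close>, which turns the product into a pair of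
  independent parts. On the support all coordinates outside the index set are False, so the first
  part decides \<open>S\<close> even if \<open>A\<close> sticks out of \<open>I\<close>; the second
  part decides \<open>T\<close> because \<open>B\<close> avoids \<open>A\<close>.\<close>

lemma Pi_pmf_indep:
  assumes fin: "finite I" and dep: "depends_on A S" "depends_on B T" "A \<inter> B = {}"
  shows "measure_pmf.prob (Pi_pmf I False p) (S \<inter> T) = measure_pmf.prob (Pi_pmf I False p) S * measure_pmf.prob (Pi_pmf I False p) T"
proof -
  define I1 where "I1 = I \<inter> A"
  define I2 where "I2 = I - A"
  let ?P1 = "Pi_pmf I1 False p" and ?P2 = "Pi_pmf I2 False p"
  let ?h = "\<lambda>(f, g) x. if x \<in> I1 then f x else g x"
  have I: "finite I1" "finite I2" "I1 \<inter> I2 = {}" "I = I1 \<union> I2" using fin by (auto simp: I1_def I2_def)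
  have P: "Pi_pmf I False p = map_pmf ?h (pair_pmf ?P1 ?P2)" unfolding I(4) by (rule Pi_pmf_union[OF I(1-3)])
  have supp: "f x = False" if "f \<in> set_pmf (Pi_pmf J False p)" "x \<notin> J" "finite J" for f J x
    using that set_Pi_pmf_subset[OF that(3), of False p] by auto
  have finsup: "countable (set_pmf ?P1 \<inter> X)" "countable (set_pmf ?P2 \<inter> Y)" for X Y
    by (auto intro: countable_subset[OF Int_lower1])
  have main: "measure_pmf.prob (Pi_pmf I False p) (S' \<inter> T') = measure_pmf.prob ?P1 S' * measure_pmf.prob ?P2 T'"
    if d: "depends_on A S'" "depends_on B T'" for S' T'
  proof -
    have "measure_pmf.prob (Pi_pmf I False p) (S' \<inter> T') = measure_pmf.prob (pair_pmf ?P1 ?P2) (?h -` (S' \<inter> T'))"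
      unfolding P by simp
    also have "\<dots> = measure_pmf.prob (pair_pmf ?P1 ?P2) ((set_pmf ?P1 \<inter> S') \<times> (set_pmf ?P2 \<inter> T'))"
    proof (rule measure_prob_cong_0)
      fix x assume x: "x \<in> ?h -` (S' \<inter> T') - (set_pmf ?P1 \<inter> S') \<times> (set_pmf ?P2 \<inter> T')"
      obtain f g where fg: "x = (f, g)" by (cases x)
      show "pmf (pair_pmf ?P1 ?P2) x = 0"
      proof (rule ccontr)
        assume "pmf (pair_pmf ?P1 ?P2) x \<noteq> 0"
        then have s: "f \<in> set_pmf ?P1" "g \<in> set_pmf ?P2" using fg by (auto simp: pmf_pair set_pmf_iff)
        have "?h (f, g) \<in> S' \<longleftrightarrow> f \<in> S'"
          by (rule depends_onD[OF d(1)]) (use supp[OF s(1) _ I(1)] supp[OF s(2) _ I(2)] in \<open>auto simp: I1_def I2_def\<close>)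
        moreover have "?h (f, g) \<in> T' \<longleftrightarrow> g \<in> T'"
          by (rule depends_onD[OF d(2)]) (use dep(3) in \<open>auto simp: I1_def\<close>)
        ultimately show False using x fg s by auto
      qed
    next
      fix x assume x: "x \<in> (set_pmf ?P1 \<inter> S') \<times> (set_pmf ?P2 \<inter> T') - ?h -` (S' \<inter> T')"
      obtain f g where fg: "x = (f, g)" by (cases x)
      have s: "f \<in> set_pmf ?P1" "g \<in> set_pmf ?P2" using x fg by auto
      have "?h (f, g) \<in> S' \<longleftrightarrow> f \<in> S'"
        by (rule depends_onD[OF d(1)]) (use supp[OF s(1) _ I(1)] supp[OF s(2) _ I(2)] in \<open>auto simp: I1_def I2_def\<close>)
      moreover have "?h (f, g) \<in> T' \<longleftrightarrow> g \<in> T'"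
        by (rule depends_onD[OF d(2)]) (use dep(3) in \<open>auto simp: I1_def\<close>)
      ultimately show "pmf (pair_pmf ?P1 ?P2) x = 0" using x fg by auto
    qed
    also have "\<dots> = measure_pmf.prob ?P1 (set_pmf ?P1 \<inter> S') * measure_pmf.prob ?P2 (set_pmf ?P2 \<inter> T')"
      by (rule measure_pmf_prob_product[OF finsup])
    also have "\<dots> = measure_pmf.prob ?P1 S' * measure_pmf.prob ?P2 T'"
      using measure_Int_set_pmf[of ?P1 S'] measure_Int_set_pmf[of ?P2 T'] by (simp add: Int_commute)
    finally show ?thesis .
  qed
  have U: "depends_on A UNIV" "depends_on B UNIV" by (auto simp: depends_on_def)
  show ?thesis
    using main[OF dep(1,2)] main[OF dep(1) U(2)] main[OF U(1) dep(2)] by simp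
qed

text \<open>Chebyshev's inequality at distance \<mu> / 2 from the mean, which is where the factor 4
  comes from; the variance is at most \<eta> \<mu>^2.\<close>

lemma pmf_second_moment:
  assumes Z: "finite Z" and \<mu>: "\<mu> = (\<Sum>z\<in>Z. measure_pmf.prob M (I z))" "0 < \<mu>"
    and sq: "(\<Sum>z\<in>Z. \<Sum>z'\<in>Z. measure_pmf.prob M (I z \<inter> I z')) \<le> (1 + \<eta>) * \<mu>\<^sup>2"
  shows "measure_pmf.prob M {\<omega>. real (card {z\<in>Z. \<omega> \<in> I z}) \<le> \<mu> / 2} \<le> 4 * \<eta>"
proof -
  define N :: "'b \<Rightarrow> real" where "N = (\<lambda>\<omega>. \<Sum>z\<in>Z. indicator (I z) \<omega>)"
  have N_card: "N \<omega> = real (card {z\<in>Z. \<omega> \<in> I z})" for \<omega>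
    using Z by (simp add: N_def indicator_def sum.If_cases Int_def)
  have int: "integrable (measure_pmf M) (\<lambda>\<omega>. indicator S \<omega> :: real)" for S
    by (rule measure_pmf.integrable_const_bound[of _ 1]) (auto simp: indicator_def)
  have N2: "(N \<omega>)\<^sup>2 = (\<Sum>z\<in>Z. \<Sum>z'\<in>Z. indicator (I z \<inter> I z') \<omega>)" for \<omega>
    by (simp add: N_def power2_eq_square sum_product indicator_inter_arith)
  have intN: "integrable (measure_pmf M) N" unfolding N_def by (intro Bochner_Integration.integrable_sum int)
  have intN2: "integrable (measure_pmf M) (\<lambda>\<omega>. (N \<omega>)\<^sup>2)" unfolding N2 by (intro Bochner_Integration.integrable_sum int)
  have E: "measure_pmf.expectation M N = \<mu>"
    unfolding N_def \<mu>(1) by (subst Bochner_Integration.integral_sum) (auto simp: int)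
  have E2: "measure_pmf.expectation M (\<lambda>\<omega>. (N \<omega>)\<^sup>2) = (\<Sum>z\<in>Z. \<Sum>z'\<in>Z. measure_pmf.prob M (I z \<inter> I z'))"
    unfolding N2
    by (subst Bochner_Integration.integral_sum, intro Bochner_Integration.integrable_sum int)
      (intro sum.cong refl, subst Bochner_Integration.integral_sum, auto simp: int)
  have var: "measure_pmf.variance M N \<le> \<eta> * \<mu>\<^sup>2"
    using measure_pmf.variance_eq[OF intN intN2] sq unfolding E2 E by (simp add: algebra_simps)
  have "measure_pmf.prob M {\<omega>. real (card {z\<in>Z. \<omega> \<in> I z}) \<le> \<mu> / 2} \<le>
      measure_pmf.prob M {\<omega>\<in>space (measure_pmf M). \<mu> / 2 \<le> \<bar>N \<omega> - measure_pmf.expectation M N\<bar>}"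
    unfolding E using \<mu>(2) by (intro measure_pmf.finite_measure_mono) (auto simp: N_card[symmetric] abs_real_def)
  also have "\<dots> \<le> measure_pmf.variance M N / (\<mu> / 2)\<^sup>2"
    using intN2 \<mu>(2) by (intro measure_pmf.Chebyshev_inequality) auto
  also have "\<dots> \<le> \<eta> * \<mu>\<^sup>2 / (\<mu> / 2)\<^sup>2" using var by (intro divide_right_mono) auto
  also have "\<dots> = 4 * \<eta>" using \<mu>(2) by (simp add: power2_eq_square field_simps)
  finally show ?thesis .
qed

lemma pmf_markov_card:
  assumes Z: "finite Z" and a: "0 < a"
  shows "measure_pmf.prob M {\<omega>. a \<le> real (card {z\<in>Z. \<omega> \<in> I z})} \<le> (\<Sum>z\<in>Z. measure_pmf.prob M (I z)) / a"
proof -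
  define N :: "'b \<Rightarrow> real" where "N = (\<lambda>\<omega>. \<Sum>z\<in>Z. indicator (I z) \<omega>)"
  have N_card: "N \<omega> = real (card {z\<in>Z. \<omega> \<in> I z})" for \<omega>
    using Z by (simp add: N_def indicator_def sum.If_cases Int_def)
  have int: "integrable (measure_pmf M) (\<lambda>\<omega>. indicator S \<omega> :: real)" for S
    by (rule measure_pmf.integrable_const_bound[of _ 1]) (auto simp: indicator_def)
  have intN: "integrable (measure_pmf M) N" unfolding N_def by (intro Bochner_Integration.integrable_sum int)
  have E: "measure_pmf.expectation M N = (\<Sum>z\<in>Z. measure_pmf.prob M (I z))"
    unfolding N_def by (subst Bochner_Integration.integral_sum) (auto simp: int)
  have "measure_pmf.prob M {\<omega>\<in>space (measure_pmf M). a \<le> N \<omega>} \<le> measure_pmf.expectation M N / a"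
    by (rule integral_Markov_inequality_measure[OF intN, of "{}"]) (use a in \<open>auto simp: N_def intro!: sum_nonneg AE_I2\<close>)
  then show ?thesis unfolding E N_card by simp
qed

section \<open>Probabilities of edge events\<close>

context exponent
begin

definition edge_pmf :: "nat \<Rightarrow> (nat \<times> nat \<Rightarrow> bool) pmf" where
  "edge_pmf n = Pi_pmf (pairs {1..n}) False (\<lambda>(i, j). bernoulli_pmf (edge_prob \<alpha> (j - i)))"

abbreviation pr :: "nat \<Rightarrow> (nat \<times> nat \<Rightarrow> bool) set \<Rightarrow> real" where
  "pr n S \<equiv> measure_pmf.prob (edge_pmf n) S"

lemma edge_prob_le: "1 \<le> d \<Longrightarrow> edge_prob \<alpha> d \<le> real d powr (- \<alpha>)"
  using \<alpha>_pos by (auto simp: edge_prob_def powr_minus_divide ge_one_powr_ge_zero)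

text \<open>Distance 1 has the probability of distance 2, so no pair is adjacent with certainty.
  Non-edges thus have probability bounded below, without which an exact copy could not be
  prescribed.\<close>

lemma edge_prob_le_const: "1 \<le> d \<Longrightarrow> edge_prob \<alpha> d \<le> 2 powr (- \<alpha>)"
  using \<alpha>_pos by (auto simp: edge_prob_def powr_minus_divide frac_le powr_mono2)

lemma edge_prob_ge: "1 \<le> d \<Longrightarrow> d \<le> n \<Longrightarrow> 2 powr (- \<alpha>) * real n powr (- \<alpha>) \<le> edge_prob \<alpha> d"
proof -
  assume d: "1 \<le> d" "d \<le> n"
  have n1: "real n powr (- \<alpha>) \<le> 1" using d \<alpha>_pos by (simp add: powr_minus_divide ge_one_powr_ge_zero)
  show ?thesis
  proof (cases "d = 1")
    case True
    then show ?thesis using mult_left_mono[OF n1, of "2 powr (- \<alpha>)"] by (simp add: edge_prob_def powr_minus_divide)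
  next
    case False
    have "2 powr (- \<alpha>) \<le> (1::real)" using \<alpha>_pos by (simp add: powr_minus_divide ge_one_powr_ge_zero)
    then have "2 powr (- \<alpha>) * real n powr (- \<alpha>) \<le> 1 * real n powr (- \<alpha>)" by (intro mult_right_mono) auto
    also have "\<dots> \<le> real d powr (- \<alpha>)" using d \<alpha>_pos by (simp add: powr_mono2')
    finally show ?thesis using False by (simp add: edge_prob_def powr_minus_divide)
  qed
qed

lemma edge_prob_nonneg: "0 \<le> edge_prob \<alpha> d" by (simp add: edge_prob_def)

lemma two_powr_less_1: "2 powr (- \<alpha>) < (1::real)"
  using \<alpha>_pos by (simp add: powr_less_one)

lemma edge_prob_le_1: "1 \<le> d \<Longrightarrow> edge_prob \<alpha> d \<le> 1"
  using edge_prob_le_const[of d] two_powr_less_1 by linarith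

lemma pr_exact:
  assumes D: "D \<subseteq> pairs {1..n}"
  shows "pr n {\<omega>. \<forall>e\<in>D. \<omega> e = b e} = (\<Prod>(i, j)\<in>D. if b (i, j) then edge_prob \<alpha> (j - i) else 1 - edge_prob \<alpha> (j - i))"
proof -
  let ?A = "pairs {1..n}" and ?p = "\<lambda>(i, j). bernoulli_pmf (edge_prob \<alpha> (j - i))"
  have fin: "finite ?A" by simp
  have eq: "{\<omega>. \<forall>e\<in>D. \<omega> e = b e} = Pi ?A (\<lambda>e. if e \<in> D then {b e} else UNIV)"
    using D by (auto simp: Pi_def)
  have "pr n {\<omega>. \<forall>e\<in>D. \<omega> e = b e} = (\<Prod>e\<in>?A. measure_pmf.prob (?p e) (if e \<in> D then {b e} else UNIV))"
    by (simp only: edge_pmf_def eq measure_Pi_pmf_Pi[OF fin])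
  also have "\<dots> = (\<Prod>e\<in>D. measure_pmf.prob (?p e) (if e \<in> D then {b e} else UNIV))"
    by (rule prod.mono_neutral_right[OF fin D]) auto
  also have "\<dots> = (\<Prod>(i, j)\<in>D. if b (i, j) then edge_prob \<alpha> (j - i) else 1 - edge_prob \<alpha> (j - i))"
  proof (rule prod.cong[OF refl])
    fix e assume e: "e \<in> D"
    then obtain i j where ij: "e = (i, j)" "i < j" using D by (auto simp: pairs_def)
    then have "0 \<le> edge_prob \<alpha> (j - i)" "edge_prob \<alpha> (j - i) \<le> 1" using edge_prob_nonneg edge_prob_le_1 by auto
    then show "measure_pmf.prob (?p e) (if e \<in> D then {b e} else UNIV) =
        (case e of (i, j) \<Rightarrow> if b (i, j) then edge_prob \<alpha> (j - i) else 1 - edge_prob \<alpha> (j - i))"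
      using e ij by (cases "b (i, j)") (simp_all add: measure_pmf_single)
  qed
  finally show ?thesis .
qed

lemma pr_present:
  assumes D: "D \<subseteq> pairs {1..n}"
  shows "pr n {\<omega>. \<forall>e\<in>D. \<omega> e} = (\<Prod>(i, j)\<in>D. edge_prob \<alpha> (j - i))"
  using pr_exact[OF D, of "\<lambda>_. True"] by simp

lemma pr_present_le:
  assumes D: "D \<subseteq> pairs {1..n}"
  shows "pr n {\<omega>. \<forall>e\<in>D. \<omega> e} \<le> (\<Prod>(i, j)\<in>D. real (j - i) powr (- \<alpha>))"
  unfolding pr_present[OF D]
  by (intro prod_mono) (use D in \<open>auto simp: pairs_def edge_prob_nonneg intro!: edge_prob_le\<close>)

lemma pr_indep:
  "depends_on A S \<Longrightarrow> depends_on B T \<Longrightarrow> A \<inter> B = {} \<Longrightarrow> pr n (S \<inter> T) = pr n S * pr n T"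
  unfolding edge_pmf_def by (rule Pi_pmf_indep) auto

lemma pr_indep_family:
  assumes "finite J" "\<And>j. j \<in> J \<Longrightarrow> depends_on (A j) (S j)"
    "\<And>i j. i \<in> J \<Longrightarrow> j \<in> J \<Longrightarrow> i \<noteq> j \<Longrightarrow> A i \<inter> A j = {}"
  shows "pr n (\<Inter>j\<in>J. S j) = (\<Prod>j\<in>J. pr n (S j))"
  using assms
proof (induction J rule: finite_induct)
  case (insert j J)
  have "pr n (S j \<inter> (\<Inter>j\<in>J. S j)) = pr n (S j) * pr n (\<Inter>j\<in>J. S j)"
  proof (rule pr_indep)
    show "depends_on (A j) (S j)" using insert.prems by simp
    show "depends_on (\<Union>j\<in>J. A j) (\<Inter>j\<in>J. S j)" using insert.prems by (intro depends_on_INT) simp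
    have "A j \<inter> A i = {}" if "i \<in> J" for i using insert.prems(2)[of j i] insert.hyps(2) that by auto
    then show "A j \<inter> (\<Union>j\<in>J. A j) = {}" by blast
  qed
  then show ?case using insert by simp
qed simp

lemma pr_mono: "S \<subseteq> T \<Longrightarrow> pr n S \<le> pr n T"
  by (rule measure_pmf.finite_measure_mono) auto

lemma pr_UN_le: "finite J \<Longrightarrow> pr n (\<Union>j\<in>J. S j) \<le> (\<Sum>j\<in>J. pr n (S j))"
  by (rule measure_pmf.finite_measure_subadditive_finite) auto

lemma sentence_prob_eq: "sentence_prob \<alpha> \<phi> n = pr n {\<omega>. models {1..n} (adjacency \<omega>) \<phi>}"
proof -
  have "vertex_pairs n = pairs {1..n}" by (auto simp: vertex_pairs_def pairs_def)
  then show ?thesis by (simp add: sentence_prob_def random_graph_def edge_pmf_def vimage_def)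
qed

end

section \<open>Copies of a pattern\<close>

lemma pairs_mono: "S \<subseteq> T \<Longrightarrow> pairs S \<subseteq> pairs T"
  by (auto simp: pairs_def)

lemma adjacency_sym: "adjacency \<omega> a b \<longleftrightarrow> adjacency \<omega> b a"
  by (auto simp: adjacency_def)

lemma symp_adjacency: "symp (adjacency \<omega>)" by (auto simp: symp_def adjacency_def)

lemma irreflp_adjacency: "irreflp (adjacency \<omega>)" by (auto simp: irreflp_def adjacency_def)

lemma adjacency_cong: "(\<And>e. e \<in> pairs S \<Longrightarrow> \<omega> e = \<omega>' e) \<Longrightarrow> a \<in> S \<Longrightarrow> b \<in> S \<Longrightarrow> adjacency \<omega> a b = adjacency \<omega>' a b"
  by (auto simp: adjacency_def pairs_def)

lemma adj_of_present_edges: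
  assumes "x \<in> S" "y \<in> S" "(x, y) \<notin> Q" "(y, x) \<notin> Q"
  shows "adj_of {e \<in> pairs S - Q. \<omega> e} x y \<longleftrightarrow> adjacency \<omega> x y"
  using assms by (auto simp: adj_of_def adjacency_def pairs_def)

section \<open>Dense graphs after some pairs have been exposed\<close>

context exponent
begin

text \<open>Union bound over all dense graphs that avoid the exposed pairs \<open>A\<close>; each of
  them is independent of \<open>E\<close>. The factor \<open>pr n E\<close> plays the part of a
  conditioning.\<close>

lemma pr_dense_exposed:
  assumes \<theta>: "0 < \<theta>"
  obtains C where "0 < C" "\<And>n F l g A E. F \<subseteq> {1..n} \<Longrightarrow> card F \<le> f \<Longrightarrow> 1 \<le> l \<Longrightarrow> depends_on A E \<Longrightarrow>
    pr n (E \<inter> {\<omega>. \<exists>X D. X \<subseteq> {1..n} - F \<and> card X \<le> k \<and> D \<in> dense_graphs \<theta> l g F X \<and> D \<inter> A = {} \<and> (\<forall>e\<in>D. \<omega> e)})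
      \<le> pr n E * (C * real l powr (- (\<theta> / (2 * (1 + \<theta>)) * \<alpha> * real g)))"
proof -
  obtain C where C: "0 < C" "\<And>n F l g. F \<subseteq> {1..n} \<Longrightarrow> card F \<le> f \<Longrightarrow> 1 \<le> l \<Longrightarrow>
    (\<Sum>X | X \<subseteq> {1..n} - F \<and> card X \<le> k. \<Sum>D\<in>dense_graphs \<theta> l g F X. \<Prod>(a, b)\<in>D. real (b - a) powr (- \<alpha>))
      \<le> C * real l powr (- (\<theta> / (2 * (1 + \<theta>)) * \<alpha> * real g))"
    by (rule dense_graphs_sum[OF \<theta>, of f k]) (rule that)
  show ?thesis
  proof (rule that[OF C(1)])
    fix n l g :: nat and F :: "nat set" and A :: "(nat \<times> nat) set" and E :: "(nat \<times> nat \<Rightarrow> bool) set"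
    assume F: "F \<subseteq> {1..n}" "card F \<le> f" and l: "1 \<le> l" and dep: "depends_on A E"
    let ?XS = "{X. X \<subseteq> {1..n} - F \<and> card X \<le> k}"
    let ?DS = "\<lambda>X. {D \<in> dense_graphs \<theta> l g F X. D \<inter> A = {}}"
    let ?J = "Sigma ?XS ?DS"
    have finF: "finite F" using F(1) by (rule finite_subset) auto
    have finX: "finite X" if "X \<in> ?XS" for X using that finite_subset[of X "{1..n}"] by auto
    have finXS: "finite ?XS" by (rule finite_subset[of _ "Pow {1..n}"]) auto
    have finDG: "finite (dense_graphs \<theta> l g F X)" if "X \<in> ?XS" for X
      by (rule finite_subset[of _ "Pow (pairs (F \<union> X))"]) (use finF finX[OF that] in \<open>auto simp: dense_graphs_def\<close>)
    have finDS: "finite (?DS X)" if "X \<in> ?XS" for X using finDG[OF that] by simp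
    have finJ: "finite ?J" by (rule finite_SigmaI[OF finXS finDS])
    have sub: "D \<subseteq> pairs {1..n}" if "X \<in> ?XS" "D \<in> dense_graphs \<theta> l g F X" for X D
    proof -
      have "D \<subseteq> pairs (F \<union> X)" using that by (simp add: dense_graphs_def)
      also have "\<dots> \<subseteq> pairs {1..n}" using that(1) F(1) by (intro pairs_mono) auto
      finally show ?thesis .
    qed
    have "E \<inter> {\<omega>. \<exists>X D. X \<subseteq> {1..n} - F \<and> card X \<le> k \<and> D \<in> dense_graphs \<theta> l g F X \<and> D \<inter> A = {} \<and> (\<forall>e\<in>D. \<omega> e)}
        \<subseteq> (\<Union>j\<in>?J. E \<inter> {\<omega>. \<forall>e\<in>snd j. \<omega> e})"
    proof
      fix \<omega> assume \<omega>: "\<omega> \<in> E \<inter> {\<omega>. \<exists>X D. X \<subseteq> {1..n} - F \<and> card X \<le> k \<and> D \<in> dense_graphs \<theta> l g F X \<and> D \<inter> A = {} \<and> (\<forall>e\<in>D. \<omega> e)}"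
      then obtain X D where XD: "X \<in> ?XS" "D \<in> ?DS X" "\<forall>e\<in>D. \<omega> e" by blast
      have "(X, D) \<in> ?J" using XD(1,2) by (rule SigmaI)
      moreover have "\<omega> \<in> E \<inter> {\<omega>. \<forall>e\<in>snd (X, D). \<omega> e}" using \<omega> XD(3) by simp
      ultimately show "\<omega> \<in> (\<Union>j\<in>?J. E \<inter> {\<omega>. \<forall>e\<in>snd j. \<omega> e})" by (rule UN_I)
    qed
    then have "pr n (E \<inter> {\<omega>. \<exists>X D. X \<subseteq> {1..n} - F \<and> card X \<le> k \<and> D \<in> dense_graphs \<theta> l g F X \<and> D \<inter> A = {} \<and> (\<forall>e\<in>D. \<omega> e)})
        \<le> pr n (\<Union>j\<in>?J. E \<inter> {\<omega>. \<forall>e\<in>snd j. \<omega> e})" by (rule pr_mono)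
    also have "\<dots> \<le> (\<Sum>j\<in>?J. pr n (E \<inter> {\<omega>. \<forall>e\<in>snd j. \<omega> e}))" by (rule pr_UN_le[OF finJ])
    also have "\<dots> \<le> (\<Sum>j\<in>?J. pr n E * (\<Prod>(a, b)\<in>snd j. real (b - a) powr (- \<alpha>)))"
    proof (rule sum_mono)
      fix j assume "j \<in> ?J"
      then obtain X D where j: "j = (X, D)" "X \<in> ?XS" "D \<in> dense_graphs \<theta> l g F X" "D \<inter> A = {}" by blast
      have "pr n (E \<inter> {\<omega>. \<forall>e\<in>D. \<omega> e}) = pr n E * pr n {\<omega>. \<forall>e\<in>D. \<omega> e}"
        by (rule pr_indep[OF dep depends_on_present]) (use j in auto)
      also have "\<dots> \<le> pr n E * (\<Prod>(a, b)\<in>D. real (b - a) powr (- \<alpha>))"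
        by (intro mult_left_mono pr_present_le sub[OF j(2,3)]) auto
      finally show "pr n (E \<inter> {\<omega>. \<forall>e\<in>snd j. \<omega> e}) \<le> pr n E * (\<Prod>(a, b)\<in>snd j. real (b - a) powr (- \<alpha>))"
        using j by simp
    qed
    also have "\<dots> = pr n E * (\<Sum>(X, D)\<in>?J. \<Prod>(a, b)\<in>D. real (b - a) powr (- \<alpha>))"
      by (simp add: sum_distrib_left case_prod_beta)
    also have "(\<Sum>(X, D)\<in>?J. \<Prod>(a, b)\<in>D. real (b - a) powr (- \<alpha>)) = (\<Sum>X\<in>?XS. \<Sum>D\<in>?DS X. \<Prod>(a, b)\<in>D. real (b - a) powr (- \<alpha>))"
      by (rule sum.Sigma [symmetric]) (use finXS finDS in auto)
    also have "\<dots> \<le> (\<Sum>X\<in>?XS. \<Sum>D\<in>dense_graphs \<theta> l g F X. \<Prod>(a, b)\<in>D. real (b - a) powr (- \<alpha>))"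
      by (intro sum_mono sum_mono2 finDG) (auto intro!: prod_nonneg)
    also have "\<dots> \<le> C * real l powr (- (\<theta> / (2 * (1 + \<theta>)) * \<alpha> * real g))" by (rule C(2)[OF F l])
    finally show "pr n (E \<inter> {\<omega>. \<exists>X D. X \<subseteq> {1..n} - F \<and> card X \<le> k \<and> D \<in> dense_graphs \<theta> l g F X \<and> D \<inter> A = {} \<and> (\<forall>e\<in>D. \<omega> e)})
      \<le> pr n E * (C * real l powr (- (\<theta> / (2 * (1 + \<theta>)) * \<alpha> * real g)))" by (simp add: mult_left_mono)
  qed
qed

text \<open>Edges inside the root never cross and may be discarded, so the witness of density
  becomes disjoint from what was exposed there.\<close>

lemma dense_ext_present_edges:
  assumes "dense_ext \<theta> (adjacency \<omega>) A S" "Q \<subseteq> pairs A"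
  shows "dense_ext \<theta> (adj_of {e \<in> pairs S - Q. \<omega> e}) A S"
proof -
  have "adj_of {e \<in> pairs S - Q. \<omega> e} x y \<longleftrightarrow> adjacency \<omega> x y" if "x \<in> S" "y \<in> S" "x \<notin> A \<or> y \<notin> A" for x y
    by (rule adj_of_present_edges) (use that assms(2) in \<open>auto simp: pairs_def\<close>)
  then show ?thesis using assms(1) dense_ext_cong[of S A "adj_of {e \<in> pairs S - Q. \<omega> e}" "adjacency \<omega>" \<theta>] by blast
qed

text \<open>Otherwise \<open>X\<close> as a single block would have no crossing edge.\<close>

lemma iext_has_edge:
  assumes "iext E A (A \<union> X)" "X \<noteq> {}" "A \<inter> X = {}" "symp E"
  obtains a x where "a \<in> A" "x \<in> X" "E a x"
proof -
  let ?c = "\<lambda>v. if v \<in> X then 1 else 0 :: nat"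
  have fin: "finite (A \<union> X)" using assms(1) by (simp add: iext_def)
  have "blocks ?c (A \<union> X) \<noteq> 0" using blocks_eq_0_iff[OF fin, of ?c] assms(2) by auto
  then have "real (blocks ?c (A \<union> X)) < \<alpha> * real (card (crossing E ?c (A \<union> X)))"
    using assms(3) by (intro iextD[OF assms(1)]) auto
  then have "card (crossing E ?c (A \<union> X)) \<noteq> 0" by (intro notI) simp
  then have "crossing E ?c (A \<union> X) \<noteq> {}" by auto
  then obtain u v where uv: "u \<in> A \<union> X" "v \<in> A \<union> X" "E u v" "(u \<in> X) \<noteq> (v \<in> X)"
    by (auto simp: crossing_def split: if_splits)
  show ?thesis
  proof (cases "u \<in> X")
    case True
    then show ?thesis using uv sympD[OF assms(4) uv(3)] by (intro that[of v u]) auto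
  next
    case False
    then show ?thesis using uv by (intro that[of u v]) auto
  qed
qed

end

text \<open>\<open>\<kappa>\<close> stands for a maximal colouring, with colour 0 exactly on the
  root, and \<open>ofs\<close> arranges the vertices of a cluster on the line. By
  \<open>strict\<close>, each part spanned by the root and some clusters has a positive
  exponent.\<close>

locale pattern_copy = irrational_exponent +
  fixes K :: "nat set" and F :: "nat \<Rightarrow> nat \<Rightarrow> bool" and B :: "nat set" and \<kappa> ofs :: "nat \<Rightarrow> nat" and m :: nat
  assumes finK: "finite K" and BK: "B \<subseteq> K" "K \<noteq> B" and symF: "symp F" and irrF: "irreflp F"
    and \<kappa>: "\<And>v. v \<in> K \<Longrightarrow> \<kappa> v = 0 \<longleftrightarrow> v \<in> B"
    and ofs: "inj_on ofs K" "\<And>v. v \<in> K \<Longrightarrow> ofs v < card K"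
    and strict: "\<And>J. J \<subseteq> \<kappa> ` K - {0} \<Longrightarrow> J \<noteq> {} \<Longrightarrow>
      \<alpha> * real (card {(u, v) \<in> crossing F \<kappa> K. \<kappa> u \<in> insert 0 J \<and> \<kappa> v \<in> insert 0 J}) < real (card J)"
begin

definition colours :: "nat set" where "colours = \<kappa> ` K - {0}"
definition cls :: "nat \<Rightarrow> nat set" where "cls j = {v \<in> K. \<kappa> v = j}"
definition cluster :: "nat \<Rightarrow> nat \<Rightarrow> nat set" where "cluster j x = (\<lambda>v. x + ofs v) ` cls j"

text \<open>Dense extensions close to a cluster can have a probability that does not tend to 0, so
  their absence is built into the event. Restricting them to a window makes it depend on the pairs
  of that window only.\<close>

definition local_copy :: "nat \<Rightarrow> nat \<Rightarrow> nat \<Rightarrow> nat \<Rightarrow> (nat \<times> nat \<Rightarrow> bool) set" where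
  "local_copy n R j x = {\<omega>. (\<forall>v\<in>cls j. \<forall>w\<in>cls j. adjacency \<omega> (x + ofs v) (x + ofs w) \<longleftrightarrow> F v w) \<and>
     (\<forall>X. X \<subseteq> {1..n} \<inter> {x - R..x + R} \<longrightarrow> X \<noteq> {} \<longrightarrow> card X \<le> m \<longrightarrow> cluster j x \<inter> X = {} \<longrightarrow>
        \<not> iext (adjacency \<omega>) (cluster j x) (cluster j x \<union> X))}"

lemma finite_colours: "finite colours" using finK by (simp add: colours_def)

lemma colours_nonempty: "colours \<noteq> {}"
proof -
  obtain v where "v \<in> K" "v \<notin> B" using BK by blast
  then show ?thesis using \<kappa> by (auto simp: colours_def)
qed

lemma cls_subset: "cls j \<subseteq> K" by (auto simp: cls_def)

lemma card_cluster: "card (cluster j x) \<le> card K"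
  unfolding cluster_def using card_image_le[OF finite_subset[OF cls_subset finK]] card_mono[OF finK cls_subset] le_trans by blast

lemma cluster_bounds: "y \<in> cluster j x \<Longrightarrow> x \<le> y \<and> y < x + card K"
  using ofs(2) by (auto simp: cluster_def cls_def)

lemma local_copy_depends:
  assumes "card K \<le> R" shows "depends_on (pairs {x - R..x + R}) (local_copy n R j x)"
proof -
  have "\<omega>' \<in> local_copy n R j x" if eq: "\<forall>e\<in>pairs {x - R..x + R}. \<omega> e = \<omega>' e" and \<omega>: "\<omega> \<in> local_copy n R j x" for \<omega> \<omega>'
  proof -
    let ?N = "{x - R..x + R}"
    have adj: "adjacency \<omega> a b = adjacency \<omega>' a b" if "a \<in> ?N" "b \<in> ?N" for a b
      by (rule adjacency_cong[of ?N]) (use eq that in auto)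
    have cN: "cluster j x \<subseteq> ?N" using cluster_bounds assms by fastforce
    have vN: "x + ofs v \<in> ?N" if "v \<in> cls j" for v
      using cN that by (auto simp: cluster_def)
    show ?thesis
      unfolding local_copy_def
    proof (intro CollectI conjI ballI allI impI)
      fix v w assume "v \<in> cls j" "w \<in> cls j"
      then show "adjacency \<omega>' (x + ofs v) (x + ofs w) \<longleftrightarrow> F v w"
        using \<omega> adj[OF vN vN] by (simp add: local_copy_def)
    next
      fix X assume X: "X \<subseteq> {1..n} \<inter> ?N" "X \<noteq> {}" "card X \<le> m" "cluster j x \<inter> X = {}"
      have "iext (adjacency \<omega>') (cluster j x) (cluster j x \<union> X) \<longleftrightarrow> iext (adjacency \<omega>) (cluster j x) (cluster j x \<union> X)"
        by (rule iext_cong) (use adj cN X(1) in blast)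
      then show "\<not> iext (adjacency \<omega>') (cluster j x) (cluster j x \<union> X)"
        using \<omega> X by (simp add: local_copy_def)
    qed
  qed
  then show ?thesis unfolding depends_on_def by (metis (full_types))
qed

text \<open>All pairs that meet the cluster and stay near it are prescribed: the pattern inside, no
  edge to other vertices. A dense extension then needs an edge of length above \<open>L\<close> at
  the cluster, and for large \<open>L\<close> this has probability at most 1/2 relative to the
  prescription. The bound is uniform in n, R and the position.\<close>

lemma local_copy_prob:
  obtains c :: real and L :: nat where "0 < c" "\<And>n R j x. L \<le> x \<Longrightarrow> x + L \<le> n \<Longrightarrow> c \<le> pr n (local_copy n R j x)"
proof -
  obtain \<theta> where \<theta>: "0 < \<theta>" "\<And>E A S. iext E A S \<Longrightarrow> card (S - A) \<le> m \<Longrightarrow> dense_ext \<theta> E A S"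
    using iext_imp_dense_ext[of m] by blast
  define \<eta> where "\<eta> = \<theta> / (2 * (1 + \<theta>)) * \<alpha>"
  have \<eta>: "0 < \<eta>" using \<theta> \<alpha>_pos by (simp add: \<eta>_def)
  obtain C where C: "0 < C" "\<And>n F l g A E. F \<subseteq> {1..n} \<Longrightarrow> card F \<le> card K \<Longrightarrow> 1 \<le> l \<Longrightarrow> depends_on A E \<Longrightarrow>
    pr n (E \<inter> {\<omega>. \<exists>X D. X \<subseteq> {1..n} - F \<and> card X \<le> m \<and> D \<in> dense_graphs \<theta> l g F X \<and> D \<inter> A = {} \<and> (\<forall>e\<in>D. \<omega> e)})
      \<le> pr n E * (C * real l powr (- (\<theta> / (2 * (1 + \<theta>)) * \<alpha> * real g)))"
    by (rule pr_dense_exposed[OF \<theta>(1), of "card K" m]) (rule that)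
  obtain L :: nat where L: "1 \<le> L" "C * real L powr (- \<eta>) \<le> 1 / 2"
  proof -
    have "((\<lambda>L. C * real L powr (- \<eta>)) \<longlongrightarrow> C * 0) at_top"
      using \<eta> by (intro tendsto_mult tendsto_const tendsto_neg_powr filterlim_real_sequentially) auto
    then have "\<forall>\<^sub>F L in sequentially. C * real L powr (- \<eta>) < 1 / 2"
      by (rule order_tendstoD) simp
    then have "\<forall>\<^sub>F L in sequentially. C * real L powr (- \<eta>) < 1 / 2 \<and> 1 \<le> L"
      using eventually_ge_at_top[of 1] by eventually_elim simp
    then obtain L where "C * real L powr (- \<eta>) < 1 / 2 \<and> 1 \<le> L"
      using eventually_happens'[OF sequentially_bot] by blast
    then show ?thesis by (intro that[of L]) auto
  qed
  define W where "W = L + card K"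
  define q where "q = min (2 powr (- \<alpha>) * real (2 * W) powr (- \<alpha>)) (1 - 2 powr (- \<alpha>))"
  have W: "1 \<le> W" using L by (simp add: W_def)
  have q: "0 < q" "q \<le> 1" using two_powr_less_1 W by (auto simp: q_def min_le_iff_disj)
  show ?thesis
  \<comment> \<open>The exponent bounds the number of prescribed pairs, each of which costs at most
    a factor \<open>q\<close>; one half is lost to dense extensions. With \<open>W + 1\<close> the
    prescribed range lies inside \<open>{1..n}\<close> and \<open>x - W\<close> is not
    truncated.\<close>
  proof (rule that[of "q ^ ((2 * W + 1) * (2 * W + 1)) / 2" "W + 1"])
    show "0 < q ^ ((2 * W + 1) * (2 * W + 1)) / 2" using q by simp
    fix n R j x assume x': "W + 1 \<le> x" "x + (W + 1) \<le> n"
    then have x: "W < x" "x + W \<le> n" by auto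
    define P where "P = cluster j x"
    have Pb: "x \<le> y \<and> y < x + card K" if "y \<in> P" for y using cluster_bounds that unfolding P_def by blast
    have Pn: "P \<subseteq> {1..n}" using Pb x W by (fastforce simp: W_def)
    define DA where "DA = {(a, b) \<in> pairs {x - W..x + W}. a \<in> P \<or> b \<in> P}"
    have DAn: "DA \<subseteq> pairs {1..n}"
    proof
      fix e assume "e \<in> DA"
      then obtain a b where "e = (a, b)" "x - W \<le> a" "a < b" "b \<le> x + W" "a \<in> P \<or> b \<in> P" by (auto simp: DA_def pairs_def)
      then show "e \<in> pairs {1..n}" using x by (auto simp: pairs_def)
    qed
    have finDA: "finite DA" using DAn by (rule finite_subset) simp
    define b where "b = (\<lambda>e. \<exists>v\<in>cls j. \<exists>w\<in>cls j. e = (x + ofs v, x + ofs w) \<and> F v w)"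
    define E where "E = {\<omega>. \<forall>e\<in>DA. \<omega> e = b e}"
    have depE: "depends_on DA E" unfolding E_def by (rule depends_on_exact)
    have prE: "q ^ ((2 * W + 1) * (2 * W + 1)) \<le> pr n E"
    proof -
      have "card DA \<le> card ({x - W..x + W} \<times> {x - W..x + W})"
        by (intro card_mono) (auto simp: DA_def pairs_def)
      also have "\<dots> = card {x - W..x + W} * card {x - W..x + W}" by (rule card_cartesian_product)
      also have "\<dots> \<le> (2 * W + 1) * (2 * W + 1)" by (intro mult_mono) auto
      finally have "q ^ ((2 * W + 1) * (2 * W + 1)) \<le> q ^ card DA" using q by (intro power_decreasing) auto
      also have "\<dots> = (\<Prod>e\<in>DA. q)" by simp
      also have "\<dots> \<le> (\<Prod>(i, k)\<in>DA. if b (i, k) then edge_prob \<alpha> (k - i) else 1 - edge_prob \<alpha> (k - i))"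
      proof (rule prod_mono, rule conjI)
        fix e assume e: "e \<in> DA"
        obtain i k where ik: "e = (i, k)" by (cases e)
        have d: "1 \<le> k - i" "k - i \<le> 2 * W" using e ik by (auto simp: DA_def pairs_def)
        show "q \<le> (case e of (i, k) \<Rightarrow> if b (i, k) then edge_prob \<alpha> (k - i) else 1 - edge_prob \<alpha> (k - i))"
          using edge_prob_ge[OF d] edge_prob_le_const[OF d(1)] ik by (auto simp: q_def)
      qed (use q in simp)
      also have "\<dots> = pr n E" unfolding E_def by (rule pr_exact[OF DAn, symmetric])
      finally show ?thesis .
    qed
    define Bad where "Bad = {\<omega>. \<exists>X D. X \<subseteq> {1..n} - P \<and> card X \<le> m \<and> D \<in> dense_graphs \<theta> L 1 P X \<and> D \<inter> DA = {} \<and> (\<forall>e\<in>D. \<omega> e)}"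
    have cP: "card P \<le> card K" unfolding P_def by (rule card_cluster)
    have "pr n (E \<inter> Bad) \<le> pr n E * (C * real L powr (- (\<theta> / (2 * (1 + \<theta>)) * \<alpha> * real 1)))"
      unfolding Bad_def by (rule C(2)[OF Pn cP L(1) depE])
    also have "\<dots> \<le> pr n E * (1 / 2)" using L(2) by (intro mult_left_mono) (auto simp: \<eta>_def)
    finally have bad: "pr n (E \<inter> Bad) \<le> pr n E / 2" by simp
    have "E \<subseteq> local_copy n R j x \<union> (E \<inter> Bad)"
    proof
      fix \<omega> assume \<omega>: "\<omega> \<in> E"
      have eq: "\<omega> e = b e" if "e \<in> DA" for e using \<omega> that by (simp add: E_def)
      have inW: "{x..<x + card K} \<subseteq> {x - W..x + W}" by (auto simp: W_def)
      have PW: "y \<in> {x - W..x + W}" if "y \<in> P" for y using Pb[OF that] by (auto simp: W_def)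
      have adjP: "adjacency \<omega> (x + ofs v) (x + ofs w) \<longleftrightarrow> F v w" if vw: "v \<in> cls j" "w \<in> cls j" for v w
      proof -
        have vP: "x + ofs v \<in> P" "x + ofs w \<in> P" using vw by (auto simp: P_def cluster_def)
        have inj: "v' = v \<longleftrightarrow> ofs v' = ofs v" if "v' \<in> cls j" "v \<in> cls j" for v v'
          using that cls_subset ofs(1) by (metis inj_on_eq_iff subsetD)
        have b_iff: "b (x + ofs v', x + ofs w') \<longleftrightarrow> F v' w'" if "v' \<in> cls j" "w' \<in> cls j" for v' w'
          unfolding b_def using that inj by auto
        have less: "adjacency \<omega> (x + ofs v') (x + ofs w') \<longleftrightarrow> F v' w'" if "v' \<in> cls j" "w' \<in> cls j" "ofs v' < ofs w'" for v' w'
        proof -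
          have p: "x + ofs v' \<in> P" "x + ofs w' \<in> P" using that by (auto simp: P_def cluster_def)
          then have "(x + ofs v', x + ofs w') \<in> DA" using PW[OF p(1)] PW[OF p(2)] that by (auto simp: DA_def pairs_def)
          then have "\<omega> (x + ofs v', x + ofs w') = F v' w'" using eq b_iff that by simp
          then show ?thesis using that(3) by (simp add: adjacency_def)
        qed
        consider "ofs v < ofs w" | "ofs w < ofs v" | "v = w" using inj[OF vw] by force
        then show ?thesis
        proof cases
          case 1 then show ?thesis using less vw by blast
        next
          case 2 then show ?thesis using less[OF vw(2,1)] adjacency_sym sympD[OF symF] by metis
        next
          case 3 then show ?thesis using irrF by (auto simp: adjacency_def irreflp_def)
        qed
      qed
      show "\<omega> \<in> local_copy n R j x \<union> (E \<inter> Bad)"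
      proof (cases "\<omega> \<in> local_copy n R j x")
        case False
        then obtain X where X: "X \<subseteq> {1..n} \<inter> {x - R..x + R}" "X \<noteq> {}" "card X \<le> m" "P \<inter> X = {}"
          "iext (adjacency \<omega>) P (P \<union> X)"
          using adjP unfolding local_copy_def P_def[symmetric] by blast
        define D where "D = {e \<in> pairs (P \<union> X) - pairs P. \<omega> e}"
        have dense: "dense_ext \<theta> (adj_of D) P (P \<union> X)"
          unfolding D_def
        proof (rule dense_ext_present_edges[OF \<theta>(2)[OF X(5)]])
          have "(P \<union> X) - P = X" using X(4) by auto
          then show "card ((P \<union> X) - P) \<le> m" using X(3) by simp
        qed simp
        \<comment> \<open>A pair of \<open>DA\<close> that is present is an edge of the pattern
          inside the cluster, and pairs inside the cluster were removed from
          \<open>D\<close>.\<close>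
        have noDA: "D \<inter> DA = {}"
        proof (rule ccontr)
          assume "D \<inter> DA \<noteq> {}"
          then obtain e where e: "e \<in> D" "e \<in> DA" by blast
          then have "b e" using eq by (simp add: D_def)
          then have "e \<in> P \<times> P" by (auto simp: b_def P_def cluster_def)
          then show False using e by (auto simp: D_def pairs_def)
        qed
        obtain a y where ay: "a \<in> P" "y \<in> X" "adjacency \<omega> a y"
          using iext_has_edge[OF X(5,2,4) symp_adjacency] by blast
        define e where "e = (min a y, max a y)"
        have ne: "a \<noteq> y" using ay X(4) by auto
        have \<omega>e: "\<omega> e" using ay(3) ne by (auto simp: e_def adjacency_def min_def max_def)
        have eD: "e \<in> D" using \<omega>e ay ne X(4) by (auto simp: e_def D_def pairs_def min_def max_def)
        have "e \<notin> DA" using eD noDA by blast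
        then have "y \<notin> {x - W..x + W}" using ay(1) PW[OF ay(1)] ne by (auto simp: e_def DA_def pairs_def min_def max_def split: if_splits)
        then have "L < max a y - min a y" using Pb[OF ay(1)] x by (auto simp: W_def)
        then have "e \<in> {(a, b) \<in> D. L < b - a}" using eD by (simp add: e_def)
        moreover have "finite {(a, b) \<in> D. L < b - a}"
        proof (rule finite_subset)
          show "{(a, b) \<in> D. L < b - a} \<subseteq> pairs (P \<union> X)" by (auto simp: D_def)
          show "finite (pairs (P \<union> X))" using X(5) by (simp add: iext_def)
        qed
        ultimately have "0 < card {(a, b) \<in> D. L < b - a}" by (subst card_gt_0_iff) blast
        then have "1 \<le> card {(a, b) \<in> D. L < b - a}" by simp
        moreover have "D \<subseteq> pairs (P \<union> X)" unfolding D_def by blast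
        ultimately have DD: "D \<in> dense_graphs \<theta> L 1 P X" using dense unfolding dense_graphs_def by simp
        have "X \<subseteq> {1..n} - P" using X(1,4) by auto
        moreover have "\<forall>e\<in>D. \<omega> e" by (simp add: D_def)
        ultimately have "\<omega> \<in> Bad" unfolding Bad_def using DD noDA X(3) by (intro CollectI exI[of _ X] exI[of _ D] conjI)
        then show ?thesis using \<omega> by blast
      qed simp
    qed
    then have "pr n E \<le> pr n (local_copy n R j x \<union> (E \<inter> Bad))" by (rule pr_mono)
    also have "\<dots> \<le> pr n (local_copy n R j x) + pr n (E \<inter> Bad)"
      by (rule measure_Un_le) auto
    finally have "pr n E / 2 \<le> pr n (local_copy n R j x)" using bad by linarith
    then show "q ^ ((2 * W + 1) * (2 * W + 1)) / 2 \<le> pr n (local_copy n R j x)" using prE by linarith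
  qed
qed

end

text \<open>Edges up to length \<open>l\<close> count as short. A path of \<open>m + 1\<close> short
  edges starting in a cluster stays within \<open>R\<close> of its centre, windows of different
  slots of width \<open>\<sigma>\<close> are disjoint, and \<open>u\<close> is the scale of the long
  distances, far above all of these.\<close>

locale trial_geometry = pattern_copy +
  fixes n u l R \<sigma> M :: nat
  assumes l: "1 \<le> l" and R: "(m + 1) * l + card K \<le> R" and \<sigma>: "2 * R + card K < \<sigma>"
    and u: "4 * (R + card K) < u" and M: "4 * u * M \<le> n"
begin

text \<open>The interval \<open>{1..n}\<close> contains \<open>M\<close> consecutive blocks of length \<open>4 * u\<close>, and \<open>fat i\<close> is the part of block \<open>i\<close>
  that a trial explores. A trial assigns the block \<open>a j\<close> to the colour class \<open>j\<close>, and \<open>z j\<close> selects one of \<open>G\<close> slots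
  of width \<open>\<sigma>\<close> in that block, so that distinct slots have disjoint windows.\<close>

definition centre :: "nat \<Rightarrow> nat \<Rightarrow> nat" where "centre i y = 4 * u * i + 2 * u + \<sigma> * y"
definition G :: nat where "G = u div \<sigma>"
definition fat :: "nat \<Rightarrow> nat set" where "fat i = {4 * u * i + 2 * u - R..4 * u * i + 3 * u + card K + R}"
text \<open>Slots begin in the third quarter of a block. Confining the root vertices of that block
  to its first quarter keeps them at distance at least u / 2 from everything the trial explores
  there.\<close>

definition avoids :: "(nat \<Rightarrow> nat) \<Rightarrow> nat \<Rightarrow> bool" where
  "avoids \<beta> i \<longleftrightarrow> (\<forall>b\<in>B. \<beta> b \<le> 4 * u * i + u \<or> 4 * u * i + 4 * u \<le> \<beta> b)"
definition base :: "(nat \<Rightarrow> nat) \<Rightarrow> bool" where "base \<beta> \<longleftrightarrow> inj_on \<beta> B \<and> \<beta> ` B \<subseteq> {1..n}"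
definition trial :: "(nat \<Rightarrow> nat) \<Rightarrow> (nat \<Rightarrow> nat) \<Rightarrow> bool" where
  "trial \<beta> a \<longleftrightarrow> inj_on a colours \<and> a ` colours \<subseteq> {..<M} \<and> (\<forall>j\<in>colours. avoids \<beta> (a j))"
definition positions :: "(nat \<Rightarrow> nat) set" where "positions = PiE colours (\<lambda>_. {..<G})"
definition place :: "(nat \<Rightarrow> nat) \<Rightarrow> (nat \<Rightarrow> nat) \<Rightarrow> (nat \<Rightarrow> nat) \<Rightarrow> nat \<Rightarrow> nat" where
  "place \<beta> a z v = (if v \<in> B then \<beta> v else centre (a (\<kappa> v)) (z (\<kappa> v)) + ofs v)"
definition cpairs :: "(nat \<Rightarrow> nat) \<Rightarrow> (nat \<times> nat) set" where
  "cpairs g = {(p, q). p < q \<and> (\<exists>v\<in>K. \<exists>w\<in>K. \<kappa> v \<noteq> \<kappa> w \<and> p = g v \<and> q = g w)}"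
definition cedges :: "(nat \<Rightarrow> nat) \<Rightarrow> (nat \<times> nat) set" where
  "cedges g = {(p, q). p < q \<and> (\<exists>v\<in>K. \<exists>w\<in>K. \<kappa> v \<noteq> \<kappa> w \<and> F v w \<and> p = g v \<and> q = g w)}"
definition window :: "(nat \<Rightarrow> nat) \<Rightarrow> (nat \<Rightarrow> nat) \<Rightarrow> nat \<Rightarrow> nat set" where
  "window a z j = {centre (a j) (z j) - R..centre (a j) (z j) + R}"
definition copy :: "(nat \<Rightarrow> nat) \<Rightarrow> (nat \<Rightarrow> nat) \<Rightarrow> (nat \<Rightarrow> nat) \<Rightarrow> (nat \<times> nat \<Rightarrow> bool) set" where
  "copy \<beta> a z = {\<omega>. \<forall>v\<in>K. \<forall>w\<in>K. \<kappa> v \<noteq> \<kappa> w \<longrightarrow> (adjacency \<omega> (place \<beta> a z v) (place \<beta> a z w) \<longleftrightarrow> F v w)} \<inter>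
     (\<Inter>j\<in>colours. local_copy n R j (centre (a j) (z j)))"

lemma R_pos: "1 \<le> R"
  using R l by (cases l) auto

lemma u_ge: "4 < u"
proof -
  have "4 * 1 \<le> 4 * (R + card K)" using R_pos by (intro mult_le_mono) auto
  from le_less_trans[OF this u] show ?thesis by simp
qed

lemma finite_positions: "finite positions"
  unfolding positions_def by (intro finite_PiE finite_colours) auto

lemma card_positions: "card positions = G ^ card colours"
  unfolding positions_def by (simp add: card_PiE finite_colours)

lemma positions_less: "z \<in> positions \<Longrightarrow> j \<in> colours \<Longrightarrow> z j < G"
  by (auto simp: positions_def)

lemma colour_in: "v \<in> K \<Longrightarrow> v \<notin> B \<Longrightarrow> \<kappa> v \<in> colours"
  using \<kappa> by (auto simp: colours_def)

lemma centre_bounds: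
  assumes "y < G" shows "4 * u * i + 2 * u \<le> centre i y" "centre i y < 4 * u * i + 3 * u"
proof -
  have "\<sigma> * y < u"
  proof -
    have "\<sigma> * Suc y \<le> \<sigma> * (u div \<sigma>)" using assms by (intro mult_left_mono) (auto simp: G_def)
    also have "\<dots> \<le> u" by simp
    finally show ?thesis using \<sigma> by simp
  qed
  then show "centre i y < 4 * u * i + 3 * u" by (simp add: centre_def)
qed (simp add: centre_def)

lemma window_fat:
  assumes "y < G" "centre i y - R \<le> x" "x \<le> centre i y + card K + R" shows "x \<in> fat i"
  using centre_bounds[OF assms(1), of i] assms u by (auto simp: fat_def)

lemma fat_apart:
  assumes "x \<in> fat i" "x' \<in> fat i'" "i < i'" shows "x + u \<le> x'"
proof -
  have "4 * u * Suc i \<le> 4 * u * i'" using assms(3) by (intro mult_left_mono) auto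
  then show ?thesis using assms(1,2) u by (auto simp: fat_def)
qed

lemma fat_disjoint: "i \<noteq> i' \<Longrightarrow> x \<in> fat i \<Longrightarrow> x \<in> fat i' \<Longrightarrow> False"
  using fat_apart[of x i x i'] fat_apart[of x i' x i] u by (cases "i < i'") auto

lemma fat_base:
  assumes "x \<in> fat i" "avoids \<beta> i" "b \<in> B" shows "2 * \<beta> b + u \<le> 2 * x \<or> 2 * x + u \<le> 2 * \<beta> b"
  using assms u by (fastforce simp: fat_def avoids_def)

lemma fat_range:
  assumes "x \<in> fat i" "i < M" shows "u \<le> x" "x + (u - card K - R) \<le> n"
proof -
  have "4 * u * Suc i \<le> 4 * u * M" using assms(2) by (intro mult_left_mono) auto
  then show "u \<le> x" "x + (u - card K - R) \<le> n" using assms(1) u M by (auto simp: fat_def)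
qed

lemma cedges_cpairs: "cedges g \<subseteq> cpairs g"
  unfolding cedges_def cpairs_def by blast

lemma finite_cpairs: "finite (cpairs g)"
  by (rule finite_subset[of _ "g ` K \<times> g ` K"]) (use finK in \<open>auto simp: cpairs_def\<close>)

lemma finite_cedges: "finite (cedges g)"
  by (rule finite_subset[OF cedges_cpairs finite_cpairs])

definition edge_image :: "(nat \<Rightarrow> nat) \<Rightarrow> nat \<times> nat \<Rightarrow> nat \<times> nat" where
  "edge_image g = (\<lambda>(v, w). (min (g v) (g w), max (g v) (g w)))"

lemma cedges_image:
  assumes inj: "inj_on g K" shows "cedges g = edge_image g ` crossing F \<kappa> K"
proof (intro set_eqI iffI)
  fix e assume "e \<in> cedges g"
  then obtain p q v w where e: "e = (p, q)" "p < q" "v \<in> K" "w \<in> K" "\<kappa> v \<noteq> \<kappa> w" "F v w" "p = g v" "q = g w"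
    by (auto simp: cedges_def)
  show "e \<in> edge_image g ` crossing F \<kappa> K"
  proof (cases "v < w")
    case True
    then have "(v, w) \<in> crossing F \<kappa> K" using e by (auto simp: crossing_def)
    moreover have "e = edge_image g (v, w)" using e by (auto simp: edge_image_def)
    ultimately show ?thesis by blast
  next
    case False
    then have "w < v" using e by (cases "v = w") auto
    then have "(w, v) \<in> crossing F \<kappa> K" using e sympD[OF symF] by (auto simp: crossing_def)
    moreover have "e = edge_image g (w, v)" using e by (auto simp: edge_image_def)
    ultimately show ?thesis by blast
  qed
next
  fix e assume "e \<in> edge_image g ` crossing F \<kappa> K"
  then obtain v w where e: "e = edge_image g (v, w)" "v \<in> K" "w \<in> K" "\<kappa> v \<noteq> \<kappa> w" "F v w" by (auto simp: crossing_def)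
  have ne: "g v \<noteq> g w" using e inj by (metis inj_on_eq_iff)
  show "e \<in> cedges g"
  proof (cases "g v < g w")
    case True
    then have "e = (g v, g w)" using e by (simp add: edge_image_def)
    then show ?thesis using True e unfolding cedges_def by blast
  next
    case False
    then have g: "e = (g w, g v)" "g w < g v" using e ne by (auto simp: edge_image_def)
    have "F w v" by (rule sympD[OF symF e(5)])
    then show ?thesis using g e(2,3) e(4)[symmetric] unfolding cedges_def g(1) by blast
  qed
qed

lemma edge_image_inj:
  assumes inj: "inj_on g K" shows "inj_on (edge_image g) (crossing F \<kappa> K)"
proof (rule inj_onI)
  fix e e' assume "e \<in> crossing F \<kappa> K" "e' \<in> crossing F \<kappa> K" and eq: "edge_image g e = edge_image g e'"
  then obtain v w v' w' where e: "e = (v, w)" "v < w" "v \<in> K" "w \<in> K" "e' = (v', w')" "v' < w'" "v' \<in> K" "w' \<in> K"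
    by (auto simp: crossing_def)
  have "g v = g v' \<and> g w = g w' \<or> g v = g w' \<and> g w = g v'"
    using eq e by (auto simp: edge_image_def min_def max_def split: if_splits)
  then have "v = v' \<and> w = w' \<or> v = w' \<and> w = v'" using e inj by (auto dest: inj_onD)
  then show "e = e'" using e by auto
qed

lemma edges_prob_le:
  assumes D: "D \<subseteq> pairs {1..n}" "\<And>p q. (p, q) \<in> D \<Longrightarrow> u \<le> 2 * (q - p)"
  shows "pr n {\<omega>. \<forall>e\<in>D. \<omega> e} \<le> ((real u / 2) powr (- \<alpha>)) ^ card D"
proof -
  have "pr n {\<omega>. \<forall>e\<in>D. \<omega> e} \<le> (\<Prod>(i, j)\<in>D. real (j - i) powr (- \<alpha>))" by (rule pr_present_le[OF D(1)])
  also have "\<dots> \<le> (\<Prod>e\<in>D. (real u / 2) powr (- \<alpha>))"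
  proof (rule prod_mono, rule conjI)
    fix e assume "e \<in> D"
    then obtain p q where e: "e = (p, q)" "(p, q) \<in> D" by (cases e) auto
    have "u \<le> 2 * (q - p)" by (rule D(2)[OF e(2)])
    then have "real u / 2 \<le> real (q - p)" by linarith
    then show "(case e of (i, j) \<Rightarrow> real (j - i) powr (- \<alpha>)) \<le> (real u / 2) powr (- \<alpha>)"
      using e u \<alpha>_pos by (auto intro!: powr_mono2')
  qed auto
  also have "\<dots> = ((real u / 2) powr (- \<alpha>)) ^ card D" by simp
  finally show ?thesis .
qed

text \<open>All pairs a trial may inspect. Pairs inside the root are left out because all trials
  share them; without them, trials in different blocks have disjoint zones.\<close>

definition zone :: "(nat \<Rightarrow> nat) \<Rightarrow> (nat \<Rightarrow> nat) \<Rightarrow> (nat \<times> nat) set" where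
  "zone \<beta> a = {(p, q). p < q \<and> p \<in> (\<Union>j\<in>colours. fat (a j)) \<union> \<beta> ` B \<and> q \<in> (\<Union>j\<in>colours. fat (a j)) \<union> \<beta> ` B \<and>
     \<not> (p \<in> \<beta> ` B \<and> q \<in> \<beta> ` B)}"

definition reach :: "(nat \<Rightarrow> nat) \<Rightarrow> (nat \<Rightarrow> nat) \<Rightarrow> (nat \<Rightarrow> nat) \<Rightarrow> (nat \<times> nat) set" where
  "reach \<beta> a z = cpairs (place \<beta> a z) \<union> (\<Union>j\<in>colours. pairs (window a z j))"

definition cross_event :: "(nat \<Rightarrow> nat) \<Rightarrow> (nat \<Rightarrow> nat) \<Rightarrow> (nat \<Rightarrow> nat) \<Rightarrow> (nat \<times> nat \<Rightarrow> bool) set" where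
  "cross_event \<beta> a z = {\<omega>. \<forall>v\<in>K. \<forall>w\<in>K. \<kappa> v \<noteq> \<kappa> w \<longrightarrow> (adjacency \<omega> (place \<beta> a z v) (place \<beta> a z w) \<longleftrightarrow> F v w)}"

lemma cross_event_depends: "depends_on (cpairs (place \<beta> a z)) (cross_event \<beta> a z)"
proof -
  let ?g = "place \<beta> a z"
  have "adjacency \<omega> (?g v) (?g w) \<longleftrightarrow> adjacency \<omega>' (?g v) (?g w)"
    if eq: "\<forall>e\<in>cpairs ?g. \<omega> e = \<omega>' e" and vw: "v \<in> K" "w \<in> K" "\<kappa> v \<noteq> \<kappa> w" for \<omega> \<omega>' v w
  proof -
    have "?g v < ?g w \<Longrightarrow> (?g v, ?g w) \<in> cpairs ?g"
      using vw unfolding cpairs_def by blast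
    moreover have "?g w < ?g v \<Longrightarrow> (?g w, ?g v) \<in> cpairs ?g"
      using vw(1,2) vw(3)[symmetric] unfolding cpairs_def by blast
    ultimately show ?thesis using eq unfolding adjacency_def by blast
  qed
  note adj = this
  show ?thesis unfolding depends_on_def cross_event_def mem_Collect_eq
  proof (intro allI impI)
    fix \<omega> \<omega>' :: "nat \<times> nat \<Rightarrow> bool" assume eq: "\<forall>e\<in>cpairs ?g. \<omega> e = \<omega>' e"
    show "(\<forall>v\<in>K. \<forall>w\<in>K. \<kappa> v \<noteq> \<kappa> w \<longrightarrow> adjacency \<omega> (?g v) (?g w) = F v w) =
        (\<forall>v\<in>K. \<forall>w\<in>K. \<kappa> v \<noteq> \<kappa> w \<longrightarrow> adjacency \<omega>' (?g v) (?g w) = F v w)"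
      using adj[OF eq] by auto
  qed
qed

lemma window_short: "(p, q) \<in> pairs (window a z j) \<Longrightarrow> 2 * (q - p) < u"
  using u by (auto simp: pairs_def window_def)

context
  fixes \<beta> a
  assumes \<beta>: "base \<beta>" and a: "trial \<beta> a"
begin

lemma trialD: "j \<in> colours \<Longrightarrow> a j < M" "j \<in> colours \<Longrightarrow> avoids \<beta> (a j)" "inj_on a colours"
  using a by (auto simp: trial_def)

lemma place_base: "v \<in> B \<Longrightarrow> place \<beta> a z v = \<beta> v" by (simp add: place_def)

lemma place_fat:
  assumes "z \<in> positions" "v \<in> K" "v \<notin> B" shows "place \<beta> a z v \<in> fat (a (\<kappa> v))"
proof -
  have y: "z (\<kappa> v) < G" using positions_less assms colour_in by blast
  show ?thesis by (rule window_fat[OF y]) (use assms ofs(2)[of v] in \<open>auto simp: place_def\<close>)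
qed

text \<open>Different clusters lie in different blocks, and the blocks in use avoid the root. The
  statement covers two placements at once because overlapping copies have to be compared.\<close>

lemma place_far:
  assumes z: "z \<in> positions" "z' \<in> positions" and v: "v \<in> K" "v' \<in> K" and ne: "\<kappa> v \<noteq> \<kappa> v'"
  shows "2 * place \<beta> a z v + u \<le> 2 * place \<beta> a z' v' \<or> 2 * place \<beta> a z' v' + u \<le> 2 * place \<beta> a z v"
proof -
  consider "v \<in> B" "v' \<notin> B" | "v \<notin> B" "v' \<in> B" | "v \<notin> B" "v' \<notin> B"
    using ne \<kappa>[OF v(1)] \<kappa>[OF v(2)] by metis
  then show ?thesis
  proof cases
    case 1
    then show ?thesis
      using fat_base[OF place_fat[OF z(2) v(2)] trialD(2)[OF colour_in[OF v(2)]], of v] by (auto simp: place_base)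
  next
    case 2
    then show ?thesis
      using fat_base[OF place_fat[OF z(1) v(1)] trialD(2)[OF colour_in[OF v(1)]], of v'] by (auto simp: place_base)
  next
    case 3
    have "a (\<kappa> v) \<noteq> a (\<kappa> v')" using ne trialD(3) colour_in v 3 by (metis inj_onD)
    then consider "a (\<kappa> v) < a (\<kappa> v')" | "a (\<kappa> v') < a (\<kappa> v)" by linarith
    then show ?thesis
    proof cases
      case 1
      from fat_apart[OF place_fat[OF z(1) v(1) 3(1)] place_fat[OF z(2) v(2) 3(2)] this] show ?thesis by auto
    next
      case 2
      from fat_apart[OF place_fat[OF z(2) v(2) 3(2)] place_fat[OF z(1) v(1) 3(1)] this] show ?thesis by auto
    qed
  qed
qed

lemma place_eq:
  assumes z: "z \<in> positions" "z' \<in> positions" and v: "v \<in> K" "v' \<in> K" and eq: "place \<beta> a z v = place \<beta> a z' v'"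
  shows "v = v'" "v \<notin> B \<Longrightarrow> z (\<kappa> v) = z' (\<kappa> v)"
proof -
  have k: "\<kappa> v = \<kappa> v'"
  proof (rule ccontr)
    assume "\<kappa> v \<noteq> \<kappa> v'"
    from place_far[OF z v this] show False using eq u by simp
  qed
  then have B: "v \<in> B \<longleftrightarrow> v' \<in> B" using \<kappa>[OF v(1)] \<kappa>[OF v(2)] by simp
  have "v = v' \<and> (v \<notin> B \<longrightarrow> z (\<kappa> v) = z' (\<kappa> v))"
  proof (cases "v \<in> B")
    case True
    then have "\<beta> v = \<beta> v'" using eq B by (simp add: place_base)
    then show ?thesis using True B \<beta> by (auto simp: base_def dest: inj_onD)
  next
    case False
    have e: "\<sigma> * z (\<kappa> v) + ofs v = \<sigma> * z' (\<kappa> v) + ofs v'"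
      using eq False B k by (simp add: place_def centre_def)
    have o: "ofs v < \<sigma>" "ofs v' < \<sigma>" using ofs(2) v \<sigma> by fastforce+
    have "z (\<kappa> v) = z' (\<kappa> v)"
    proof -
      have "(\<sigma> * z (\<kappa> v) + ofs v) div \<sigma> = (\<sigma> * z' (\<kappa> v) + ofs v') div \<sigma>" using e by simp
      then show ?thesis using o by simp
    qed
    then have "ofs v = ofs v'" using e by simp
    then show ?thesis using ofs(1) v \<open>z (\<kappa> v) = z' (\<kappa> v)\<close> by (auto dest: inj_onD)
  qed
  then show "v = v'" "v \<notin> B \<Longrightarrow> z (\<kappa> v) = z' (\<kappa> v)" by auto
qed

lemma place_inj: "z \<in> positions \<Longrightarrow> inj_on (place \<beta> a z) K"
  using place_eq(1) by (intro inj_onI) blast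

lemma place_range: "z \<in> positions \<Longrightarrow> place \<beta> a z ` K \<subseteq> {1..n}"
proof
  fix x assume z: "z \<in> positions" and "x \<in> place \<beta> a z ` K"
  then obtain v where v: "v \<in> K" "x = place \<beta> a z v" by blast
  show "x \<in> {1..n}"
  proof (cases "v \<in> B")
    case True
    then show ?thesis using \<beta> v by (auto simp: base_def place_base)
  next
    case False
    show ?thesis
      using fat_range[OF place_fat[OF z v(1) False] trialD(1)[OF colour_in[OF v(1) False]]] u v(2) by auto
  qed
qed

lemma cpairs_range: "z \<in> positions \<Longrightarrow> cpairs (place \<beta> a z) \<subseteq> pairs {1..n}"
  using place_range unfolding cpairs_def pairs_def by blast

lemma cpairs_long:
  assumes "z \<in> positions" "(p, q) \<in> cpairs (place \<beta> a z)" shows "u \<le> 2 * (q - p)"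
proof -
  obtain v w where "p < q" "v \<in> K" "w \<in> K" "\<kappa> v \<noteq> \<kappa> w" "p = place \<beta> a z v" "q = place \<beta> a z w"
    using assms(2) by (auto simp: cpairs_def)
  then show ?thesis using place_far[OF assms(1,1), of v w] by auto
qed

lemma card_cedges:
  assumes "z \<in> positions" shows "card (cedges (place \<beta> a z)) = card (crossing F \<kappa> K)"
  unfolding cedges_image[OF place_inj[OF assms]] by (rule card_image[OF edge_image_inj[OF place_inj[OF assms]]])

lemma copy_cedges: "copy \<beta> a z \<subseteq> {\<omega>. \<forall>e\<in>cedges (place \<beta> a z). \<omega> e}"
proof (intro subsetI CollectI ballI)
  fix \<omega> e assume \<omega>: "\<omega> \<in> copy \<beta> a z" and "e \<in> cedges (place \<beta> a z)"
  then obtain v w where e: "e = (place \<beta> a z v, place \<beta> a z w)" "place \<beta> a z v < place \<beta> a z w"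
    "v \<in> K" "w \<in> K" "\<kappa> v \<noteq> \<kappa> w" "F v w" by (auto simp: cedges_def)
  then have "adjacency \<omega> (place \<beta> a z v) (place \<beta> a z w)" using \<omega> by (simp add: copy_def)
  then show "\<omega> e" using e(1,2) by (simp add: adjacency_def)
qed

text \<open>A position determines its vertex and its slot, so an edge shared by the two copies joins
  clusters in \<open>S\<close> or the root. The union of both edge sets is correspondingly large,
  and each of its edges has length at least u / 2. The local events are simply bounded by 1.\<close>

lemma copy_overlap:
  assumes z: "z \<in> positions" "z' \<in> positions"
  defines "S \<equiv> {j \<in> colours. z j = z' j}"
  shows "pr n (copy \<beta> a z \<inter> copy \<beta> a z') \<le> ((real u / 2) powr (- \<alpha>)) ^
     (2 * card (crossing F \<kappa> K) - card {(v, w) \<in> crossing F \<kappa> K. \<kappa> v \<in> insert 0 S \<and> \<kappa> w \<in> insert 0 S})"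
proof -
  let ?g = "place \<beta> a z" and ?g' = "place \<beta> a z'" and ?E = "crossing F \<kappa> K"
  let ?ES = "{(v, w) \<in> crossing F \<kappa> K. \<kappa> v \<in> insert 0 S \<and> \<kappa> w \<in> insert 0 S}"
  let ?D = "cedges ?g \<union> cedges ?g'"
  have finE: "finite ?E" using finK by simp
  have "cedges ?g \<inter> cedges ?g' \<subseteq> edge_image ?g ` ?ES"
  proof
    fix e assume e: "e \<in> cedges ?g \<inter> cedges ?g'"
    then obtain v w where vw: "(v, w) \<in> ?E" "e = edge_image ?g (v, w)" using cedges_image[OF place_inj[OF z(1)]] by auto
    obtain v' w' where vw': "(v', w') \<in> ?E" "e = edge_image ?g' (v', w')" using e cedges_image[OF place_inj[OF z(2)]] by auto
    have K: "v \<in> K" "w \<in> K" "v' \<in> K" "w' \<in> K" using vw vw' by (auto simp: crossing_def)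
    have "?g v = ?g' v' \<and> ?g w = ?g' w' \<or> ?g v = ?g' w' \<and> ?g w = ?g' v'"
      using vw(2) vw'(2) by (auto simp: edge_image_def min_def max_def split: if_splits)
    then have "(v \<notin> B \<longrightarrow> z (\<kappa> v) = z' (\<kappa> v)) \<and> (w \<notin> B \<longrightarrow> z (\<kappa> w) = z' (\<kappa> w))"
      using place_eq(2)[OF z] K by blast
    then have "\<kappa> v \<in> insert 0 S" "\<kappa> w \<in> insert 0 S"
      using K \<kappa> colour_in by (auto simp: S_def)
    then show "e \<in> edge_image ?g ` ?ES" using vw by blast
  qed
  then have "card (cedges ?g \<inter> cedges ?g') \<le> card (edge_image ?g ` ?ES)"
    by (intro card_mono finite_imageI finite_subset[OF _ finE]) auto
  also have "\<dots> \<le> card ?ES" by (intro card_image_le finite_subset[OF _ finE]) auto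
  finally have "card (cedges ?g \<inter> cedges ?g') \<le> card ?ES" .
  moreover have "card ?D + card (cedges ?g \<inter> cedges ?g') = 2 * card ?E"
    using card_Un_Int[OF finite_cedges finite_cedges, of ?g ?g'] card_cedges[OF z(1)] card_cedges[OF z(2)] by simp
  ultimately have cD: "2 * card ?E - card ?ES \<le> card ?D" by linarith
  have "copy \<beta> a z \<inter> copy \<beta> a z' \<subseteq> {\<omega>. \<forall>e\<in>?D. \<omega> e}"
    using copy_cedges[of z] copy_cedges[of z'] by blast
  then have "pr n (copy \<beta> a z \<inter> copy \<beta> a z') \<le> pr n {\<omega>. \<forall>e\<in>?D. \<omega> e}" by (rule pr_mono)
  also have "\<dots> \<le> ((real u / 2) powr (- \<alpha>)) ^ card ?D"
  proof (rule edges_prob_le)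
    show "?D \<subseteq> pairs {1..n}"
      using cedges_cpairs[of ?g] cedges_cpairs[of ?g'] cpairs_range[OF z(1)] cpairs_range[OF z(2)] by blast
    show "u \<le> 2 * (q - p)" if "(p, q) \<in> ?D" for p q
      using that cedges_cpairs[of ?g] cedges_cpairs[of ?g'] cpairs_long[OF z(1), of p q] cpairs_long[OF z(2), of p q] by blast
  qed
  also have "\<dots> \<le> ((real u / 2) powr (- \<alpha>)) ^ (2 * card ?E - card ?ES)"
  proof (rule power_decreasing[OF cD])
    have "1 \<le> real u / 2" using u_ge by simp
    then show "(real u / 2) powr (- \<alpha>) \<le> 1" using \<alpha>_pos by (simp add: powr_minus_divide ge_one_powr_ge_zero)
  qed simp
  finally show ?thesis .
qed

lemma locals_depend: "depends_on (\<Union>j\<in>colours. pairs (window a z j)) (\<Inter>j\<in>colours. local_copy n R j (centre (a j) (z j)))"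
  unfolding window_def using R by (intro depends_on_INT local_copy_depends) auto

lemma copy_depends: "depends_on (reach \<beta> a z) (copy \<beta> a z)"
  unfolding reach_def copy_def using depends_on_Int[OF cross_event_depends[of \<beta> a z, unfolded cross_event_def] locals_depend] .

lemma window_subset_fat:
  assumes "z \<in> positions" "j \<in> colours" shows "window a z j \<subseteq> fat (a j)"
proof
  fix x assume "x \<in> window a z j"
  then show "x \<in> fat (a j)"
    by (intro window_fat[OF positions_less[OF assms]]) (auto simp: window_def)
qed

lemma windows_disjoint:
  assumes "z \<in> positions" "z' \<in> positions" "i \<in> colours" "j \<in> colours" "i = j \<longrightarrow> z i \<noteq> z' i"
  shows "window a z i \<inter> window a z' j = {}"
proof (cases "i = j")
  case False
  then have "a i \<noteq> a j" using trialD(3) assms by (auto dest: inj_onD)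
  then show ?thesis
    using window_subset_fat[OF assms(1,3)] window_subset_fat[OF assms(2,4)] fat_disjoint by blast
next
  case True
  then have ne: "z i \<noteq> z' i" using assms(5) by simp
  have far: "centre k y + 2 * R < centre k y'" if "y < y'" for k y y'
  proof -
    have "\<sigma> * Suc y \<le> \<sigma> * y'" using that by (intro mult_left_mono) auto
    then show ?thesis using \<sigma> by (simp add: centre_def)
  qed
  have "window a z i \<inter> window a z' i = {}"
  proof (cases "z i < z' i")
    case True
    then show ?thesis using far[OF True, of "a i"] by (auto simp: window_def)
  next
    case False
    then have "z' i < z i" using ne by simp
    then show ?thesis using far[of "z' i" "z i" "a i"] by (auto simp: window_def)
  qed
  then show ?thesis using True by simp
qed

text \<open>Pairs between clusters are long and pairs in windows are short, so these two kinds never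
  coincide. If all slots differ, the windows of the two copies are disjoint, and so are their long
  pairs. Exact independence leaves only the agreeing copies in the variance.\<close>

lemma copies_indep:
  assumes z: "z \<in> positions" "z' \<in> positions" and ne: "\<And>j. j \<in> colours \<Longrightarrow> z j \<noteq> z' j"
  shows "pr n (copy \<beta> a z \<inter> copy \<beta> a z') = pr n (copy \<beta> a z) * pr n (copy \<beta> a z')"
proof (rule pr_indep[OF copy_depends copy_depends])
  have 1: "cpairs (place \<beta> a z) \<inter> cpairs (place \<beta> a z') = {}"
  proof (rule ccontr)
    assume "cpairs (place \<beta> a z) \<inter> cpairs (place \<beta> a z') \<noteq> {}"
    then obtain v w v' w' where *: "v \<in> K" "w \<in> K" "\<kappa> v \<noteq> \<kappa> w" "v' \<in> K" "w' \<in> K"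
      "place \<beta> a z v = place \<beta> a z' v'" "place \<beta> a z w = place \<beta> a z' w'" unfolding cpairs_def by auto
    have "v \<notin> B \<or> w \<notin> B" using * \<kappa> by metis
    then show False using place_eq(2)[OF z] * ne colour_in by metis
  qed
  have 2: "cpairs (place \<beta> a y) \<inter> pairs (window a y' j) = {}" if "y \<in> positions" for y y' j
    using cpairs_long[OF that] window_short[of _ _ a y' j] by fastforce
  have 3: "pairs (window a z i) \<inter> pairs (window a z' j) = {}" if "i \<in> colours" "j \<in> colours" for i j
    using windows_disjoint[OF z that] ne[OF that(1)] by (auto simp: pairs_def)
  show "reach \<beta> a z \<inter> reach \<beta> a z' = {}"
    unfolding reach_def using 1 2[OF z(1)] 2[OF z(2)] 3 by (simp add: Int_Un_distrib Int_Un_distrib2) blast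
qed

lemma reach_zone: assumes z: "z \<in> positions" shows "reach \<beta> a z \<subseteq> zone \<beta> a"
proof
  fix e assume "e \<in> reach \<beta> a z"
  then consider "e \<in> cpairs (place \<beta> a z)" | j where "j \<in> colours" "e \<in> pairs (window a z j)"
    by (auto simp: reach_def)
  then show "e \<in> zone \<beta> a"
  proof cases
    case 1
    then obtain p q v w where e: "e = (p, q)" "p < q" "v \<in> K" "w \<in> K" "\<kappa> v \<noteq> \<kappa> w" "p = place \<beta> a z v" "q = place \<beta> a z w"
      by (auto simp: cpairs_def)
    have in': "place \<beta> a z x \<in> (\<Union>j\<in>colours. fat (a j)) \<union> \<beta> ` B \<and> (x \<notin> B \<longrightarrow> place \<beta> a z x \<notin> \<beta> ` B)" if x: "x \<in> K" for x
    proof (cases "x \<in> B")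
      case True then show ?thesis by (simp add: place_base)
    next
      case False
      have f: "place \<beta> a z x \<in> fat (a (\<kappa> x))" by (rule place_fat[OF z x False])
      have "place \<beta> a z x \<noteq> \<beta> b" if "b \<in> B" for b
        using fat_base[OF f trialD(2)[OF colour_in[OF x False]] that] u by auto
      then show ?thesis using f colour_in[OF x False] by blast
    qed
    have "v \<notin> B \<or> w \<notin> B" using e \<kappa> by metis
    then show ?thesis unfolding e(1) zone_def mem_Collect_eq case_prod_conv
      using in'[OF e(3)] in'[OF e(4)] e(2,6,7) by auto
  next
    case 2
    then obtain p q where e: "e = (p, q)" "p < q" "p \<in> fat (a j)" "q \<in> fat (a j)"
      using window_subset_fat[OF z 2(1)] by (auto simp: pairs_def)
    have "p \<notin> \<beta> ` B" using fat_base[OF e(3) trialD(2)[OF 2(1)]] u by force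
    then show ?thesis using e 2(1) unfolding zone_def by blast
  qed
qed

text \<open>Long pairs and windows are disjoint, so the probability factorises. Only the edges
  between clusters contribute a power of n; the non-edges and the local copies cost
  constants.\<close>

lemma copy_prob_ge:
  assumes z: "z \<in> positions" and c: "0 < c" "\<And>j x. u \<le> x \<Longrightarrow> x + u \<le> n \<Longrightarrow> c \<le> pr n (local_copy n R j x)"
  shows "(2 powr (- \<alpha>) * real n powr (- \<alpha>)) ^ card (crossing F \<kappa> K) * (1 - 2 powr (- \<alpha>)) ^ (card K * card K) * c ^ card colours
     \<le> pr n (copy \<beta> a z)"
proof -
  let ?g = "place \<beta> a z" and ?x = "2 powr (- \<alpha>) * real n powr (- \<alpha>)" and ?y = "1 - 2 powr (- \<alpha>) :: real"
  let ?D = "cpairs (place \<beta> a z)"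
  have y: "0 \<le> ?y" "?y \<le> 1" using two_powr_less_1 by auto
  have "pr n (\<Inter>j\<in>colours. local_copy n R j (centre (a j) (z j))) = (\<Prod>j\<in>colours. pr n (local_copy n R j (centre (a j) (z j))))"
  proof (rule pr_indep_family[OF finite_colours])
    fix j show "depends_on (pairs (window a z j)) (local_copy n R j (centre (a j) (z j)))"
      unfolding window_def using R by (intro local_copy_depends) auto
  next
    fix i j assume "i \<in> colours" "j \<in> colours" "i \<noteq> j"
    then show "pairs (window a z i) \<inter> pairs (window a z j) = {}"
      using windows_disjoint[OF z z] by (auto simp: pairs_def)
  qed
  moreover have "c ^ card colours \<le> (\<Prod>j\<in>colours. pr n (local_copy n R j (centre (a j) (z j))))"
  proof -
    have "(\<Prod>j\<in>colours. c) \<le> (\<Prod>j\<in>colours. pr n (local_copy n R j (centre (a j) (z j))))"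
    proof (rule prod_mono, rule conjI)
      fix j assume j: "j \<in> colours"
      have b: "4 * u * a j + 2 * u \<le> centre (a j) (z j)" "centre (a j) (z j) < 4 * u * a j + 3 * u"
        using centre_bounds[OF positions_less[OF z j]] by auto
      have "4 * u * Suc (a j) \<le> 4 * u * M" using trialD(1)[OF j] by (intro mult_left_mono) auto
      then show "c \<le> pr n (local_copy n R j (centre (a j) (z j)))" using b M by (intro c(2)) auto
    qed (use c in auto)
    then show ?thesis by simp
  qed
  ultimately have loc: "c ^ card colours \<le> pr n (\<Inter>j\<in>colours. local_copy n R j (centre (a j) (z j)))" by simp
  have cr: "?x ^ card (crossing F \<kappa> K) * ?y ^ (card K * card K) \<le> pr n (cross_event \<beta> a z)"
  proof -
    define b where "b = (\<lambda>e. e \<in> cedges ?g)"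
    have Dn: "?D \<subseteq> pairs {1..n}" by (rule cpairs_range[OF z])
    have "{e \<in> ?D. b e} = cedges ?g" using cedges_cpairs[of ?g] by (auto simp: b_def)
    then have c1: "card (?D \<inter> {e. b e}) = card (crossing F \<kappa> K)" using card_cedges[OF z] by (simp add: Int_def)
    have "card ?D \<le> card (?g ` K \<times> ?g ` K)"
      by (intro card_mono) (use finK in \<open>auto simp: cpairs_def\<close>)
    also have "\<dots> \<le> card K * card K"
      unfolding card_cartesian_product using finK by (intro mult_mono card_image_le) auto
    finally have "card (?D \<inter> - {e. b e}) \<le> card K * card K"
      using card_mono[OF finite_cpairs, of "?D \<inter> - {e. b e}" ?g] by auto
    then have "?x ^ card (crossing F \<kappa> K) * ?y ^ (card K * card K) \<le> ?x ^ card (crossing F \<kappa> K) * ?y ^ card (?D \<inter> - {e. b e})"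
      using y by (intro mult_left_mono power_decreasing) auto
    also have "\<dots> = (\<Prod>e\<in>?D. if b e then ?x else ?y)"
      using finite_cpairs[of ?g] by (simp add: prod.If_cases c1)
    also have "\<dots> \<le> (\<Prod>(i, j)\<in>?D. if b (i, j) then edge_prob \<alpha> (j - i) else 1 - edge_prob \<alpha> (j - i))"
    proof (rule prod_mono, rule conjI)
      fix e assume "e \<in> ?D"
      then obtain i j where e: "e = (i, j)" "1 \<le> j - i" "j - i \<le> n" using Dn by (cases e) (auto simp: pairs_def)
      show "(if b e then ?x else ?y) \<le> (case e of (i, j) \<Rightarrow> if b (i, j) then edge_prob \<alpha> (j - i) else 1 - edge_prob \<alpha> (j - i))"
        using edge_prob_ge[OF e(2,3)] edge_prob_le_const[OF e(2)] e(1) by auto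
      show "0 \<le> (if b e then ?x else ?y)" using y by auto
    qed
    also have "\<dots> = pr n {\<omega>. \<forall>e\<in>?D. \<omega> e = b e}" by (rule pr_exact[OF Dn, symmetric])
    also have "\<dots> \<le> pr n (cross_event \<beta> a z)"
    proof (rule pr_mono, rule subsetI)
      fix \<omega> assume "\<omega> \<in> {\<omega>. \<forall>e\<in>?D. \<omega> e = b e}"
      then have \<omega>: "\<omega> e = b e" if "e \<in> ?D" for e using that by blast
      have less: "\<omega> (?g v, ?g w) \<longleftrightarrow> F v w" if vw: "v \<in> K" "w \<in> K" "\<kappa> v \<noteq> \<kappa> w" "?g v < ?g w" for v w
      proof -
        have "(?g v, ?g w) \<in> ?D" using vw unfolding cpairs_def by blast
        then have "\<omega> (?g v, ?g w) \<longleftrightarrow> (?g v, ?g w) \<in> cedges ?g" using \<omega> by (simp add: b_def)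
        also have "\<dots> \<longleftrightarrow> F v w"
        proof
          assume "(?g v, ?g w) \<in> cedges ?g"
          then obtain v' w' where "v' \<in> K" "w' \<in> K" "F v' w'" "?g v = ?g v'" "?g w = ?g w'" by (auto simp: cedges_def)
          then show "F v w" using place_eq(1)[OF z z] vw by metis
        next
          assume "F v w" then show "(?g v, ?g w) \<in> cedges ?g" using vw unfolding cedges_def by blast
        qed
        finally show ?thesis .
      qed
      show "\<omega> \<in> cross_event \<beta> a z" unfolding cross_event_def
      proof (intro CollectI ballI impI)
        fix v w assume vw: "v \<in> K" "w \<in> K" "\<kappa> v \<noteq> \<kappa> w"
        consider "?g v < ?g w" | "?g w < ?g v" using place_far[OF z z vw] u by linarith
        then show "adjacency \<omega> (?g v) (?g w) \<longleftrightarrow> F v w"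
        proof cases
          case 1 then show ?thesis using less[OF vw 1] by (simp add: adjacency_def)
        next
          case 2
          have "F w v \<longleftrightarrow> F v w" using sympD[OF symF] by blast
          then show ?thesis using less[OF vw(2,1) vw(3)[symmetric] 2] 2 by (simp add: adjacency_def)
        qed
      qed
    qed
    finally show ?thesis .
  qed
  have "pr n (copy \<beta> a z) = pr n (cross_event \<beta> a z) * pr n (\<Inter>j\<in>colours. local_copy n R j (centre (a j) (z j)))"
    unfolding copy_def cross_event_def[symmetric]
  proof (rule pr_indep[OF cross_event_depends locals_depend])
    show "cpairs ?g \<inter> (\<Union>j\<in>colours. pairs (window a z j)) = {}"
      using cpairs_long[OF z] window_short[of _ _ a z] by fastforce
  qed
  moreover have "?x ^ card (crossing F \<kappa> K) * ?y ^ (card K * card K) * c ^ card colours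
      \<le> pr n (cross_event \<beta> a z) * pr n (\<Inter>j\<in>colours. local_copy n R j (centre (a j) (z j)))"
    using c(1) y by (intro mult_mono cr loc) auto
  ultimately show ?thesis by simp
qed

end

end

section \<open>Extensions of copies\<close>

context exponent
begin

lemma dense_ext_refl: "finite A \<Longrightarrow> dense_ext \<theta> E A A"
  unfolding dense_ext_def
proof (intro conjI allI impI)
  fix c :: "nat \<Rightarrow> nat" assume "finite A" "\<forall>v\<in>A. c v = 0"
  then have "blocks c A = 0" using blocks_eq_0_iff[of A c] by simp
  then show "(1 + \<theta>) * real (blocks c A) \<le> \<alpha> * real (card (crossing E c A))" using \<alpha>_pos by simp
qed auto

lemma dense_ext_Un:
  assumes "dense_ext \<theta> E A S" "dense_ext \<theta> E A T" shows "dense_ext \<theta> E A (S \<union> T)"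
proof -
  have "A \<subseteq> S" "finite S" using assms by (auto simp: dense_ext_def)
  then have "dense_ext \<theta> E S (S \<union> T)" by (intro dense_ext_mono[OF assms(2)])
  with assms(1) show ?thesis by (rule dense_ext_trans)
qed

lemma dense_ext_UN:
  assumes "finite J" "finite A" "0 \<le> \<theta>" "\<And>j. j \<in> J \<Longrightarrow> dense_ext \<theta> E A (A \<union> X j)"
  shows "dense_ext \<theta> E A (A \<union> (\<Union>j\<in>J. X j))"
  using assms
proof (induction J rule: finite_induct)
  case empty
  then show ?case by (simp add: dense_ext_refl)
next
  case (insert j J)
  have "dense_ext \<theta> E A ((A \<union> X j) \<union> (A \<union> (\<Union>j\<in>J. X j)))"
    by (rule dense_ext_Un) (use insert in simp_all)
  moreover have "(A \<union> X j) \<union> (A \<union> (\<Union>j\<in>J. X j)) = A \<union> (\<Union>j\<in>insert j J. X j)" by auto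
  ultimately show ?case by simp
qed

end

section \<open>Number of copies found by one trial, and what may spoil them\<close>

context trial_geometry
begin

abbreviation phi :: real where "phi \<equiv> (real u / 2) powr (- \<alpha>)"
abbreviation ncross :: nat where "ncross \<equiv> card (crossing F \<kappa> K)"
definition nsub :: "nat set \<Rightarrow> nat" where
  "nsub S = card {(v, w) \<in> crossing F \<kappa> K. \<kappa> v \<in> insert 0 S \<and> \<kappa> w \<in> insert 0 S}"

text \<open>Copies that agree in no slot are independent and contribute at most the squared mean.
  The others are sorted by a nonempty set \<open>S\<close> of colours on which the slots agree:
  there are \<open>G ^ (2 * card colours - card S)\<close> such pairs, and the hypothesis on
  \<delta> makes their joint probability negligible. The factor \<open>2 ^ card colours\<close>
  counts the sets \<open>S\<close>.\<close>

lemma trial_small: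
  assumes \<beta>: "base \<beta>" and a: "trial \<beta> a" and G: "0 < G" and p0: "0 < p0" "\<And>z. z \<in> positions \<Longrightarrow> p0 \<le> pr n (copy \<beta> a z)"
    and \<delta>: "\<And>S. S \<subseteq> colours \<Longrightarrow> S \<noteq> {} \<Longrightarrow>
      real G ^ (2 * card colours - card S) * phi ^ (2 * ncross - nsub S) \<le> \<delta> * (real G ^ card colours * p0)\<^sup>2"
  shows "pr n {\<omega>. real (card {z\<in>positions. \<omega> \<in> copy \<beta> a z}) \<le> real G ^ card colours * p0 / 2} \<le> 4 * (2 ^ card colours * \<delta>)"
proof -
  let ?h = "card colours"
  define \<mu> where "\<mu> = (\<Sum>z\<in>positions. pr n (copy \<beta> a z))"
  define \<mu>0 where "\<mu>0 = real G ^ ?h * p0"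
  have "(\<Sum>z\<in>positions. p0) \<le> \<mu>" unfolding \<mu>_def by (intro sum_mono p0)
  then have \<mu>0: "\<mu>0 \<le> \<mu>" "0 < \<mu>0" using G p0 by (auto simp: \<mu>0_def card_positions)
  let ?PS = "Pow colours - {{}}"
  have finPS: "finite ?PS" using finite_colours by simp
  have agree: "card {z'\<in>positions. \<forall>j\<in>S. z j = z' j} = G ^ (?h - card S)" if S: "S \<subseteq> colours" and z: "z \<in> positions" for S z
  proof -
    have "{z'\<in>positions. \<forall>j\<in>S. z j = z' j} = PiE colours (\<lambda>j. if j \<in> S then {z j} else {..<G})"
      using S z unfolding positions_def by (auto simp: PiE_iff extensional_def split: if_splits)
    then have "card {z'\<in>positions. \<forall>j\<in>S. z j = z' j} = (\<Prod>j\<in>colours. if j \<in> S then 1 else G)"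
      by (simp add: card_PiE finite_colours if_distrib[of card] cong: if_cong)
    also have "\<dots> = G ^ card (colours - S)"
      using finite_colours by (simp add: prod.If_cases Diff_eq)
    also have "card (colours - S) = ?h - card S" using S finite_colours by (simp add: card_Diff_subset finite_subset)
    finally show ?thesis .
  qed
  have "(\<Sum>z\<in>positions. \<Sum>z'\<in>positions. pr n (copy \<beta> a z \<inter> copy \<beta> a z'))
      \<le> (\<Sum>z\<in>positions. \<Sum>z'\<in>positions. pr n (copy \<beta> a z) * pr n (copy \<beta> a z') +
          (\<Sum>S\<in>?PS. if \<forall>j\<in>S. z j = z' j then phi ^ (2 * ncross - nsub S) else 0))"
  proof (intro sum_mono)
    fix z z' assume z: "z \<in> positions" "z' \<in> positions"
    let ?S = "{j \<in> colours. z j = z' j}"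
    let ?R = "\<Sum>S\<in>?PS. if \<forall>j\<in>S. z j = z' j then phi ^ (2 * ncross - nsub S) else 0"
    have R0: "0 \<le> ?R" by (intro sum_nonneg) auto
    show "pr n (copy \<beta> a z \<inter> copy \<beta> a z') \<le> pr n (copy \<beta> a z) * pr n (copy \<beta> a z') + ?R"
    proof (cases "?S = {}")
      case True
      then have "pr n (copy \<beta> a z \<inter> copy \<beta> a z') = pr n (copy \<beta> a z) * pr n (copy \<beta> a z')"
        by (intro copies_indep[OF \<beta> a z]) auto
      then show ?thesis using R0 by simp
    next
      case False
      have "pr n (copy \<beta> a z \<inter> copy \<beta> a z') \<le> phi ^ (2 * ncross - nsub ?S)"
        using copy_overlap[OF \<beta> a z] unfolding nsub_def .
      also have "\<dots> = (if \<forall>j\<in>?S. z j = z' j then phi ^ (2 * ncross - nsub ?S) else 0)" by simp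
      also have "\<dots> \<le> ?R"
        using False finPS by (intro member_le_sum[of ?S ?PS "\<lambda>S. if \<forall>j\<in>S. z j = z' j then phi ^ (2 * ncross - nsub S) else 0"]) auto
      finally show ?thesis by (simp add: add_increasing)
    qed
  qed
  also have "\<dots> = \<mu>\<^sup>2 + (\<Sum>z\<in>positions. \<Sum>z'\<in>positions. \<Sum>S\<in>?PS. if \<forall>j\<in>S. z j = z' j then phi ^ (2 * ncross - nsub S) else 0)"
    by (simp add: sum.distrib \<mu>_def power2_eq_square sum_product)
  also have "(\<Sum>z\<in>positions. \<Sum>z'\<in>positions. \<Sum>S\<in>?PS. if \<forall>j\<in>S. z j = z' j then phi ^ (2 * ncross - nsub S) else 0)
     = (\<Sum>z\<in>positions. \<Sum>S\<in>?PS. \<Sum>z'\<in>positions. if \<forall>j\<in>S. z j = z' j then phi ^ (2 * ncross - nsub S) else 0)"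
    by (intro sum.cong refl sum.swap)
  also have "\<dots> = (\<Sum>z\<in>positions. \<Sum>S\<in>?PS. real G ^ (?h - card S) * phi ^ (2 * ncross - nsub S))"
  proof (intro sum.cong refl)
    fix z S assume z: "z \<in> positions" and "S \<in> ?PS"
    then have S: "S \<subseteq> colours" by simp
    have "(\<Sum>z'\<in>positions. if \<forall>j\<in>S. z j = z' j then phi ^ (2 * ncross - nsub S) else 0)
        = real (card {z'\<in>positions. \<forall>j\<in>S. z j = z' j}) * phi ^ (2 * ncross - nsub S)"
      using finite_positions by (simp add: sum.If_cases Int_def)
    then show "(\<Sum>z'\<in>positions. if \<forall>j\<in>S. z j = z' j then phi ^ (2 * ncross - nsub S) else 0)
        = real G ^ (?h - card S) * phi ^ (2 * ncross - nsub S)" using agree[OF S z] by simp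
  qed
  also have "\<dots> = (\<Sum>S\<in>?PS. real G ^ ?h * (real G ^ (?h - card S) * phi ^ (2 * ncross - nsub S)))"
    by (simp add: card_positions sum_distrib_left)
  also have "\<dots> \<le> (\<Sum>S\<in>?PS. \<delta> * \<mu>0\<^sup>2)"
  proof (rule sum_mono)
    fix S assume S: "S \<in> ?PS"
    then have "card S \<le> ?h" using finite_colours by (intro card_mono) auto
    then have "?h + (?h - card S) = 2 * ?h - card S" by simp
    then have "real G ^ ?h * (real G ^ (?h - card S) * phi ^ (2 * ncross - nsub S)) = real G ^ (2 * ?h - card S) * phi ^ (2 * ncross - nsub S)"
      by (simp add: power_add[symmetric] mult.assoc[symmetric])
    also have "\<dots> \<le> \<delta> * \<mu>0\<^sup>2" unfolding \<mu>0_def using S by (intro \<delta>) auto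
    finally show "real G ^ ?h * (real G ^ (?h - card S) * phi ^ (2 * ncross - nsub S)) \<le> \<delta> * \<mu>0\<^sup>2" .
  qed
  also have "\<dots> \<le> (2 ^ ?h * \<delta>) * \<mu>\<^sup>2"
  proof -
    have "0 \<le> \<delta> * \<mu>0\<^sup>2" using \<delta>[of colours] colours_nonempty unfolding \<mu>0_def
      by (intro order_trans[OF _ \<delta>[of colours]]) auto
    then have d0: "0 \<le> \<delta>" using \<mu>0(2) by (simp add: zero_le_mult_iff)
    have "card ?PS \<le> 2 ^ ?h" using finite_colours card_mono[of "Pow colours" ?PS] by (simp add: card_Pow)
    then have r1: "real (card ?PS) \<le> 2 ^ ?h" by (metis of_nat_le_iff of_nat_numeral of_nat_power)
    have r2: "\<delta> * \<mu>0\<^sup>2 \<le> \<delta> * \<mu>\<^sup>2" using \<mu>0 d0 by (intro mult_left_mono power_mono) auto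
    have "real (card ?PS) * (\<delta> * \<mu>0\<^sup>2) \<le> 2 ^ ?h * (\<delta> * \<mu>\<^sup>2)"
      by (rule mult_mono[OF r1 r2]) (use d0 in auto)
    then show ?thesis by simp
  qed
  finally have sq: "(\<Sum>z\<in>positions. \<Sum>z'\<in>positions. pr n (copy \<beta> a z \<inter> copy \<beta> a z')) \<le> (1 + 2 ^ ?h * \<delta>) * \<mu>\<^sup>2"
    by (simp add: distrib_right)
  have "pr n {\<omega>. real (card {z\<in>positions. \<omega> \<in> copy \<beta> a z}) \<le> \<mu>0 / 2} \<le> pr n {\<omega>. real (card {z\<in>positions. \<omega> \<in> copy \<beta> a z}) \<le> \<mu> / 2}"
    by (rule pr_mono) (use \<mu>0 in auto)
  also have "\<dots> \<le> 4 * (2 ^ ?h * \<delta>)"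
    by (rule pmf_second_moment[OF finite_positions \<mu>_def _ sq]) (use \<mu>0 in auto)
  finally show ?thesis by (simp add: \<mu>0_def)
qed

text \<open>The long edge must have an end in \<open>X\<close>, so it is not an edge of the copy,
  and an end in the fat part of this trial, so it can be charged to at most two trials of a disjoint
  family.\<close>

definition far_bad :: "(nat \<Rightarrow> nat) \<Rightarrow> (nat \<Rightarrow> nat) \<Rightarrow> (nat \<Rightarrow> nat) \<Rightarrow> (nat \<times> nat \<Rightarrow> bool) \<Rightarrow> bool" where
  "far_bad \<beta> a z \<omega> \<longleftrightarrow> (\<exists>X p q. X \<subseteq> {1..n} \<and> X \<inter> place \<beta> a z ` K = {} \<and> card X \<le> m \<and>
     iext (adjacency \<omega>) (place \<beta> a z ` K) (place \<beta> a z ` K \<union> X) \<and> \<omega> (p, q) \<and> p < q \<and> l < q - p \<and>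
     p \<in> X \<union> place \<beta> a z ` K \<and> q \<in> X \<union> place \<beta> a z ` K \<and> (p \<in> X \<or> q \<in> X) \<and>
     (p \<in> (\<Union>j\<in>colours. fat (a j)) \<or> q \<in> (\<Union>j\<in>colours. fat (a j))))"

lemma cluster_place:
  assumes "j \<in> colours" shows "cluster j (centre (a j) (z j)) = place \<beta> a z ` cls j"
proof -
  have "v \<notin> B" if "v \<in> cls j" for v using that assms \<kappa>[of v] by (auto simp: cls_def colours_def)
  then show ?thesis unfolding cluster_def by (intro image_cong refl) (auto simp: place_def cls_def)
qed

text \<open>An extension touching the new vertices is either local, hence excluded by \<open>local_copy\<close>, or leaves the
  window through an edge longer than \<open>l\<close>.\<close>

lemma copy_extension:
  assumes \<beta>: "base \<beta>" and a: "trial \<beta> a" and z: "z \<in> positions" and \<omega>: "\<omega> \<in> copy \<beta> a z" and nf: "\<not> far_bad \<beta> a z \<omega>"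
    and W: "W \<subseteq> {1..n}" "card (W - place \<beta> a z ` K) \<le> m" "iext (adjacency \<omega>) (place \<beta> a z ` K) (place \<beta> a z ` K \<union> W)"
    and x0: "x0 \<in> W - place \<beta> a z ` K" and f0: "f0 \<in> place \<beta> a z ` (K - B)"
  shows "\<not> adjacency \<omega> x0 f0"
proof
  assume adj0: "adjacency \<omega> x0 f0"
  let ?E = "adjacency \<omega>"
  define P where "P = place \<beta> a z ` K"
  define X0 where "X0 = W - P"
  have x0X: "x0 \<in> X0" using x0 by (simp add: X0_def P_def)
  have PX0: "P \<union> W = P \<union> X0" by (auto simp: X0_def)
  have ie0: "iext ?E P (P \<union> X0)" using W(3) PX0 by (simp add: P_def)
  \<comment> \<open>Only the component of \<open>x0\<close> among the new vertices is kept. It is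
    still dense over the copy, as no edge joins it to the other new vertices.\<close>
  define r where "r = {(x, y). x \<in> X0 \<and> y \<in> X0 \<and> ?E x y}"
  define C where "C = r\<^sup>* `` {x0}"
  have CX0: "C \<subseteq> X0"
  proof
    fix x assume "x \<in> C"
    then have "(x0, x) \<in> r\<^sup>*" by (simp add: C_def)
    then show "x \<in> X0" by (induction rule: rtrancl_induct) (use x0X in \<open>auto simp: r_def\<close>)
  qed
  have x0C: "x0 \<in> C" by (simp add: C_def)
  have finX0: "finite X0" using W(1) finite_subset[of W "{1..n}"] by (auto simp: X0_def)
  have finC: "finite C" using CX0 finX0 by (rule finite_subset)
  have cC: "card C \<le> m" using card_mono[OF finX0 CX0] W(2) by (simp add: X0_def P_def)
  have CP: "C \<inter> P = {}" using CX0 by (auto simp: X0_def)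
  have Cn: "C \<subseteq> {1..n}" using CX0 W(1) by (auto simp: X0_def)
  have closed: "y \<in> C" if "x \<in> C" "y \<in> X0" "?E x y" for x y
  proof -
    have "(x, y) \<in> r" using that CX0 by (auto simp: r_def)
    then show ?thesis using that(1) by (auto simp: C_def intro: rtrancl_into_rtrancl)
  qed
  have ieC: "iext ?E P (P \<union> C)"
  proof -
    have "iext ?E (P \<inter> (P \<union> C)) (P \<union> C)"
    proof (rule iext_restrict[OF ie0 _ symp_adjacency])
      show "P \<union> C \<subseteq> P \<union> X0" using CX0 by auto
      fix x y assume "x \<in> P \<union> C - P" "y \<in> P \<union> X0 - (P \<union> C)"
      then show "\<not> ?E x y" using closed by blast
    qed
    moreover have "P \<inter> (P \<union> C) = P" by auto
    ultimately show ?thesis by simp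
  qed
  \<comment> \<open>A longer edge would make the copy \<open>far_bad\<close>, with \<open>C\<close>
    as the extension.\<close>
  have short: "dst x y \<le> real l" if xy: "?E x y" "x \<in> C" "y \<in> C \<union> P" and fat: "x \<in> (\<Union>j\<in>colours. fat (a j)) \<or> y \<in> (\<Union>j\<in>colours. fat (a j))" for x y
  proof (rule ccontr)
    assume "\<not> dst x y \<le> real l"
    then have long: "real l < dst x y" by simp
    have "x \<noteq> y" using xy(1) by (auto simp: adjacency_def)
    then consider "x < y" | "y < x" by linarith
    then show False
    proof cases
      case 1
      then have "\<omega> (x, y)" "l < y - x" using xy(1) long by (auto simp: adjacency_def dst_def)
      then have "far_bad \<beta> a z \<omega>" unfolding far_bad_def P_def[symmetric]
        by (intro exI[of _ C] exI[of _ x] exI[of _ y]) (use Cn CP cC ieC 1 xy fat in auto)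
      then show False using nf by simp
    next
      case 2
      then have "\<omega> (y, x)" "l < x - y" using xy(1) long by (auto simp: adjacency_def dst_def)
      then have "far_bad \<beta> a z \<omega>" unfolding far_bad_def P_def[symmetric]
        by (intro exI[of _ C] exI[of _ y] exI[of _ x]) (use Cn CP cC ieC 2 xy fat in auto)
      then show False using nf by simp
    qed
  qed
  obtain v0 where v0: "v0 \<in> K" "v0 \<notin> B" "f0 = place \<beta> a z v0" using f0 by blast
  define j where "j = \<kappa> v0"
  define c where "c = centre (a j) (z j)"
  have j: "j \<in> colours" using colour_in v0 by (simp add: j_def)
  have f0c: "f0 = c + ofs v0" "ofs v0 < card K" using v0 ofs(2) by (auto simp: place_def c_def j_def)
  have near: "y \<in> window a z j" if "dst y f0 \<le> real ((m + 1) * l)" for y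
  proof -
    have "real y \<le> real f0 + real ((m + 1) * l)" "real f0 \<le> real y + real ((m + 1) * l)"
      using that unfolding dst_def by linarith+
    then have "y \<le> f0 + (m + 1) * l" "f0 \<le> y + (m + 1) * l" by (metis of_nat_add of_nat_le_iff)+
    then have "y \<le> c + R" "c \<le> y + R" using f0c R by linarith+
    then show ?thesis unfolding window_def c_def[symmetric] by auto
  qed
  have wfat: "y \<in> (\<Union>j\<in>colours. fat (a j))" if "y \<in> window a z j" for y
    using window_subset_fat[OF \<beta> a z j] that j by blast
  \<comment> \<open>By connectedness every increase of the radius by \<open>l\<close> catches a new
    vertex until all of \<open>C\<close> is caught. As \<open>C\<close> has at most \<open>m\<close>
    vertices, it stays within distance m l of \<open>f0\<close>, and its neighbours in the copy
    within (m + 1) l, which is inside the window.\<close>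
  define D where "D = (\<lambda>k. {x \<in> C. dst x f0 \<le> real (k * l)})"
  have grow: "1 \<le> k \<Longrightarrow> k \<le> m \<Longrightarrow> x0 \<in> D k \<and> (k \<le> card (D k) \<or> D k = C)" for k
  proof (induction k rule: nat_induct_at_least)
    case base
    have "f0 \<in> window a z j" by (rule near) (simp add: dst_def)
    then have "dst x0 f0 \<le> real l" using adj0 x0C v0 by (intro short wfat disjI2) (auto simp: P_def)
    then have "x0 \<in> D 1" using x0C by (simp add: D_def)
    moreover have "finite (D 1)" using finC by (simp add: D_def)
    ultimately show ?case by (metis One_nat_def Suc_leI card_gt_0_iff empty_iff)
  next
    case (Suc k)
    then have IH: "x0 \<in> D k" "k \<le> card (D k) \<or> D k = C" by auto
    have le: "real (k * l) \<le> real (Suc k * l)" by (intro of_nat_mono mult_le_mono1) simp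
    have sub: "D k \<subseteq> D (Suc k)"
      unfolding D_def by (intro subsetI CollectI conjI; elim CollectE conjE) (assumption, erule order_trans[OF _ le])
    have subC: "D i \<subseteq> C" for i by (auto simp: D_def)
    show ?case
    proof (cases "D k = C")
      case True
      then show ?thesis using sub subC IH by blast
    next
      case False
      have "\<exists>x y. x \<in> D k \<and> y \<in> C - D k \<and> ?E x y"
      proof (rule ccontr)
        assume no: "\<not> ?thesis"
        have "x \<in> D k" if "(x0, x) \<in> r\<^sup>*" for x
          using that
        proof (induction rule: rtrancl_induct)
          case (step y x)
          have "x \<in> C" using step.hyps by (auto simp: C_def)
          then show ?case using no step by (auto simp: r_def)
        qed (rule IH)
        then have "C \<subseteq> D k" by (auto simp: C_def)
        then show False using False subC by blast
      qed
      then obtain x y where xy: "x \<in> D k" "y \<in> C" "y \<notin> D k" "?E x y" by blast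
      have "dst x f0 \<le> real (k * l)" using xy by (simp add: D_def)
      moreover have "real (k * l) \<le> real ((m + 1) * l)" using Suc.prems by (intro of_nat_mono mult_le_mono1) simp
      ultimately have "x \<in> window a z j" by (intro near) linarith
      then have "dst x y \<le> real l" using xy subC by (intro short wfat disjI1) auto
      moreover have "dst y f0 \<le> dst x y + dst x f0" by (auto simp: dst_def)
      moreover have "real l + real (k * l) = real (Suc k * l)" by simp
      ultimately have "dst y f0 \<le> real (Suc k * l)" using \<open>dst x f0 \<le> real (k * l)\<close> by linarith
      then have "y \<in> D (Suc k)" unfolding D_def using xy(2) by (intro CollectI conjI)
      then have "D k \<subset> D (Suc k)" using sub xy by blast
      then have "card (D k) < card (D (Suc k))" using finC subC by (intro psubset_card_mono finite_subset[OF subC]) auto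
      then have "Suc k \<le> card (D (Suc k))" using IH(2) False by linarith
      then show ?thesis using sub IH by blast
    qed
  qed
  have "1 \<le> card C" using x0C finC by (metis One_nat_def Suc_leI card_gt_0_iff empty_iff)
  then have m1: "1 \<le> m" using cC by simp
  have all: "D (card C) = C"
  proof -
    have "card C \<le> card (D (card C)) \<or> D (card C) = C" using grow[OF \<open>1 \<le> card C\<close> cC] by simp
    moreover have "D (card C) \<subseteq> C" by (auto simp: D_def)
    ultimately show ?thesis using card_seteq[OF finC] by blast
  qed
  have dC: "dst x f0 \<le> real (m * l)" if "x \<in> C" for x
  proof -
    have "dst x f0 \<le> real (card C * l)" using that all by (auto simp: D_def)
    also have "\<dots> \<le> real (m * l)" using cC by (intro of_nat_mono mult_le_mono1)
    finally show ?thesis .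
  qed
  have Cw: "C \<subseteq> window a z j"
  proof
    fix x assume "x \<in> C"
    from dC[OF this] show "x \<in> window a z j" by (intro near) (simp add: algebra_simps)
  qed
  define Q where "Q = cluster j c"
  have QP: "Q \<subseteq> P" unfolding Q_def c_def cluster_place[OF j, where \<beta> = \<beta>] P_def using cls_subset by blast
  \<comment> \<open>A neighbour inside the window lies in the fat part of the block
    \<open>a j\<close>, so it is neither a root vertex nor in another cluster.\<close>
  have only: "f \<in> Q" if f: "f \<in> P" "x \<in> C" "?E x f" for f x
  proof -
    have "dst x f \<le> real l" using f Cw by (intro short wfat disjI1) auto
    moreover have "dst f f0 \<le> dst x f + dst x f0" by (auto simp: dst_def)
    ultimately have "dst f f0 \<le> real ((m + 1) * l)" using dC[OF f(2)] by (simp add: algebra_simps)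
    then have fw: "f \<in> window a z j" by (rule near)
    then have ff: "f \<in> fat (a j)" using window_subset_fat[OF \<beta> a z j] by blast
    obtain w where w: "w \<in> K" "f = place \<beta> a z w" using f(1) by (auto simp: P_def)
    have "w \<notin> B"
    proof
      assume "w \<in> B"
      then show False using fat_base[OF ff trialD(2)[OF \<beta> a j], of w] w(2) u_ge by (simp add: place_base[OF \<beta> a])
    qed
    then have "f \<in> fat (a (\<kappa> w))" "\<kappa> w \<in> colours" using place_fat[OF \<beta> a z w(1)] w(2) colour_in[OF w(1)] by auto
    then have "a (\<kappa> w) = a j" using ff fat_disjoint by blast
    then have "\<kappa> w = j" using trialD(3)[OF \<beta> a] j \<open>\<kappa> w \<in> colours\<close> by (auto dest: inj_onD)
    then show ?thesis unfolding Q_def c_def cluster_place[OF j, where \<beta> = \<beta>] using w by (auto simp: cls_def)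
  qed
  have "iext ?E (P \<inter> (Q \<union> C)) (Q \<union> C)"
  proof (rule iext_restrict[OF ieC _ symp_adjacency])
    show "Q \<union> C \<subseteq> P \<union> C" using QP by auto
    fix x y assume "x \<in> Q \<union> C - P" "y \<in> P \<union> C - (Q \<union> C)"
    then show "\<not> ?E x y" using only QP by blast
  qed
  moreover have "P \<inter> (Q \<union> C) = Q" using QP CP by auto
  ultimately have "iext ?E Q (Q \<union> C)" by simp
  moreover have "\<omega> \<in> local_copy n R j c" using \<omega> j by (auto simp: copy_def c_def)
  moreover have "C \<subseteq> {1..n} \<inter> {c - R..c + R}" using Cn Cw unfolding window_def c_def[symmetric] by (rule Int_greatest)
  moreover have "Q \<inter> C = {}" using QP CP by auto
  ultimately show False using x0C cC unfolding local_copy_def Q_def by blast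
qed

section \<open>Independent trials\<close>

definition trials :: "(nat \<Rightarrow> nat) \<Rightarrow> nat set \<Rightarrow> (nat \<Rightarrow> nat \<Rightarrow> nat) \<Rightarrow> bool" where
  "trials \<beta> T a \<longleftrightarrow> finite T \<and> (\<forall>t\<in>T. trial \<beta> (a t)) \<and>
     (\<forall>t\<in>T. \<forall>t'\<in>T. \<forall>j\<in>colours. \<forall>j'\<in>colours. a t j = a t' j' \<longrightarrow> t = t')"

lemma trials_subset: "trials \<beta> T a \<Longrightarrow> T' \<subseteq> T \<Longrightarrow> trials \<beta> T' a"
  unfolding trials_def by (blast intro: finite_subset)

lemma trials_fat:
  assumes "trials \<beta> T a" "t \<in> T" "t' \<in> T" "x \<in> (\<Union>j\<in>colours. fat (a t j))" "x \<in> (\<Union>j\<in>colours. fat (a t' j))"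
  shows "t = t'"
proof -
  obtain j j' where j: "j \<in> colours" "x \<in> fat (a t j)" "j' \<in> colours" "x \<in> fat (a t' j')" using assms(4,5) by blast
  then have "a t j = a t' j'" using fat_disjoint by blast
  then show ?thesis using assms(1-3) j unfolding trials_def by blast
qed

lemma fat_not_base:
  assumes "trial \<beta> a" "x \<in> (\<Union>j\<in>colours. fat (a j))" shows "x \<notin> \<beta> ` B"
proof
  assume "x \<in> \<beta> ` B"
  then obtain b j where bj: "b \<in> B" "x = \<beta> b" "j \<in> colours" "x \<in> fat (a j)" using assms(2) by blast
  then have "avoids \<beta> (a j)" using assms(1) by (simp add: trial_def)
  from fat_base[OF bj(4) this bj(1)] show False using bj(2) u_ge by simp
qed

lemma zones_disjoint:
  assumes "trials \<beta> T a" "t \<in> T" "t' \<in> T" "t \<noteq> t'" shows "zone \<beta> (a t) \<inter> zone \<beta> (a t') = {}"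
proof -
  have tr: "trial \<beta> (a t)" "trial \<beta> (a t')" using assms by (auto simp: trials_def)
  have False if z: "(p, q) \<in> zone \<beta> (a t)" "(p, q) \<in> zone \<beta> (a t')" for p q
  proof -
    have "p \<notin> \<beta> ` B \<or> q \<notin> \<beta> ` B" using z(1) by (auto simp: zone_def)
    then show False
    proof
      assume "p \<notin> \<beta> ` B"
      then show False using z trials_fat[OF assms(1-3), of p] assms(4) by (auto simp: zone_def)
    next
      assume "q \<notin> \<beta> ` B"
      then show False using z trials_fat[OF assms(1-3), of q] assms(4) by (auto simp: zone_def)
    qed
  qed
  then show ?thesis by auto
qed

text \<open>The extensions of the 2 r copies together form a dense extension of the union of the
  copies. Each contributes a long edge that meets its own fat part; an edge has two ends and serves
  at most two trials, which leaves at least r different long edges. The edges of the copies are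
  exposed and yield the power of \<open>phi\<close>. Pairs inside a single copy are removed from the
  witness, which makes it disjoint from the exposed edges.\<close>

lemma far_prob:
  assumes \<beta>: "base \<beta>" and T: "trials \<beta> T a" "card T = 2 * r" and z: "\<And>t. t \<in> T \<Longrightarrow> z t \<in> positions"
    and \<theta>: "0 < \<theta>" "\<And>E A S. iext E A S \<Longrightarrow> card (S - A) \<le> m \<Longrightarrow> dense_ext \<theta> E A S"
    and C: "\<And>F g A E. F \<subseteq> {1..n} \<Longrightarrow> card F \<le> 2 * r * card K \<Longrightarrow> depends_on A E \<Longrightarrow>
    pr n (E \<inter> {\<omega>. \<exists>X D. X \<subseteq> {1..n} - F \<and> card X \<le> 2 * r * m \<and> D \<in> dense_graphs \<theta> l g F X \<and> D \<inter> A = {} \<and> (\<forall>e\<in>D. \<omega> e)})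
      \<le> pr n E * (C * real l powr (- (\<theta> / (2 * (1 + \<theta>)) * \<alpha> * real g)))" "0 < C"
  shows "pr n {\<omega>. \<forall>t\<in>T. (\<forall>e\<in>cedges (place \<beta> (a t) (z t)). \<omega> e) \<and> far_bad \<beta> (a t) (z t) \<omega>}
     \<le> phi ^ (2 * r * ncross) * (C * real l powr (- (\<theta> / (2 * (1 + \<theta>)) * \<alpha> * real r)))"
proof -
  define P where "P = (\<lambda>t. place \<beta> (a t) (z t) ` K)"
  define Fs where "Fs = (\<Union>t\<in>T. P t)"
  define Q where "Q = (\<Union>t\<in>T. cedges (place \<beta> (a t) (z t)))"
  define Q' where "Q' = (\<Union>t\<in>T. pairs (P t))"
  define E0 where "E0 = {\<omega>. \<forall>e\<in>Q. \<omega> e}"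
  have finT: "finite T" using T by (simp add: trials_def)
  have tr: "trial \<beta> (a t)" if "t \<in> T" for t using T that by (simp add: trials_def)
  have Pn: "P t \<subseteq> {1..n}" if "t \<in> T" for t
    unfolding P_def by (rule place_range[OF \<beta> tr[OF that] z[OF that]])
  have Fn: "Fs \<subseteq> {1..n}" using Pn by (auto simp: Fs_def)
  have finF: "finite Fs" using Fn by (rule finite_subset) simp
  have cF: "card Fs \<le> 2 * r * card K"
  proof -
    have "card Fs \<le> (\<Sum>t\<in>T. card (P t))" unfolding Fs_def by (rule card_UN_le[OF finT])
    also have "\<dots> \<le> (\<Sum>t\<in>T. card K)" unfolding P_def by (intro sum_mono card_image_le finK)
    finally show ?thesis using T by simp
  qed
  have QQ: "Q \<subseteq> Q'"
  proof
    fix e assume "e \<in> Q"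
    then obtain t where t: "t \<in> T" "e \<in> cedges (place \<beta> (a t) (z t))" by (auto simp: Q_def)
    then have "e \<in> pairs (P t)" by (auto simp: cedges_def pairs_def P_def)
    then show "e \<in> Q'" using t by (auto simp: Q'_def)
  qed
  have Q'F: "Q' \<subseteq> pairs Fs" unfolding Q'_def Fs_def by (auto simp: pairs_def)
  have cz: "cedges (place \<beta> (a t) (z t)) \<subseteq> zone \<beta> (a t)" if "t \<in> T" for t
    using cedges_cpairs[of "place \<beta> (a t) (z t)"] reach_zone[OF \<beta> tr[OF that] z[OF that]]
    by (auto simp: reach_def)
  have cardQ: "card Q = 2 * r * ncross"
  proof -
    have "card Q = (\<Sum>t\<in>T. card (cedges (place \<beta> (a t) (z t))))"
      unfolding Q_def
    proof (rule card_UN_disjoint[OF finT])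
      show "\<forall>t\<in>T. finite (cedges (place \<beta> (a t) (z t)))" using finite_cedges by blast
      show "\<forall>t\<in>T. \<forall>t'\<in>T. t \<noteq> t' \<longrightarrow> cedges (place \<beta> (a t) (z t)) \<inter> cedges (place \<beta> (a t') (z t')) = {}"
        using cz zones_disjoint[OF T(1)] by blast
    qed
    also have "\<dots> = (\<Sum>t\<in>T. ncross)" using card_cedges[OF \<beta> tr z] by (intro sum.cong refl) auto
    finally show ?thesis using T by simp
  qed
  have prE0: "pr n E0 \<le> phi ^ (2 * r * ncross)"
    unfolding E0_def cardQ[symmetric]
  proof (rule edges_prob_le)
    show "Q \<subseteq> pairs {1..n}" using QQ Q'F pairs_mono[OF Fn] by blast
    fix p q assume "(p, q) \<in> Q"
    then obtain t where t: "t \<in> T" "(p, q) \<in> cedges (place \<beta> (a t) (z t))" by (auto simp: Q_def)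
    then have "(p, q) \<in> cpairs (place \<beta> (a t) (z t))" using cedges_cpairs by blast
    then show "u \<le> 2 * (q - p)" by (rule cpairs_long[OF \<beta> tr[OF t(1)] z[OF t(1)]])
  qed
  have depE0: "depends_on Q E0" unfolding E0_def by (rule depends_on_present)
  have "{\<omega>. \<forall>t\<in>T. (\<forall>e\<in>cedges (place \<beta> (a t) (z t)). \<omega> e) \<and> far_bad \<beta> (a t) (z t) \<omega>} \<subseteq>
     E0 \<inter> {\<omega>. \<exists>X D. X \<subseteq> {1..n} - Fs \<and> card X \<le> 2 * r * m \<and> D \<in> dense_graphs \<theta> l r Fs X \<and> D \<inter> Q = {} \<and> (\<forall>e\<in>D. \<omega> e)}"
  proof
    fix \<omega> assume "\<omega> \<in> {\<omega>. \<forall>t\<in>T. (\<forall>e\<in>cedges (place \<beta> (a t) (z t)). \<omega> e) \<and> far_bad \<beta> (a t) (z t) \<omega>}"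
    then have \<omega>: "\<And>t e. t \<in> T \<Longrightarrow> e \<in> cedges (place \<beta> (a t) (z t)) \<Longrightarrow> \<omega> e" "\<And>t. t \<in> T \<Longrightarrow> far_bad \<beta> (a t) (z t) \<omega>" by auto
    have "\<forall>t\<in>T. \<exists>X p q. X \<subseteq> {1..n} \<and> X \<inter> P t = {} \<and> card X \<le> m \<and>
     iext (adjacency \<omega>) (P t) (P t \<union> X) \<and> \<omega> (p, q) \<and> p < q \<and> l < q - p \<and>
     p \<in> X \<union> P t \<and> q \<in> X \<union> P t \<and> (p \<in> X \<or> q \<in> X) \<and>
     (p \<in> (\<Union>j\<in>colours. fat (a t j)) \<or> q \<in> (\<Union>j\<in>colours. fat (a t j)))"
      using \<omega>(2) unfolding far_bad_def P_def by blast
    then obtain X p q where X: "\<And>t. t \<in> T \<Longrightarrow> X t \<subseteq> {1..n} \<and> X t \<inter> P t = {} \<and> card (X t) \<le> m \<and>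
     iext (adjacency \<omega>) (P t) (P t \<union> X t) \<and> \<omega> (p t, q t) \<and> p t < q t \<and> l < q t - p t \<and>
     p t \<in> X t \<union> P t \<and> q t \<in> X t \<union> P t \<and> (p t \<in> X t \<or> q t \<in> X t) \<and>
     (p t \<in> (\<Union>j\<in>colours. fat (a t j)) \<or> q t \<in> (\<Union>j\<in>colours. fat (a t j)))"
      by metis
    define Xs where "Xs = (\<Union>t\<in>T. X t) - Fs"
    have FX: "Fs \<union> Xs = Fs \<union> (\<Union>t\<in>T. X t)" by (auto simp: Xs_def)
    define D where "D = {e \<in> pairs (Fs \<union> Xs) - Q'. \<omega> e}"
    have Xn: "Xs \<subseteq> {1..n} - Fs" using X by (fastforce simp: Xs_def)
    have finX: "finite Xs" using Xn finite_subset[of Xs "{1..n}"] by auto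
    have cX: "card Xs \<le> 2 * r * m"
    proof -
      have finXt: "finite (X t)" if "t \<in> T" for t using X[OF that] finite_subset[of "X t" "{1..n}"] by auto
      have "card Xs \<le> card (\<Union>t\<in>T. X t)" unfolding Xs_def using finT finXt by (intro card_mono) auto
      also have "\<dots> \<le> (\<Sum>t\<in>T. card (X t))" by (rule card_UN_le[OF finT])
      also have "\<dots> \<le> (\<Sum>t\<in>T. m)" using X by (intro sum_mono) auto
      finally show ?thesis using T by simp
    qed
    have "dense_ext \<theta> (adjacency \<omega>) Fs (Fs \<union> (\<Union>t\<in>T. X t))"
    proof (rule dense_ext_UN[OF finT finF])
      fix t assume t: "t \<in> T"
      have "(P t \<union> X t) - P t = X t" using X[OF t] by auto
      then have "dense_ext \<theta> (adjacency \<omega>) (P t) (P t \<union> X t)" using X[OF t] by (intro \<theta>(2)) auto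
      then have "dense_ext \<theta> (adjacency \<omega>) Fs (Fs \<union> (P t \<union> X t))"
        by (rule dense_ext_mono) (use t finF in \<open>auto simp: Fs_def\<close>)
      moreover have "Fs \<union> (P t \<union> X t) = Fs \<union> X t" using t by (auto simp: Fs_def)
      ultimately show "dense_ext \<theta> (adjacency \<omega>) Fs (Fs \<union> X t)" by simp
    qed (use \<theta> in simp)
    then have dense: "dense_ext \<theta> (adj_of D) Fs (Fs \<union> Xs)"
      unfolding D_def FX[symmetric] by (rule dense_ext_present_edges[OF _ Q'F])
    define ed where "ed = (\<lambda>t. (p t, q t))"
    have edD: "ed t \<in> {(x, y) \<in> D. l < y - x}" if t: "t \<in> T" for t
    proof -
      have "p t \<in> Fs \<union> Xs" "q t \<in> Fs \<union> Xs" unfolding FX using X[OF t] t by (auto simp: Fs_def)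
      then have "(p t, q t) \<in> pairs (Fs \<union> Xs)" using X[OF t] by (auto simp: pairs_def)
      \<comment> \<open>If both ends were in one copy, the end in the fat part of \<open>t\<close>
        would show that it is the copy of \<open>t\<close> itself; but one end is in
        \<open>X t\<close>, which is disjoint from that copy.\<close>
      moreover have "(p t, q t) \<notin> Q'"
      proof
        assume "(p t, q t) \<in> Q'"
        then obtain t' where t': "t' \<in> T" "p t \<in> P t'" "q t \<in> P t'" by (auto simp: Q'_def pairs_def)
        have fatP: "t = t'" if x: "x \<in> P t'" "x \<in> (\<Union>j\<in>colours. fat (a t j))" for x
        proof -
          obtain w where w: "w \<in> K" "x = place \<beta> (a t') (z t') w" using x(1) by (auto simp: P_def)
          have "w \<notin> B"
          proof
            assume "w \<in> B"
            then have "x \<in> \<beta> ` B" using w(2) by (simp add: place_base[OF \<beta> tr[OF t'(1)]])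
            then show False using fat_not_base[OF tr[OF t] x(2)] by simp
          qed
          then have "x \<in> (\<Union>j\<in>colours. fat (a t' j))"
            using place_fat[OF \<beta> tr[OF t'(1)] z[OF t'(1)] w(1)] w(2) colour_in[OF w(1)] by blast
          then show ?thesis using trials_fat[OF T(1) t t'(1) x(2)] by simp
        qed
        have "t = t'" using fatP[OF t'(2)] fatP[OF t'(3)] X[OF t] by blast
        then show False using t' X[OF t] by blast
      qed
      ultimately show ?thesis using X[OF t] by (simp add: ed_def D_def)
    qed
    have "card T \<le> 2 * card (ed ` T)"
    proof -
      have "card T = card (\<Union>e\<in>ed ` T. {t \<in> T. ed t = e})" by (rule arg_cong[of _ _ card]) auto
      also have "\<dots> \<le> (\<Sum>e\<in>ed ` T. card {t \<in> T. ed t = e})" using finT by (intro card_UN_le) simp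
      also have "\<dots> \<le> (\<Sum>e\<in>ed ` T. 2)"
      proof (rule sum_mono)
        fix e assume "e \<in> ed ` T"
        let ?S = "\<lambda>x. {t \<in> T. x \<in> (\<Union>j\<in>colours. fat (a t j))}"
        have one: "card (?S x) \<le> 1" for x
          using finT trials_fat[OF T(1)] by (simp add: card_le_Suc0_iff_eq) blast
        have "{t \<in> T. ed t = e} \<subseteq> ?S (fst e) \<union> ?S (snd e)"
        proof
          fix t assume "t \<in> {t \<in> T. ed t = e}"
          then have t: "t \<in> T" "p t = fst e" "q t = snd e" by (auto simp: ed_def)
          then show "t \<in> ?S (fst e) \<union> ?S (snd e)" using X[OF t(1)] by auto
        qed
        then have "card {t \<in> T. ed t = e} \<le> card (?S (fst e) \<union> ?S (snd e))" using finT by (intro card_mono) auto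
        also have "\<dots> \<le> card (?S (fst e)) + card (?S (snd e))" by (rule card_Un_le)
        finally show "card {t \<in> T. ed t = e} \<le> 2" using one[of "fst e"] one[of "snd e"] by linarith
      qed
      finally show ?thesis by simp
    qed
    then have "r \<le> card (ed ` T)" using T by simp
    also have "\<dots> \<le> card {(x, y) \<in> D. l < y - x}"
    proof (rule card_mono)
      show "finite {(x, y) \<in> D. l < y - x}"
        by (rule finite_subset[of _ "pairs (Fs \<union> Xs)"]) (use finF finX in \<open>auto simp: D_def\<close>)
      show "ed ` T \<subseteq> {(x, y) \<in> D. l < y - x}" using edD by (rule image_subsetI)
    qed
    finally have long: "r \<le> card {(x, y) \<in> D. l < y - x}" .
    have "D \<subseteq> pairs (Fs \<union> Xs)" unfolding D_def by blast
    then have "D \<in> dense_graphs \<theta> l r Fs Xs" using dense long unfolding dense_graphs_def by simp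
    moreover have "D \<inter> Q = {}" using QQ unfolding D_def by blast
    moreover have "\<forall>e\<in>D. \<omega> e" unfolding D_def by blast
    moreover have "\<omega> \<in> E0" using \<omega>(1) unfolding E0_def Q_def by blast
    ultimately show "\<omega> \<in> E0 \<inter> {\<omega>. \<exists>X D. X \<subseteq> {1..n} - Fs \<and> card X \<le> 2 * r * m \<and> D \<in> dense_graphs \<theta> l r Fs X \<and> D \<inter> Q = {} \<and> (\<forall>e\<in>D. \<omega> e)}"
      using Xn cX by (intro IntI CollectI exI[of _ Xs] exI[of _ D] conjI)
  qed
  then have "pr n {\<omega>. \<forall>t\<in>T. (\<forall>e\<in>cedges (place \<beta> (a t) (z t)). \<omega> e) \<and> far_bad \<beta> (a t) (z t) \<omega>} \<le>
     pr n (E0 \<inter> {\<omega>. \<exists>X D. X \<subseteq> {1..n} - Fs \<and> card X \<le> 2 * r * m \<and> D \<in> dense_graphs \<theta> l r Fs X \<and> D \<inter> Q = {} \<and> (\<forall>e\<in>D. \<omega> e)})"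
    by (rule pr_mono)
  also have "\<dots> \<le> pr n E0 * (C * real l powr (- (\<theta> / (2 * (1 + \<theta>)) * \<alpha> * real r)))"
    by (rule C(1)[OF Fn cF depE0])
  also have "\<dots> \<le> phi ^ (2 * r * ncross) * (C * real l powr (- (\<theta> / (2 * (1 + \<theta>)) * \<alpha> * real r)))"
    using prE0 C(2) by (intro mult_right_mono) auto
  finally show ?thesis .
qed

text \<open>A root vertex can disqualify only the block that contains it, so all but
  \<open>card B\<close> of the \<open>M\<close> blocks are available, and every trial takes
  \<open>card colours\<close> of them.\<close>

lemma trials_exist:
  assumes M': "M = 4 * r * card colours + card B"
  obtains a where "trials \<beta> {..<4 * r} a"
proof -
  let ?I = "{i \<in> {..<M}. avoids \<beta> i}"
  have "{i \<in> {..<M}. \<not> avoids \<beta> i} \<subseteq> (\<lambda>b. \<beta> b div (4 * u)) ` B"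
  proof
    fix i assume "i \<in> {i \<in> {..<M}. \<not> avoids \<beta> i}"
    then obtain b where b: "b \<in> B" "4 * u * i + u < \<beta> b" "\<beta> b < 4 * u * i + 4 * u" by (auto simp: avoids_def not_le)
    have "\<beta> b div (4 * u) = i"
    proof (rule div_nat_eqI)
      show "4 * u * i \<le> \<beta> b" "\<beta> b < 4 * u * Suc i" using b by auto
    qed
    then show "i \<in> (\<lambda>b. \<beta> b div (4 * u)) ` B" using b(1) by blast
  qed
  moreover have finB: "finite B" using BK finK finite_subset by blast
  ultimately have "card {i \<in> {..<M}. \<not> avoids \<beta> i} \<le> card B"
    by (meson card_image_le card_mono finite_imageI le_trans)
  moreover have "card {..<M} = card ?I + card {i \<in> {..<M}. \<not> avoids \<beta> i}"
  proof -
    have "card (?I \<union> {i \<in> {..<M}. \<not> avoids \<beta> i}) = card ?I + card {i \<in> {..<M}. \<not> avoids \<beta> i}"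
      by (intro card_Un_disjoint) auto
    moreover have "?I \<union> {i \<in> {..<M}. \<not> avoids \<beta> i} = {..<M}" by auto
    ultimately show ?thesis by simp
  qed
  ultimately have "card ({..<4 * r} \<times> colours) \<le> card ?I"
    using M' by (simp add: card_cartesian_product)
  then obtain h where h: "h ` ({..<4 * r} \<times> colours) \<subseteq> ?I" "inj_on h ({..<4 * r} \<times> colours)"
    using card_le_inj[of "{..<4 * r} \<times> colours" ?I] finite_colours by auto
  have "trials \<beta> {..<4 * r} (\<lambda>t j. h (t, j))"
    unfolding trials_def trial_def
  proof (intro conjI ballI impI)
    fix t assume t: "t \<in> {..<4 * r}"
    show "inj_on (\<lambda>j. h (t, j)) colours"
      using h(2) t by (auto simp: inj_on_def)
    show "(\<lambda>j. h (t, j)) ` colours \<subseteq> {..<M}" using h(1) t by blast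
    show "avoids \<beta> (h (t, j))" if "j \<in> colours" for j using h(1) t that by blast
  next
    fix t t' j j' assume "t \<in> {..<4 * r}" "t' \<in> {..<4 * r}" "j \<in> colours" "j' \<in> colours" "h (t, j) = h (t', j')"
    then show "t = t'" using h(2) by (auto dest: inj_onD)
  qed simp
  then show ?thesis by (rule that)
qed

text \<open>Of 4 r trials, 2 r have few copies, or 2 r have many copies which are all spoiled. The
  first case consists of independent events in disjoint zones. In the second, the number of ways to
  pick a spoiled copy from each of the 2 r trials is at least (\<mu> / 2)^(2 r), and Markov's
  inequality with \<open>far_prob\<close> bounds this. The loss per trial is a constant, as
  \<open>phi ^ ncross\<close> and \<open>p0\<close> will be of the same order. The factor
  \<open>2 ^ (4 * r)\<close> bounds the number of choices of the 2 r trials.\<close>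

theorem fail_prob:
  assumes \<beta>: "base \<beta>" and M': "M = 4 * r * card colours + card B" and G: "0 < G" and p0: "0 < p0"
    "\<And>a z. trial \<beta> a \<Longrightarrow> z \<in> positions \<Longrightarrow> p0 \<le> pr n (copy \<beta> a z)"
    and \<delta>: "\<And>S. S \<subseteq> colours \<Longrightarrow> S \<noteq> {} \<Longrightarrow>
      real G ^ (2 * card colours - card S) * phi ^ (2 * ncross - nsub S) \<le> \<delta> * (real G ^ card colours * p0)\<^sup>2"
    and \<theta>: "0 < \<theta>" "\<And>E A S. iext E A S \<Longrightarrow> card (S - A) \<le> m \<Longrightarrow> dense_ext \<theta> E A S"
    and C: "\<And>F g A E. F \<subseteq> {1..n} \<Longrightarrow> card F \<le> 2 * r * card K \<Longrightarrow> depends_on A E \<Longrightarrow>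
    pr n (E \<inter> {\<omega>. \<exists>X D. X \<subseteq> {1..n} - F \<and> card X \<le> 2 * r * m \<and> D \<in> dense_graphs \<theta> l g F X \<and> D \<inter> A = {} \<and> (\<forall>e\<in>D. \<omega> e)})
      \<le> pr n E * (C * real l powr (- (\<theta> / (2 * (1 + \<theta>)) * \<alpha> * real g)))" "0 < C"
  shows "pr n {\<omega>. \<not> (\<exists>a z. trial \<beta> a \<and> z \<in> positions \<and> \<omega> \<in> copy \<beta> a z \<and> \<not> far_bad \<beta> a z \<omega>)}
     \<le> 2 ^ (4 * r) * ((4 * (2 ^ card colours * \<delta>)) ^ (2 * r) +
         (2 * phi ^ ncross / p0) ^ (2 * r) * (C * real l powr (- (\<theta> / (2 * (1 + \<theta>)) * \<alpha> * real r))))"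
proof -
  obtain a where a: "trials \<beta> {..<4 * r} a" by (rule trials_exist[OF M'])
  let ?h = "card colours"
  let ?N = "\<lambda>t \<omega>. real (card {z\<in>positions. \<omega> \<in> copy \<beta> (a t) z})"
  define \<mu> where "\<mu> = real G ^ ?h * p0"
  define far where "far = C * real l powr (- (\<theta> / (2 * (1 + \<theta>)) * \<alpha> * real r))"
  define small where "small = (\<lambda>t. {\<omega>. ?N t \<omega> \<le> \<mu> / 2})"
  define many where "many = (\<lambda>T. {\<omega>. \<forall>t\<in>T. \<mu> / 2 < ?N t \<omega> \<and> (\<forall>z\<in>positions. \<omega> \<in> copy \<beta> (a t) z \<longrightarrow> far_bad \<beta> (a t) z \<omega>)})"
  define Ts where "Ts = {T. T \<subseteq> {..<4 * r} \<and> card T = 2 * r}"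
  have \<mu>: "0 < \<mu>" using G p0 by (simp add: \<mu>_def)
  have finTs: "finite Ts" by (rule finite_subset[of _ "Pow {..<4 * r}"]) (auto simp: Ts_def)
  have finT: "finite T" if "T \<in> Ts" for T using that finite_subset[of T "{..<4 * r}"] by (auto simp: Ts_def)
  have trT: "trials \<beta> T a" if "T \<in> Ts" for T using trials_subset[OF a] that by (auto simp: Ts_def)
  have tr: "trial \<beta> (a t)" if "t < 4 * r" for t using a that by (simp add: trials_def)
  have cardTs: "real (card Ts) \<le> 2 ^ (4 * r)"
  proof -
    have "card Ts \<le> card (Pow {..<4 * r})" by (rule card_mono) (auto simp: Ts_def)
    also have "\<dots> = 2 ^ (4 * r)" by (simp add: card_Pow)
    finally show ?thesis by (metis of_nat_le_iff of_nat_numeral of_nat_power)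
  qed
  have small_prob: "pr n (small t) \<le> 4 * (2 ^ ?h * \<delta>)" if "t < 4 * r" for t
    unfolding small_def \<mu>_def by (rule trial_small[OF \<beta> tr[OF that] G p0(1) p0(2)[OF tr[OF that]] \<delta>])
  have small_dep: "depends_on (zone \<beta> (a t)) (small t)" if t: "t < 4 * r" for t
  proof -
    have dep: "depends_on (zone \<beta> (a t)) (copy \<beta> (a t) z)" if "z \<in> positions" for z
      by (rule depends_on_mono[OF copy_depends[OF \<beta> tr[OF t]] reach_zone[OF \<beta> tr[OF t] that]])
    show ?thesis unfolding depends_on_def small_def mem_Collect_eq
    proof (intro allI impI)
      fix \<omega> \<omega>' :: "nat \<times> nat \<Rightarrow> bool" assume eq: "\<forall>e\<in>zone \<beta> (a t). \<omega> e = \<omega>' e"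
      have "\<omega> \<in> copy \<beta> (a t) z \<longleftrightarrow> \<omega>' \<in> copy \<beta> (a t) z" if "z \<in> positions" for z
        by (rule depends_onD[OF dep[OF that]]) (use eq in simp)
      then have "{z\<in>positions. \<omega> \<in> copy \<beta> (a t) z} = {z\<in>positions. \<omega>' \<in> copy \<beta> (a t) z}" by auto
      then show "?N t \<omega> \<le> \<mu> / 2 \<longleftrightarrow> ?N t \<omega>' \<le> \<mu> / 2" by simp
    qed
  qed
  have 1: "pr n (\<Inter>t\<in>T. small t) \<le> (4 * (2 ^ ?h * \<delta>)) ^ (2 * r)" if T: "T \<in> Ts" for T
  proof -
    have lt: "t < 4 * r" if "t \<in> T" for t using T that by (auto simp: Ts_def)
    have "pr n (\<Inter>t\<in>T. small t) = (\<Prod>t\<in>T. pr n (small t))"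
      by (rule pr_indep_family[OF finT[OF T] small_dep[OF lt] zones_disjoint[OF trT[OF T]]])
    also have "\<dots> \<le> (\<Prod>t\<in>T. 4 * (2 ^ ?h * \<delta>))" using small_prob lt by (intro prod_mono) auto
    also have "\<dots> = (4 * (2 ^ ?h * \<delta>)) ^ (2 * r)" using T by (simp add: Ts_def)
    finally show ?thesis .
  qed
  have 2: "pr n (many T) \<le> (2 * phi ^ ncross / p0) ^ (2 * r) * far" if T: "T \<in> Ts" for T
  proof -
    let ?Z = "PiE T (\<lambda>_. positions)"
    let ?J = "\<lambda>z. {\<omega>. \<forall>t\<in>T. (\<forall>e\<in>cedges (place \<beta> (a t) (z t)). \<omega> e) \<and> far_bad \<beta> (a t) (z t) \<omega>}"
    have cT: "card T = 2 * r" using T by (simp add: Ts_def)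
    have finZ: "finite ?Z" by (intro finite_PiE finT[OF T] finite_positions)
    have "many T \<subseteq> {\<omega>. (\<mu> / 2) ^ (2 * r) \<le> real (card {z\<in>?Z. \<omega> \<in> ?J z})}"
    proof
      fix \<omega> assume \<omega>: "\<omega> \<in> many T"
      have "(\<mu> / 2) ^ (2 * r) = (\<Prod>t\<in>T. \<mu> / 2)" using cT by simp
      also have "\<dots> \<le> (\<Prod>t\<in>T. ?N t \<omega>)" using \<omega> \<mu> by (intro prod_mono) (auto simp: many_def)
      also have "\<dots> = real (card (PiE T (\<lambda>t. {z\<in>positions. \<omega> \<in> copy \<beta> (a t) z})))"
        by (simp add: card_PiE[OF finT[OF T]])
      also have "\<dots> \<le> real (card {z\<in>?Z. \<omega> \<in> ?J z})"
      proof (intro of_nat_mono card_mono)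
        show "finite {z\<in>?Z. \<omega> \<in> ?J z}" using finZ by simp
        show "PiE T (\<lambda>t. {z\<in>positions. \<omega> \<in> copy \<beta> (a t) z}) \<subseteq> {z\<in>?Z. \<omega> \<in> ?J z}"
        proof
          fix z assume z: "z \<in> PiE T (\<lambda>t. {z\<in>positions. \<omega> \<in> copy \<beta> (a t) z})"
          then have zt: "z t \<in> positions" "\<omega> \<in> copy \<beta> (a t) (z t)" if "t \<in> T" for t
            using that by (auto simp: PiE_iff)
          have "z \<in> ?Z" using z by (auto simp: PiE_iff)
          moreover have "\<omega> \<in> ?J z"
          proof (intro CollectI ballI conjI)
            fix t assume t: "t \<in> T"
            then have "t < 4 * r" using T by (auto simp: Ts_def)
            then show "\<omega> e" if "e \<in> cedges (place \<beta> (a t) (z t))" for e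
              using copy_cedges[OF \<beta> tr, of t "z t"] zt(2)[OF t] that by blast
            show "far_bad \<beta> (a t) (z t) \<omega>" using \<omega> zt[OF t] t unfolding many_def by blast
          qed
          ultimately show "z \<in> {z\<in>?Z. \<omega> \<in> ?J z}" by simp
        qed
      qed
      finally show "\<omega> \<in> {\<omega>. (\<mu> / 2) ^ (2 * r) \<le> real (card {z\<in>?Z. \<omega> \<in> ?J z})}" by simp
    qed
    then have "pr n (many T) \<le> pr n {\<omega>. (\<mu> / 2) ^ (2 * r) \<le> real (card {z\<in>?Z. \<omega> \<in> ?J z})}" by (rule pr_mono)
    also have "\<dots> \<le> (\<Sum>z\<in>?Z. pr n (?J z)) / (\<mu> / 2) ^ (2 * r)"
      by (rule pmf_markov_card[OF finZ]) (use \<mu> in simp)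
    also have "\<dots> \<le> (\<Sum>z\<in>?Z. phi ^ (2 * r * ncross) * far) / (\<mu> / 2) ^ (2 * r)"
    proof (intro divide_right_mono sum_mono)
      fix z assume "z \<in> ?Z"
      then have z: "z t \<in> positions" if "t \<in> T" for t using that by auto
      show "pr n (?J z) \<le> phi ^ (2 * r * ncross) * far"
        unfolding far_def by (rule far_prob[OF \<beta> trT[OF T] cT z \<theta> C])
    qed (use \<mu> in simp)
    also have "\<dots> = (real G ^ ?h) ^ (2 * r) * (phi ^ (2 * r * ncross) * far) / (\<mu> / 2) ^ (2 * r)"
      by (simp add: card_PiE[OF finT[OF T]] card_positions cT)
    also have "\<dots> = (2 * phi ^ ncross / p0) ^ (2 * r) * far"
    proof -
      have "phi ^ (2 * r * ncross) = (phi ^ ncross) ^ (2 * r)" by (simp add: power_mult[symmetric] mult.commute)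
      then show ?thesis using G p0 by (simp add: \<mu>_def power_mult_distrib power_divide)
    qed
    finally show ?thesis .
  qed
  have "{\<omega>. \<not> (\<exists>a z. trial \<beta> a \<and> z \<in> positions \<and> \<omega> \<in> copy \<beta> a z \<and> \<not> far_bad \<beta> a z \<omega>)}
      \<subseteq> (\<Union>T\<in>Ts. (\<Inter>t\<in>T. small t) \<union> many T)"
  proof
    fix \<omega> assume "\<omega> \<in> {\<omega>. \<not> (\<exists>a z. trial \<beta> a \<and> z \<in> positions \<and> \<omega> \<in> copy \<beta> a z \<and> \<not> far_bad \<beta> a z \<omega>)}"
    then have bad: "far_bad \<beta> (a t) z \<omega>" if "t < 4 * r" "z \<in> positions" "\<omega> \<in> copy \<beta> (a t) z" for t z
      using that tr by blast
    let ?S = "{t \<in> {..<4 * r}. \<omega> \<in> small t}" and ?L = "{t \<in> {..<4 * r}. \<omega> \<notin> small t}"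
    have c1: "card (?S \<union> ?L) = card ?S + card ?L" by (intro card_Un_disjoint) auto
    have c2: "?S \<union> ?L = {..<4 * r}" by auto
    have "card ?S + card ?L = 4 * r" using c1 unfolding c2 by (simp only: card_lessThan)
    then have "2 * r \<le> card ?S \<or> 2 * r \<le> card ?L" by linarith
    then show "\<omega> \<in> (\<Union>T\<in>Ts. (\<Inter>t\<in>T. small t) \<union> many T)"
    proof
      assume "2 * r \<le> card ?S"
      then obtain T where T: "T \<subseteq> ?S" "card T = 2 * r" by (rule obtain_subset_with_card_n) (rule that)
      then have "T \<in> Ts" "\<omega> \<in> (\<Inter>t\<in>T. small t)" by (auto simp: Ts_def)
      then show ?thesis by blast
    next
      assume "2 * r \<le> card ?L"
      then obtain T where T: "T \<subseteq> ?L" "card T = 2 * r" by (rule obtain_subset_with_card_n) (rule that)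
      then have "T \<in> Ts" by (auto simp: Ts_def)
      moreover have "\<omega> \<in> many T" using T bad by (auto simp: many_def small_def)
      ultimately show ?thesis by blast
    qed
  qed
  then have "pr n {\<omega>. \<not> (\<exists>a z. trial \<beta> a \<and> z \<in> positions \<and> \<omega> \<in> copy \<beta> a z \<and> \<not> far_bad \<beta> a z \<omega>)}
      \<le> pr n (\<Union>T\<in>Ts. (\<Inter>t\<in>T. small t) \<union> many T)" by (rule pr_mono)
  also have "\<dots> \<le> (\<Sum>T\<in>Ts. pr n ((\<Inter>t\<in>T. small t) \<union> many T))" by (rule pr_UN_le[OF finTs])
  also have "\<dots> \<le> (\<Sum>T\<in>Ts. (4 * (2 ^ ?h * \<delta>)) ^ (2 * r) + (2 * phi ^ ncross / p0) ^ (2 * r) * far)"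
  proof (rule sum_mono)
    fix T assume T: "T \<in> Ts"
    have "pr n ((\<Inter>t\<in>T. small t) \<union> many T) \<le> pr n (\<Inter>t\<in>T. small t) + pr n (many T)"
      by (rule measure_Un_le) auto
    then show "pr n ((\<Inter>t\<in>T. small t) \<union> many T) \<le> (4 * (2 ^ ?h * \<delta>)) ^ (2 * r) + (2 * phi ^ ncross / p0) ^ (2 * r) * far"
      using 1[OF T] 2[OF T] by linarith
  qed
  also have "\<dots> = real (card Ts) * ((4 * (2 ^ ?h * \<delta>)) ^ (2 * r) + (2 * phi ^ ncross / p0) ^ (2 * r) * far)" by simp
  also have "\<dots> \<le> 2 ^ (4 * r) * ((4 * (2 ^ ?h * \<delta>)) ^ (2 * r) + (2 * phi ^ ncross / p0) ^ (2 * r) * far)"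
    using C(2) p0 by (intro mult_right_mono cardTs add_nonneg_nonneg mult_nonneg_nonneg)
      (auto simp: far_def zero_le_even_power intro!: zero_le_power)
  finally show ?thesis unfolding far_def .
qed

end

section \<open>The zero-one law\<close>

lemma nat_floor_bounds:
  fixes x :: real assumes "1 \<le> x"
  shows "1 \<le> nat \<lfloor>x\<rfloor>" "real (nat \<lfloor>x\<rfloor>) \<le> x" "x / 2 \<le> real (nat \<lfloor>x\<rfloor>)"
proof -
  have f: "1 \<le> \<lfloor>x\<rfloor>" using assms by linarith
  then have e: "real (nat \<lfloor>x\<rfloor>) = of_int \<lfloor>x\<rfloor>" by simp
  show "1 \<le> nat \<lfloor>x\<rfloor>" using f by linarith
  show "real (nat \<lfloor>x\<rfloor>) \<le> x" unfolding e by linarith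
  have "x - 1 < of_int \<lfloor>x\<rfloor>" "1 \<le> (of_int \<lfloor>x\<rfloor> :: real)" using f by linarith+
  then show "x / 2 \<le> real (nat \<lfloor>x\<rfloor>)" unfolding e by linarith
qed

context trial_geometry
begin

lemma copy_realises:
  assumes \<beta>: "base \<beta>" and a: "trial \<beta> a" and z: "z \<in> positions" and \<omega>: "\<omega> \<in> copy \<beta> a z" and nf: "\<not> far_bad \<beta> a z \<omega>"
    and adj\<beta>: "\<forall>x\<in>B. \<forall>y\<in>B. adjacency \<omega> (\<beta> x) (\<beta> y) \<longleftrightarrow> F x y"
  shows "\<exists>g. inj_on g K \<and> g ` K \<subseteq> {1..n} \<and> (\<forall>x\<in>B. g x = \<beta> x) \<and> (\<forall>x\<in>K. \<forall>y\<in>K. adjacency \<omega> (g x) (g y) \<longleftrightarrow> F x y) \<and>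
          (\<forall>W. W \<subseteq> {1..n} \<longrightarrow> card (W - g ` K) \<le> m \<longrightarrow> iext (adjacency \<omega>) (g ` K) (g ` K \<union> W) \<longrightarrow>
             (\<forall>x\<in>W - g ` K. \<forall>y\<in>g ` (K - B). \<not> adjacency \<omega> x y))"
proof (intro exI[of _ "place \<beta> a z"] conjI ballI allI impI)
  show "inj_on (place \<beta> a z) K" by (rule place_inj[OF \<beta> a z])
  show "place \<beta> a z ` K \<subseteq> {1..n}" by (rule place_range[OF \<beta> a z])
  show "place \<beta> a z x = \<beta> x" if "x \<in> B" for x by (rule place_base[OF \<beta> a that])
  fix x y assume xy: "x \<in> K" "y \<in> K"
  show "adjacency \<omega> (place \<beta> a z x) (place \<beta> a z y) \<longleftrightarrow> F x y"
  proof (cases "\<kappa> x = \<kappa> y")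
    case False
    then show ?thesis using \<omega> xy by (simp add: copy_def)
  next
    case True
    show ?thesis
    proof (cases "x \<in> B")
      case xB: True
      then have "y \<in> B" using True \<kappa>[OF xy(1)] \<kappa>[OF xy(2)] by simp
      then show ?thesis using xB adj\<beta> by (simp add: place_base[OF \<beta> a])
    next
      case xB: False
      then have yB: "y \<notin> B" using True \<kappa>[OF xy(1)] \<kappa>[OF xy(2)] by simp
      have j: "\<kappa> x \<in> colours" by (rule colour_in[OF xy(1) xB])
      have "\<omega> \<in> local_copy n R (\<kappa> x) (centre (a (\<kappa> x)) (z (\<kappa> x)))" using \<omega> j by (simp add: copy_def)
      moreover have "x \<in> cls (\<kappa> x)" "y \<in> cls (\<kappa> x)" using xy True by (auto simp: cls_def)
      ultimately show ?thesis using xB yB True by (simp add: local_copy_def place_def)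
    qed
  qed
next
  fix W x y assume "W \<subseteq> {1..n}" "card (W - place \<beta> a z ` K) \<le> m" "iext (adjacency \<omega>) (place \<beta> a z ` K) (place \<beta> a z ` K \<union> W)"
    "x \<in> W - place \<beta> a z ` K" "y \<in> place \<beta> a z ` (K - B)"
  then show "\<not> adjacency \<omega> x y" by (rule copy_extension[OF \<beta> a z \<omega> nf])
qed

text \<open>Only the values of a root map on \<open>B\<close> matter; restricted to \<open>B\<close>
  there are at most \<open>n ^ card B\<close> of them for the union bound.\<close>

lemma axiom_fail:
  assumes "\<And>\<beta>. \<beta> \<in> PiE B (\<lambda>_. {1..n}) \<Longrightarrow> base \<beta> \<Longrightarrow>
    pr n {\<omega>. \<not> (\<exists>a z. trial \<beta> a \<and> z \<in> positions \<and> \<omega> \<in> copy \<beta> a z \<and> \<not> far_bad \<beta> a z \<omega>)} \<le> x" and x: "0 \<le> x"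
  shows "pr n {\<omega>. \<not> extension_axiom m K F B {1..n} (adjacency \<omega>)} \<le> real n ^ card B * x"
proof -
  have finB: "finite B" using BK finK finite_subset by blast
  let ?J = "{\<beta> \<in> PiE B (\<lambda>_. {1..n}). base \<beta>}"
  let ?S = "\<lambda>\<beta>. {\<omega>. \<not> (\<exists>a z. trial \<beta> a \<and> z \<in> positions \<and> \<omega> \<in> copy \<beta> a z \<and> \<not> far_bad \<beta> a z \<omega>)}"
  have finP: "finite (PiE B (\<lambda>_. {1..n}))" by (intro finite_PiE finB) auto
  have finJ: "finite ?J" using finP by simp
  have cJ: "card ?J \<le> n ^ card B"
    using card_mono[OF finP, of ?J] by (auto simp: card_PiE[OF finB])
  have "{\<omega>. \<not> extension_axiom m K F B {1..n} (adjacency \<omega>)} \<subseteq> (\<Union>\<beta>\<in>?J. ?S \<beta>)"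
  proof (rule subsetI, rule ccontr)
    fix \<omega> assume \<omega>: "\<omega> \<in> {\<omega>. \<not> extension_axiom m K F B {1..n} (adjacency \<omega>)}" and no: "\<omega> \<notin> (\<Union>\<beta>\<in>?J. ?S \<beta>)"
    have "extension_axiom m K F B {1..n} (adjacency \<omega>)"
      unfolding extension_axiom_def
    proof (intro allI impI)
      fix \<beta>' assume b: "inj_on \<beta>' B" "\<beta>' ` B \<subseteq> {1..n}" "\<forall>x\<in>B. \<forall>y\<in>B. adjacency \<omega> (\<beta>' x) (\<beta>' y) = F x y"
      define \<beta> where "\<beta> = restrict \<beta>' B"
      have eq: "\<beta> x = \<beta>' x" if "x \<in> B" for x using that by (simp add: \<beta>_def)
      have img: "\<beta> ` B = \<beta>' ` B" using eq by (intro image_cong) auto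
      have base: "base \<beta>" unfolding base_def img using b(1,2) eq by (simp cong: inj_on_cong)
      have "\<beta> \<in> PiE B (\<lambda>_. {1..n})" using b(2) by (auto simp: \<beta>_def)
      then have "\<omega> \<notin> ?S \<beta>" using no base by blast
      then obtain a z where az: "trial \<beta> a" "z \<in> positions" "\<omega> \<in> copy \<beta> a z" "\<not> far_bad \<beta> a z \<omega>" by blast
      have adj: "\<forall>x\<in>B. \<forall>y\<in>B. adjacency \<omega> (\<beta> x) (\<beta> y) \<longleftrightarrow> F x y" using b(3) eq by simp
      have eqB: "(\<forall>x\<in>B. g x = \<beta>' x) \<longleftrightarrow> (\<forall>x\<in>B. g x = \<beta> x)" for g using eq by simp
      show "\<exists>g. inj_on g K \<and> g ` K \<subseteq> {1..n} \<and> (\<forall>x\<in>B. g x = \<beta>' x) \<and> (\<forall>x\<in>K. \<forall>y\<in>K. adjacency \<omega> (g x) (g y) = F x y) \<and>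
          (\<forall>W. W \<subseteq> {1..n} \<longrightarrow> card (W - g ` K) \<le> m \<longrightarrow> iext (adjacency \<omega>) (g ` K) (g ` K \<union> W) \<longrightarrow>
             (\<forall>x\<in>W - g ` K. \<forall>y\<in>g ` (K - B). \<not> adjacency \<omega> x y))"
        unfolding eqB by (rule copy_realises[OF base az adj])
    qed
    then show False using \<omega> by simp
  qed
  then have "pr n {\<omega>. \<not> extension_axiom m K F B {1..n} (adjacency \<omega>)} \<le> pr n (\<Union>\<beta>\<in>?J. ?S \<beta>)" by (rule pr_mono)
  also have "\<dots> \<le> (\<Sum>\<beta>\<in>?J. pr n (?S \<beta>))" by (rule pr_UN_le[OF finJ])
  also have "\<dots> \<le> (\<Sum>\<beta>\<in>?J. x)" using assms(1) by (intro sum_mono) auto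
  also have "\<dots> = real (card ?J) * x" by simp
  also have "\<dots> \<le> real n ^ card B * x"
  proof (rule mult_right_mono[OF _ x])
    show "real (card ?J) \<le> real n ^ card B" using cJ by (metis of_nat_le_iff of_nat_power)
  qed
  finally show ?thesis .
qed

end

section \<open>Choice of the parameters\<close>

context pattern_copy
begin

lemma colour_gap:
  obtains \<zeta> where "0 < \<zeta>" "\<zeta> \<le> real (card colours)" "\<And>S. S \<subseteq> colours \<Longrightarrow> S \<noteq> {} \<Longrightarrow>
    \<alpha> * real (card {(v, w) \<in> crossing F \<kappa> K. \<kappa> v \<in> insert 0 S \<and> \<kappa> w \<in> insert 0 S}) + \<zeta> \<le> real (card S)"
proof -
  let ?f = "\<lambda>S. real (card S) - \<alpha> * real (card {(v, w) \<in> crossing F \<kappa> K. \<kappa> v \<in> insert 0 S \<and> \<kappa> w \<in> insert 0 S})"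
  let ?A = "?f ` (Pow colours - {{}})"
  have fin: "finite ?A" using finite_colours by simp
  have ne: "?A \<noteq> {}" using colours_nonempty by auto
  show ?thesis
  proof (rule that[of "Min ?A"])
    have "Min ?A \<in> ?A" using fin ne by (rule Min_in)
    moreover have "0 < w" if w: "w \<in> ?A" for w
    proof -
      obtain S where S: "w = ?f S" "S \<subseteq> colours" "S \<noteq> {}" using w by blast
      have "\<alpha> * real (card {(v, w) \<in> crossing F \<kappa> K. \<kappa> v \<in> insert 0 S \<and> \<kappa> w \<in> insert 0 S}) < real (card S)"
        by (rule strict) (use S in \<open>simp_all add: colours_def\<close>)
      then show ?thesis unfolding S(1) by linarith
    qed
    ultimately show "0 < Min ?A" by blast
    have "Min ?A \<le> ?f colours" using fin colours_nonempty by (intro Min_le) auto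
    moreover have "?f colours \<le> real (card colours)" using \<alpha>_pos by simp
    ultimately show "Min ?A \<le> real (card colours)" by linarith
    fix S assume "S \<subseteq> colours" "S \<noteq> {}"
    then have "Min ?A \<le> ?f S" using fin by (intro Min_le) auto
    then show "\<alpha> * real (card {(v, w) \<in> crossing F \<kappa> K. \<kappa> v \<in> insert 0 S \<and> \<kappa> w \<in> insert 0 S}) + Min ?A \<le> real (card S)" by linarith
  qed
qed

text \<open>With \<open>l\<close> about n^\<epsilon> there are about n^(1 - \<epsilon>) slots per
  cluster. One trial finds too few copies with probability about n^(-\<zeta> / 2), and r long edges
  cost about n^(-\<epsilon> \<gamma> r). With 2 r such trials both contributions drop below n^(-b -
  1), up to a constant, which survives the sum over n^b roots.\<close>

theorem extension_axiom_fail_bound: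
  obtains Q where "\<forall>\<^sub>F n in sequentially. pr n {\<omega>. \<not> extension_axiom m K F B {1..n} (adjacency \<omega>)} \<le> Q / real n"
proof -
  define h where "h = card colours"
  define e where "e = card (crossing F \<kappa> K)"
  define s where "s = card K"
  define b where "b = card B"
  have h1: "1 \<le> h" using colours_nonempty finite_colours by (simp add: h_def Suc_le_eq card_gt_0_iff)
  obtain \<zeta> where \<zeta>: "0 < \<zeta>" "\<zeta> \<le> real (card colours)" "\<And>S. S \<subseteq> colours \<Longrightarrow> S \<noteq> {} \<Longrightarrow>
    \<alpha> * real (card {(v, w) \<in> crossing F \<kappa> K. \<kappa> v \<in> insert 0 S \<and> \<kappa> w \<in> insert 0 S}) + \<zeta> \<le> real (card S)"
    by (rule colour_gap) (rule that)
  note \<zeta>(2)[folded h_def]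
  note \<zeta> = \<zeta>(1) this \<zeta>(3)
  \<comment> \<open>Wide slots cost a factor of about n^\<epsilon> for each of the \<open>h\<close>
    clusters; this choice spends exactly half of the gap \<zeta>.\<close>
  define \<epsilon> where "\<epsilon> = \<zeta> / (2 * real h)"
  have \<epsilon>: "0 < \<epsilon>" "\<epsilon> < 1" "\<epsilon> * real h = \<zeta> / 2" using \<zeta> h1 by (auto simp: \<epsilon>_def field_simps)
  obtain \<theta> where \<theta>: "0 < \<theta>" "\<And>E A S. iext E A S \<Longrightarrow> card (S - A) \<le> m \<Longrightarrow> dense_ext \<theta> E A S"
    using iext_imp_dense_ext[of m] by blast
  define \<gamma> where "\<gamma> = \<theta> / (2 * (1 + \<theta>)) * \<alpha>"
  have \<gamma>: "0 < \<gamma>" using \<theta> \<alpha>_pos by (simp add: \<gamma>_def)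
  \<comment> \<open>The two inequalities bring n^(-\<zeta> / 2) to the power 2 r, and n^(-\<epsilon>
    \<gamma> r), below n^(-b - 1).\<close>
  obtain r :: nat where r: "1 \<le> r" "real b + 1 \<le> \<zeta> * real r" "real b + 1 \<le> \<epsilon> * \<gamma> * real r"
  proof -
    obtain r1 :: nat where r1: "real b + 1 < real r1 * \<zeta>" using reals_Archimedean3[OF \<zeta>(1)] by blast
    have "0 < \<epsilon> * \<gamma>" using \<epsilon> \<gamma> by simp
    then obtain r2 :: nat where r2: "real b + 1 < real r2 * (\<epsilon> * \<gamma>)" using reals_Archimedean3 by blast
    have "real r1 * \<zeta> \<le> real (r1 + r2 + 1) * \<zeta>" using \<zeta> by (intro mult_right_mono) auto
    moreover have "real r2 * (\<epsilon> * \<gamma>) \<le> real (r1 + r2 + 1) * (\<epsilon> * \<gamma>)" using \<epsilon> \<gamma> by (intro mult_right_mono) auto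
    ultimately show ?thesis using r1 r2 by (intro that[of "r1 + r2 + 1"]) (auto simp: mult.commute)
  qed
  define M where "M = 4 * r * h + b"
  have M1: "1 \<le> M"
  proof -
    have "1 \<le> r * h" using r(1) h1 by (metis mult_le_mono mult_1)
    then show ?thesis unfolding M_def by linarith
  qed
  obtain C where C: "0 < C" "\<And>n F l g A E. F \<subseteq> {1..n} \<Longrightarrow> card F \<le> 2 * r * card K \<Longrightarrow> 1 \<le> l \<Longrightarrow> depends_on A E \<Longrightarrow>
    pr n (E \<inter> {\<omega>. \<exists>X D. X \<subseteq> {1..n} - F \<and> card X \<le> 2 * r * m \<and> D \<in> dense_graphs \<theta> l g F X \<and> D \<inter> A = {} \<and> (\<forall>e\<in>D. \<omega> e)})
      \<le> pr n E * (C * real l powr (- (\<theta> / (2 * (1 + \<theta>)) * \<alpha> * real g)))"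
    by (rule pr_dense_exposed[OF \<theta>(1), of "2 * r * card K" "2 * r * m"]) (rule that)
  obtain c :: real and L :: nat where c: "0 < c" "\<And>n R j x. L \<le> x \<Longrightarrow> x + L \<le> n \<Longrightarrow> c \<le> pr n (local_copy n R j x)"
    by (rule local_copy_prob) (rule that)
  \<comment> \<open>The slot width 2 ((m + 1) l + s) + s + 1 is at most A n^\<epsilon>.\<close>
  define A where "A = real (2 * (m + 1) + 3 * s + 1)"
  have A1: "1 \<le> A" by (simp add: A_def)
  \<comment> \<open>From u \<ge> n / (8 M): the factor \<open>phi\<close> is at most D
    n^(-\<alpha>).\<close>
  define D where "D = (16 * real M) powr \<alpha>"
  have D1: "1 \<le> D" unfolding D_def using M1 \<alpha>_pos by (intro ge_one_powr_ge_zero) auto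
  define y where "y = (1 - 2 powr (- \<alpha>) :: real)"
  have y: "0 < y" using two_powr_less_1 by (simp add: y_def)
  define q where "q = (2 powr (- \<alpha>)) ^ e * y ^ (s * s) * c ^ h"
  have q: "0 < q" using y c by (simp add: q_def)
  \<comment> \<open>From G \<ge> u / (2 \<sigma>) and the bounds for u and \<sigma>: there are at
    least cG n^(1 - \<epsilon>) slots.\<close>
  define cG where "cG = 1 / (16 * real M * A)"
  have MA: "1 \<le> 16 * real M * A"
  proof -
    have "1 * 1 \<le> (16 * real M) * A" using M1 A1 by (intro mult_mono) auto
    then show ?thesis by simp
  qed
  have cG: "0 < cG" "cG \<le> 1"
  proof -
    have "0 < 16 * real M * A" using MA by linarith
    then show "0 < cG" unfolding cG_def by (rule divide_pos_pos[OF zero_less_one])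
    then show "cG \<le> 1" unfolding cG_def using MA by (subst divide_le_eq_1) auto
  qed
  \<comment> \<open>The quotient of the constants when overlapping pairs of copies are compared with
    the squared mean.\<close>
  define D' where "D' = D ^ (2 * e) / (cG ^ h * q\<^sup>2)"
  have D': "0 < D'" using D1 cG q by (simp add: D'_def)
  define Q where "Q = 2 ^ (4 * r) * ((4 * (2 ^ h * D')) ^ (2 * r) + (2 * D ^ e / q) ^ (2 * r) * (C * 2 powr (\<gamma> * real r)))"
  have ev: "\<forall>\<^sub>F n in sequentially. 1 \<le> n \<and> 8 * M \<le> n \<and> 8 * M * L \<le> n \<and> 32 * real M * A * real n powr \<epsilon> < real n"
  proof -
    have "((\<lambda>n. real n powr (\<epsilon> - 1)) \<longlongrightarrow> 0) at_top"
      using \<epsilon> by (intro tendsto_neg_powr filterlim_real_sequentially) auto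
    moreover have "0 < 1 / (32 * real M * A)" using M1 A1 by simp
    ultimately have "\<forall>\<^sub>F n in sequentially. real n powr (\<epsilon> - 1) < 1 / (32 * real M * A)" by (rule order_tendstoD)
    then show ?thesis
      using eventually_ge_at_top[of 1] eventually_ge_at_top[of "8 * M"] eventually_ge_at_top[of "8 * M * L"]
    proof eventually_elim
      case (elim n)
      have "real n powr \<epsilon> = real n powr (\<epsilon> - 1) * real n" using elim by (simp add: powr_diff)
      also have "\<dots> < 1 / (32 * real M * A) * real n" using elim by (intro mult_strict_right_mono) auto
      finally have "real n powr \<epsilon> < 1 / (32 * real M * A) * real n" .
      moreover have "0 < 32 * real M * A" using M1 A1 by simp
      ultimately show ?case using elim by (simp add: field_simps)
    qed
  qed
  have main: "pr n {\<omega>. \<not> extension_axiom m K F B {1..n} (adjacency \<omega>)} \<le> Q / real n"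
    if n: "1 \<le> n" "8 * M \<le> n" "8 * M * L \<le> n" "32 * real M * A * real n powr \<epsilon> < real n" for n
  proof -
    define x where "x = real n"
    have x: "1 \<le> x" using n by (simp add: x_def)
    define l where "l = nat \<lfloor>x powr \<epsilon>\<rfloor>"
    define R where "R = (m + 1) * l + s"
    define \<sigma> where "\<sigma> = 2 * R + s + 1"
    define u where "u = n div (4 * M)"
    have xe: "1 \<le> x powr \<epsilon>" using x \<epsilon> by (intro ge_one_powr_ge_zero) auto
    note l = nat_floor_bounds[OF xe, folded l_def]
    have u1: "x / (8 * real M) \<le> real u"
    proof -
      have "n = 4 * M * u + n mod (4 * M)" by (simp add: u_def)
      moreover have "n mod (4 * M) < 4 * M" using M1 by simp
      ultimately have "n < 4 * M * (u + 1)" by (simp add: algebra_simps)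
      then have "real n < real (4 * M * (u + 1))" by (rule less_imp_of_nat_less)
      then have "x < 4 * real M * real u + 4 * real M" by (simp add: x_def algebra_simps)
      moreover have "8 * real M \<le> x" using n(2) unfolding x_def by (metis of_nat_le_iff of_nat_mult of_nat_numeral)
      ultimately have "x \<le> 8 * real M * real u" by (simp add: algebra_simps) 
      then show ?thesis using M1 by (simp add: field_simps)
    qed
    have \<sigma>A: "real \<sigma> \<le> A * x powr \<epsilon>"
    proof -
      have "real \<sigma> = 2 * real (m + 1) * real l + (3 * real s + 1)" by (simp add: \<sigma>_def R_def algebra_simps)
      also have "\<dots> \<le> 2 * real (m + 1) * x powr \<epsilon> + (3 * real s + 1) * x powr \<epsilon>"
        using l(2) xe mult_left_mono[OF xe, of "3 * real s + 1"] by (intro add_mono mult_left_mono) auto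
      also have "\<dots> = A * x powr \<epsilon>" by (simp add: A_def algebra_simps)
      finally show ?thesis .
    qed
    have u\<sigma>: "4 * \<sigma> < u"
    proof -
      have "4 * real \<sigma> \<le> 4 * (A * x powr \<epsilon>)" using \<sigma>A by simp
      also have "\<dots> < x / (8 * real M)" using n(4) M1 by (simp add: x_def field_simps)
      also have "\<dots> \<le> real u" by (rule u1)
      finally have "real (4 * \<sigma>) < real u" by simp
      then show ?thesis by (simp only: of_nat_less_iff)
    qed
    have Lu: "L \<le> u"
    proof -
      have "L * (4 * M) \<le> n" using n(3) by (simp add: mult_ac)
      then show ?thesis unfolding u_def using M1 by (simp add: less_eq_div_iff_mult_less_eq)
    qed
    interpret tg: trial_geometry \<alpha> K F B \<kappa> ofs m n u l R \<sigma> M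
    proof unfold_locales
      show "1 \<le> l" by (rule l(1))
      show "(m + 1) * l + card K \<le> R" by (simp add: R_def s_def)
      show "2 * R + card K < \<sigma>" by (simp add: \<sigma>_def s_def)
      show "4 * (R + card K) < u" using u\<sigma> by (simp add: \<sigma>_def s_def)
      show "4 * u * M \<le> n" unfolding u_def by (metis mult.assoc mult.commute times_div_less_eq_dividend)
    qed
    have \<sigma>0: "0 < \<sigma>" by (simp add: \<sigma>_def)
    have G1: "real u / (2 * real \<sigma>) \<le> real tg.G"
    proof -
      have "u = \<sigma> * tg.G + u mod \<sigma>" by (simp add: tg.G_def)
      moreover have "u mod \<sigma> < \<sigma>" using \<sigma>0 by simp
      ultimately have "u < \<sigma> * (tg.G + 1)" by (simp add: algebra_simps)
      then have "real u < real (\<sigma> * (tg.G + 1))" by (rule less_imp_of_nat_less)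
      then have 1: "real u < real \<sigma> * real tg.G + real \<sigma>" by (simp add: algebra_simps)
      have "real (4 * \<sigma>) < real u" using u\<sigma> by (rule less_imp_of_nat_less)
      then have "real u \<le> 2 * real \<sigma> * real tg.G" using 1 by simp
      then show ?thesis using \<sigma>0 by (simp add: field_simps)
    qed
    have G2: "cG * x powr (1 - \<epsilon>) \<le> real tg.G"
    proof -
      have "cG * x powr (1 - \<epsilon>) = (x / (8 * real M)) / (2 * (A * x powr \<epsilon>))"
        using x by (simp add: cG_def powr_diff field_simps)
      also have "\<dots> \<le> real u / (2 * (A * x powr \<epsilon>))" using u1 A1 by (intro divide_right_mono) auto
      also have "\<dots> \<le> real u / (2 * real \<sigma>)" 
      proof (intro divide_left_mono)
        show "0 < 2 * (A * x powr \<epsilon>) * (2 * real \<sigma>)" using A1 xe \<sigma>0 by (intro mult_pos_pos) auto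
      qed (use \<sigma>A in auto)
      finally show ?thesis using G1 by linarith
    qed
    have Gpos: "0 < tg.G"
    proof -
      have "0 < cG * x powr (1 - \<epsilon>)" using cG x by simp
      then show ?thesis using G2 by (cases "tg.G") auto
    qed
    have phi: "tg.phi \<le> D * x powr (- \<alpha>)"
    proof -
      have "tg.phi \<le> (x / (16 * real M)) powr (- \<alpha>)"
        using u1 x M1 \<alpha>_pos by (intro powr_mono2') (auto simp: field_simps)
      also have "\<dots> = D * x powr (- \<alpha>)"
        using x M1 by (simp add: D_def powr_divide powr_minus field_simps)
      finally show ?thesis .
    qed
    define p0 where "p0 = q * x powr (- (\<alpha> * real e))"
    have p0: "0 < p0" using q x by (simp add: p0_def)
    have powe: "(x powr (- \<alpha>)) ^ k = x powr (- (\<alpha> * real k))" for k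
      using x by (simp add: powr_power mult.commute)
    have p0_copy: "p0 \<le> pr n (tg.copy \<beta> a z)" if "tg.base \<beta>" "tg.trial \<beta> a" "z \<in> tg.positions" for \<beta> a z
    proof -
      have "c \<le> pr n (local_copy n R j x)" if "u \<le> x" "x + u \<le> n" for j x
        using that Lu by (intro c(2)) auto
      from tg.copy_prob_ge[OF that c(1) this]
      have "(2 powr (- \<alpha>) * x powr (- \<alpha>)) ^ e * y ^ (s * s) * c ^ h \<le> pr n (tg.copy \<beta> a z)"
        unfolding e_def y_def s_def h_def x_def .
      moreover have "(2 powr (- \<alpha>) * x powr (- \<alpha>)) ^ e * y ^ (s * s) * c ^ h = p0"
        by (simp add: p0_def q_def power_mult_distrib powe)
      ultimately show ?thesis by simp
    qed
    define \<delta> where "\<delta> = D' * x powr (- (\<zeta> / 2))"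
    have \<delta>: "real tg.G ^ (2 * h - card S) * tg.phi ^ (2 * e - tg.nsub S) \<le> \<delta> * (real tg.G ^ h * p0)\<^sup>2"
      if S: "S \<subseteq> colours" "S \<noteq> {}" for S
    proof -
      let ?k = "card S" and ?w = "tg.nsub S"
      have kh: "?k \<le> h" using card_mono[OF finite_colours S(1)] by (simp add: h_def)
      have we: "?w \<le> e" unfolding tg.nsub_def e_def using finK by (intro card_mono) auto
      have gap: "\<alpha> * real ?w + \<zeta> \<le> real ?k" using \<zeta>(3)[OF S] by (simp add: tg.nsub_def)
      have "\<epsilon> * real ?k \<le> \<epsilon> * real h" using kh \<epsilon> by (intro mult_left_mono) auto
      \<comment> \<open>After cancelling 2 \<alpha> e this reads \<alpha> w + \<zeta> / 2 \<le> (1 -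
        \<epsilon>) k, with k and w for \<open>?k\<close> and \<open>?w\<close>: the gap supplies
        \<zeta>, and the slot width takes at most \<zeta> / 2 of it.\<close>
      then have ex: "- (\<alpha> * real (2 * e - ?w)) \<le> - (\<zeta> / 2) + (1 - \<epsilon>) * real ?k + - (\<alpha> * real e) * 2"
        using gap \<epsilon>(3) we by (simp add: of_nat_diff algebra_simps)
      have "tg.phi ^ (2 * e - ?w) \<le> (D * x powr (- \<alpha>)) ^ (2 * e - ?w)" using phi by (intro power_mono) auto
      also have "\<dots> = D ^ (2 * e - ?w) * x powr (- (\<alpha> * real (2 * e - ?w)))" by (simp add: power_mult_distrib powe)
      also have "\<dots> \<le> D ^ (2 * e) * x powr (- (\<zeta> / 2) + (1 - \<epsilon>) * real ?k + - (\<alpha> * real e) * 2)"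
        using D1 x ex by (intro mult_mono power_increasing powr_mono) auto
      also have "\<dots> = D' * (cG ^ h * q\<^sup>2) * (x powr (- (\<zeta> / 2)) * x powr ((1 - \<epsilon>) * real ?k) * (x powr (- (\<alpha> * real e)))\<^sup>2)"

      proof -
        have "(x powr (- (\<alpha> * real e)))\<^sup>2 = x powr (- (\<alpha> * real e) * 2)" using x by (simp add: powr_power mult_ac)
        then have "x powr (- (\<zeta> / 2) + (1 - \<epsilon>) * real ?k + - (\<alpha> * real e) * 2)
          = x powr (- (\<zeta> / 2)) * x powr ((1 - \<epsilon>) * real ?k) * (x powr (- (\<alpha> * real e)))\<^sup>2"
          by (simp only: powr_add)
        moreover have "D ^ (2 * e) = D' * (cG ^ h * q\<^sup>2)" using cG q by (simp add: D'_def)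
        ultimately show ?thesis by (simp only:)
      qed
      also have "\<dots> = \<delta> * (cG ^ h * x powr ((1 - \<epsilon>) * real ?k)) * p0\<^sup>2"
        by (simp add: \<delta>_def p0_def power_mult_distrib algebra_simps)
      also have "\<dots> \<le> \<delta> * real tg.G ^ ?k * p0\<^sup>2"
      proof (intro mult_right_mono mult_left_mono)
        have "cG ^ h * x powr ((1 - \<epsilon>) * real ?k) \<le> cG ^ ?k * x powr ((1 - \<epsilon>) * real ?k)"
          using cG kh by (intro mult_right_mono power_decreasing) auto
        also have "\<dots> = (cG * x powr (1 - \<epsilon>)) ^ ?k" using x by (simp add: power_mult_distrib powr_power mult.commute)
        also have "\<dots> \<le> real tg.G ^ ?k" using G2 cG by (intro power_mono) auto
        finally show "cG ^ h * x powr ((1 - \<epsilon>) * real ?k) \<le> real tg.G ^ ?k" .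
      qed (use D' in \<open>auto simp: \<delta>_def\<close>)
      finally have le: "tg.phi ^ (2 * e - ?w) \<le> \<delta> * real tg.G ^ ?k * p0\<^sup>2" .
      have "real tg.G ^ (2 * h - ?k) * tg.phi ^ (2 * e - ?w) \<le> real tg.G ^ (2 * h - ?k) * (\<delta> * real tg.G ^ ?k * p0\<^sup>2)"
        using le by (intro mult_left_mono) auto
      also have "\<dots> = \<delta> * (real tg.G ^ (2 * h - ?k + ?k)) * p0\<^sup>2" by (simp add: power_add)
      also have "2 * h - ?k + ?k = h * 2" using kh by simp
      also have "\<delta> * real tg.G ^ (h * 2) * p0\<^sup>2 = \<delta> * (real tg.G ^ h * p0)\<^sup>2" by (simp add: power_mult power_mult_distrib)
      finally show ?thesis .
    qed
    have fail: "pr n {\<omega>. \<not> (\<exists>a z. tg.trial \<beta> a \<and> z \<in> tg.positions \<and> \<omega> \<in> tg.copy \<beta> a z \<and> \<not> tg.far_bad \<beta> a z \<omega>)}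
       \<le> Q * x powr (- (real b + 1))" if \<beta>: "tg.base \<beta>" for \<beta>
    proof -
      have "pr n {\<omega>. \<not> (\<exists>a z. tg.trial \<beta> a \<and> z \<in> tg.positions \<and> \<omega> \<in> tg.copy \<beta> a z \<and> \<not> tg.far_bad \<beta> a z \<omega>)}
        \<le> 2 ^ (4 * r) * ((4 * (2 ^ h * \<delta>)) ^ (2 * r) +
         (2 * tg.phi ^ e / p0) ^ (2 * r) * (C * real l powr (- (\<theta> / (2 * (1 + \<theta>)) * \<alpha> * real r))))"
        unfolding h_def e_def
      proof (rule tg.fail_prob[OF \<beta> _ Gpos p0 p0_copy[OF \<beta>] _ \<theta> C(2)[OF _ _ l(1)] C(1)])
        show "M = 4 * r * card colours + card B" by (simp add: M_def h_def b_def)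
      qed (use \<delta> in \<open>simp_all add: h_def e_def\<close>)
      also have "\<dots> \<le> 2 ^ (4 * r) * ((4 * (2 ^ h * D')) ^ (2 * r) * x powr (- (real b + 1)) +
         (2 * D ^ e / q) ^ (2 * r) * (C * 2 powr (\<gamma> * real r)) * x powr (- (real b + 1)))"
      proof (intro mult_left_mono add_mono)
        have "(4 * (2 ^ h * \<delta>)) ^ (2 * r) = (4 * (2 ^ h * D')) ^ (2 * r) * (x powr (- (\<zeta> / 2))) ^ (2 * r)"
          by (simp add: \<delta>_def power_mult_distrib mult.assoc)
        also have "(x powr (- (\<zeta> / 2))) ^ (2 * r) = x powr (- (\<zeta> * real r))"
          using x by (simp add: powr_power mult.commute)
        also have "\<dots> \<le> x powr (- (real b + 1))" using r(2) x by (intro powr_mono) auto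
        finally show "(4 * (2 ^ h * \<delta>)) ^ (2 * r) \<le> (4 * (2 ^ h * D')) ^ (2 * r) * x powr (- (real b + 1))"
          using D' by (simp add: mult_left_mono)
        have 1: "2 * tg.phi ^ e / p0 \<le> 2 * D ^ e / q"
        proof -
          have "tg.phi ^ e \<le> (D * x powr (- \<alpha>)) ^ e" using phi by (intro power_mono) auto
          also have "\<dots> = D ^ e * x powr (- (\<alpha> * real e))" by (simp add: power_mult_distrib powe)
          finally have "2 * tg.phi ^ e / p0 \<le> 2 * (D ^ e * x powr (- (\<alpha> * real e))) / p0"
            using p0 by (intro divide_right_mono mult_left_mono) auto
          also have "\<dots> = 2 * D ^ e / q" using x q by (simp add: p0_def)
          finally show ?thesis .
        qed
        have 2: "real l powr (- (\<theta> / (2 * (1 + \<theta>)) * \<alpha> * real r)) \<le> 2 powr (\<gamma> * real r) * x powr (- (real b + 1))"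
        proof -
          have "real l powr (- (\<gamma> * real r)) \<le> (x powr \<epsilon> / 2) powr (- (\<gamma> * real r))"
            using l(3) xe \<gamma> by (intro powr_mono2') auto
          also have "\<dots> = 2 powr (\<gamma> * real r) * x powr (- (\<epsilon> * \<gamma> * real r))"
            using x by (simp add: powr_divide powr_powr powr_minus field_simps)
          also have "\<dots> \<le> 2 powr (\<gamma> * real r) * x powr (- (real b + 1))"
            using r(3) x by (intro mult_left_mono powr_mono) auto
          finally show ?thesis by (simp add: \<gamma>_def)
        qed
        have "(2 * tg.phi ^ e / p0) ^ (2 * r) * (C * real l powr (- (\<theta> / (2 * (1 + \<theta>)) * \<alpha> * real r)))
          \<le> (2 * D ^ e / q) ^ (2 * r) * (C * (2 powr (\<gamma> * real r) * x powr (- (real b + 1))))"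
          using 1 2 C(1) p0 D1 q by (intro mult_mono power_mono mult_left_mono) auto
        then show "(2 * tg.phi ^ e / p0) ^ (2 * r) * (C * real l powr (- (\<theta> / (2 * (1 + \<theta>)) * \<alpha> * real r)))
          \<le> (2 * D ^ e / q) ^ (2 * r) * (C * 2 powr (\<gamma> * real r)) * x powr (- (real b + 1))"
          by (simp add: mult.assoc)
      qed simp
      also have "\<dots> = Q * x powr (- (real b + 1))" by (simp add: Q_def algebra_simps)
      finally show ?thesis .
    qed
    have Q0: "0 \<le> Q" unfolding Q_def using D' D1 q C(1) by (intro mult_nonneg_nonneg add_nonneg_nonneg zero_le_power) auto
    have "pr n {\<omega>. \<not> extension_axiom m K F B {1..n} (adjacency \<omega>)} \<le> real n ^ card B * (Q * x powr (- (real b + 1)))"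
      by (rule tg.axiom_fail[OF fail]) (use Q0 in simp_all)
    also have "real n ^ card B * (Q * x powr (- (real b + 1))) = Q / real n"
    proof -
      have "real n ^ card B = x powr real b" using x by (simp add: x_def b_def powr_realpow)
      moreover have "x powr real b * x powr (- (real b + 1)) = x powr (- 1)" by (simp add: powr_add[symmetric])
      moreover have "x powr (- 1) = 1 / real n" using x by (simp add: powr_minus_divide x_def)
      ultimately show ?thesis by (simp add: mult.left_commute)
    qed
    finally show ?thesis .
  qed
  show ?thesis
    by (rule that[of Q], rule eventually_mono[OF ev]) (use main in blast)
qed

end

context irrational_exponent
begin

text \<open>A maximal colouring of the pattern meets the requirements of
  \<open>pattern_copy\<close>: it is nonzero off the root because the extension is free, and its
  partial exponents are strictly positive by maximality and irrationality. If \<open>K = B\<close>,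
  the root map itself is the required copy.\<close>

theorem extension_axiom_aas:
  assumes "pattern K F B"
  shows "(\<lambda>n. pr n {\<omega>. \<not> extension_axiom m K F B {1..n} (adjacency \<omega>)}) \<longlonglongrightarrow> 0"
proof (cases "K = B")
  case True
  have "extension_axiom m K F B {1..n} (adjacency \<omega>)" for n \<omega>
    unfolding extension_axiom_def True by (intro allI impI) (rule_tac x = \<beta> in exI, simp)
  then show ?thesis by simp
next
  case False
  have P: "symp F" "irreflp F" "ifree F B K" using assms by (simp_all add: pattern_def)
  have fin: "finite K" "B \<subseteq> K" using P(3) by (simp_all add: ifree_def)
  obtain \<kappa> where \<kappa>: "is_max F B K \<kappa>" using is_max_exists[OF fin(1)] by blast
  obtain ofs where "bij_betw ofs K {0..<card K}" using ex_bij_betw_finite_nat[OF fin(1)] by blast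
  then have ofs: "inj_on ofs K" "ofs ` K = {0..<card K}" by (simp_all add: bij_betw_def)
  interpret pattern_copy \<alpha> K F B \<kappa> ofs m
  proof unfold_locales
    show "\<kappa> v = 0 \<longleftrightarrow> v \<in> B" if "v \<in> K" for v
      using ifree_is_max_nonzero[OF \<kappa> P(3)] is_max_zero[OF \<kappa>] that by blast
    show "ofs v < card K" if "v \<in> K" for v
    proof -
      have "ofs v \<in> {0..<card K}" using that ofs(2) by blast
      then show ?thesis by simp
    qed
    show "\<alpha> * real (card {(u, v) \<in> crossing F \<kappa> K. \<kappa> u \<in> insert 0 J \<and> \<kappa> v \<in> insert 0 J}) < real (card J)"
      if "J \<subseteq> \<kappa> ` K - {0}" "J \<noteq> {}" for J
      by (rule is_max_colours_strict[OF \<kappa> fin(1) that])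
  qed (use fin False P ofs in auto)
  obtain Q where Q: "\<forall>\<^sub>F n in sequentially. pr n {\<omega>. \<not> extension_axiom m K F B {1..n} (adjacency \<omega>)} \<le> Q / real n"
    by (rule extension_axiom_fail_bound)
  show ?thesis
  proof (rule tendsto_sandwich[OF _ Q tendsto_const])
    show "(\<lambda>n. Q / real n) \<longlonglongrightarrow> 0" by (rule lim_const_over_n)
  qed simp
qed

theorem good_graph_aas:
  assumes "patterns \<I>"
  shows "(\<lambda>n. pr n {\<omega>. \<not> good_graph \<I> {1..n} (adjacency \<omega>)}) \<longlonglongrightarrow> 0"
proof -
  have fin: "finite \<I>" using assms by (simp add: patterns_def)
  let ?S = "\<lambda>n (m, K, F, B). {\<omega>. \<not> extension_axiom m K F B {1..n} (adjacency \<omega>)}"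
  have le: "pr n {\<omega>. \<not> good_graph \<I> {1..n} (adjacency \<omega>)} \<le> (\<Sum>i\<in>\<I>. pr n (?S n i))" for n
  proof -
    have "{\<omega>. \<not> good_graph \<I> {1..n} (adjacency \<omega>)} \<subseteq> (\<Union>i\<in>\<I>. ?S n i)"
      by (auto simp: good_graph_def symp_adjacency irreflp_adjacency)
    then have "pr n {\<omega>. \<not> good_graph \<I> {1..n} (adjacency \<omega>)} \<le> pr n (\<Union>i\<in>\<I>. ?S n i)" by (rule pr_mono)
    also have "\<dots> \<le> (\<Sum>i\<in>\<I>. pr n (?S n i))" by (rule pr_UN_le[OF fin])
    finally show ?thesis .
  qed
  have "(\<lambda>n. \<Sum>i\<in>\<I>. pr n (?S n i)) \<longlonglongrightarrow> (\<Sum>i\<in>\<I>. 0)"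
  proof (rule tendsto_sum)
    fix i assume i: "i \<in> \<I>"
    obtain m K F B where eq: "i = (m, K, F, B)" by (cases i) auto
    then have "pattern K F B" using assms i by (auto simp: patterns_def)
    then show "(\<lambda>n. pr n (?S n i)) \<longlonglongrightarrow> 0" unfolding eq using extension_axiom_aas[of K F B m] by (simp only: case_prod_conv)
  qed
  then have lim: "(\<lambda>n. \<Sum>i\<in>\<I>. pr n (?S n i)) \<longlonglongrightarrow> 0" by simp
  show ?thesis by (rule tendsto_sandwich[OF _ _ tendsto_const lim]) (use le in auto)
qed

end

theorem mainTheorem1:
  fixes \<alpha> :: real and \<phi> :: fo_formula
  assumes "0 < \<alpha>" and "\<alpha> < 1" and "\<alpha> \<notin> \<rat>"
    and "sentence \<phi>"
  shows "sentence_prob \<alpha> \<phi> \<longlonglongrightarrow> 0 \<or> sentence_prob \<alpha> \<phi> \<longlonglongrightarrow> 1"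
proof -
  interpret irrational_exponent \<alpha> using assms(1-3) by unfold_locales
  obtain \<I> b where I: "patterns \<I>" "\<And>V E. good_graph \<I> V E \<Longrightarrow> V \<noteq> {} \<Longrightarrow> models V E \<phi> = b"
    by (rule sentence_decided[OF assms(4)]) (rule that)
  let ?bad = "\<lambda>n. pr n {\<omega>. \<not> good_graph \<I> {1..n} (adjacency \<omega>)}"
  have bad: "?bad \<longlonglongrightarrow> 0" by (rule good_graph_aas[OF I(1)])
  have ge1: "\<forall>\<^sub>F n in sequentially. 1 \<le> (n :: nat)" by (rule eventually_ge_at_top)
  show ?thesis
  proof (cases b)
    case False
    have "sentence_prob \<alpha> \<phi> n \<le> ?bad n" if "1 \<le> n" for n
      unfolding sentence_prob_eq by (rule pr_mono) (use I(2) False that in force)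
    then have "\<forall>\<^sub>F n in sequentially. sentence_prob \<alpha> \<phi> n \<le> ?bad n" using ge1 by (rule eventually_mono[rotated])
    then have "sentence_prob \<alpha> \<phi> \<longlonglongrightarrow> 0"
      by (intro tendsto_sandwich[OF _ _ tendsto_const bad]) (auto simp: sentence_prob_def)
    then show ?thesis ..
  next
    case True
    have "1 - ?bad n \<le> sentence_prob \<alpha> \<phi> n" if "1 \<le> n" for n
    proof -
      have "1 - ?bad n = pr n (- {\<omega>. \<not> good_graph \<I> {1..n} (adjacency \<omega>)})"
        using measure_pmf.prob_compl[of "{\<omega>. \<not> good_graph \<I> {1..n} (adjacency \<omega>)}" "edge_pmf n"]
        by (simp add: Compl_eq_Diff_UNIV)
      also have "\<dots> \<le> sentence_prob \<alpha> \<phi> n"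
        unfolding sentence_prob_eq by (rule pr_mono) (use I(2) True that in force)
      finally show ?thesis .
    qed
    then have ev: "\<forall>\<^sub>F n in sequentially. 1 - ?bad n \<le> sentence_prob \<alpha> \<phi> n" using ge1 by (rule eventually_mono[rotated])
    have "(\<lambda>n. 1 - ?bad n) \<longlonglongrightarrow> 1 - 0" by (intro tendsto_diff tendsto_const bad)
    then have "(\<lambda>n. 1 - ?bad n) \<longlonglongrightarrow> 1" by simp
    then have "sentence_prob \<alpha> \<phi> \<longlonglongrightarrow> 1"
      by (intro tendsto_sandwich[OF ev _ _ tendsto_const]) (simp_all add: sentence_prob_def)
    then show ?thesis ..
  qed
qed

end
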